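(* Let $\varphi_0\in(0,\pi)$ and let $\mathcal K_{\varphi_0}$ be the solid cone of points with spherical coordinates $\rho>0$, $\theta\in(0,2\pi]$, $\varphi\in[0,\varphi_0]$. There exist constants $\varepsilon(\varphi_0)>0$ and $\delta(\varphi_0)>0$ such that the following holds. Let $\boldsymbol F$ be an axisymmetric vector field of class $C^1$, homogeneous of degree $-3$ on $\mathcal K_{\varphi_0}$, with $$\|(\operatorname{curl}\boldsymbol F)^{\tan}\|_{C^0(\mathbb S^2\cap\mathcal K_{\varphi_0})}\le\varepsilon(\varphi_0).$$ Then the system $$-\Delta\boldsymbol u+(\boldsymbol u\cdot\nabla)\boldsymbol u+\nabla p=\boldsymbol F,\qquad \operatorname{div}\boldsymbol u=0\quad\text{in the interior of }\mathcal K_{\varphi_0},\qquad \boldsymbol u=0\ \text{ on }\partial\mathcal K_{\varphi_0}\setminus\{0\}$$ admits exactly one axisymmetric self-similar solution $(\boldsymbol u,p)$ that is small in the sense that $\sup_{\mathbb S^2\cap\mathcal K_{\varphi_0}}|\boldsymbol u|\le\delta(\varphi_0)$; moreover this solution satisfies $\boldsymbol u\in C^{2,\alpha}_{\mathrm{loc}}(\mathcal K_{\varphi_0})$ and $p\in C^{1,\alpha}_{\mathrm{loc}}(\mathcal K_{\varphi_0})$ for every $\alpha\in(0,1)$. Moreover, if $\boldsymbol F$ has no swirl, then any axisymmetric self-similar solution of the system (not assumed small) is necessarily swirl-free, and it is unique (there is at most one axisymmetric self-similar solution).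
   Context: $\mathbb S^2$ is the unit sphere of $\mathbb R^3$. Spherical coordinates: $\boldsymbol x=(\rho\sin\varphi\cos\theta,\rho\sin\varphi\sin\theta,\rho\cos\varphi)$, with orthonormal basis $\boldsymbol e_\rho=\boldsymbol x/\rho$, $\boldsymbol e_\theta=(-\sin\theta,\cos\theta,0)$, $\boldsymbol e_\varphi=\boldsymbol e_\theta\times\boldsymbol e_\rho$. A vector field $\boldsymbol v=v^\rho\boldsymbol e_\rho+v^\varphi\boldsymbol e_\varphi+v^\theta\boldsymbol e_\theta$ is axisymmetric if $v^\rho,v^\varphi,v^\theta$ depend only on $(\rho,\varphi)$; $v^\theta$ is its swirl, and $\boldsymbol v$ is swirl-free (has no swirl) if $v^\theta\equiv0$. A scalar function is axisymmetric if it depends only on $(\rho,\varphi)$. The set $\mathcal K_{\varphi_0}$ contains its lateral boundary $\{\varphi=\varphi_0\}$ but not the origin, so regularity on $\mathcal K_{\varphi_0}$ means regularity up to the lateral boundary, away from the origin; the subscript loc refers to compact subsets of $\mathcal K_{\varphi_0}$. $(\operatorname{curl}\boldsymbol F)^{\tan}$ denotes the tangential part of $\operatorname{curl}\boldsymbol F$ on the unit sphere, i.e. its $\boldsymbol e_\varphi$ and $\boldsymbol e_\theta$ components, restricted to $\mathbb S^2\cap\mathcal K_{\varphi_0}$. An axisymmetric self-similar solution is a pair $(\boldsymbol u,p)$ with $\boldsymbol u\in C^2(\mathcal K_{\varphi_0})$, $p\in C^1(\mathcal K_{\varphi_0})$, both axisymmetric, solving the system pointwise and satisfying $\boldsymbol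 u(\lambda x)=\lambda^{-1}\boldsymbol u(x)$, $p(\lambda x)=\lambda^{-2}p(x)$ for all $\lambda>0$. In particular $\boldsymbol u=\rho^{-1}(f(\varphi)\boldsymbol e_\rho+g(\varphi)\boldsymbol e_\varphi+h(\varphi)\boldsymbol e_\theta)$ with angular profiles $f,g,h$ bounded on $[0,\varphi_0]$. *)

theory Defs
  imports "HOL-Analysis.Analysis"
begin

section \<open>Spherical coordinates and the solid cone\<close>

definition spherical :: "real \<Rightarrow> real \<Rightarrow> real \<Rightarrow> real^3" where
  "spherical \<rho> \<phi> \<theta> = vector [\<rho> * sin \<phi> * cos \<theta>, \<rho> * sin \<phi> * sin \<theta>, \<rho> * cos \<phi>]"

definition e_rho :: "real \<Rightarrow> real \<Rightarrow> real^3" where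
  "e_rho \<phi> \<theta> = spherical 1 \<phi> \<theta>"

definition e_theta :: "real \<Rightarrow> real^3" where
  "e_theta \<theta> = vector [- sin \<theta>, cos \<theta>, 0]"

definition e_phi :: "real \<Rightarrow> real \<Rightarrow> real^3" where
  "e_phi \<phi> \<theta> = cross3 (e_theta \<theta>) (e_rho \<phi> \<theta>)"

definition solid_cone :: "real \<Rightarrow> (real^3) set" where
  "solid_cone \<phi>0 = {spherical \<rho> \<phi> \<theta> | \<rho> \<phi> \<theta>. \<rho> > 0 \<and> \<theta> \<in> {0<..2*pi} \<and> \<phi> \<in> {0..\<phi>0}}"

definition v_rho :: "(real^3 \<Rightarrow> real^3) \<Rightarrow> real \<Rightarrow> real \<Rightarrow> real \<Rightarrow> real" where
  "v_rho v \<rho> \<phi> \<theta> = v (spherical \<rho> \<phi> \<theta>) \<bullet> e_rho \<phi> \<theta>"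

definition v_phi :: "(real^3 \<Rightarrow> real^3) \<Rightarrow> real \<Rightarrow> real \<Rightarrow> real \<Rightarrow> real" where
  "v_phi v \<rho> \<phi> \<theta> = v (spherical \<rho> \<phi> \<theta>) \<bullet> e_phi \<phi> \<theta>"

definition v_theta :: "(real^3 \<Rightarrow> real^3) \<Rightarrow> real \<Rightarrow> real \<Rightarrow> real \<Rightarrow> real" where
  "v_theta v \<rho> \<phi> \<theta> = v (spherical \<rho> \<phi> \<theta>) \<bullet> e_theta \<theta>"

text \<open>
  On the axis, where \<open>spherical \<rho> 0 \<theta>\<close> does not depend on \<open>\<theta>\<close> but the basis does, independence
  of \<open>\<theta>\<close> says that the field is parallel to the axis. Continuity forces this anyway.
\<close>

definition axisymmetric :: "real \<Rightarrow> (real^3 \<Rightarrow> real^3) \<Rightarrow> bool" where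
  "axisymmetric \<phi>0 v \<longleftrightarrow>
     (\<forall>\<rho>>0. \<forall>\<phi>\<in>{0..\<phi>0}. \<forall>\<theta>\<in>{0<..2*pi}. \<forall>\<theta>'\<in>{0<..2*pi}.
        v_rho v \<rho> \<phi> \<theta> = v_rho v \<rho> \<phi> \<theta>' \<and>
        v_phi v \<rho> \<phi> \<theta> = v_phi v \<rho> \<phi> \<theta>' \<and>
        v_theta v \<rho> \<phi> \<theta> = v_theta v \<rho> \<phi> \<theta>')"

definition axisymmetric_scalar :: "real \<Rightarrow> (real^3 \<Rightarrow> real) \<Rightarrow> bool" where
  "axisymmetric_scalar \<phi>0 p \<longleftrightarrow>
     (\<forall>\<rho>>0. \<forall>\<phi>\<in>{0..\<phi>0}. \<forall>\<theta>\<in>{0<..2*pi}. \<forall>\<theta>'\<in>{0<..2*pi}.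
        p (spherical \<rho> \<phi> \<theta>) = p (spherical \<rho> \<phi> \<theta>'))"

definition swirl_free :: "real \<Rightarrow> (real^3 \<Rightarrow> real^3) \<Rightarrow> bool" where
  "swirl_free \<phi>0 v \<longleftrightarrow> (\<forall>\<rho>>0. \<forall>\<phi>\<in>{0..\<phi>0}. \<forall>\<theta>\<in>{0<..2*pi}. v_theta v \<rho> \<phi> \<theta> = 0)"

definition homogeneous_on :: "(real^3) set \<Rightarrow> int \<Rightarrow> (real^3 \<Rightarrow> 'b::real_normed_vector) \<Rightarrow> bool" where
  "homogeneous_on S k f \<longleftrightarrow> (\<forall>l>0. \<forall>x\<in>S. f (l *\<^sub>R x) = (l powi k) *\<^sub>R f x)"

section \<open>Regularity up to the lateral boundary\<close>

text \<open>
  Derivatives are taken within \<open>S\<close>: at interior points they are the ordinary ones, and at lateral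
  boundary points of a cone they are one-sided. They are unique there as well, because the lateral
  boundary is smooth, so the choice made by \<open>frechet_derivative\<close> is harmless. The resulting
  class \<open>Ck_on k\<close> on a cone is the usual one: the derivatives up to order \<open>k\<close> in the
  interior extend continuously to the lateral boundary.
\<close>

definition partial_within :: "(real^3) set \<Rightarrow> 3 \<Rightarrow> (real^3 \<Rightarrow> 'b::real_normed_vector) \<Rightarrow> real^3 \<Rightarrow> 'b" where
  "partial_within S i f x = frechet_derivative f (at x within S) (axis i 1)"

primrec Ck_on :: "nat \<Rightarrow> (real^3) set \<Rightarrow> (real^3 \<Rightarrow> 'b::real_normed_vector) \<Rightarrow> bool" where
  "Ck_on 0 S f \<longleftrightarrow> continuous_on S f"
| "Ck_on (Suc k) S f \<longleftrightarrow> f differentiable_on S \<and> (\<forall>i. Ck_on k S (partial_within S i f))"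

definition locally_Holder_on :: "real \<Rightarrow> (real^3) set \<Rightarrow> (real^3 \<Rightarrow> 'b::real_normed_vector) \<Rightarrow> bool" where
  "locally_Holder_on \<alpha> S f \<longleftrightarrow>
     (\<forall>C. compact C \<and> C \<subseteq> S \<longrightarrow> (\<exists>M. \<forall>x\<in>C. \<forall>y\<in>C. dist (f x) (f y) \<le> M * dist x y powr \<alpha>))"

primrec Ck_Holder_loc_on :: "nat \<Rightarrow> real \<Rightarrow> (real^3) set \<Rightarrow> (real^3 \<Rightarrow> 'b::real_normed_vector) \<Rightarrow> bool" where
  "Ck_Holder_loc_on 0 \<alpha> S f \<longleftrightarrow> continuous_on S f \<and> locally_Holder_on \<alpha> S f"
| "Ck_Holder_loc_on (Suc k) \<alpha> S f \<longleftrightarrow>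
     f differentiable_on S \<and> (\<forall>i. Ck_Holder_loc_on k \<alpha> S (partial_within S i f))"

section \<open>Differential operators and the stationary Navier--Stokes system\<close>

definition grad_within :: "(real^3) set \<Rightarrow> (real^3 \<Rightarrow> real) \<Rightarrow> real^3 \<Rightarrow> real^3" where
  "grad_within S p x = (\<chi> i. partial_within S i p x)"

definition div_within :: "(real^3) set \<Rightarrow> (real^3 \<Rightarrow> real^3) \<Rightarrow> real^3 \<Rightarrow> real" where
  "div_within S u x = (\<Sum>i\<in>UNIV. partial_within S i u x $ i)"

definition laplacian_within :: "(real^3) set \<Rightarrow> (real^3 \<Rightarrow> real^3) \<Rightarrow> real^3 \<Rightarrow> real^3" where
  "laplacian_within S u x = (\<Sum>i\<in>UNIV. partial_within S i (partial_within S i u) x)"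

definition advection_within ::
  "(real^3) set \<Rightarrow> (real^3 \<Rightarrow> real^3) \<Rightarrow> (real^3 \<Rightarrow> real^3) \<Rightarrow> real^3 \<Rightarrow> real^3" where
  "advection_within S u v x = (\<Sum>i\<in>UNIV. (u x $ i) *\<^sub>R partial_within S i v x)"

definition curl_within :: "(real^3) set \<Rightarrow> (real^3 \<Rightarrow> real^3) \<Rightarrow> real^3 \<Rightarrow> real^3" where
  "curl_within S F x = vector
     [partial_within S 2 F x $ 3 - partial_within S 3 F x $ 2,
      partial_within S 3 F x $ 1 - partial_within S 1 F x $ 3,
      partial_within S 1 F x $ 2 - partial_within S 2 F x $ 1]"

definition tangential_part :: "(real^3 \<Rightarrow> real^3) \<Rightarrow> real^3 \<Rightarrow> real^3" where
  "tangential_part w x = w x - (w x \<bullet> sgn x) *\<^sub>R sgn x"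

text \<open>This is well-defined on the axis too, where \<open>e_phi\<close> and \<open>e_theta\<close> are not determined by the point:\<close>

lemma tangential_part_spherical:
  assumes "\<rho> > 0"
  shows "tangential_part w (spherical \<rho> \<phi> \<theta>) =
           v_phi w \<rho> \<phi> \<theta> *\<^sub>R e_phi \<phi> \<theta> + v_theta w \<rho> \<phi> \<theta> *\<^sub>R e_theta \<theta>"
proof -
  have e1: "sin \<phi> * sin \<phi> = 1 - cos \<phi> * cos \<phi>" and e2: "sin \<theta> * sin \<theta> = 1 - cos \<theta> * cos \<theta>"
    using sin_cos_squared_add[of \<phi>] sin_cos_squared_add[of \<theta>] by (simp_all add: power2_eq_square)
  have sc: "spherical \<rho> \<phi> \<theta> = \<rho> *\<^sub>R e_rho \<phi> \<theta>"
    by (simp add: spherical_def e_rho_def vec_eq_iff forall_3)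
  have "e_rho \<phi> \<theta> \<bullet> e_rho \<phi> \<theta> = 1"
    using e1 e2 by (simp add: e_rho_def spherical_def inner_vec_def sum_3) algebra
  hence "norm (e_rho \<phi> \<theta>) = 1" by (simp add: norm_eq_sqrt_inner)
  hence sg: "sgn (spherical \<rho> \<phi> \<theta>) = e_rho \<phi> \<theta>"
    using assms by (simp add: sc sgn_div_norm)
  have "y - (y \<bullet> e_rho \<phi> \<theta>) *\<^sub>R e_rho \<phi> \<theta> =
      (y \<bullet> e_phi \<phi> \<theta>) *\<^sub>R e_phi \<phi> \<theta> + (y \<bullet> e_theta \<theta>) *\<^sub>R e_theta \<theta>" for y :: "real^3"
    using e1 e2
    by (simp add: vec_eq_iff forall_3 e_rho_def e_phi_def e_theta_def spherical_def cross3_def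
          inner_vec_def sum_3) algebra
  then show ?thesis
    by (simp add: tangential_part_def sg v_phi_def v_theta_def)
qed

text \<open>The supremum is meaningful for bounded \<open>f\<close> only; below \<open>f\<close> is continuous and \<open>A\<close> compact.\<close>

definition C0_norm :: "(real^3) set \<Rightarrow> (real^3 \<Rightarrow> real^3) \<Rightarrow> real" where
  "C0_norm A f = (SUP x\<in>A. norm (f x))"

definition solves_NS :: "real \<Rightarrow> (real^3 \<Rightarrow> real^3) \<Rightarrow> (real^3 \<Rightarrow> real^3) \<Rightarrow> (real^3 \<Rightarrow> real) \<Rightarrow> bool" where
  "solves_NS \<phi>0 F u p \<longleftrightarrow>
     (\<forall>x\<in>interior (solid_cone \<phi>0).
        - laplacian_within (solid_cone \<phi>0) u x + advection_within (solid_cone \<phi>0) u u x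
          + grad_within (solid_cone \<phi>0) p x = F x \<and>
        div_within (solid_cone \<phi>0) u x = 0) \<and>
     (\<forall>x\<in>frontier (solid_cone \<phi>0) - {0}. u x = 0)"

definition axi_self_similar_solution ::
  "real \<Rightarrow> (real^3 \<Rightarrow> real^3) \<Rightarrow> (real^3 \<Rightarrow> real^3) \<Rightarrow> (real^3 \<Rightarrow> real) \<Rightarrow> bool" where
  "axi_self_similar_solution \<phi>0 F u p \<longleftrightarrow>
     Ck_on 2 (solid_cone \<phi>0) u \<and> Ck_on 1 (solid_cone \<phi>0) p \<and>
     axisymmetric \<phi>0 u \<and> axisymmetric_scalar \<phi>0 p \<and>
     homogeneous_on (solid_cone \<phi>0) (-1) u \<and> homogeneous_on (solid_cone \<phi>0) (-2) p \<and>
     solves_NS \<phi>0 F u p"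

text \<open>Fields on the cone are total functions here, so they are identified when they agree on it.\<close>

definition same_on_cone :: "real \<Rightarrow> (real^3 \<Rightarrow> real^3) \<Rightarrow> (real^3 \<Rightarrow> real) \<Rightarrow>
    (real^3 \<Rightarrow> real^3) \<Rightarrow> (real^3 \<Rightarrow> real) \<Rightarrow> bool" where
  "same_on_cone \<phi>0 u p u' p' \<longleftrightarrow> (\<forall>x\<in>solid_cone \<phi>0. u x = u' x \<and> p x = p' x)"

end

theory Submission
  imports Defs
begin

text \<open>Put \<open>x = cos \<phi>\<close>. Off the axis, a self-similar axisymmetric divergence-free field is given by two profiles,
  \<open>\<eta> = u\<^sup>\<phi> / sin \<phi>\<close> and \<open>s = sin \<phi> u\<^sup>\<theta>\<close> on the unit sphere; the divergence condition says
  \<open>u\<^sup>\<rho> = ((1 - x\<^sup>2) \<eta>)'\<close>. The swirl component of the momentum equation is \<open>s'' + \<eta> s' = - \<tau>\<close>. Eliminating the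
  pressure from the other two and integrating twice gives the Riccati equation \<open>\<eta>' + \<eta>\<^sup>2 / 2 + Q = 0\<close>, where \<open>Q\<close> depends on
  the force and on \<open>s\<close>. Regularity on the axis removes two of the constants of integration, and the boundary conditions
  \<open>\<eta> = \<eta>' = 0\<close> and \<open>s = 0\<close> on the lateral boundary fix the third one and the initial value of \<open>\<eta>\<close>. The linear
  problem for \<open>s\<close> is solved explicitly, so a solution is the same as a fixed point of
  \<open>\<eta> \<mapsto> - \<integral> (\<eta>\<^sup>2 / 2 + Q[\<eta>])\<close>, a contraction of a small ball when the tangential curl of the force, which controls
  \<open>\<tau>\<close> and the forcing part of \<open>Q\<close>, is small. Without swirl forcing, \<open>\<tau> = 0\<close> forces \<open>s = 0\<close>; then \<open>Q\<close> is independent of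
  \<open>\<eta>\<close>, and the difference of two solutions of the Riccati equation solves a linear homogeneous equation.\<close>

section \<open>Geometry of the cone\<close>

text \<open>The reduction to a Riccati equation goes back to Slezkin; what shapes the development is
  the axis \<open>x = 1\<close>. The profile equations degenerate there, and a force that is merely
  C^1 gives profiles whose \<open>x\<close>-derivatives blow up like powers of \<open>1 - x\<close>.
  Weights count these powers: every factor sin \<phi> carried by a gradient of \<open>mu\<close> or
  by a horizontal coordinate pays for one half power, and the fields come out C^{2,1}, which covers
  all exponents below 1 at once. Divisions by powers of \<open>1 - x\<close> are written as averages
  over \<open>[x, 1]\<close>, so that regularity on the axis is built in. Divisions by
  \<open>1 + x\<close> are controlled by \<open>x0 > -1\<close>; through them the constants depend
  on \<phi>0. Only the curl of the force can matter, since a gradient of degree -3 is absorbed by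
  the pressure: \<open>KF\<close> vanishes at 1 and its derivative is the \<theta>-component of the
  curl over sin \<phi>. The swirl forcing \<tau> is F^\<theta> / sin \<phi>; smallness of F^\<theta>
  bounds it only after multiplication by \<open>sqrt (1 - x)\<close>, which is enough because
  \<open>1 / sqrt (1 - x)\<close> is integrable.\<close>

text \<open>In spherical coordinates \<open>mu\<close> is \<open>cos \<phi>\<close> and \<open>rot_gen\<close> is \<open>\<rho> sin \<phi> e\<^sub>\<theta>\<close>.\<close>

definition rot_gen :: "real^3 \<Rightarrow> real^3" where
  "rot_gen X = vector [- X$2, X$1, 0]"

abbreviation e3 :: "real^3" where "e3 \<equiv> axis 3 1"

definition mu :: "real^3 \<Rightarrow> real" where
  "mu X = X$3 / norm X"

lemma rot_gen_nth [simp]: "rot_gen X $ 1 = - X$2" "rot_gen X $ 2 = X$1" "rot_gen X $ 3 = 0"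
  by (simp_all add: rot_gen_def)

lemma norm_sq3: "(norm (X::real^3))\<^sup>2 = (X$1)\<^sup>2 + (X$2)\<^sup>2 + (X$3)\<^sup>2"
  by (simp only: power2_norm_eq_inner) (simp add: inner_vec_def sum_3 power2_eq_square)

lemma spherical_nth [simp]:
  "spherical \<rho> \<phi> \<theta> $ 1 = \<rho> * sin \<phi> * cos \<theta>" "spherical \<rho> \<phi> \<theta> $ 2 = \<rho> * sin \<phi> * sin \<theta>"
  "spherical \<rho> \<phi> \<theta> $ 3 = \<rho> * cos \<phi>"
  by (simp_all add: spherical_def)

lemma norm_spherical:
  assumes "\<rho> \<ge> 0" shows "norm (spherical \<rho> \<phi> \<theta>) = \<rho>"
proof -
  have "(norm (spherical \<rho> \<phi> \<theta>))\<^sup>2 = \<rho>\<^sup>2 * (sin \<phi> ^ 2 * (cos \<theta> ^ 2 + sin \<theta> ^ 2) + cos \<phi> ^ 2)"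
    unfolding norm_sq3 spherical_nth by (simp only: power_mult_distrib algebra_simps)
  then have "(norm (spherical \<rho> \<phi> \<theta>))\<^sup>2 = \<rho>\<^sup>2" by simp
  with assms show ?thesis by (simp add: power2_eq_iff_nonneg)
qed

lemma mu_spherical: "\<rho> > 0 \<Longrightarrow> mu (spherical \<rho> \<phi> \<theta>) = cos \<phi>"
  by (simp add: mu_def norm_spherical)

lemma spherical_eq:
  "spherical \<rho> \<phi> \<theta> = (\<rho> * sin \<phi> * cos \<theta>) *\<^sub>R axis 1 1 + (\<rho> * sin \<phi> * sin \<theta>) *\<^sub>R axis 2 1 + (\<rho> * cos \<phi>) *\<^sub>R e3"
  by (simp add: vec_eq_iff forall_3 axis_def)

lemma spherical_surj:
  fixes X :: "real^3"
  assumes "X \<noteq> 0"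
  obtains \<theta> where "0 < \<theta>" "\<theta> \<le> 2*pi" "X = spherical (norm X) (arccos (mu X)) \<theta>"
proof -
  have n: "norm X > 0" using assms by simp
  define r where "r = sqrt ((X$1)\<^sup>2 + (X$2)\<^sup>2)"
  have m1: "\<bar>mu X\<bar> \<le> 1" using n component_le_norm_cart[of X 3] by (simp add: mu_def)
  have m2: "cos (arccos (mu X)) = mu X" using m1 by (simp add: cos_arccos_abs)
  have rn: "r = norm X * sin (arccos (mu X))"
  proof -
    have "sin (arccos (mu X)) = sqrt (1 - (mu X)\<^sup>2)" using m1 by (simp add: sin_arccos_abs)
    then have "norm X * sin (arccos (mu X)) = sqrt ((norm X)\<^sup>2 * (1 - (mu X)\<^sup>2))"
      by (simp add: real_sqrt_mult)
    also have "(norm X)\<^sup>2 * (1 - (mu X)\<^sup>2) = (X$1)\<^sup>2 + (X$2)\<^sup>2"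
    proof -
      have "(norm X)\<^sup>2 * (1 - (mu X)\<^sup>2) = (norm X)\<^sup>2 - (X$3)\<^sup>2"
        using n by (simp add: mu_def power_divide right_diff_distrib)
      then show ?thesis using norm_sq3[of X] by simp
    qed
    finally show ?thesis by (simp add: r_def)
  qed
  obtain t where t: "0 \<le> t" "t < 2*pi" "X$1 = r * cos t" "X$2 = r * sin t"
  proof (cases "r = 0")
    case True
    then have "X$1 = 0" "X$2 = 0" by (auto simp: r_def sum_power2_eq_zero_iff)
    then show ?thesis using True that[of 0] by simp
  next
    case False
    have r2: "r\<^sup>2 = (X$1)\<^sup>2 + (X$2)\<^sup>2" by (simp add: r_def)
    have "(X$1 / r)\<^sup>2 + (X$2 / r)\<^sup>2 = 1"
      unfolding power_divide add_divide_distrib[symmetric] r2[symmetric] using False by simp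
    from sincos_total_2pi[OF this] obtain t where "0 \<le> t" "t < 2*pi" "X$1/r = cos t" "X$2/r = sin t"
      by blast
    then show ?thesis using False that[of t] by (simp add: field_simps)
  qed
  \<comment> \<open>\<open>sincos_total_2pi\<close> returns an angle in [0, 2\<pi>), whereas the
    cone is parametrised by (0, 2\<pi>]; the angle 0 is moved to 2\<pi>.\<close>
  define th where "th = (if t = 0 then 2*pi else t)"
  have "0 < th" "th \<le> 2*pi" "cos th = cos t" "sin th = sin t" using t by (auto simp: th_def)
  moreover have "X = spherical (norm X) (arccos (mu X)) th"
    unfolding vec_eq_iff forall_3 spherical_nth m2
    using t(3,4) n \<open>cos th = cos t\<close> \<open>sin th = sin t\<close> by (simp add: rn mu_def)
  ultimately show ?thesis using that by blast
qed

locale cone =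
  fixes \<phi>0 :: real
  assumes phi0_pos: "0 < \<phi>0" and phi0_pi: "\<phi>0 < pi"
begin

abbreviation S where "S \<equiv> solid_cone \<phi>0"
abbreviation x0 where "x0 \<equiv> cos \<phi>0"

lemma x0_gt: "- 1 < x0"
  using phi0_pos phi0_pi cos_monotone_0_pi[of \<phi>0 pi] by simp

lemma x0_lt: "x0 < 1"
  using phi0_pos phi0_pi cos_monotone_0_pi[of 0 \<phi>0] by simp

text \<open>Cosine decreases on [0, \<pi>], so the bound on the polar angle is a bound on
  \<open>X$3 / norm X\<close>. Cleared of the denominator it also describes the case
  \<open>x0 < 0\<close>, where the cone is not convex.\<close>

lemma S_eq: "S = {X. X \<noteq> 0 \<and> x0 * norm X \<le> X$3}"
proof (intro set_eqI iffI)
  fix X :: "real^3" assume "X \<in> S"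
  then obtain \<rho> \<phi> \<theta> where *: "X = spherical \<rho> \<phi> \<theta>" "\<rho> > 0" "\<phi> \<in> {0..\<phi>0}"
    by (auto simp: solid_cone_def)
  have "x0 \<le> cos \<phi>" using * phi0_pi by (intro cos_monotone_0_pi_le) auto
  moreover have "norm X = \<rho>" using * by (simp add: norm_spherical)
  ultimately show "X \<in> {X. X \<noteq> 0 \<and> x0 * norm X \<le> X$3}" using * by auto
next
  fix X :: "real^3" assume X: "X \<in> {X. X \<noteq> 0 \<and> x0 * norm X \<le> X$3}"
  then have n: "norm X > 0" by simp
  from X obtain \<theta> where \<theta>: "0 < \<theta>" "\<theta> \<le> 2*pi" "X = spherical (norm X) (arccos (mu X)) \<theta>"
    using spherical_surj[of X] by blast
  have m1: "\<bar>mu X\<bar> \<le> 1" using n component_le_norm_cart[of X 3] by (simp add: mu_def)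
  have "x0 \<le> mu X" using X n by (simp add: mu_def field_simps)
  then have "arccos (mu X) \<le> arccos x0" using m1 by (intro arccos_le_arccos) auto
  also have "\<dots> = \<phi>0" using phi0_pos phi0_pi by (simp add: arccos_cos)
  finally have "arccos (mu X) \<in> {0..\<phi>0}" using m1 by (auto intro: arccos_lbound)
  then show "X \<in> S" unfolding solid_cone_def using \<theta> n by fastforce
qed

lemma S_nz: "X \<in> S \<Longrightarrow> X \<noteq> 0" by (auto simp: S_eq)

lemma mu_mem: assumes "X \<in> S" shows "mu X \<in> {x0..1}"
  using assms component_le_norm_cart[of X 3] by (auto simp: S_eq mu_def field_simps)

lemma S_iff_mu: "X \<in> S \<longleftrightarrow> X \<noteq> 0 \<and> x0 \<le> mu X"
  by (auto simp: S_eq mu_def field_simps)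

lemma scale_S: "X \<in> S \<Longrightarrow> l > 0 \<Longrightarrow> l *\<^sub>R X \<in> S"
  by (auto simp: S_eq mult_left_mono mult.left_commute)

lemma spherical_in_S: "\<rho> > 0 \<Longrightarrow> 0 \<le> \<phi> \<Longrightarrow> \<phi> \<le> \<phi>0 \<Longrightarrow> spherical \<rho> \<phi> \<theta> \<in> S"
  unfolding S_iff_mu using norm_spherical[of \<rho> \<phi> \<theta>] phi0_pi
  by (auto simp: mu_spherical intro!: cos_monotone_0_pi_le)

definition S_open :: "(real^3) set" where
  "S_open = {X. X \<noteq> 0 \<and> x0 * norm X < X$3}"

lemma open_S_open: "open S_open"
proof -
  have "S_open = {X. x0 * norm X < X$3} \<inter> - {0}" by (auto simp: S_open_def)
  moreover have "open {X::real^3. x0 * norm X < X$3}"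
    by (intro open_Collect_less continuous_intros)
  ultimately show ?thesis by (simp add: open_Int open_delete Compl_eq_Diff_UNIV)
qed

lemma S_open_subset: "S_open \<subseteq> S" by (auto simp: S_open_def S_eq)

lemma S_open_iff_mu: "X \<in> S_open \<longleftrightarrow> X \<noteq> 0 \<and> x0 < mu X"
  by (auto simp: S_open_def mu_def field_simps)

text \<open>The cone meets the axis only in its positive half, because \<open>x0 > -1\<close>
  excludes points with \<open>X$3 = - norm X\<close>; there \<open>mu\<close> is 1, away from the
  boundary value \<open>x0\<close>.\<close>

lemma axis_S_open:
  assumes "X \<in> S" "X$1 = 0" "X$2 = 0" shows "X \<in> S_open" "mu X = 1"
proof -
  have "(norm X)\<^sup>2 = (X$3)\<^sup>2" using assms by (simp add: norm_sq3)
  then have n: "norm X = \<bar>X$3\<bar>" by (metis abs_norm_cancel real_sqrt_abs)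
  have "X$3 > 0"
  proof (rule ccontr)
    assume "\<not> ?thesis"
    then have *: "X$3 \<le> 0" by simp
    then have "x0 * (- X$3) \<le> X$3" using assms n by (auto simp: S_eq)
    then have "(1 + x0) * X$3 \<ge> 0" by (simp add: algebra_simps)
    then have "X$3 = 0" using x0_gt * by (simp add: zero_le_mult_iff)
    then show False using n assms S_nz[of X] by simp
  qed
  with n have "norm X = X$3" by simp
  with \<open>X$3 > 0\<close> show "mu X = 1" by (simp add: mu_def)
  then show "X \<in> S_open" using S_nz[OF assms(1)] x0_lt by (simp add: S_open_iff_mu)
qed

text \<open>Adding \<open>t\<close> times \<open>e3\<close> raises the third coordinate by
  \<open>t\<close> and changes the norm by at most \<open>t\<close>, while \<open>x0\<close> has
  modulus below 1. Together with dilation and rotation this is one of three motions that stay in the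
  cone.\<close>

lemma add_e3_in_S:
  assumes "X \<in> S" "t \<ge> 0" shows "X + t *\<^sub>R e3 \<in> S"
proof (cases "X + t *\<^sub>R e3 = 0")
  case True
  then have "X $ i = - (t *\<^sub>R e3) $ i" for i by (metis add.inverse_inverse minus_add_cancel neg_eq_iff_add_eq_0 vector_add_component vector_uminus_component zero_index)
  then have "X$1 = 0" "X$2 = 0" "X$3 = -t" by (auto simp: axis_def)
  have "X$3 = norm X" using axis_S_open(2)[OF assms(1) \<open>X$1 = 0\<close> \<open>X$2 = 0\<close>] S_nz[OF assms(1)]
    by (simp add: mu_def)
  then have "X$3 > 0" using S_nz[OF assms(1)] by simp
  then show ?thesis using \<open>X$3 = -t\<close> assms by simp
next
  case False
  have nt: "norm (t *\<^sub>R e3) = t" using assms by simp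
  have *: "x0 * norm X \<le> X$3" using assms by (simp add: S_eq)
  have "x0 * norm (X + t *\<^sub>R e3) \<le> x0 * norm X + t"
  proof (cases "x0 \<ge> 0")
    case True
    have "x0 * norm (X + t *\<^sub>R e3) \<le> x0 * (norm X + t)"
      using True norm_triangle_ineq[of X "t *\<^sub>R e3"] nt by (intro mult_left_mono) auto
    also have "\<dots> \<le> x0 * norm X + t" using x0_lt assms True mult_right_mono[of x0 1 t] by (simp add: algebra_simps)
    finally show ?thesis .
  next
    case False
    have "x0 * norm (X + t *\<^sub>R e3) \<le> x0 * (norm X - t)"
      using False norm_triangle_ineq4[of "X + t *\<^sub>R e3" "t *\<^sub>R e3"] nt by (intro mult_left_mono_neg) auto
    also have "\<dots> \<le> x0 * norm X + t" using x0_gt assms mult_right_mono[of "-x0" 1 t] by (simp add: algebra_simps)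
    finally show ?thesis .
  qed
  then show ?thesis using * False by (simp add: S_eq)
qed

lemma rotate_in_S:
  assumes "X \<in> S"
  shows "vector [cos t * X$1 - sin t * X$2, sin t * X$1 + cos t * X$2, X$3] \<in> S" (is "?Y \<in> S")
proof -
  have "(norm ?Y)\<^sup>2 = ((cos t)\<^sup>2 + (sin t)\<^sup>2) * ((X$1)\<^sup>2 + (X$2)\<^sup>2) + (X$3)\<^sup>2"
    unfolding norm_sq3 vector_3 by (simp only: power2_eq_square algebra_simps)
  then have "norm ?Y = norm X" by (simp add: norm_sq3[of X, symmetric] power2_eq_iff_nonneg)
  moreover from this have "?Y \<noteq> 0" using S_nz[OF assms] by (metis norm_eq_zero)
  ultimately show ?thesis using assms by (simp add: S_eq)
qed

text \<open>Off the axis, dilation, upward shift and rotation are curves inside the cone that leave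
  \<open>X\<close> with velocities \<open>X\<close>, \<open>e3\<close> and \<open>rot_gen X\<close>.
  One-sided differentiation along them fixes the derivative on a basis. Points of the axis are
  interior.\<close>

lemma has_derivative_unique_S:
  fixes f :: "real^3 \<Rightarrow> 'b::real_normed_vector"
  assumes X: "X \<in> S" and f1: "(f has_derivative f1) (at X within S)" and f2: "(f has_derivative f2) (at X within S)"
  shows "f1 = f2"
proof (cases "X$1 = 0 \<and> X$2 = 0")
  case True
  then have "X \<in> S_open" using axis_S_open X by blast
  then have "X \<in> interior S" using open_S_open S_open_subset by (meson interiorI)
  then show ?thesis using f1 f2 has_derivative_unique by (metis at_within_interior)
next
  case False
  define d where "d = (\<lambda>h. f1 h - f2 h)"
  have d: "((\<lambda>_. 0) has_derivative d) (at X within S)"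
    using has_derivative_diff[OF f1 f2] by (simp add: d_def)
  then have lin: "linear d" by (simp add: has_derivative_bounded_linear bounded_linear.linear)
  have curve: "d v = 0" if g: "(g has_vector_derivative v) (at 0 within {0..1})" "g 0 = X" "\<And>t. 0 \<le> t \<Longrightarrow> g t \<in> S"
    for g and v
  proof -
    have "((\<lambda>_. 0) has_derivative d) (at (g 0) within g ` {0..1})"
      using g(3) unfolding g(2) by (intro has_derivative_subset[OF d]) auto
    from vector_derivative_diff_chain_within[OF g(1) this]
    have "((\<lambda>_. 0) has_vector_derivative d v) (at (0::real) within {0..1})" by (simp add: o_def)
    moreover have "((\<lambda>_. 0) has_vector_derivative (0::'b)) (at (0::real) within {0..1})" by simp
    ultimately show ?thesis
      using vector_derivative_unique_within_closed_interval[of 0 1 0 "\<lambda>_. 0" "d v" 0] by auto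
  qed
  have dX: "d X = 0"
    by (rule curve[of "\<lambda>t. (1+t) *\<^sub>R X"]) (auto intro!: derivative_eq_intros scale_S X)
  have de3: "d e3 = 0"
    by (rule curve[of "\<lambda>t. X + t *\<^sub>R e3"]) (auto intro!: derivative_eq_intros add_e3_in_S X)
  define g where "g = (\<lambda>t. vector [cos t * X$1 - sin t * X$2, sin t * X$1 + cos t * X$2, X$3] :: real^3)"
  have ge: "g = (\<lambda>t. cos t *\<^sub>R (X - X$3 *\<^sub>R e3) + sin t *\<^sub>R rot_gen X + X$3 *\<^sub>R e3)"
    by (auto simp: g_def vec_eq_iff forall_3 axis_def)
  have "(g has_vector_derivative rot_gen X) (at 0 within {0..1})"
    unfolding ge by (auto intro!: derivative_eq_intros)
  then have dJ: "d (rot_gen X) = 0"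
    by (rule curve) (auto simp: g_def rotate_in_S[OF X] vec_eq_iff forall_3)
  define r where "r = (X$1)\<^sup>2 + (X$2)\<^sup>2"
  have r: "r \<noteq> 0" using False by (auto simp: r_def sum_power2_eq_zero_iff)
  \<comment> \<open>Off the axis \<open>r\<close> is nonzero, so the horizontal basis vectors are
    recovered from the three velocities.\<close>
  have 1: "r *\<^sub>R axis 1 1 = X$1 *\<^sub>R (X - X$3 *\<^sub>R e3) - X$2 *\<^sub>R rot_gen X"
    by (simp add: vec_eq_iff forall_3 axis_def r_def power2_eq_square)
  have 2: "r *\<^sub>R axis 2 1 = X$2 *\<^sub>R (X - X$3 *\<^sub>R e3) + X$1 *\<^sub>R rot_gen X"
    by (simp add: vec_eq_iff forall_3 axis_def r_def power2_eq_square)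
  have "d (r *\<^sub>R axis 1 1) = 0" "d (r *\<^sub>R axis 2 1) = 0"
    unfolding 1 2 using dX de3 dJ by (simp_all add: linear_add[OF lin] linear_diff[OF lin] linear_cmul[OF lin])
  then have d12: "d (axis 1 1) = 0" "d (axis 2 1) = 0" using r by (simp_all add: linear_cmul[OF lin])
  have "d h = 0" for h
  proof -
    have "h = h$1 *\<^sub>R axis 1 1 + h$2 *\<^sub>R axis 2 1 + h$3 *\<^sub>R e3" by (simp add: vec_eq_iff forall_3 axis_def)
    then have "d h = d (h$1 *\<^sub>R axis 1 1 + h$2 *\<^sub>R axis 2 1 + h$3 *\<^sub>R e3)" by simp
    also have "\<dots> = 0" using d12 de3 by (simp add: linear_add[OF lin] linear_cmul[OF lin])
    finally show ?thesis .
  qed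
  then show ?thesis by (auto simp: d_def)
qed

lemma partial_within_eq:
  assumes "X \<in> S" "(f has_derivative f') (at X within S)"
  shows "partial_within S i f X = f' (axis i 1)"
proof -
  have "(f has_derivative frechet_derivative f (at X within S)) (at X within S)"
    using assms(2) differentiableI frechet_derivative_works by blast
  from has_derivative_unique_S[OF assms(1) this assms(2)] show ?thesis by (simp add: partial_within_def)
qed

lemma frontier_S: "X \<in> frontier S \<Longrightarrow> X \<noteq> 0 \<Longrightarrow> X \<in> S \<and> mu X = x0"
proof -
  assume X: "X \<in> frontier S" "X \<noteq> 0"
  have "closure S \<subseteq> {X. x0 * norm X \<le> X$3}"
  proof (rule closure_minimal)
    show "S \<subseteq> {X. x0 * norm X \<le> X$3}" by (auto simp: S_eq)
    show "closed {X::real^3. x0 * norm X \<le> X$3}"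
      by (intro closed_Collect_le continuous_intros)
  qed
  then have 1: "x0 * norm X \<le> X$3" using X by (auto simp: frontier_def)
  have "X \<notin> S_open" using X open_S_open S_open_subset by (auto simp: frontier_def interior_def)
  then have "X$3 \<le> x0 * norm X" using X by (auto simp: S_open_def)
  with 1 X show ?thesis by (auto simp: S_eq mu_def field_simps)
qed

text \<open>A point with \<open>mu X = x0\<close> is a limit of points with polar angle slightly
  above \<open>\<phi>0\<close>, and these lie outside the cone.\<close>

lemma interior_S: "interior S = S_open"
proof
  show "S_open \<subseteq> interior S" by (simp add: S_open_subset interior_maximal open_S_open)
  show "interior S \<subseteq> S_open"
  proof
    fix X assume X: "X \<in> interior S"
    then have XS: "X \<in> S" using interior_subset by blast
    show "X \<in> S_open"
    proof (rule ccontr)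
      assume "X \<notin> S_open"
      then have mX: "mu X = x0" using XS by (auto simp: S_open_iff_mu S_iff_mu)
      obtain \<theta> where \<theta>: "X = spherical (norm X) (arccos (mu X)) \<theta>" using spherical_surj S_nz[OF XS] by metis
      then have th: "X = spherical (norm X) \<phi>0 \<theta>" using phi0_pos phi0_pi by (simp add: mX arccos_cos)
      have n: "norm X > 0" using S_nz XS by simp
      have "isCont (\<lambda>t. spherical (norm X) t \<theta>) \<phi>0"
        unfolding spherical_eq by (intro continuous_intros)
      then have "((\<lambda>t. spherical (norm X) t \<theta>) \<longlongrightarrow> X) (at_right \<phi>0)"
        using th by (simp add: isCont_def filterlim_at_split)
      then have "\<forall>\<^sub>F t in at_right \<phi>0. spherical (norm X) t \<theta> \<in> interior S"
        using X by (auto elim!: topological_tendstoD)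
      moreover have "\<forall>\<^sub>F t in at_right \<phi>0. t \<in> {\<phi>0<..<pi}"
        using phi0_pi by (simp add: eventually_at_right_field) (meson less_trans)
      ultimately have "\<forall>\<^sub>F t in at_right \<phi>0. False"
      proof eventually_elim
        case (elim t)
        then have "spherical (norm X) t \<theta> \<in> S" using interior_subset by blast
        then have "x0 \<le> cos t" using mu_mem[of "spherical (norm X) t \<theta>"] n by (simp add: mu_spherical)
        moreover have "cos t < x0" using elim phi0_pos by (intro cos_monotone_0_pi) auto
        ultimately show False by simp
      qed
      then show False by (simp add: trivial_limit_at_right_real)
    qed
  qed
qed

lemma boundary_frontier: "X \<in> S \<Longrightarrow> mu X = x0 \<Longrightarrow> X \<in> frontier S - {0}"
  using S_nz[of X] closure_subset[of S] by (auto simp: frontier_def interior_S S_open_iff_mu)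

end

section \<open>Local Lipschitz regularity up to the lateral boundary\<close>

text \<open>The quantifier over compact subsets is that of \<open>locally_Holder_on\<close>, so that
  constants pass over directly.\<close>

definition loc_lipschitz :: "'a::metric_space set \<Rightarrow> ('a \<Rightarrow> 'b::metric_space) \<Rightarrow> bool" where
  "loc_lipschitz S f \<longleftrightarrow> (\<forall>C. compact C \<and> C \<subseteq> S \<longrightarrow> (\<exists>M. M-lipschitz_on C f))"

lemma loc_lipschitz_cong:
  "(\<And>x. x \<in> S \<Longrightarrow> f x = g x) \<Longrightarrow> loc_lipschitz S f \<Longrightarrow> loc_lipschitz S g"
  unfolding loc_lipschitz_def
proof (intro allI impI)
  fix C assume fg: "\<And>x. x \<in> S \<Longrightarrow> f x = g x" and f: "\<forall>C. compact C \<and> C \<subseteq> S \<longrightarrow> (\<exists>M. M-lipschitz_on C f)"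
    and C: "compact C \<and> C \<subseteq> S"
  then obtain M where "M-lipschitz_on C f" by blast
  then have "M-lipschitz_on C g" by (rule lipschitz_on_transform) (use fg C in auto)
  then show "\<exists>M. M-lipschitz_on C g" by blast
qed

lemma loc_lipschitz_const [intro]: "loc_lipschitz S (\<lambda>_. c)"
  unfolding loc_lipschitz_def using lipschitz_on_constant by blast

lemma loc_lipschitz_add:
  fixes f g :: "'a::metric_space \<Rightarrow> 'b::real_normed_vector"
  assumes "loc_lipschitz S f" "loc_lipschitz S g" shows "loc_lipschitz S (\<lambda>x. f x + g x)"
  using assms unfolding loc_lipschitz_def by (blast intro: lipschitz_on_add)

lemma loc_lipschitz_bounded:
  fixes f :: "'a::metric_space \<Rightarrow> 'b::real_normed_vector"
  assumes "loc_lipschitz S f" "compact C" "C \<subseteq> S"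
  obtains M L where "0 \<le> M" "\<And>x. x \<in> C \<Longrightarrow> norm (f x) \<le> M" "L-lipschitz_on C f"
proof -
  obtain L where L: "L-lipschitz_on C f" using assms unfolding loc_lipschitz_def by blast
  have "compact (f ` C)" using L assms(2) lipschitz_on_continuous_on compact_continuous_image by blast
  then obtain M where "\<And>x. x \<in> C \<Longrightarrow> norm (f x) \<le> M" using compact_imp_bounded bounded_iff
    by (metis imageI)
  then show ?thesis using that[of "max M 0" L] L by (meson max.cobounded1 max.cobounded2 order_trans)
qed

lemma loc_lipschitz_mult:
  fixes f g :: "'a::metric_space \<Rightarrow> real"
  assumes "loc_lipschitz S f" "loc_lipschitz S g" shows "loc_lipschitz S (\<lambda>x. f x * g x)"
  unfolding loc_lipschitz_def
proof (intro allI impI)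
  fix C assume C: "compact C \<and> C \<subseteq> S"
  obtain M L where f: "0 \<le> M" "\<And>x. x \<in> C \<Longrightarrow> norm (f x) \<le> M" "L-lipschitz_on C f"
    using loc_lipschitz_bounded[OF assms(1)] C by metis
  obtain N K where g: "0 \<le> N" "\<And>x. x \<in> C \<Longrightarrow> norm (g x) \<le> N" "K-lipschitz_on C g"
    using loc_lipschitz_bounded[OF assms(2)] C by metis
  have "(M*K + L*N)-lipschitz_on C (\<lambda>x. f x * g x)"
  proof (rule lipschitz_onI)
    fix x y assume xy: "x \<in> C" "y \<in> C"
    have "dist (f x * g x) (f y * g y) = \<bar>f x * (g x - g y) + (f x - f y) * g y\<bar>"
      by (simp add: dist_real_def algebra_simps)
    also have "\<dots> \<le> \<bar>f x\<bar> * \<bar>g x - g y\<bar> + \<bar>f x - f y\<bar> * \<bar>g y\<bar>"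
      by (metis abs_triangle_ineq abs_mult)
    also have "\<dots> \<le> M * (K * dist x y) + (L * dist x y) * N"
      using f(2)[OF xy(1)] g(2)[OF xy(2)] lipschitz_onD[OF f(3) xy] lipschitz_onD[OF g(3) xy] f(1) g(1)
        lipschitz_on_nonneg[OF f(3)] lipschitz_on_nonneg[OF g(3)]
      by (intro add_mono mult_mono) (auto simp: dist_real_def)
    finally show "dist (f x * g x) (f y * g y) \<le> (M*K + L*N) * dist x y" by (simp add: algebra_simps)
  qed (use f(1) g(1) lipschitz_on_nonneg[OF f(3)] lipschitz_on_nonneg[OF g(3)] in auto)
  then show "\<exists>M. M-lipschitz_on C (\<lambda>x. f x * g x)" by blast
qed

lemma loc_lipschitz_linear:
  assumes "loc_lipschitz S f" "bounded_linear L" shows "loc_lipschitz S (\<lambda>x. L (f x))"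
  unfolding loc_lipschitz_def
proof (intro allI impI)
  fix C assume "compact C \<and> C \<subseteq> S"
  then obtain M where M: "M-lipschitz_on C f" using assms(1) unfolding loc_lipschitz_def by blast
  obtain K where K: "K > 0" "\<And>x. norm (L x) \<le> norm x * K" using bounded_linear.pos_bounded[OF assms(2)] by blast
  have "(K*M)-lipschitz_on C (\<lambda>x. L (f x))"
  proof (rule lipschitz_onI)
    fix x y assume xy: "x \<in> C" "y \<in> C"
    have "dist (L (f x)) (L (f y)) = norm (L (f x - f y))"
      using assms(2) by (simp add: dist_norm bounded_linear.linear linear_diff)
    also have "\<dots> \<le> norm (f x - f y) * K" by (rule K)
    also have "\<dots> \<le> (M * dist x y) * K" using lipschitz_onD[OF M xy] K(1) by (intro mult_right_mono) (auto simp: dist_norm)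
    finally show "dist (L (f x)) (L (f y)) \<le> K * M * dist x y" by (simp add: algebra_simps)
  qed (use K lipschitz_on_nonneg[OF M] in auto)
  then show "\<exists>M. M-lipschitz_on C (\<lambda>x. L (f x))" by blast
qed

lemma loc_lipschitz_sum:
  fixes f :: "'i \<Rightarrow> 'a::metric_space \<Rightarrow> 'b::real_normed_vector"
  shows "(\<And>i. i \<in> I \<Longrightarrow> loc_lipschitz S (f i)) \<Longrightarrow> loc_lipschitz S (\<lambda>x. \<Sum>i\<in>I. f i x)"
  by (induction I rule: infinite_finite_induct) (auto intro: loc_lipschitz_add loc_lipschitz_const)

lemma loc_lipschitz_vec:
  fixes f :: "'a::metric_space \<Rightarrow> real^'n"
  assumes "\<And>i. loc_lipschitz S (\<lambda>x. f x $ i)" shows "loc_lipschitz S f"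
proof -
  have "loc_lipschitz S (\<lambda>x. \<Sum>i\<in>UNIV. (f x $ i) *\<^sub>R (axis i 1 :: real^'n))"
    using loc_lipschitz_linear[OF assms bounded_linear_scaleR_left] by (intro loc_lipschitz_sum) auto
  then show ?thesis using basis_expansion[of "f x" for x] by (simp add: scalar_mult_eq_scaleR)
qed

text \<open>A convergent sequence together with its limit is a compact subset of \<open>S\<close>,
  so a Lipschitz bound is available along it.\<close>

lemma loc_lipschitz_continuous_on:
  fixes f :: "'a::heine_borel \<Rightarrow> 'b::metric_space"
  assumes "loc_lipschitz S f" shows "continuous_on S f"
  unfolding continuous_on_sequentially
proof (intro allI ballI impI)
  fix x a assume a: "a \<in> S" and x: "(\<forall>n. x n \<in> S) \<and> x \<longlonglongrightarrow> a"
  define C where "C = insert a (range x)"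
  have "compact C" "C \<subseteq> S" using x a compact_sequence_with_limit unfolding C_def by blast+
  then have "continuous_on C f" using assms lipschitz_on_continuous_on unfolding loc_lipschitz_def by blast
  moreover have "a \<in> C" "\<forall>n. x n \<in> C" by (auto simp: C_def)
  ultimately show "(f \<circ> x) \<longlonglongrightarrow> f a" using x unfolding continuous_on_sequentially by blast
qed

lemma loc_lipschitz_locally_Holder:
  assumes "loc_lipschitz S f" "0 < \<alpha>" "\<alpha> < 1" shows "locally_Holder_on \<alpha> S f"
  unfolding locally_Holder_on_def
proof (intro allI impI)
  fix C assume C: "compact C \<and> C \<subseteq> S"
  then obtain M where M: "M-lipschitz_on C f" using assms(1) unfolding loc_lipschitz_def by blast
  obtain D where D: "\<And>x y. x \<in> C \<Longrightarrow> y \<in> C \<Longrightarrow> dist x y \<le> D"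
    using C compact_imp_bounded bounded_two_points by metis
  have "dist (f x) (f y) \<le> (M * D powr (1 - \<alpha>)) * dist x y powr \<alpha>" if xy: "x \<in> C" "y \<in> C" for x y
  proof -
    have "dist (f x) (f y) \<le> M * dist x y" using lipschitz_onD[OF M xy] .
    \<comment> \<open>One factor is bounded by a power of the diameter, the other is the required
      modulus.\<close>
    also have "dist x y = dist x y powr (1 - \<alpha>) * dist x y powr \<alpha>"
      by (simp flip: powr_add)
    also have "M * \<dots> \<le> M * (D powr (1 - \<alpha>) * dist x y powr \<alpha>)"
      using D[OF xy] assms lipschitz_on_nonneg[OF M]
      by (intro mult_left_mono mult_right_mono powr_mono2) auto
    finally show ?thesis by (simp add: mult.assoc)
  qed
  then show "\<exists>M. \<forall>x\<in>C. \<forall>y\<in>C. dist (f x) (f y) \<le> M * dist x y powr \<alpha>" by blast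
qed

text \<open>The direction \<open>sgn (V x)\<close> jumps where \<open>V\<close> vanishes, but
  \<open>B\<close> is small there. What makes the product Lipschitz is that \<open>norm a\<close>
  times the distance of \<open>sgn a\<close> and \<open>sgn b\<close> is at most twice the distance
  of \<open>a\<close> and \<open>b\<close>. This carries regularity across the axis, where the
  horizontal direction has no limit.\<close>

lemma loc_lipschitz_mult_sgn:
  fixes B :: "'a::metric_space \<Rightarrow> real" and V :: "'a \<Rightarrow> real^'n"
  assumes B: "loc_lipschitz S B" and V: "loc_lipschitz S V" and M: "\<And>x. x \<in> S \<Longrightarrow> \<bar>B x\<bar> \<le> M * norm (V x)"
  shows "loc_lipschitz S (\<lambda>x. B x * sgn (V x) $ i)"
  unfolding loc_lipschitz_def
proof (intro allI impI)
  fix C assume C: "compact C \<and> C \<subseteq> S"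
  then obtain L K where L: "L-lipschitz_on C B" and K: "K-lipschitz_on C V"
    using B V unfolding loc_lipschitz_def by blast
  have sd: "norm a * norm (sgn a - sgn b) \<le> 2 * norm (a - b)" for a b :: "real^'n"
  proof (cases "a = 0 \<or> b = 0")
    case True
    then show ?thesis by (auto simp: norm_sgn)
  next
    case False
    have "norm a *\<^sub>R (sgn a - sgn b) = (a - b) + (norm b - norm a) *\<^sub>R sgn b"
      using False by (simp add: sgn_div_norm algebra_simps)
    then have "norm (norm a *\<^sub>R (sgn a - sgn b)) \<le> norm (a - b) + norm ((norm b - norm a) *\<^sub>R sgn b)"
      using norm_triangle_ineq by metis
    moreover have "norm ((norm b - norm a) *\<^sub>R sgn b) \<le> norm (a - b)"
      using False norm_triangle_ineq3[of a b] by (simp add: norm_sgn abs_minus_commute)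
    ultimately show ?thesis by simp
  qed
  have "(L + 2 * \<bar>M\<bar> * K)-lipschitz_on C (\<lambda>x. B x * sgn (V x) $ i)"
  proof (rule lipschitz_onI)
    fix x y assume xy: "x \<in> C" "y \<in> C"
    have s1: "\<bar>sgn (V y) $ i\<bar> \<le> 1" using component_le_norm_cart[of "sgn (V y)" i] by (auto simp: norm_sgn split: if_splits)
    have s2: "\<bar>B x\<bar> * \<bar>sgn (V x) $ i - sgn (V y) $ i\<bar> \<le> 2 * \<bar>M\<bar> * (K * dist x y)"
    proof -
      have "\<bar>B x\<bar> * \<bar>sgn (V x) $ i - sgn (V y) $ i\<bar> \<le> (\<bar>M\<bar> * norm (V x)) * norm (sgn (V x) - sgn (V y))"
      proof (rule mult_mono)
        have "\<bar>B x\<bar> \<le> M * norm (V x)" using M xy C by blast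
        also have "\<dots> \<le> \<bar>M\<bar> * norm (V x)" by (intro mult_right_mono) auto
        finally show "\<bar>B x\<bar> \<le> \<bar>M\<bar> * norm (V x)" .
      qed (use component_le_norm_cart[of "sgn (V x) - sgn (V y)" i] in auto)
      also have "\<dots> \<le> \<bar>M\<bar> * (2 * norm (V x - V y))"
        unfolding mult.assoc by (intro mult_left_mono sd) auto
      also have "\<dots> \<le> \<bar>M\<bar> * (2 * (K * dist x y))"
        using lipschitz_onD[OF K xy] by (intro mult_left_mono) (auto simp: dist_norm)
      finally show ?thesis by simp
    qed
    have "dist (B x * sgn (V x) $ i) (B y * sgn (V y) $ i) =
      \<bar>B x * (sgn (V x) $ i - sgn (V y) $ i) + (B x - B y) * sgn (V y) $ i\<bar>"
      by (simp add: dist_real_def algebra_simps)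
    also have "\<dots> \<le> \<bar>B x\<bar> * \<bar>sgn (V x) $ i - sgn (V y) $ i\<bar> + \<bar>B x - B y\<bar> * \<bar>sgn (V y) $ i\<bar>"
      by (metis abs_triangle_ineq abs_mult)
    also have "\<dots> \<le> 2 * \<bar>M\<bar> * (K * dist x y) + (L * dist x y) * 1"
      using s1 s2 lipschitz_onD[OF L xy] lipschitz_on_nonneg[OF L]
      by (intro add_mono[OF s2] mult_mono) (auto simp: dist_real_def)
    finally show "dist (B x * sgn (V x) $ i) (B y * sgn (V y) $ i) \<le> (L + 2 * \<bar>M\<bar> * K) * dist x y"
      by (simp add: algebra_simps)
  qed (use lipschitz_on_nonneg[OF L] lipschitz_on_nonneg[OF K] in auto)
  then show "\<exists>M. M-lipschitz_on C (\<lambda>x. B x * sgn (V x) $ i)" by blast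
qed

text \<open>This is \<open>C\<^bsup>k,1\<^esup>\<close> on compact subsets of \<open>S\<close>, hence \<open>C\<^bsup>k,\<alpha>\<^esup>\<close> for all \<open>\<alpha> < 1\<close>.\<close>

primrec CL :: "nat \<Rightarrow> (real^3) set \<Rightarrow> (real^3 \<Rightarrow> 'b::real_normed_vector) \<Rightarrow> bool" where
  "CL 0 S f \<longleftrightarrow> loc_lipschitz S f"
| "CL (Suc k) S f \<longleftrightarrow> loc_lipschitz S f \<and> f differentiable_on S \<and> (\<forall>i. CL k S (partial_within S i f))"

lemma CL_loc_lipschitz: "CL k S f \<Longrightarrow> loc_lipschitz S f" by (cases k) auto

lemma CL_Suc_D: "CL (Suc k) S f \<Longrightarrow> CL k S f"
proof (induction k arbitrary: f)
  case (Suc k)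
  then show ?case by (metis CL.simps(2))
qed simp

lemma CL_Ck_on: "CL k S f \<Longrightarrow> Ck_on k S f"
  by (induction k arbitrary: f) (auto intro: loc_lipschitz_continuous_on)

lemma CL_Ck_Holder: "CL k S f \<Longrightarrow> 0 < \<alpha> \<Longrightarrow> \<alpha> < 1 \<Longrightarrow> Ck_Holder_loc_on k \<alpha> S f"
  by (induction k arbitrary: f) (auto intro: loc_lipschitz_continuous_on loc_lipschitz_locally_Holder)

section \<open>Calculus of the classes \<open>CL\<close> on the cone\<close>

context cone begin

lemma partial_within_cong:
  assumes "\<And>X. X \<in> S \<Longrightarrow> f X = g X" "X \<in> S" shows "partial_within S i f X = partial_within S i g X"
proof -
  have "(f has_derivative f') (at X within S) \<longleftrightarrow> (g has_derivative f') (at X within S)" for f'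
    using assms has_derivative_transform[of X S f g] has_derivative_transform[of X S g f] by metis
  then show ?thesis by (simp add: partial_within_def frechet_derivative_def)
qed

lemma CL_cong: "(\<And>X. X \<in> S \<Longrightarrow> f X = g X) \<Longrightarrow> CL k S f \<Longrightarrow> CL k S g"
proof (induction k arbitrary: f g)
  case 0
  then show ?case using loc_lipschitz_cong[of S f g] by simp
next
  case (Suc k)
  have "g differentiable_on S" using Suc.prems has_derivative_transform[of _ S g f]
    unfolding CL.simps differentiable_on_def differentiable_def by metis
  moreover have "CL k S (partial_within S i g)" for i
    using Suc.IH[of "partial_within S i f" "partial_within S i g"] Suc.prems partial_within_cong[of f g] by (metis CL.simps(2))
  ultimately show ?case using Suc.prems loc_lipschitz_cong[of S f g] by (metis CL.simps(2))
qed

text \<open>Any derivative formula may be supplied: by \<open>has_derivative_unique_S\<close> it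
  agrees with the one chosen inside \<open>partial_within\<close>, also on the lateral
  boundary.\<close>

lemma CL_SucI:
  assumes "loc_lipschitz S f" "\<And>X. X \<in> S \<Longrightarrow> (f has_derivative f' X) (at X within S)"
    "\<And>i. CL k S (\<lambda>X. f' X (axis i 1))"
  shows "CL (Suc k) S f"
proof -
  have "f differentiable_on S" using assms(2) differentiableI unfolding differentiable_on_def by blast
  moreover have "CL k S (partial_within S i f)" for i
    using partial_within_eq[OF _ assms(2)] by (intro CL_cong[OF _ assms(3)[of i]]) auto
  ultimately show ?thesis using assms(1) by simp
qed

lemma diff_on_has_derivative:
  assumes "f differentiable_on S" "X \<in> S"
  obtains f' where "(f has_derivative f') (at X within S)" "\<And>i. partial_within S i f X = f' (axis i 1)"
proof -
  obtain f' where f': "(f has_derivative f') (at X within S)"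
    using assms unfolding differentiable_on_def differentiable_def by blast
  show ?thesis by (rule that[OF f' partial_within_eq[OF assms(2) f']])
qed

lemma CL_const: "CL k S (\<lambda>_. c)"
proof (induction k arbitrary: c)
  case (Suc k)
  show ?case by (rule CL_SucI[where f' = "\<lambda>_ _. 0"]) (auto simp: Suc)
qed auto

lemma CL_add: "CL k S f \<Longrightarrow> CL k S g \<Longrightarrow> CL k S (\<lambda>X. f X + g X)"
proof (induction k arbitrary: f g)
  case (Suc k)
  have "f differentiable_on S" "g differentiable_on S" using Suc.prems by auto
  then have pw: "partial_within S i f X + partial_within S i g X = partial_within S i (\<lambda>X. f X + g X) X" if XS: "X \<in> S" for X i
  proof -
    obtain f' where f': "(f has_derivative f') (at X within S)" "\<And>i. partial_within S i f X = f' (axis i 1)"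
      using diff_on_has_derivative[of f X] \<open>f differentiable_on S\<close> XS by blast
    obtain g' where g': "(g has_derivative g') (at X within S)" "\<And>i. partial_within S i g X = g' (axis i 1)"
      using diff_on_has_derivative[of g X] \<open>g differentiable_on S\<close> XS by blast
    show ?thesis using partial_within_eq[OF XS has_derivative_add[OF f'(1) g'(1)]] by (simp add: f' g')
  qed
  have "CL k S (partial_within S i (\<lambda>X. f X + g X))" for i
    by (rule CL_cong[OF pw Suc.IH]) (use Suc.prems in auto)
  then show ?case using Suc.prems by (auto intro: loc_lipschitz_add differentiable_on_add)
qed (auto intro: loc_lipschitz_add)

lemma CL_linear: "CL k S f \<Longrightarrow> bounded_linear L \<Longrightarrow> CL k S (\<lambda>X. L (f X))"
proof (induction k arbitrary: f)
  case (Suc k)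
  have d: "f differentiable_on S" using Suc.prems by auto
  then have pw: "L (partial_within S i f X) = partial_within S i (\<lambda>X. L (f X)) X" if XS: "X \<in> S" for X i
  proof -
    obtain f' where f': "(f has_derivative f') (at X within S)" "\<And>i. partial_within S i f X = f' (axis i 1)"
      using diff_on_has_derivative[OF d XS] by blast
    show ?thesis using partial_within_eq[OF XS bounded_linear.has_derivative[OF Suc.prems(2) f'(1)]] by (simp add: f')
  qed
  have "CL k S (partial_within S i (\<lambda>X. L (f X)))" for i
    by (rule CL_cong[OF pw Suc.IH]) (use Suc.prems in auto)
  moreover have "(\<lambda>X. L (f X)) differentiable_on S"
    using d bounded_linear.has_derivative[OF Suc.prems(2)] unfolding differentiable_on_def differentiable_def by blast
  ultimately show ?case using Suc.prems by (auto intro: loc_lipschitz_linear)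
qed (auto intro: loc_lipschitz_linear)

lemma CL_mult:
  fixes f g :: "real^3 \<Rightarrow> real"
  shows "CL k S f \<Longrightarrow> CL k S g \<Longrightarrow> CL k S (\<lambda>X. f X * g X)"
proof (induction k arbitrary: f g)
  case (Suc k)
  have d: "f differentiable_on S" "g differentiable_on S" using Suc.prems by auto
  have pw: "f X * partial_within S i g X + partial_within S i f X * g X = partial_within S i (\<lambda>X. f X * g X) X"
    if XS: "X \<in> S" for X i
  proof -
    obtain f' where f': "(f has_derivative f') (at X within S)" "\<And>i. partial_within S i f X = f' (axis i 1)"
      using diff_on_has_derivative[OF d(1) XS] by blast
    obtain g' where g': "(g has_derivative g') (at X within S)" "\<And>i. partial_within S i g X = g' (axis i 1)"
      using diff_on_has_derivative[OF d(2) XS] by blast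
    show ?thesis using partial_within_eq[OF XS has_derivative_mult[OF f'(1) g'(1)]] by (simp add: f' g')
  qed
  have "CL k S (partial_within S i (\<lambda>X. f X * g X))" for i
    by (rule CL_cong[OF pw CL_add[OF Suc.IH Suc.IH]]) (use Suc.prems CL_Suc_D in auto)
  then show ?case using Suc.prems d by (auto intro!: loc_lipschitz_mult differentiable_on_mult)
qed (auto intro: loc_lipschitz_mult)

lemma CL_minus: "CL k S f \<Longrightarrow> CL k S (\<lambda>X. - f X)" for f :: "real^3 \<Rightarrow> real"
  by (rule CL_linear[OF _ bounded_linear_minus[OF bounded_linear_ident]])

lemma CL_diff: "CL k S f \<Longrightarrow> CL k S g \<Longrightarrow> CL k S (\<lambda>X. f X - g X)" for f g :: "real^3 \<Rightarrow> real"
  using CL_add[of k f "\<lambda>X. - g X"] CL_minus[of k g] by simp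

lemma CL_scaleR: "CL k S f \<Longrightarrow> CL k S (\<lambda>X. f X *\<^sub>R v)" for f :: "real^3 \<Rightarrow> real"
  by (rule CL_linear) (auto intro: bounded_linear_scaleR_left)

lemma CL_coord: "CL k S (\<lambda>X. X $ i)"
proof -
  have l: "loc_lipschitz S (\<lambda>X. X $ i)"
    unfolding loc_lipschitz_def
  proof (intro allI impI)
    fix C :: "(real^3) set"
    have "dist (x $ i) (y $ i) \<le> 1 * dist x y" for x y :: "real^3"
      using component_le_norm_cart[of "x - y" i] unfolding dist_norm by simp
    then show "\<exists>M. M-lipschitz_on C (\<lambda>X. X $ i)" by (intro exI[of _ 1] lipschitz_onI) auto
  qed
  show ?thesis
  proof (cases k)
    case (Suc j)
    show ?thesis unfolding Suc
      by (rule CL_SucI[where f' = "\<lambda>_ h. h $ i"])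
        (use l in \<open>auto intro: CL_const bounded_linear_imp_has_derivative bounded_linear_vec_nth\<close>)
  qed (use l in simp)
qed

definition rinv :: "real^3 \<Rightarrow> real" where "rinv X = inverse (norm X)"

lemma rinv_has_derivative:
  assumes "X \<noteq> 0" shows "(rinv has_derivative (\<lambda>h. - (X \<bullet> h) * rinv X ^ 3)) (at X within T)"
proof -
  have "((\<lambda>X. inverse (norm X)) has_derivative (\<lambda>h. - (inverse (norm X) * (h \<bullet> sgn X) * inverse (norm X)))) (at X within T)"
    by (rule Deriv.has_derivative_inverse[OF _ has_derivative_at_withinI[OF has_derivative_norm[OF assms]]]) (use assms in simp)
  moreover have "(\<lambda>h. - (inverse (norm X) * (h \<bullet> sgn X) * inverse (norm X))) = (\<lambda>h. - (X \<bullet> h) * rinv X ^ 3)"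
    by (auto simp: rinv_def sgn_div_norm inner_commute power3_eq_cube)
  ultimately show ?thesis by (simp add: rinv_def[abs_def])
qed

lemma CL_rinv: "CL k S rinv"
proof -
  have l: "loc_lipschitz S rinv"
    unfolding loc_lipschitz_def
  proof (intro allI impI)
    fix C assume C: "compact C \<and> C \<subseteq> S"
    have "continuous_on C rinv" unfolding rinv_def[abs_def] using C S_nz by (intro continuous_intros) auto
    then have "bounded (rinv ` C)" using C compact_continuous_image compact_imp_bounded by blast
    then obtain M where M: "\<And>x. x \<in> C \<Longrightarrow> \<bar>rinv x\<bar> \<le> M" unfolding bounded_iff by auto
    have "(M*M)-lipschitz_on C rinv"
    proof (rule lipschitz_onI)
      fix x y assume xy: "x \<in> C" "y \<in> C"
      then have nz: "norm x \<noteq> 0" "norm y \<noteq> 0" using C S_nz by auto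
      have "dist (rinv x) (rinv y) = rinv x * rinv y * \<bar>norm x - norm y\<bar>"
        using nz by (simp add: dist_real_def rinv_def abs_mult[symmetric] divide_simps abs_divide abs_minus_commute)
      also have "\<dots> \<le> (M * M) * dist x y" using M[OF xy(1)] M[OF xy(2)] norm_triangle_ineq3[of x y]
        by (intro mult_mono) (auto simp: dist_norm rinv_def intro: order_trans[of 0 "inverse (norm x)"])
      finally show "dist (rinv x) (rinv y) \<le> M * M * dist x y" .
    qed simp
    then show "\<exists>M. M-lipschitz_on C rinv" by blast
  qed
  show ?thesis
  proof (induction k)
    case (Suc k)
    \<comment> \<open>The partial derivatives of \<open>rinv\<close> are polynomials in the
      coordinates and \<open>rinv\<close> itself, so the induction on \<open>k\<close>
      closes.\<close>
    have "CL k S (\<lambda>X. - (X $ i) * (rinv X * (rinv X * rinv X)))" for i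
      by (intro CL_mult CL_minus CL_coord Suc)
    then show ?case
      using l by (intro CL_SucI[where f' = "\<lambda>X h. - (X \<bullet> h) * rinv X ^ 3"] rinv_has_derivative)
        (auto simp: S_nz inner_axis power3_eq_cube mult.assoc)
  qed (use l in simp)
qed

end

text \<open>The remainder splits into \<open>c y\<close> times the remainder of \<open>m\<close>,
  plus \<open>c y - c x\<close> times the linear term \<open>m' (y - x)\<close>. Continuity of
  \<open>c\<close> makes both negligible; the derivative of \<open>c\<close> would enter only with
  the factor \<open>m x = 0\<close>.\<close>

lemma has_derivative_mult_vanishing:
  fixes c m :: "'a::real_normed_vector \<Rightarrow> real"
  assumes c: "continuous (at x within T) c" and m: "(m has_derivative m') (at x within T)" and 0: "m x = 0"
  shows "((\<lambda>y. c y * m y) has_derivative (\<lambda>h. c x * m' h)) (at x within T)"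
proof -
  have bl: "bounded_linear m'" using m has_derivative_bounded_linear by blast
  obtain K where K: "\<And>h. norm (m' h) \<le> norm h * K" using bounded_linear.bounded[OF bl] by blast
  have e: "((\<lambda>y. (m y - m' (y - x)) / norm (y - x)) \<longlongrightarrow> 0) (at x within T)"
    using m 0 by (simp add: has_derivative_within field_simps)
  have ct: "(c \<longlongrightarrow> c x) (at x within T)" using c by (simp add: continuous_within)
  have 1: "((\<lambda>y. c y * ((m y - m' (y - x)) / norm (y - x))) \<longlongrightarrow> 0) (at x within T)"
    using tendsto_mult[OF ct e] by (simp only: mult_zero_right)
  have 2: "((\<lambda>y. (c y - c x) * (m' (y - x) / norm (y - x))) \<longlongrightarrow> 0) (at x within T)"
  proof (rule Lim_null_comparison)
    have "((\<lambda>y. \<bar>c y - c x\<bar> * \<bar>K\<bar>) \<longlongrightarrow> \<bar>c x - c x\<bar> * \<bar>K\<bar>) (at x within T)"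
      by (intro tendsto_intros ct)
    then show "((\<lambda>y. \<bar>c y - c x\<bar> * \<bar>K\<bar>) \<longlongrightarrow> 0) (at x within T)" by simp
    have "norm ((c y - c x) * (m' (y - x) / norm (y - x))) \<le> \<bar>c y - c x\<bar> * \<bar>K\<bar>" for y
    proof -
      have "\<bar>m' (y - x)\<bar> \<le> \<bar>K\<bar> * norm (y - x)" using K[of "y - x"]
        mult_right_mono[of K "\<bar>K\<bar>" "norm (y - x)"] abs_ge_self[of K]
        by (simp add: mult.commute)
      then have "\<bar>m' (y - x) / norm (y - x)\<bar> \<le> \<bar>K\<bar>"
        by (cases "y = x") (auto simp: divide_simps)
      then show ?thesis unfolding real_norm_def abs_mult by (intro mult_left_mono) auto
    qed
    then show "\<forall>\<^sub>F y in at x within T. norm ((c y - c x) * (m' (y - x) / norm (y - x))) \<le> \<bar>c y - c x\<bar> * \<bar>K\<bar>"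
      by simp
  qed
  have "((\<lambda>y. (c y * m y - c x * m' (y - x)) / norm (y - x)) \<longlongrightarrow> 0) (at x within T)"
    using tendsto_add[OF 1 2] by (simp add: algebra_simps diff_divide_distrib)
  moreover have "bounded_linear (\<lambda>h. c x * m' h)" by (rule bounded_linear_const_mult[OF bl])
  ultimately show ?thesis using 0 by (simp add: has_derivative_within field_simps)
qed

section \<open>Functions of \<open>mu\<close> and weights at the axis\<close>

context cone begin

abbreviation "Ix \<equiv> {x0..1}"

lemma mu_eq: "mu X = X $ 3 * rinv X" by (simp add: mu_def rinv_def divide_inverse)

definition dmu :: "real^3 \<Rightarrow> real^3 \<Rightarrow> real" where
  "dmu X h = (h $ 3 - mu X * (X \<bullet> h) * rinv X) * rinv X"

text \<open>The partial derivatives of \<open>mu\<close>, see \<open>dmu_axis\<close>.\<close>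

definition psi :: "3 \<Rightarrow> real^3 \<Rightarrow> real" where
  "psi i X = ((if i = 3 then 1 else 0) - mu X * (X $ i) * rinv X) * rinv X"

lemma dmu_axis: "dmu X (axis i 1) = psi i X"
  by (simp add: dmu_def psi_def inner_axis) (simp add: axis_def)

lemma rinv_norm: "X \<noteq> 0 \<Longrightarrow> rinv X * norm X = 1" by (simp add: rinv_def)

lemma mu_has_derivative: assumes "X \<noteq> 0" shows "(mu has_derivative dmu X) (at X within T)"
proof -
  have "((\<lambda>X. X $ 3 * rinv X) has_derivative (\<lambda>h. X $ 3 * (- (X \<bullet> h) * rinv X ^ 3) + h $ 3 * rinv X)) (at X within T)"
    by (intro has_derivative_mult rinv_has_derivative assms bounded_linear_imp_has_derivative bounded_linear_vec_nth)
  moreover have "(\<lambda>h. X $ 3 * (- (X \<bullet> h) * rinv X ^ 3) + h $ 3 * rinv X) = dmu X"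
    by (auto simp: dmu_def mu_eq power3_eq_cube algebra_simps)
  ultimately show ?thesis by (simp add: mu_eq[abs_def])
qed

lemma CL_mu: "CL k S mu" unfolding mu_eq[abs_def] by (intro CL_mult CL_coord CL_rinv)

lemma CL_psi: "CL k S (psi i)" unfolding psi_def[abs_def]
  by (intro CL_mult CL_diff CL_const CL_coord CL_rinv CL_mu)

lemma continuous_on_mu: "continuous_on S mu"
  using CL_loc_lipschitz[OF CL_mu[of 0]] by (rule loc_lipschitz_continuous_on)

lemma comp_mu_has_derivative:
  assumes "X \<in> S" "(\<beta> has_real_derivative d) (at (mu X) within Ix)"
  shows "((\<lambda>X. \<beta> (mu X)) has_derivative (\<lambda>h. d * dmu X h)) (at X within S)"
proof -
  have "mu ` S \<subseteq> Ix" using mu_mem by blast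
  then have "(\<beta> has_derivative (*) d) (at (mu X) within mu ` S)"
    using assms(2) unfolding has_field_derivative_def by (rule has_derivative_subset[rotated])
  from has_derivative_in_compose[OF mu_has_derivative[OF S_nz[OF assms(1)]] this] show ?thesis .
qed

text \<open>\<open>Psi\<close> is the gradient of \<open>mu\<close> rescaled to degree 0, and
  \<open>Hor\<close> the horizontal part of the unit vector along \<open>X\<close>. Both have length
  sin \<phi>, so they vanish on the axis at the rate that the weights measure, while their
  directions jump there.\<close>

definition Psi :: "real^3 \<Rightarrow> real^3" where
  "Psi X = (\<chi> i. norm X * psi i X)"

definition Hor :: "real^3 \<Rightarrow> real^3" where
  "Hor X = (\<chi> i. if i = 3 then 0 else X $ i * rinv X)"

lemma rinv_sq: assumes "X \<noteq> 0" shows "(X$1 * rinv X)\<^sup>2 + (X$2 * rinv X)\<^sup>2 = 1 - (mu X)\<^sup>2"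
proof -
  have "(X$1 * rinv X)\<^sup>2 + (X$2 * rinv X)\<^sup>2 + (X$3 * rinv X)\<^sup>2 = (rinv X * norm X)\<^sup>2"
    unfolding power_mult_distrib norm_sq3 by (simp only: algebra_simps)
  then show ?thesis unfolding rinv_norm[OF assms] by (simp add: mu_eq)
qed

lemma norm_Hor: assumes "X \<noteq> 0" shows "norm (Hor X) = sqrt (1 - (mu X)\<^sup>2)"
proof -
  have "(norm (Hor X))\<^sup>2 = 1 - (mu X)\<^sup>2" using rinv_sq[OF assms] by (simp add: norm_sq3 Hor_def)
  then show ?thesis by (metis norm_ge_zero real_sqrt_unique)
qed

lemma norm_Psi: assumes "X \<noteq> 0" shows "norm (Psi X) = sqrt (1 - (mu X)\<^sup>2)"
proof -
  have *: "Psi X $ i = (if i = 3 then 1 else 0) - mu X * (X $ i * rinv X)" for i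
  proof -
    have "Psi X $ i = ((if i = 3 then 1 else 0) - mu X * (X $ i * rinv X)) * (rinv X * norm X)"
      by (simp add: Psi_def psi_def)
    then show ?thesis by (simp only: rinv_norm[OF assms] mult_1_right)
  qed
  have "(norm (Psi X))\<^sup>2 = (mu X)\<^sup>2 * ((X$1 * rinv X)\<^sup>2 + (X$2 * rinv X)\<^sup>2) + (1 - mu X * mu X)\<^sup>2"
    by (simp add: norm_sq3 * mu_eq[symmetric] power_mult_distrib distrib_left)
  also have "\<dots> = 1 - (mu X)\<^sup>2" unfolding rinv_sq[OF assms] by (simp add: power2_eq_square algebra_simps)
  finally show ?thesis by (metis norm_ge_zero real_sqrt_unique)
qed

lemma loc_lipschitz_norm: "loc_lipschitz S (\<lambda>X. norm X)"
  unfolding loc_lipschitz_def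
proof (intro allI impI)
  fix C :: "(real^3) set"
  have "dist (norm x) (norm y) \<le> 1 * dist x y" for x y :: "real^3"
    using norm_triangle_ineq3[of x y] by (simp add: dist_norm)
  then show "\<exists>M. M-lipschitz_on C norm" by (intro exI[of _ 1] lipschitz_onI) auto
qed

lemma loc_lipschitz_Psi: "loc_lipschitz S Psi"
  by (rule loc_lipschitz_vec) (simp add: Psi_def loc_lipschitz_mult loc_lipschitz_norm CL_loc_lipschitz[OF CL_psi[of 0]])

lemma loc_lipschitz_Hor: "loc_lipschitz S Hor"
proof (rule loc_lipschitz_vec)
  fix i :: 3
  show "loc_lipschitz S (\<lambda>x. Hor x $ i)"
    by (cases "i = 3") (auto simp: Hor_def intro!: loc_lipschitz_mult loc_lipschitz_const CL_loc_lipschitz[OF CL_coord[of 0]] CL_loc_lipschitz[OF CL_rinv[of 0]])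
qed

text \<open>Length and direction are separated: the length can be merged into a profile in front,
  which leaves a direction for \<open>loc_lipschitz_mult_sgn\<close>.\<close>

lemma psi_sgn: assumes "X \<noteq> 0" shows "psi i X = sqrt (1 - (mu X)\<^sup>2) * sgn (Psi X) $ i * rinv X"
proof -
  have "Psi X = norm (Psi X) *\<^sub>R sgn (Psi X)" by (cases "Psi X = 0") (simp_all add: sgn_div_norm)
  then have "Psi X $ i = sqrt (1 - (mu X)\<^sup>2) * sgn (Psi X) $ i" by (metis norm_Psi[OF assms] vector_scaleR_component real_scaleR_def)
  then show ?thesis using rinv_norm[OF assms] by (simp add: Psi_def) (metis mult.commute mult.left_commute mult.right_neutral)
qed

lemma coord_sgn: assumes "X \<noteq> 0" "k \<noteq> 3" shows "X $ k = sqrt (1 - (mu X)\<^sup>2) * sgn (Hor X) $ k * norm X"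
proof -
  have "Hor X = norm (Hor X) *\<^sub>R sgn (Hor X)" by (cases "Hor X = 0") (simp_all add: sgn_div_norm)
  then have "Hor X $ k = sqrt (1 - (mu X)\<^sup>2) * sgn (Hor X) $ k" by (metis norm_Hor[OF assms(1)] vector_scaleR_component real_scaleR_def)
  then show ?thesis using rinv_norm[OF assms(1)] assms(2) by (simp add: Hor_def) (metis mult.assoc mult.right_neutral)
qed

text \<open>The hypothesis that \<open>loc_lipschitz_mult_sgn\<close> puts on its scalar factor when
  the vector field is \<open>Psi\<close> or \<open>Hor\<close>.\<close>

definition LL0 :: "(real^3 \<Rightarrow> real) \<Rightarrow> bool" where
  "LL0 B \<longleftrightarrow> loc_lipschitz S B \<and> (\<exists>M. \<forall>X\<in>S. \<bar>B X\<bar> \<le> M * sqrt (1 - (mu X)\<^sup>2))"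

text \<open>Components of a direction are at most 1 in modulus, so the decay on the axis survives
  and several direction factors can be attached one after the other.\<close>

lemma LL0_sgn:
  assumes "LL0 B" "V = Psi \<or> V = Hor" shows "LL0 (\<lambda>X. B X * sgn (V X) $ i)"
proof -
  obtain M where M: "\<And>X. X \<in> S \<Longrightarrow> \<bar>B X\<bar> \<le> M * sqrt (1 - (mu X)\<^sup>2)" and B: "loc_lipschitz S B"
    using assms by (auto simp: LL0_def)
  have V: "loc_lipschitz S V" "\<And>X. X \<in> S \<Longrightarrow> norm (V X) = sqrt (1 - (mu X)\<^sup>2)"
    using assms(2) loc_lipschitz_Psi loc_lipschitz_Hor norm_Psi norm_Hor S_nz by auto
  have "loc_lipschitz S (\<lambda>X. B X * sgn (V X) $ i)"
    by (rule loc_lipschitz_mult_sgn[OF B V(1), of M]) (use M V(2) in auto)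
  moreover have "\<bar>B X * sgn (V X) $ i\<bar> \<le> M * sqrt (1 - (mu X)\<^sup>2)" if "X \<in> S" for X
  proof -
    have "\<bar>sgn (V X) $ i\<bar> \<le> 1" using component_le_norm_cart[of "sgn (V X)" i] by (auto simp: norm_sgn split: if_splits)
    then have "\<bar>B X * sgn (V X) $ i\<bar> \<le> \<bar>B X\<bar> * 1" unfolding abs_mult by (intro mult_left_mono) auto
    then show ?thesis using M[OF that] by simp
  qed
  ultimately show ?thesis unfolding LL0_def by blast
qed

lemma continuous_on_Ix_bounded:
  fixes f :: "real \<Rightarrow> real"
  assumes "continuous_on Ix f" obtains N where "N \<ge> 0" "\<And>x. x \<in> Ix \<Longrightarrow> \<bar>f x\<bar> \<le> N"
proof -
  have "bounded (f ` Ix)" using assms by (intro compact_imp_bounded compact_continuous_image) auto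
  then obtain N where N: "\<forall>y\<in>f ` Ix. norm y \<le> N" unfolding bounded_iff by blast
  show ?thesis using that[of "\<bar>N\<bar>"] N by (metis abs_ge_zero abs_ge_self imageI order_trans real_norm_def)
qed

text \<open>The weights measure profiles in \<open>x = cos \<phi>\<close> near the axis \<open>x = 1\<close>, where \<open>1 - x\<close> is comparable to \<open>\<phi>\<^sup>2\<close>:
  \<open>lip_wt\<close> means Lipschitz in \<open>\<phi>\<close>, \<open>lip0\<close> that moreover the profile is \<open>O(\<phi>)\<close>, and \<open>bdw\<close> that its product with
  \<open>\<phi>\<close> is Lipschitz in \<open>\<phi>\<close>.\<close>

definition lip_wt :: "(real \<Rightarrow> real) \<Rightarrow> bool" where
  "lip_wt \<beta> \<longleftrightarrow> continuous_on Ix \<beta> \<and>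
     (\<exists>M. \<forall>x\<in>{x0..<1}. \<exists>d. (\<beta> has_real_derivative d) (at x within Ix) \<and> \<bar>d\<bar> * sqrt (1 - x) \<le> M)"

definition lip0 :: "(real \<Rightarrow> real) \<Rightarrow> bool" where
  "lip0 \<beta> \<longleftrightarrow> lip_wt \<beta> \<and> (\<exists>M. \<forall>x\<in>Ix. \<bar>\<beta> x\<bar> \<le> M * sqrt (1 - x))"

definition bdw :: "(real \<Rightarrow> real) \<Rightarrow> bool" where
  "bdw \<beta> \<longleftrightarrow>
     (\<exists>M. \<forall>x\<in>{x0..<1}. \<bar>\<beta> x\<bar> \<le> M \<and> (\<exists>d. (\<beta> has_real_derivative d) (at x within Ix) \<and> \<bar>d\<bar> * (1 - x) \<le> M))"

lemma lip_wtI: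
  assumes "continuous_on Ix \<beta>" "\<And>x. x0 \<le> x \<Longrightarrow> x < 1 \<Longrightarrow> (\<beta> has_real_derivative d x) (at x within Ix)"
    "\<And>x. x0 \<le> x \<Longrightarrow> x < 1 \<Longrightarrow> \<bar>d x\<bar> * sqrt (1 - x) \<le> M"
  shows "lip_wt \<beta>"
  unfolding lip_wt_def using assms by (metis atLeastLessThan_iff)

lemma lip_wtE:
  assumes "lip_wt \<beta>"
  obtains d M where "M \<ge> 0" "\<And>x. x0 \<le> x \<Longrightarrow> x < 1 \<Longrightarrow> (\<beta> has_real_derivative d x) (at x within Ix)"
    "\<And>x. x0 \<le> x \<Longrightarrow> x < 1 \<Longrightarrow> \<bar>d x\<bar> * sqrt (1 - x) \<le> M" "\<And>x. x \<in> Ix \<Longrightarrow> \<bar>\<beta> x\<bar> \<le> M"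
proof -
  obtain M where "\<forall>x\<in>{x0..<1}. \<exists>d. (\<beta> has_real_derivative d) (at x within Ix) \<and> \<bar>d\<bar> * sqrt (1 - x) \<le> M"
    using assms unfolding lip_wt_def by blast
  then obtain d where d: "\<And>x. x \<in> {x0..<1} \<Longrightarrow> (\<beta> has_real_derivative d x) (at x within Ix) \<and> \<bar>d x\<bar> * sqrt (1 - x) \<le> M"
    by metis
  have "continuous_on Ix \<beta>" using assms by (simp add: lip_wt_def)
  then obtain N where N: "\<And>x. x \<in> Ix \<Longrightarrow> \<bar>\<beta> x\<bar> \<le> N" using continuous_on_Ix_bounded by blast
  show ?thesis
  proof (rule that[of "\<bar>M\<bar> + \<bar>N\<bar>" d])
    fix x assume x: "x0 \<le> x" "x < 1"
    then show "(\<beta> has_real_derivative d x) (at x within Ix)" using d by auto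
    have "\<bar>d x\<bar> * sqrt (1 - x) \<le> M" using d x by auto
    then show "\<bar>d x\<bar> * sqrt (1 - x) \<le> \<bar>M\<bar> + \<bar>N\<bar>" by simp
  next
    fix x assume "x \<in> Ix"
    then show "\<bar>\<beta> x\<bar> \<le> \<bar>M\<bar> + \<bar>N\<bar>" using N[of x] by simp
  qed auto
qed

lemma lip_wt_cont: "lip_wt \<beta> \<Longrightarrow> continuous_on Ix \<beta>" by (simp add: lip_wt_def)

lemma lip0_lip_wt: "lip0 \<beta> \<Longrightarrow> lip_wt \<beta>" by (simp add: lip0_def)

lemma lip_wt_add: assumes "lip_wt f" "lip_wt g" shows "lip_wt (\<lambda>x. f x + g x)"
proof -
  obtain d M where d: "\<And>x. x0 \<le> x \<Longrightarrow> x < 1 \<Longrightarrow> (f has_real_derivative d x) (at x within Ix)"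
    "\<And>x. x0 \<le> x \<Longrightarrow> x < 1 \<Longrightarrow> \<bar>d x\<bar> * sqrt (1 - x) \<le> M" using lip_wtE[OF assms(1)] by metis
  obtain e N where e: "\<And>x. x0 \<le> x \<Longrightarrow> x < 1 \<Longrightarrow> (g has_real_derivative e x) (at x within Ix)"
    "\<And>x. x0 \<le> x \<Longrightarrow> x < 1 \<Longrightarrow> \<bar>e x\<bar> * sqrt (1 - x) \<le> N" using lip_wtE[OF assms(2)] by metis
  show ?thesis
  proof (rule lip_wtI[where d = "\<lambda>x. d x + e x" and M = "M + N"])
    show "continuous_on Ix (\<lambda>x. f x + g x)" using assms by (intro continuous_intros lip_wt_cont)
    fix x assume x: "x0 \<le> x" "x < 1"
    show "((\<lambda>x. f x + g x) has_real_derivative d x + e x) (at x within Ix)"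
      using d(1)[OF x] e(1)[OF x] by (auto intro: derivative_eq_intros)
    have "\<bar>d x + e x\<bar> * sqrt (1 - x) \<le> (\<bar>d x\<bar> + \<bar>e x\<bar>) * sqrt (1 - x)" using x by (intro mult_right_mono) auto
    then show "\<bar>d x + e x\<bar> * sqrt (1 - x) \<le> M + N" using d(2)[OF x] e(2)[OF x] by (simp add: algebra_simps)
  qed
qed

lemma lip_wt_mult: assumes "lip_wt f" "lip_wt g" shows "lip_wt (\<lambda>x. f x * g x)"
proof -
  obtain d M where d: "M \<ge> 0" "\<And>x. x0 \<le> x \<Longrightarrow> x < 1 \<Longrightarrow> (f has_real_derivative d x) (at x within Ix)"
    "\<And>x. x0 \<le> x \<Longrightarrow> x < 1 \<Longrightarrow> \<bar>d x\<bar> * sqrt (1 - x) \<le> M" "\<And>x. x \<in> Ix \<Longrightarrow> \<bar>f x\<bar> \<le> M" using lip_wtE[OF assms(1)] by metis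
  obtain e N where e: "N \<ge> 0" "\<And>x. x0 \<le> x \<Longrightarrow> x < 1 \<Longrightarrow> (g has_real_derivative e x) (at x within Ix)"
    "\<And>x. x0 \<le> x \<Longrightarrow> x < 1 \<Longrightarrow> \<bar>e x\<bar> * sqrt (1 - x) \<le> N" "\<And>x. x \<in> Ix \<Longrightarrow> \<bar>g x\<bar> \<le> N" using lip_wtE[OF assms(2)] by metis
  show ?thesis
  proof (rule lip_wtI[where d = "\<lambda>x. f x * e x + d x * g x" and M = "M * N + M * N"])
    show "continuous_on Ix (\<lambda>x. f x * g x)" using assms by (intro continuous_intros lip_wt_cont)
    fix x assume x: "x0 \<le> x" "x < 1"
    show "((\<lambda>x. f x * g x) has_real_derivative f x * e x + d x * g x) (at x within Ix)"
      using d(2)[OF x] e(2)[OF x] by (auto intro: derivative_eq_intros)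
    have "\<bar>f x * e x + d x * g x\<bar> * sqrt (1 - x) \<le> (\<bar>f x\<bar> * \<bar>e x\<bar> + \<bar>d x\<bar> * \<bar>g x\<bar>) * sqrt (1 - x)"
      using x abs_triangle_ineq[of "f x * e x" "d x * g x"] by (intro mult_right_mono) (auto simp: abs_mult)
    also have "\<dots> = \<bar>f x\<bar> * (\<bar>e x\<bar> * sqrt (1 - x)) + (\<bar>d x\<bar> * sqrt (1 - x)) * \<bar>g x\<bar>" by (simp add: algebra_simps)
    also have "\<dots> \<le> M * N + M * N"
      using d(1) d(3)[OF x] e(3)[OF x] d(4)[of x] e(4)[of x] x by (intro add_mono mult_mono) auto
    finally show "\<bar>f x * e x + d x * g x\<bar> * sqrt (1 - x) \<le> M * N + M * N" .
  qed
qed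

lemma lip0_mult: assumes "lip_wt f" "lip0 g" shows "lip0 (\<lambda>x. f x * g x)"
proof -
  obtain N where N: "\<And>x. x \<in> Ix \<Longrightarrow> \<bar>g x\<bar> \<le> N * sqrt (1 - x)" using assms unfolding lip0_def by blast
  obtain d M where M: "M \<ge> 0" "\<And>x. x \<in> Ix \<Longrightarrow> \<bar>f x\<bar> \<le> M" using lip_wtE[OF assms(1)] by metis
  have "\<bar>f x * g x\<bar> \<le> (M * N) * sqrt (1 - x)" if "x \<in> Ix" for x
    using mult_mono[OF M(2)[OF that] N[OF that]] M(1) by (simp add: abs_mult mult.assoc)
  then show ?thesis using lip_wt_mult[of f g] assms unfolding lip0_def by blast
qed

lemma C1_lip_wt:
  assumes "\<And>x. x \<in> Ix \<Longrightarrow> (\<alpha> has_real_derivative \<alpha>' x) (at x within Ix)" "continuous_on Ix \<alpha>'"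
  shows "lip_wt \<alpha>"
proof -
  obtain N where N: "\<And>x. x \<in> Ix \<Longrightarrow> \<bar>\<alpha>' x\<bar> \<le> N" using continuous_on_Ix_bounded[OF assms(2)] by blast
  show ?thesis
  proof (rule lip_wtI[where d = \<alpha>' and M = "N * sqrt 2"])
    show "continuous_on Ix \<alpha>" using assms(1) by (rule DERIV_continuous_on)
    fix x assume x: "x0 \<le> x" "x < 1"
    then show "(\<alpha> has_real_derivative \<alpha>' x) (at x within Ix)" using assms by auto
    show "\<bar>\<alpha>' x\<bar> * sqrt (1 - x) \<le> N * sqrt 2" using N[of x] x x0_gt
      by (intro mult_mono) (auto intro: order_trans[of 0 "\<bar>\<alpha>' x\<bar>"])
  qed
qed

lemma bdwI:
  assumes "\<And>x. x0 \<le> x \<Longrightarrow> x < 1 \<Longrightarrow> \<bar>\<beta> x\<bar> \<le> N"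
    "\<And>x. x0 \<le> x \<Longrightarrow> x < 1 \<Longrightarrow> (\<beta> has_real_derivative d x) (at x within Ix)"
    "\<And>x. x0 \<le> x \<Longrightarrow> x < 1 \<Longrightarrow> \<bar>d x\<bar> * (1 - x) \<le> M"
  shows "bdw \<beta>"
  unfolding bdw_def
proof (rule exI[of _ "max N M"], intro ballI conjI)
  fix x assume "x \<in> {x0..<1}"
  then have x: "x0 \<le> x" "x < 1" by auto
  show "\<bar>\<beta> x\<bar> \<le> max N M" using assms(1)[OF x] by simp
  show "\<exists>d. (\<beta> has_real_derivative d) (at x within Ix) \<and> \<bar>d\<bar> * (1 - x) \<le> max N M"
    using assms(2,3)[OF x] by (intro exI[of _ "d x"]) auto
qed

lemma bdwE:
  assumes "bdw \<beta>"
  obtains d M where "M \<ge> 0" "\<And>x. x0 \<le> x \<Longrightarrow> x < 1 \<Longrightarrow> (\<beta> has_real_derivative d x) (at x within Ix)"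
    "\<And>x. x0 \<le> x \<Longrightarrow> x < 1 \<Longrightarrow> \<bar>d x\<bar> * (1 - x) \<le> M" "\<And>x. x0 \<le> x \<Longrightarrow> x < 1 \<Longrightarrow> \<bar>\<beta> x\<bar> \<le> M"
proof -
  obtain M where M: "\<forall>x\<in>{x0..<1}. \<bar>\<beta> x\<bar> \<le> M \<and> (\<exists>d. (\<beta> has_real_derivative d) (at x within Ix) \<and> \<bar>d\<bar> * (1 - x) \<le> M)"
    using assms unfolding bdw_def by blast
  then obtain d where d: "\<And>x. x \<in> {x0..<1} \<Longrightarrow> (\<beta> has_real_derivative d x) (at x within Ix) \<and> \<bar>d x\<bar> * (1 - x) \<le> M"
    by metis
  have "\<bar>\<beta> x0\<bar> \<le> M" using M x0_lt by auto
  then have "M \<ge> 0" by linarith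
  then show ?thesis using d M by (intro that[of M d]) auto
qed

lemma bdw_add: assumes "bdw f" "bdw g" shows "bdw (\<lambda>x. f x + g x)"
proof -
  obtain d M where d: "M \<ge> 0" "\<And>x. x0 \<le> x \<Longrightarrow> x < 1 \<Longrightarrow> (f has_real_derivative d x) (at x within Ix)"
    "\<And>x. x0 \<le> x \<Longrightarrow> x < 1 \<Longrightarrow> \<bar>d x\<bar> * (1 - x) \<le> M" "\<And>x. x0 \<le> x \<Longrightarrow> x < 1 \<Longrightarrow> \<bar>f x\<bar> \<le> M" using bdwE[OF assms(1)] by metis
  obtain e N where e: "N \<ge> 0" "\<And>x. x0 \<le> x \<Longrightarrow> x < 1 \<Longrightarrow> (g has_real_derivative e x) (at x within Ix)"
    "\<And>x. x0 \<le> x \<Longrightarrow> x < 1 \<Longrightarrow> \<bar>e x\<bar> * (1 - x) \<le> N" "\<And>x. x0 \<le> x \<Longrightarrow> x < 1 \<Longrightarrow> \<bar>g x\<bar> \<le> N" using bdwE[OF assms(2)] by metis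
  show ?thesis
  proof (rule bdwI[where d = "\<lambda>x. d x + e x" and M = "M + N" and N = "M + N"])
    fix x assume x: "x0 \<le> x" "x < 1"
    show "((\<lambda>x. f x + g x) has_real_derivative d x + e x) (at x within Ix)"
      using d(2)[OF x] e(2)[OF x] by (auto intro: derivative_eq_intros)
    have "\<bar>d x + e x\<bar> * (1 - x) \<le> (\<bar>d x\<bar> + \<bar>e x\<bar>) * (1 - x)" using x by (intro mult_right_mono) auto
    then show "\<bar>d x + e x\<bar> * (1 - x) \<le> M + N" using d(3)[OF x] e(3)[OF x] by (simp add: algebra_simps)
    show "\<bar>f x + g x\<bar> \<le> M + N" using d(4)[OF x] e(4)[OF x] by simp
  qed
qed

lemma bdw_mult: assumes "bdw f" "bdw g" shows "bdw (\<lambda>x. f x * g x)"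
proof -
  obtain d M where d: "M \<ge> 0" "\<And>x. x0 \<le> x \<Longrightarrow> x < 1 \<Longrightarrow> (f has_real_derivative d x) (at x within Ix)"
    "\<And>x. x0 \<le> x \<Longrightarrow> x < 1 \<Longrightarrow> \<bar>d x\<bar> * (1 - x) \<le> M" "\<And>x. x0 \<le> x \<Longrightarrow> x < 1 \<Longrightarrow> \<bar>f x\<bar> \<le> M" using bdwE[OF assms(1)] by metis
  obtain e N where e: "N \<ge> 0" "\<And>x. x0 \<le> x \<Longrightarrow> x < 1 \<Longrightarrow> (g has_real_derivative e x) (at x within Ix)"
    "\<And>x. x0 \<le> x \<Longrightarrow> x < 1 \<Longrightarrow> \<bar>e x\<bar> * (1 - x) \<le> N" "\<And>x. x0 \<le> x \<Longrightarrow> x < 1 \<Longrightarrow> \<bar>g x\<bar> \<le> N" using bdwE[OF assms(2)] by metis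
  show ?thesis
  proof (rule bdwI[where d = "\<lambda>x. f x * e x + d x * g x" and M = "M * N + M * N" and N = "M * N"])
    fix x assume x: "x0 \<le> x" "x < 1"
    show "((\<lambda>x. f x * g x) has_real_derivative f x * e x + d x * g x) (at x within Ix)"
      using d(2)[OF x] e(2)[OF x] by (auto intro: derivative_eq_intros)
    have "\<bar>f x * e x + d x * g x\<bar> * (1 - x) \<le> (\<bar>f x\<bar> * \<bar>e x\<bar> + \<bar>d x\<bar> * \<bar>g x\<bar>) * (1 - x)"
      using x abs_triangle_ineq[of "f x * e x" "d x * g x"] by (intro mult_right_mono) (auto simp: abs_mult)
    also have "\<dots> = \<bar>f x\<bar> * (\<bar>e x\<bar> * (1 - x)) + (\<bar>d x\<bar> * (1 - x)) * \<bar>g x\<bar>" by (simp add: algebra_simps)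
    also have "\<dots> \<le> M * N + M * N"
      using d(1) d(3)[OF x] e(3)[OF x] d(4)[OF x] e(4)[OF x] x by (intro add_mono mult_mono) auto
    finally show "\<bar>f x * e x + d x * g x\<bar> * (1 - x) \<le> M * N + M * N" .
    show "\<bar>f x * g x\<bar> \<le> M * N" using d(1) d(4)[OF x] e(4)[OF x] unfolding abs_mult by (intro mult_mono) auto
  qed
qed

lemma lip_wt_bdw: assumes "lip_wt f" shows "bdw f"
proof -
  obtain d M where d: "M \<ge> 0" "\<And>x. x0 \<le> x \<Longrightarrow> x < 1 \<Longrightarrow> (f has_real_derivative d x) (at x within Ix)"
    "\<And>x. x0 \<le> x \<Longrightarrow> x < 1 \<Longrightarrow> \<bar>d x\<bar> * sqrt (1 - x) \<le> M" "\<And>x. x \<in> Ix \<Longrightarrow> \<bar>f x\<bar> \<le> M" using lip_wtE[OF assms(1)] by metis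
  show ?thesis
  proof (rule bdwI[where d = d and M = "M * sqrt 2" and N = M])
    fix x assume x: "x0 \<le> x" "x < 1"
    show "(f has_real_derivative d x) (at x within Ix)" using d(2)[OF x] .
    show "\<bar>f x\<bar> \<le> M" using d(4) x by auto
    have "\<bar>d x\<bar> * (1 - x) = (\<bar>d x\<bar> * sqrt (1 - x)) * sqrt (1 - x)" using x by simp
    also have "\<dots> \<le> M * sqrt 2" using d(1) d(3)[OF x] x x0_gt by (intro mult_mono) auto
    finally show "\<bar>d x\<bar> * (1 - x) \<le> M * sqrt 2" .
  qed
qed

lemma lip0I:
  assumes "\<And>x. x0 \<le> x \<Longrightarrow> x < 1 \<Longrightarrow> (\<beta> has_real_derivative d x) (at x within Ix)"
    "\<And>x. x0 \<le> x \<Longrightarrow> x < 1 \<Longrightarrow> \<bar>d x\<bar> * sqrt (1 - x) \<le> M" "\<And>x. x0 \<le> x \<Longrightarrow> x \<le> 1 \<Longrightarrow> \<bar>\<beta> x\<bar> \<le> N * sqrt (1 - x)"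
  shows "lip0 \<beta>"
proof -
  have "continuous (at x within Ix) \<beta>" if "x \<in> Ix" for x
  proof (cases "x = 1")
    case False
    then show ?thesis using assms(1)[of x] that DERIV_isCont has_field_derivative_imp_has_derivative has_derivative_continuous by force
  next
    case True
    have "\<beta> 1 = 0" using assms(3)[of 1] x0_lt by simp
    moreover have "(\<beta> \<longlongrightarrow> 0) (at 1 within Ix)"
    proof (rule Lim_null_comparison)
      have "((\<lambda>x. N * sqrt (1 - x)) \<longlongrightarrow> N * sqrt (1 - 1)) (at 1 within Ix)" by (intro tendsto_intros)
      then show "((\<lambda>x. N * sqrt (1 - x)) \<longlongrightarrow> 0) (at 1 within Ix)" by simp
      show "\<forall>\<^sub>F x in at 1 within Ix. norm (\<beta> x) \<le> N * sqrt (1 - x)"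
        using assms(3) by (auto simp: eventually_at_filter)
    qed
    ultimately show ?thesis using True by (simp add: continuous_within)
  qed
  then have "lip_wt \<beta>" using assms by (intro lip_wtI[of \<beta> d M]) (auto simp: continuous_on_eq_continuous_within)
  then show ?thesis unfolding lip0_def using assms(3) by (metis atLeastAtMost_iff)
qed

text \<open>The derivative of the product is \<open>sqrt (1 - x)\<close> times that of
  \<open>B\<close>, minus \<open>B x / (2 * sqrt (1 - x))\<close>; after multiplication by
  \<open>sqrt (1 - x)\<close> the two halves of \<open>bdw\<close> bound the two terms. At 1 the
  factor \<open>sqrt (1 - x)\<close> vanishes, whatever value \<open>B\<close> has there.\<close>

lemma bdw_lip0: assumes "bdw B" shows "lip0 (\<lambda>x. sqrt (1 - x) * B x)"
proof -
  obtain d M where d: "M \<ge> 0" "\<And>x. x0 \<le> x \<Longrightarrow> x < 1 \<Longrightarrow> (B has_real_derivative d x) (at x within Ix)"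
    "\<And>x. x0 \<le> x \<Longrightarrow> x < 1 \<Longrightarrow> \<bar>d x\<bar> * (1 - x) \<le> M" "\<And>x. x0 \<le> x \<Longrightarrow> x < 1 \<Longrightarrow> \<bar>B x\<bar> \<le> M" using bdwE[OF assms(1)] by metis
  show ?thesis
  proof (rule lip0I[where d = "\<lambda>x. sqrt (1 - x) * d x - B x / (2 * sqrt (1 - x))" and M = "2 * M" and N = M])
    fix x assume x: "x0 \<le> x" "x < 1"
    show "((\<lambda>x. sqrt (1 - x) * B x) has_real_derivative sqrt (1 - x) * d x - B x / (2 * sqrt (1 - x))) (at x within Ix)"
      using d(2)[OF x] x by (auto intro!: derivative_eq_intros simp: field_simps)
    have "\<bar>sqrt (1 - x) * d x - B x / (2 * sqrt (1 - x))\<bar> * sqrt (1 - x) = \<bar>(sqrt (1 - x) * d x - B x / (2 * sqrt (1 - x))) * sqrt (1 - x)\<bar>"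
      using x by (simp add: abs_mult)
    also have "(sqrt (1 - x) * d x - B x / (2 * sqrt (1 - x))) * sqrt (1 - x) = d x * (sqrt (1-x) * sqrt (1-x)) - B x / 2"
      using x by (simp add: field_simps)
    also have "\<dots> = d x * (1 - x) - B x / 2" using x by simp
    also have "\<bar>\<dots>\<bar> \<le> \<bar>d x\<bar> * (1 - x) + \<bar>B x\<bar>" using x abs_triangle_ineq4[of "d x * (1 - x)" "B x / 2"] by (simp add: abs_mult)
    finally show "\<bar>sqrt (1 - x) * d x - B x / (2 * sqrt (1 - x))\<bar> * sqrt (1 - x) \<le> 2 * M" using d(3)[OF x] d(4)[OF x] by simp
  next
    fix x assume x: "x0 \<le> x" "x \<le> 1"
    show "\<bar>sqrt (1 - x) * B x\<bar> \<le> M * sqrt (1 - x)"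
    proof (cases "x = 1")
      case False
      then show ?thesis using d(4)[of x] x by (simp add: abs_mult mult.commute mult_left_mono)
    qed simp
  qed
qed

lemma lip_wt_sqrt_plus: "lip_wt (\<lambda>x. sqrt (1 + x))"
  by (rule C1_lip_wt[where \<alpha>' = "\<lambda>x. inverse (sqrt (1 + x)) / 2"])
    (use x0_gt in \<open>auto intro!: derivative_eq_intros continuous_intros\<close>)

lemma bdw_lip0': assumes "bdw B" shows "lip0 (\<lambda>x. sqrt (1 - x\<^sup>2) * B x)"
proof -
  have "(\<lambda>x. sqrt (1 - x\<^sup>2) * B x) = (\<lambda>x. sqrt (1 + x) * (sqrt (1 - x) * B x))"
    by (simp add: real_sqrt_mult[symmetric] power2_eq_square algebra_simps mult.assoc[symmetric])
  then show ?thesis using lip0_mult[OF lip_wt_sqrt_plus bdw_lip0[OF assms]] by simp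
qed

text \<open>The derivative of \<open>\<beta>\<close> is dominated by
  \<open>M / sqrt (1 - t)\<close>, the derivative of \<open>- 2 * M * sqrt (1 - t)\<close>. So
  \<open>\<beta>\<close> is Lipschitz in \<open>sqrt (1 - x)\<close>, which is sqrt 2 times the sine
  of \<phi>/2.\<close>

lemma lip_wt_increment:
  assumes "lip_wt \<beta>"
  obtains M where "M \<ge> 0" "\<And>x y. x \<in> Ix \<Longrightarrow> y \<in> Ix \<Longrightarrow> \<bar>\<beta> x - \<beta> y\<bar> \<le> M * \<bar>sqrt (1 - x) - sqrt (1 - y)\<bar>"
proof -
  obtain d M where d: "M \<ge> 0" "\<And>x. x0 \<le> x \<Longrightarrow> x < 1 \<Longrightarrow> (\<beta> has_real_derivative d x) (at x within Ix)"
    "\<And>x. x0 \<le> x \<Longrightarrow> x < 1 \<Longrightarrow> \<bar>d x\<bar> * sqrt (1 - x) \<le> M" using lip_wtE[OF assms] by metis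
  have *: "\<bar>\<beta> y - \<beta> x\<bar> \<le> 2 * M * (sqrt (1 - x) - sqrt (1 - y))" if xy: "x \<in> Ix" "y \<in> Ix" "x < y" for x y
  proof -
    have sub: "{x..y} \<subseteq> Ix" using xy by auto
    have "norm (\<beta> y - \<beta> x) \<le> - 2 * M * sqrt (1 - y) - (- 2 * M * sqrt (1 - x))"
    proof (rule differentiable_bound_general[OF xy(3), where f' = d and \<phi>' = "\<lambda>t. M / sqrt (1 - t)"])
      show "continuous_on {x..y} \<beta>" using continuous_on_subset[OF lip_wt_cont[OF assms] sub] .
      show "continuous_on {x..y} (\<lambda>t. - 2 * M * sqrt (1 - t))" by (intro continuous_intros)
      fix t assume t: "x < t" "t < y"
      then have t': "x0 \<le> t" "t < 1" "x0 < t" using xy by auto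
      have "at t within Ix = at t" using t' by (intro at_within_interior) (auto simp: interior_atLeastAtMost_real)
      then show "(\<beta> has_vector_derivative d t) (at t)" using d(2)[OF t'(1,2)]
        by (simp add: has_real_derivative_iff_has_vector_derivative)
      have "((\<lambda>t. - 2 * M * sqrt (1 - t)) has_real_derivative M / sqrt (1 - t)) (at t)"
        using t' by (auto intro!: derivative_eq_intros simp: field_simps)
      then show "((\<lambda>t. - 2 * M * sqrt (1 - t)) has_vector_derivative M / sqrt (1 - t)) (at t)"
        by (simp add: has_real_derivative_iff_has_vector_derivative)
      show "norm (d t) \<le> M / sqrt (1 - t)" using d(3)[OF t'(1,2)] t' by (simp add: field_simps)
    qed
    then show ?thesis by (simp add: algebra_simps)
  qed
  show ?thesis
  proof (rule that[of "2 * M"])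
    show "2 * M \<ge> 0" using d by simp
    fix x y assume xy: "x \<in> Ix" "y \<in> Ix"
    have m: "2 * M * t \<le> 2 * M * \<bar>t\<bar>" "2 * M * (- t) \<le> 2 * M * \<bar>t\<bar>" for t using d(1) by (intro mult_left_mono; simp)+
    consider "x < y" | "x = y" | "y < x" by linarith
    then show "\<bar>\<beta> x - \<beta> y\<bar> \<le> 2 * M * \<bar>sqrt (1 - x) - sqrt (1 - y)\<bar>"
    proof cases
      case 1
      then show ?thesis using *[OF xy 1] m(1)[of "sqrt (1 - x) - sqrt (1 - y)"] by simp
    next
      case 3
      then show ?thesis using *[OF xy(2,1) 3] m(2)[of "sqrt (1 - x) - sqrt (1 - y)"] by simp
    qed simp
  qed
qed

text \<open>Up to the factor sqrt 2 this is the chordal distance of the unit vector along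
  \<open>X\<close> from the pole \<open>e3\<close>, and distances are Lipschitz.\<close>

lemma loc_lipschitz_sqrt_mu: "loc_lipschitz S (\<lambda>X. sqrt (1 - mu X))"
proof -
  have ll: "loc_lipschitz S (\<lambda>X. sgn X - e3)"
  proof (rule loc_lipschitz_vec)
    fix i :: 3
    have "loc_lipschitz S (\<lambda>X. X $ i * rinv X + (- e3 $ i))"
      by (intro loc_lipschitz_add loc_lipschitz_mult loc_lipschitz_const CL_loc_lipschitz[OF CL_coord[of 0]] CL_loc_lipschitz[OF CL_rinv[of 0]])
    then show "loc_lipschitz S (\<lambda>X. (sgn X - e3) $ i)"
      by (simp add: sgn_div_norm rinv_def mult.commute)
  qed
  have eq: "sqrt (1 - mu X) = norm (sgn X - e3) / sqrt 2" if "X \<in> S" for X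
  proof -
    have n: "norm X \<noteq> 0" using S_nz[OF that] by simp
    have "(norm (sgn X - e3))\<^sup>2 = (norm (sgn X))\<^sup>2 + (norm e3)\<^sup>2 - 2 * (sgn X \<bullet> e3)"
      by (simp add: power2_norm_eq_inner inner_diff_left inner_diff_right inner_commute)
    also have "\<dots> = 2 * (1 - mu X)" using n by (simp add: norm_sgn inner_axis mu_def sgn_div_norm divide_inverse mult.commute)
    finally have "norm (sgn X - e3) = sqrt (2 * (1 - mu X))" by (metis norm_ge_zero real_sqrt_unique)
    then show ?thesis unfolding real_sqrt_mult by simp
  qed
  have "loc_lipschitz S (\<lambda>X. norm (sgn X - e3))"
    unfolding loc_lipschitz_def
  proof (intro allI impI)
    fix C assume "compact C \<and> C \<subseteq> S"
    then obtain M where M: "M-lipschitz_on C (\<lambda>X. sgn X - e3)" using ll unfolding loc_lipschitz_def by blast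
    have "M-lipschitz_on C (\<lambda>X. norm (sgn X - e3))"
    proof (rule lipschitz_onI)
      fix x y assume "x \<in> C" "y \<in> C"
      then show "dist (norm (sgn x - e3)) (norm (sgn y - e3)) \<le> M * dist x y"
        using lipschitz_onD[OF M] norm_triangle_ineq3[of "sgn x - e3" "sgn y - e3"] by (fastforce simp: dist_norm)
    qed (rule lipschitz_on_nonneg[OF M])
    then show "\<exists>M. M-lipschitz_on C (\<lambda>X. norm (sgn X - e3))" by blast
  qed
  then have "loc_lipschitz S (\<lambda>X. norm (sgn X - e3) * (1 / sqrt 2))"
    by (intro loc_lipschitz_mult loc_lipschitz_const)
  then show ?thesis by (rule loc_lipschitz_cong[rotated]) (simp add: eq)
qed

lemma loc_lipschitz_comp_mu: assumes "lip_wt \<beta>" shows "loc_lipschitz S (\<lambda>X. \<beta> (mu X))"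
  unfolding loc_lipschitz_def
proof (intro allI impI)
  fix C assume C: "compact C \<and> C \<subseteq> S"
  then obtain L where L: "L-lipschitz_on C (\<lambda>X. sqrt (1 - mu X))" using loc_lipschitz_sqrt_mu unfolding loc_lipschitz_def by blast
  obtain M where M: "M \<ge> 0" "\<And>x y. x \<in> Ix \<Longrightarrow> y \<in> Ix \<Longrightarrow> \<bar>\<beta> x - \<beta> y\<bar> \<le> M * \<bar>sqrt (1 - x) - sqrt (1 - y)\<bar>"
    using lip_wt_increment[OF assms] by blast
  have "(M * L)-lipschitz_on C (\<lambda>X. \<beta> (mu X))"
  proof (rule lipschitz_onI)
    fix X Y assume XY: "X \<in> C" "Y \<in> C"
    then have "mu X \<in> Ix" "mu Y \<in> Ix" using C mu_mem by blast+
    then have "dist (\<beta> (mu X)) (\<beta> (mu Y)) \<le> M * dist (sqrt (1 - mu X)) (sqrt (1 - mu Y))"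
      using M(2) by (simp add: dist_real_def)
    also have "\<dots> \<le> M * (L * dist X Y)" using lipschitz_onD[OF L XY] M(1) by (intro mult_left_mono) auto
    finally show "dist (\<beta> (mu X)) (\<beta> (mu Y)) \<le> M * L * dist X Y" by (simp add: mult.assoc)
  qed (use M lipschitz_on_nonneg[OF L] in auto)
  then show "\<exists>M. M-lipschitz_on C (\<lambda>X. \<beta> (mu X))" by blast
qed

lemma sqrt_mu_nonneg: "X \<in> S \<Longrightarrow> 1 - (mu X)\<^sup>2 \<ge> 0"
  using mu_mem[of X] x0_gt by (auto simp: abs_square_le_1)

lemma LL0_comp_mu: assumes "lip0 \<beta>" shows "LL0 (\<lambda>X. \<beta> (mu X))"
proof -
  obtain M where M: "\<And>x. x \<in> Ix \<Longrightarrow> \<bar>\<beta> x\<bar> \<le> M * sqrt (1 - x)" using assms unfolding lip0_def by blast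
  \<comment> \<open>\<open>sqrt (1 - x)\<close> and \<open>sqrt (1 - x\<^sup>2)\<close> are
    comparable because \<open>sqrt (1 + x)\<close> is at least this.\<close>
  define K where "K = sqrt (1 + x0)"
  have K: "K > 0" using x0_gt by (simp add: K_def)
  have "\<bar>\<beta> (mu X)\<bar> \<le> (\<bar>M\<bar> / K) * sqrt (1 - (mu X)\<^sup>2)" if X: "X \<in> S" for X
  proof -
    have m: "mu X \<in> Ix" using mu_mem[OF X] .
    have "1 - (mu X)\<^sup>2 = (1 - mu X) * (1 + mu X)" by (simp add: power2_eq_square algebra_simps)
    then have e: "sqrt (1 - (mu X)\<^sup>2) = sqrt (1 - mu X) * sqrt (1 + mu X)" by (simp add: real_sqrt_mult)
    have "\<bar>\<beta> (mu X)\<bar> \<le> \<bar>M\<bar> * sqrt (1 - mu X)"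
      using M[OF m] mult_right_mono[of M "\<bar>M\<bar>" "sqrt (1 - mu X)"] abs_ge_self[of M] m by auto
    also have "\<dots> = (\<bar>M\<bar> / K) * (sqrt (1 - mu X) * K)" using K by simp
    also have "\<dots> \<le> (\<bar>M\<bar> / K) * (sqrt (1 - mu X) * sqrt (1 + mu X))"
      using K m by (intro mult_left_mono) (auto simp: K_def)
    finally show ?thesis by (simp only: e)
  qed
  then show ?thesis unfolding LL0_def using loc_lipschitz_comp_mu[OF lip0_lip_wt[OF assms]] by blast
qed

lemma psi_axis: "X \<in> S \<Longrightarrow> mu X = 1 \<Longrightarrow> psi i X = 0"
  using psi_sgn[of X i] S_nz[of X] by simp

lemma coord_axis: "X \<in> S \<Longrightarrow> mu X = 1 \<Longrightarrow> k \<noteq> 3 \<Longrightarrow> X $ k = 0"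
  using coord_sgn[of X k] S_nz[of X] by simp

lemma LL0_loc_lipschitz: "LL0 B \<Longrightarrow> loc_lipschitz S B" by (simp add: LL0_def)

lemmas ll_coord = CL_loc_lipschitz[OF CL_coord[of 0]]
lemmas ll_rinv = CL_loc_lipschitz[OF CL_rinv[of 0]]
lemmas ll_psi = CL_loc_lipschitz[OF CL_psi[of 0]]

text \<open>A profile that is only \<open>bdw\<close> may oscillate on approach to the axis; the
  length sin \<phi> hidden in \<open>psi\<close> turns it into a \<open>lip0\<close> profile times a
  direction.\<close>

lemma ll_bdw_psi: assumes "bdw B" shows "loc_lipschitz S (\<lambda>X. B (mu X) * psi i X)"
proof -
  have "loc_lipschitz S (\<lambda>X. (sqrt (1 - (mu X)\<^sup>2) * B (mu X) * sgn (Psi X) $ i) * rinv X)"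
    using LL0_sgn[OF LL0_comp_mu[OF bdw_lip0'[OF assms]], of Psi i]
    by (intro loc_lipschitz_mult ll_rinv LL0_loc_lipschitz) auto
  then show ?thesis by (rule loc_lipschitz_cong[rotated]) (simp add: psi_sgn[OF S_nz])
qed

lemma ll_bdw_coord: assumes "bdw B" "k \<noteq> 3" shows "loc_lipschitz S (\<lambda>X. B (mu X) * X $ k)"
proof -
  have "loc_lipschitz S (\<lambda>X. (sqrt (1 - (mu X)\<^sup>2) * B (mu X) * sgn (Hor X) $ k) * norm X)"
    using LL0_sgn[OF LL0_comp_mu[OF bdw_lip0'[OF assms(1)]], of Hor k]
    by (intro loc_lipschitz_mult loc_lipschitz_norm LL0_loc_lipschitz) auto
  moreover have "sqrt (1 - (mu X)\<^sup>2) * B (mu X) * sgn (Hor X) $ k * norm X = B (mu X) * X $ k" if "X \<in> S" for X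
    using coord_sgn[OF S_nz[OF that] assms(2)] by (metis mult.assoc mult.left_commute)
  ultimately show ?thesis by (rule loc_lipschitz_cong[rotated])
qed

lemma sqrt_mu_sq: "X \<in> S \<Longrightarrow> sqrt (1 - (mu X)\<^sup>2) * sqrt (1 - (mu X)\<^sup>2) = 1 - (mu X)\<^sup>2"
  using sqrt_mu_nonneg by simp

text \<open>Two factors \<open>psi\<close> contribute \<open>1 - x\<^sup>2\<close>, the weight under
  which second derivatives of profiles are controlled; two directions are left over.\<close>

lemma ll_lip0_psi2: assumes "lip0 (\<lambda>x. (1 - x\<^sup>2) * A x)" shows "loc_lipschitz S (\<lambda>X. A (mu X) * psi j X * psi i X)"
proof -
  have "loc_lipschitz S (\<lambda>X. ((1 - (mu X)\<^sup>2) * A (mu X) * sgn (Psi X) $ j * sgn (Psi X) $ i) * (rinv X * rinv X))"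
    using LL0_sgn[OF LL0_sgn[OF LL0_comp_mu[OF assms], of Psi j], of Psi i]
    by (intro loc_lipschitz_mult ll_rinv LL0_loc_lipschitz) auto
  moreover have "((1 - (mu X)\<^sup>2) * A (mu X) * sgn (Psi X) $ j * sgn (Psi X) $ i) * (rinv X * rinv X) = A (mu X) * psi j X * psi i X"
    if "X \<in> S" for X
    using psi_sgn[OF S_nz[OF that], of i] psi_sgn[OF S_nz[OF that], of j] sqrt_mu_sq[OF that, symmetric]
    by (simp add: mult_ac)
  ultimately show ?thesis by (rule loc_lipschitz_cong[rotated])
qed

text \<open>The horizontal coordinate contributes one more factor sin \<phi>, which lowers the
  demand on the weighted second derivative from \<open>lip0\<close> to \<open>bdw\<close>.\<close>

lemma ll_bdw_psi2_coord: assumes "bdw (\<lambda>x. (1 - x\<^sup>2) * A x)" "k \<noteq> 3"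
  shows "loc_lipschitz S (\<lambda>X. A (mu X) * psi j X * psi i X * X $ k)"
proof -
  have "loc_lipschitz S (\<lambda>X. (sqrt (1 - (mu X)\<^sup>2) * ((1 - (mu X)\<^sup>2) * A (mu X)) * sgn (Psi X) $ j * sgn (Psi X) $ i * sgn (Hor X) $ k) * (rinv X * rinv X * norm X))"
    using LL0_sgn[OF LL0_sgn[OF LL0_sgn[OF LL0_comp_mu[OF bdw_lip0'[OF assms(1)]], of Psi j], of Psi i], of Hor k]
    by (intro loc_lipschitz_mult ll_rinv loc_lipschitz_norm LL0_loc_lipschitz) auto
  moreover have "(sqrt (1 - (mu X)\<^sup>2) * ((1 - (mu X)\<^sup>2) * A (mu X)) * sgn (Psi X) $ j * sgn (Psi X) $ i * sgn (Hor X) $ k) * (rinv X * rinv X * norm X) = A (mu X) * psi j X * psi i X * X $ k"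
    if "X \<in> S" for X
  proof -
    have "A (mu X) * psi j X * psi i X * X $ k = A (mu X) * (sqrt (1 - (mu X)\<^sup>2) * sgn (Psi X) $ j * rinv X)
       * (sqrt (1 - (mu X)\<^sup>2) * sgn (Psi X) $ i * rinv X) * (sqrt (1 - (mu X)\<^sup>2) * sgn (Hor X) $ k * norm X)"
      by (simp only: flip: psi_sgn[OF S_nz[OF that]] coord_sgn[OF S_nz[OF that] assms(2)])
    also have "\<dots> = (sqrt (1 - (mu X)\<^sup>2) * ((sqrt (1 - (mu X)\<^sup>2) * sqrt (1 - (mu X)\<^sup>2)) * A (mu X)) * sgn (Psi X) $ j * sgn (Psi X) $ i * sgn (Hor X) $ k) * (rinv X * rinv X * norm X)"
      by (simp only: mult_ac)
    finally show ?thesis unfolding sqrt_mu_sq[OF that] by (rule sym)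
  qed
  ultimately show ?thesis by (rule loc_lipschitz_cong[rotated])
qed

section \<open>Criteria for \<open>CL 1\<close> and \<open>CL 2\<close> in terms of profiles\<close>

lemma CL1_comp_mu:
  assumes "\<And>x. x \<in> Ix \<Longrightarrow> (\<alpha> has_real_derivative \<alpha>' x) (at x within Ix)" "continuous_on Ix \<alpha>'" "bdw \<alpha>'"
  shows "CL 1 S (\<lambda>X. \<alpha> (mu X))"
  unfolding One_nat_def
proof (rule CL_SucI[where f' = "\<lambda>X h. \<alpha>' (mu X) * dmu X h"])
  show "loc_lipschitz S (\<lambda>X. \<alpha> (mu X))" by (intro loc_lipschitz_comp_mu C1_lip_wt[OF assms(1,2)])
  show "((\<lambda>X. \<alpha> (mu X)) has_derivative (\<lambda>h. \<alpha>' (mu X) * dmu X h)) (at X within S)" if "X \<in> S" for X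
    using that mu_mem[OF that] by (intro comp_mu_has_derivative assms(1))
  show "CL 0 S (\<lambda>X. \<alpha>' (mu X) * dmu X (axis i 1))" for i
    using ll_bdw_psi[OF assms(3)] by (simp add: dmu_axis)
qed

text \<open>On the axis \<open>\<beta>\<close> need not be differentiable: there the vanishing factor \<open>m\<close> takes over.\<close>

lemma CL1_prod:
  assumes \<beta>: "continuous_on Ix \<beta>" "\<And>x. x0 \<le> x \<Longrightarrow> x < 1 \<Longrightarrow> (\<beta> has_real_derivative \<beta>' x) (at x within Ix)"
    and m: "m differentiable_on S" "\<And>X. X \<in> S \<Longrightarrow> mu X = 1 \<Longrightarrow> m X = 0"
    and ll: "loc_lipschitz S (\<lambda>X. \<beta> (mu X) * m X)"
      "\<And>j. loc_lipschitz S (\<lambda>X. \<beta>' (mu X) * psi j X * m X + \<beta> (mu X) * partial_within S j m X)"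
  shows "CL 1 S (\<lambda>X. \<beta> (mu X) * m X)"
proof -
  define dm where "dm = (\<lambda>X. SOME f'. (m has_derivative f') (at X within S))"
  have dm: "(m has_derivative dm X) (at X within S)" if "X \<in> S" for X
    using m(1) that someI_ex[of "\<lambda>f'. (m has_derivative f') (at X within S)"]
    unfolding differentiable_on_def differentiable_def dm_def by blast
  have "CL (Suc 0) S (\<lambda>X. \<beta> (mu X) * m X)"
  proof (rule CL_SucI[OF ll(1), where f' = "\<lambda>X h. \<beta>' (mu X) * dmu X h * m X + \<beta> (mu X) * dm X h"])
    fix X assume X: "X \<in> S"
    show "((\<lambda>X. \<beta> (mu X) * m X) has_derivative (\<lambda>h. \<beta>' (mu X) * dmu X h * m X + \<beta> (mu X) * dm X h)) (at X within S)"
    proof (cases "mu X = 1")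
      case True
      have "continuous_on S (\<lambda>X. \<beta> (mu X))"
        using continuous_on_compose2[OF \<beta>(1) continuous_on_mu] mu_mem by blast
      then have "continuous (at X within S) (\<lambda>X. \<beta> (mu X))" using X by (simp add: continuous_on_eq_continuous_within)
      from has_derivative_mult_vanishing[OF this dm[OF X] m(2)[OF X True]] m(2)[OF X True] show ?thesis by simp
    next
      case False
      then have "mu X < 1" "x0 \<le> mu X" using mu_mem[OF X] by auto
      from has_derivative_mult[OF comp_mu_has_derivative[OF X \<beta>(2)[OF this(2,1)]] dm[OF X]]
      show ?thesis by (simp add: add.commute)
    qed
  next
    fix j
    have "CL 0 S (\<lambda>X. \<beta>' (mu X) * psi j X * m X + \<beta> (mu X) * partial_within S j m X)" using ll(2) by simp
    then show "CL 0 S (\<lambda>X. \<beta>' (mu X) * dmu X (axis j 1) * m X + \<beta> (mu X) * dm X (axis j 1))"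
      by (rule CL_cong[rotated]) (simp add: dmu_axis partial_within_eq[OF _ dm])
  qed
  then show ?thesis by simp
qed

lemma CL_differentiable: "CL (Suc k) S f \<Longrightarrow> f differentiable_on S" by simp

lemma CL_partial: "CL (Suc k) S f \<Longrightarrow> CL k S (partial_within S i f)" by simp

text \<open>The first derivatives are \<open>\<alpha>'\<close> times \<open>psi\<close>. A
  derivative of \<open>\<alpha>'\<close> is given only off the axis, so they are differentiated with
  \<open>CL1_prod\<close>, \<open>psi\<close> being the factor that vanishes at
  \<open>mu X = 1\<close>.\<close>

lemma CL2_comp_mu:
  assumes "\<And>x. x \<in> Ix \<Longrightarrow> (\<alpha> has_real_derivative \<alpha>' x) (at x within Ix)"
    "\<And>x. x0 \<le> x \<Longrightarrow> x < 1 \<Longrightarrow> (\<alpha>' has_real_derivative \<alpha>'' x) (at x within Ix)"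
    "lip_wt \<alpha>'" "lip0 (\<lambda>x. (1 - x\<^sup>2) * \<alpha>'' x)"
  shows "CL 2 S (\<lambda>X. \<alpha> (mu X))"
proof -
  have "CL (Suc 1) S (\<lambda>X. \<alpha> (mu X))"
  proof (rule CL_SucI[where f' = "\<lambda>X h. \<alpha>' (mu X) * dmu X h"])
    show "loc_lipschitz S (\<lambda>X. \<alpha> (mu X))" by (intro loc_lipschitz_comp_mu C1_lip_wt[OF assms(1) lip_wt_cont[OF assms(3)]])
    show "((\<lambda>X. \<alpha> (mu X)) has_derivative (\<lambda>h. \<alpha>' (mu X) * dmu X h)) (at X within S)" if "X \<in> S" for X
      using that mu_mem[OF that] by (intro comp_mu_has_derivative assms(1))
    fix i
    have "CL 1 S (\<lambda>X. \<alpha>' (mu X) * psi i X)"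
    proof (rule CL1_prod[OF lip_wt_cont[OF assms(3)] assms(2) CL_differentiable[OF CL_psi] psi_axis])
      show "loc_lipschitz S (\<lambda>X. \<alpha>' (mu X) * psi i X)" by (intro loc_lipschitz_mult loc_lipschitz_comp_mu assms ll_psi)
      show "loc_lipschitz S (\<lambda>X. \<alpha>'' (mu X) * psi j X * psi i X + \<alpha>' (mu X) * partial_within S j (psi i) X)" for j
        by (intro loc_lipschitz_add loc_lipschitz_mult[of _ "\<lambda>X. \<alpha>' (mu X)"] ll_lip0_psi2 assms loc_lipschitz_comp_mu
          CL_loc_lipschitz[OF CL_partial[OF CL_psi[of "Suc 0"]]])
    qed
    then show "CL 1 S (\<lambda>X. \<alpha>' (mu X) * dmu X (axis i 1))" by (simp only: dmu_axis)
  qed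
  then show ?thesis by (simp only: numeral_2_eq_2 One_nat_def)
qed

text \<open>Meant for the swirl, whose profile multiplies a horizontal coordinate: that factor of
  order sin \<phi> makes up for \<open>bdw\<close> bounds in place of \<open>lip_wt\<close> and
  \<open>lip0\<close>. A C^1 force yields no more than \<open>bdw\<close> for its swirl
  profile.\<close>

lemma CL2_comp_mu_coord:
  assumes "\<And>x. x \<in> Ix \<Longrightarrow> (\<alpha> has_real_derivative \<alpha>' x) (at x within Ix)"
    "\<And>x. x0 \<le> x \<Longrightarrow> x < 1 \<Longrightarrow> (\<alpha>' has_real_derivative \<alpha>'' x) (at x within Ix)"
    "continuous_on Ix \<alpha>'" "bdw \<alpha>'" "bdw (\<lambda>x. (1 - x\<^sup>2) * \<alpha>'' x)" "k \<noteq> 3"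
  shows "CL 2 S (\<lambda>X. \<alpha> (mu X) * X $ k)"
proof -
  have ll_\<alpha>: "loc_lipschitz S (\<lambda>X. \<alpha> (mu X))" by (intro loc_lipschitz_comp_mu C1_lip_wt[OF assms(1,3)])
  have "CL (Suc 1) S (\<lambda>X. \<alpha> (mu X) * X $ k)"
  proof (rule CL_SucI[where f' = "\<lambda>X h. \<alpha> (mu X) * h $ k + \<alpha>' (mu X) * dmu X h * X $ k"])
    show "loc_lipschitz S (\<lambda>X. \<alpha> (mu X) * X $ k)" by (intro loc_lipschitz_mult ll_\<alpha> ll_coord)
    show "((\<lambda>X. \<alpha> (mu X) * X $ k) has_derivative (\<lambda>h. \<alpha> (mu X) * h $ k + \<alpha>' (mu X) * dmu X h * X $ k)) (at X within S)" if "X \<in> S" for X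
      using that mu_mem[OF that]
      by (intro has_derivative_mult comp_mu_has_derivative assms(1) bounded_linear_imp_has_derivative bounded_linear_vec_nth)
    fix i
    define m where "m = (\<lambda>X. psi i X * X $ k)"
    have m: "CL j S m" for j unfolding m_def by (intro CL_mult CL_psi CL_coord)
    have pm: "psi i X * (if j = k then 1 else 0) + partial_within S j (psi i) X * X $ k = partial_within S j m X" if X: "X \<in> S" for j X
    proof -
      obtain f' where f': "(psi i has_derivative f') (at X within S)" "\<And>j. partial_within S j (psi i) X = f' (axis j 1)"
        using diff_on_has_derivative[OF CL_differentiable[OF CL_psi[of "Suc 0"]] X] by blast
      have "((\<lambda>X. X $ k) has_derivative (\<lambda>h. h $ k)) (at X within S)"
        by (intro bounded_linear_imp_has_derivative bounded_linear_vec_nth)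
      from partial_within_eq[OF X has_derivative_mult[OF f'(1) this], of j] show ?thesis
        by (auto simp: m_def f' axis_def)
    qed
    have 1: "CL 1 S (\<lambda>X. \<alpha>' (mu X) * m X)"
    proof (rule CL1_prod[OF assms(3,2) CL_differentiable[OF m]])
      show "m X = 0" if "X \<in> S" "mu X = 1" for X using psi_axis[OF that] by (simp add: m_def)
      have "loc_lipschitz S (\<lambda>X. \<alpha>' (mu X) * psi i X * X $ k)" by (intro loc_lipschitz_mult[OF ll_bdw_psi] assms ll_coord)
      then show "loc_lipschitz S (\<lambda>X. \<alpha>' (mu X) * m X)" by (simp add: m_def mult.assoc)
      fix j
      have "loc_lipschitz S (\<lambda>X. \<alpha>'' (mu X) * psi j X * psi i X * X $ k +
          ((\<alpha>' (mu X) * psi i X) * (if j = k then 1 else 0) + (\<alpha>' (mu X) * X $ k) * partial_within S j (psi i) X))"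
        by (intro loc_lipschitz_add ll_bdw_psi2_coord assms loc_lipschitz_mult[OF ll_bdw_psi] loc_lipschitz_mult[OF ll_bdw_coord] loc_lipschitz_const
           CL_loc_lipschitz[OF CL_partial[OF CL_psi[of "Suc 0"]]])
      then show "loc_lipschitz S (\<lambda>X. \<alpha>'' (mu X) * psi j X * m X + \<alpha>' (mu X) * partial_within S j m X)"
        by (rule loc_lipschitz_cong[rotated]) (simp add: pm[symmetric], simp add: m_def algebra_simps)
    qed
    have 2: "CL 1 S (\<lambda>X. \<alpha> (mu X) * (axis i 1 :: real^3) $ k)"
      using CL1_comp_mu[OF assms(1,3,4)] by (intro CL_mult CL_const)
    show "CL 1 S (\<lambda>X. \<alpha> (mu X) * (axis i 1 :: real^3) $ k + \<alpha>' (mu X) * dmu X (axis i 1) * X $ k)"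
      using CL_add[OF 2 1] by (simp only: m_def dmu_axis mult.assoc)
  qed
  then show ?thesis by (simp only: numeral_2_eq_2 One_nat_def)
qed

end

section \<open>Axisymmetric homogeneous fields off the axis\<close>

lemma bounded_linear_rot_gen: "bounded_linear rot_gen"
proof (rule linear_conv_bounded_linear[THEN iffD1], rule linearI)
  fix x y :: "real^3" and r :: real
  show "rot_gen (x + y) = rot_gen x + rot_gen y" by (simp add: vec_eq_iff forall_3)
  show "rot_gen (r *\<^sub>R x) = r *\<^sub>R rot_gen x" by (simp add: vec_eq_iff forall_3)
qed

lemma axis_nth: "(axis i (1::real) :: real^'n) $ j = (if j = i then 1 else 0)" by (simp add: axis_def)

lemma linear_rot_gen: "linear rot_gen" using bounded_linear_rot_gen bounded_linear.linear by blast

context cone begin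

text \<open>The interior of the cone without its axis: only there are the profiles twice differentiable.\<close>

definition Om :: "(real^3) set" where "Om = {X \<in> S_open. mu X < 1}"

lemma Om_S: "X \<in> Om \<Longrightarrow> X \<in> S" "X \<in> Om \<Longrightarrow> X \<noteq> 0" "X \<in> Om \<Longrightarrow> x0 < mu X" "X \<in> Om \<Longrightarrow> mu X < 1"
  using S_open_subset by (auto simp: Om_def S_open_iff_mu)

lemma Om_iff: "X \<in> Om \<longleftrightarrow> X \<noteq> 0 \<and> x0 < mu X \<and> mu X < 1" by (auto simp: Om_def S_open_iff_mu)

lemma open_Om: "open Om"
proof -
  have "continuous_on S_open mu" using continuous_on_mu continuous_on_subset S_open_subset by blast
  then have "open (S_open \<inter> mu -` {..<1})" using open_S_open by (simp add: continuous_on_open_vimage Int_commute)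
  moreover have "S_open \<inter> mu -` {..<1} = Om" by (auto simp: Om_def)
  ultimately show ?thesis by simp
qed

lemma at_within_S_Om: "X \<in> Om \<Longrightarrow> at X within S = at X"
  using open_Om Om_S(1) by (intro at_within_interior) (meson interiorI subsetI)

lemma partial_within_Om: "X \<in> Om \<Longrightarrow> (f has_derivative f') (at X) \<Longrightarrow> partial_within S i f X = f' (axis i 1)"
  using partial_within_eq[OF Om_S(1)] at_within_S_Om by metis

lemma inner_self_rinv: "X \<noteq> 0 \<Longrightarrow> (X \<bullet> X) * (rinv X)\<^sup>2 = 1"
  by (simp add: rinv_def power2_norm_eq_inner[symmetric] power_inverse)

lemma dmu_lin: "dmu X (\<Sum>i\<in>I. f i) = (\<Sum>i\<in>I. dmu X (f i))" "dmu X (h + k) = dmu X h + dmu X k" "dmu X (r *\<^sub>R h) = r * dmu X h"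
  by (simp_all add: dmu_def inner_sum_right sum_distrib_left sum_distrib_right sum_subtractf inner_add_right algebra_simps)

lemma dmu_frame:
  assumes "X \<noteq> 0" shows "dmu X X = 0" "dmu X e3 = (1 - (mu X)\<^sup>2) * rinv X" "dmu X (rot_gen X) = 0"
proof -
  have "mu X * (X \<bullet> X) * rinv X = X $ 3 * ((X \<bullet> X) * (rinv X)\<^sup>2)" by (simp add: mu_eq power2_eq_square)
  then show "dmu X X = 0" using inner_self_rinv[OF assms] by (simp add: dmu_def)
  show "dmu X e3 = (1 - (mu X)\<^sup>2) * rinv X"
    by (simp add: dmu_def inner_axis mu_eq power2_eq_square axis_nth)
  show "dmu X (rot_gen X) = 0" by (simp add: dmu_def inner_vec_def sum_3)
qed

lemma X_rot_gen: "X \<bullet> rot_gen X = 0" by (simp add: inner_vec_def sum_3)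

text \<open>A profile times the power of the norm that makes the degree \<open>- n\<close>;
  \<open>dsc\<close> is its differential, and \<open>ddsc\<close> that of its partial
  derivatives.\<close>

definition sc :: "(real \<Rightarrow> real) \<Rightarrow> nat \<Rightarrow> real^3 \<Rightarrow> real" where
  "sc \<alpha> n X = \<alpha> (mu X) * rinv X ^ n"

definition dsc :: "(real \<Rightarrow> real) \<Rightarrow> (real \<Rightarrow> real) \<Rightarrow> nat \<Rightarrow> real^3 \<Rightarrow> real^3 \<Rightarrow> real" where
  "dsc \<alpha> \<alpha>' n X h = \<alpha>' (mu X) * dmu X h * rinv X ^ n - real n * \<alpha> (mu X) * (X \<bullet> h) * rinv X ^ (n + 2)"

lemma rinv_power_has_derivative:
  assumes "X \<noteq> 0" shows "((\<lambda>X. rinv X ^ n) has_derivative (\<lambda>h. - real n * (X \<bullet> h) * rinv X ^ (n + 2))) (at X within T)"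
proof (cases n)
  case (Suc m)
  show ?thesis unfolding Suc
    by (rule has_derivative_eq_rhs[OF has_derivative_power[OF rinv_has_derivative[OF assms]]])
      (auto simp: power_add power2_eq_square power3_eq_cube algebra_simps fun_eq_iff)
qed simp

lemma sc_has_derivative:
  assumes "X \<in> Om" "(\<alpha> has_real_derivative \<alpha>' (mu X)) (at (mu X))"
  shows "(sc \<alpha> n has_derivative dsc \<alpha> \<alpha>' n X) (at X)"
proof -
  have 1: "((\<lambda>X. \<alpha> (mu X)) has_derivative (\<lambda>h. \<alpha>' (mu X) * dmu X h)) (at X)"
    using has_derivative_compose[OF mu_has_derivative[OF Om_S(2)[OF assms(1)], of UNIV], of \<alpha> "(*) (\<alpha>' (mu X))"] assms(2)
    by (simp add: has_field_derivative_def)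
  have "((\<lambda>X. \<alpha> (mu X) * rinv X ^ n) has_derivative (\<lambda>h. \<alpha> (mu X) * (- real n * (X \<bullet> h) * rinv X ^ (n + 2)) + \<alpha>' (mu X) * dmu X h * rinv X ^ n)) (at X)"
    by (intro has_derivative_mult 1 rinv_power_has_derivative Om_S(2) assms(1))
  moreover have "(\<lambda>h. \<alpha> (mu X) * (- real n * (X \<bullet> h) * rinv X ^ (n + 2)) + \<alpha>' (mu X) * dmu X h * rinv X ^ n) = dsc \<alpha> \<alpha>' n X"
    by (auto simp: dsc_def)
  ultimately show ?thesis by (simp add: sc_def[abs_def])
qed

definition dpsi :: "3 \<Rightarrow> real^3 \<Rightarrow> real^3 \<Rightarrow> real" where
  "dpsi i X h = (if i = 3 then 1 else 0) * (- (X \<bullet> h) * rinv X ^ 3)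
     - (dmu X h * X $ i * rinv X ^ 2 + mu X * h $ i * rinv X ^ 2 + mu X * X $ i * (- 2 * (X \<bullet> h) * rinv X ^ 4))"

lemma psi_has_derivative: assumes "X \<noteq> 0" shows "(psi i has_derivative dpsi i X) (at X)"
proof -
  have "psi i = (\<lambda>X. (if i = 3 then 1 else 0) * rinv X - mu X * X $ i * rinv X ^ 2)"
    by (auto simp: psi_def power2_eq_square algebra_simps)
  moreover have "((\<lambda>X. (if i = 3 then 1 else 0) * rinv X - mu X * X $ i * rinv X ^ 2) has_derivative
     (\<lambda>h. (if i = 3 then 1 else 0) * (- (X \<bullet> h) * rinv X ^ 3) -
       ((mu X * X $ i) * (- real 2 * (X \<bullet> h) * rinv X ^ (2 + 2)) + (mu X * h $ i + dmu X h * X $ i) * rinv X ^ 2))) (at X)"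
    by (intro has_derivative_diff has_derivative_mult mu_has_derivative rinv_has_derivative has_derivative_mult_right assms
      rinv_power_has_derivative bounded_linear_imp_has_derivative bounded_linear_vec_nth)
  moreover have "(\<lambda>h. (if i = 3 then 1 else 0) * (- (X \<bullet> h) * rinv X ^ 3) -
       ((mu X * X $ i) * (- real 2 * (X \<bullet> h) * rinv X ^ (2 + 2)) + (mu X * h $ i + dmu X h * X $ i) * rinv X ^ 2)) = dpsi i X"
    by (auto simp: dpsi_def algebra_simps)
  ultimately show ?thesis by simp
qed

definition ddsc :: "(real \<Rightarrow> real) \<Rightarrow> (real \<Rightarrow> real) \<Rightarrow> (real \<Rightarrow> real) \<Rightarrow> nat \<Rightarrow> 3 \<Rightarrow> real^3 \<Rightarrow> real^3 \<Rightarrow> real" where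
  "ddsc \<alpha> \<alpha>' \<alpha>'' n i X h = dsc \<alpha>' \<alpha>'' n X h * psi i X + sc \<alpha>' n X * dpsi i X h
     - real n * (dsc \<alpha> \<alpha>' (n + 2) X h * X $ i + sc \<alpha> (n + 2) X * h $ i)"

lemma dsc_has_derivative:
  assumes "X \<in> Om" "(\<alpha> has_real_derivative \<alpha>' (mu X)) (at (mu X))" "(\<alpha>' has_real_derivative \<alpha>'' (mu X)) (at (mu X))"
  shows "((\<lambda>X. dsc \<alpha> \<alpha>' n X (axis i 1)) has_derivative ddsc \<alpha> \<alpha>' \<alpha>'' n i X) (at X)"
proof -
  have "(\<lambda>X. dsc \<alpha> \<alpha>' n X (axis i 1)) = (\<lambda>X. sc \<alpha>' n X * psi i X - real n * (sc \<alpha> (n + 2) X * X $ i))"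
    by (auto simp: dsc_def sc_def dmu_axis inner_axis algebra_simps)
  moreover have "((\<lambda>X. sc \<alpha>' n X * psi i X - real n * (sc \<alpha> (n + 2) X * X $ i)) has_derivative
    (\<lambda>h. (sc \<alpha>' n X * dpsi i X h + dsc \<alpha>' \<alpha>'' n X h * psi i X) - real n * (sc \<alpha> (n + 2) X * h $ i + dsc \<alpha> \<alpha>' (n + 2) X h * X $ i))) (at X)"
    by (intro has_derivative_diff has_derivative_mult has_derivative_mult_right psi_has_derivative sc_has_derivative assms Om_S
       bounded_linear_imp_has_derivative bounded_linear_vec_nth)
  moreover have "(\<lambda>h. (sc \<alpha>' n X * dpsi i X h + dsc \<alpha>' \<alpha>'' n X h * psi i X) - real n * (sc \<alpha> (n + 2) X * h $ i + dsc \<alpha> \<alpha>' (n + 2) X h * X $ i)) = ddsc \<alpha> \<alpha>' \<alpha>'' n i X"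
    by (auto simp: ddsc_def)
  ultimately show ?thesis by simp
qed

text \<open>The gradient of \<open>sc \<alpha> n\<close>. It has no component along
  \<open>rot_gen X\<close>, the direction of the rotation that leaves the function
  invariant.\<close>

lemma sum_dsc_axis:
  assumes "X \<noteq> 0"
  shows "(\<Sum>i\<in>UNIV. dsc \<alpha> \<alpha>' n X (axis i 1) *\<^sub>R axis i 1) =
    (\<alpha>' (mu X) * rinv X ^ (n + 1)) *\<^sub>R e3 - (rinv X ^ (n + 2) * (mu X * \<alpha>' (mu X) + real n * \<alpha> (mu X))) *\<^sub>R X"
  unfolding vec_eq_iff forall_3 sum_3
  by (simp add: dsc_def dmu_axis inner_axis psi_def axis_nth algebra_simps power2_eq_square)


text \<open>In this order: the squared length of the gradient of \<open>mu\<close>, its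
  orthogonality to \<open>X\<close> (degree 0), the Laplacian of \<open>mu\<close>, and a
  normalisation. The factor -2 is the eigenvalue of the zonal harmonic cos \<phi>.\<close>

lemma psi_sums:
  assumes "X \<noteq> 0"
  shows "(\<Sum>i\<in>UNIV. psi i X * psi i X) = (1 - (mu X)\<^sup>2) * (rinv X)\<^sup>2" "(\<Sum>i\<in>UNIV. psi i X * X $ i) = 0"
    "(\<Sum>i\<in>UNIV. dpsi i X (axis i 1)) = - 2 * mu X * (rinv X)\<^sup>2" "(\<Sum>i\<in>UNIV. X $ i * X $ i * (rinv X)\<^sup>2) = 1"
proof -
  have s: "(\<Sum>i\<in>UNIV. h $ i * psi i X) = dmu X h" for h
  proof -
    have "h = (\<Sum>i\<in>UNIV. h $ i *\<^sub>R axis i 1)" using basis_expansion[of h] by (simp add: scalar_mult_eq_scaleR)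
    then have "dmu X h = (\<Sum>i\<in>UNIV. dmu X (h $ i *\<^sub>R axis i 1))" using dmu_lin(1) by metis
    then show ?thesis by (simp add: dmu_lin dmu_axis)
  qed
  show 2: "(\<Sum>i\<in>UNIV. psi i X * X $ i) = 0" using s[of X] dmu_frame[OF assms] by (simp add: mult.commute)
  show 4: "(\<Sum>i\<in>UNIV. X $ i * X $ i * (rinv X)\<^sup>2) = 1" using inner_self_rinv[OF assms]
    by (simp add: inner_vec_def sum_distrib_right)
  have "(\<Sum>i\<in>UNIV. psi i X * psi i X) = (\<Sum>i\<in>UNIV. (e3 $ i * psi i X) * rinv X - mu X * (psi i X * X $ i) * rinv X * rinv X)"
    by (rule sum.cong) (auto simp: psi_def axis_nth algebra_simps)
  also have "\<dots> = (\<Sum>i\<in>UNIV. e3 $ i * psi i X) * rinv X - mu X * (\<Sum>i\<in>UNIV. psi i X * X $ i) * rinv X * rinv X"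
    by (simp add: sum_subtractf sum_distrib_left sum_distrib_right)
  also have "\<dots> = (1 - (mu X)\<^sup>2) * (rinv X)\<^sup>2" unfolding 2 s using dmu_frame[OF assms] by (simp add: power2_eq_square)
  finally show "(\<Sum>i\<in>UNIV. psi i X * psi i X) = (1 - (mu X)\<^sup>2) * (rinv X)\<^sup>2" .
  have "(\<Sum>i\<in>UNIV. dpsi i X (axis i 1)) = (\<Sum>i\<in>UNIV. - (e3 $ i * X $ i * rinv X ^ 3) - psi i X * X $ i * (rinv X)\<^sup>2 - mu X * (rinv X)\<^sup>2
     + 2 * mu X * (rinv X)\<^sup>2 * (X $ i * X $ i * (rinv X)\<^sup>2))"
    by (rule sum.cong) (auto simp: dpsi_def dmu_axis inner_axis axis_nth power2_eq_square power3_eq_cube power4_eq_xxxx)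
  also have "\<dots> = - ((\<Sum>i\<in>UNIV. e3 $ i * X $ i) * rinv X ^ 3) - (\<Sum>i\<in>UNIV. psi i X * X $ i) * (rinv X)\<^sup>2 - 3 * mu X * (rinv X)\<^sup>2
     + 2 * mu X * (rinv X)\<^sup>2 * (\<Sum>i\<in>UNIV. X $ i * X $ i * (rinv X)\<^sup>2)"
    by (simp add: sum.distrib sum_subtractf sum_negf sum_distrib_left sum_distrib_right)
  also have "(\<Sum>i\<in>UNIV. e3 $ i * X $ i) = X $ 3" by (simp add: sum_3 axis_nth)
  finally show "(\<Sum>i\<in>UNIV. dpsi i X (axis i 1)) = - 2 * mu X * (rinv X)\<^sup>2" unfolding 2 4
    by (simp add: mu_eq power2_eq_square power3_eq_cube)
qed

text \<open>The Laplacian of a homogeneous function: the Legendre operator applied to the profile,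
  plus the radial contribution n (n - 1) of the power \<open>- n\<close> of the norm.\<close>

lemma sum_ddsc:
  assumes "X \<noteq> 0"
  shows "(\<Sum>i\<in>UNIV. ddsc \<alpha> \<alpha>' \<alpha>'' n i X (axis i 1)) = rinv X ^ (n + 2) *
    ((1 - (mu X)\<^sup>2) * \<alpha>'' (mu X) - 2 * mu X * \<alpha>' (mu X) + real n * (real n - 1) * \<alpha> (mu X))"
proof -
  have "(\<Sum>i\<in>UNIV. ddsc \<alpha> \<alpha>' \<alpha>'' n i X (axis i 1)) = (\<Sum>i\<in>UNIV. \<alpha>'' (mu X) * rinv X ^ n * (psi i X * psi i X)
     - 2 * real n * \<alpha>' (mu X) * rinv X ^ (n + 2) * (psi i X * X $ i) + \<alpha>' (mu X) * rinv X ^ n * dpsi i X (axis i 1)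
     - real n * \<alpha> (mu X) * rinv X ^ (n + 2) + real n * (real n + 2) * \<alpha> (mu X) * rinv X ^ (n + 2) * (X $ i * X $ i * (rinv X)\<^sup>2))"
    by (rule sum.cong) (auto simp: ddsc_def dsc_def sc_def dmu_axis inner_axis power_add power2_eq_square power4_eq_xxxx algebra_simps)
  also have "\<dots> = \<alpha>'' (mu X) * rinv X ^ n * (\<Sum>i\<in>UNIV. psi i X * psi i X)
     - 2 * real n * \<alpha>' (mu X) * rinv X ^ (n + 2) * (\<Sum>i\<in>UNIV. psi i X * X $ i) + \<alpha>' (mu X) * rinv X ^ n * (\<Sum>i\<in>UNIV. dpsi i X (axis i 1))
     - 3 * (real n * \<alpha> (mu X) * rinv X ^ (n + 2)) + real n * (real n + 2) * \<alpha> (mu X) * rinv X ^ (n + 2) * (\<Sum>i\<in>UNIV. X $ i * X $ i * (rinv X)\<^sup>2)"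
    by (simp add: sum.distrib sum_subtractf sum_distrib_left)
  also have "\<dots> = rinv X ^ (n + 2) *
    ((1 - (mu X)\<^sup>2) * \<alpha>'' (mu X) - 2 * mu X * \<alpha>' (mu X) + real n * (real n - 1) * \<alpha> (mu X))"
    unfolding psi_sums[OF assms] by (simp add: power_add algebra_simps power2_eq_square)
  finally show ?thesis .
qed

lemma sum_axis_linear:
  fixes f :: "real^3 \<Rightarrow> 'b::real_vector"
  assumes "linear f" shows "(\<Sum>i\<in>UNIV. (v $ i) *\<^sub>R f (axis i 1)) = f v"
proof -
  have "f v = f (\<Sum>i\<in>UNIV. (v $ i) *\<^sub>R axis i 1)" using basis_expansion[of v] by (simp add: scalar_mult_eq_scaleR)
  then show ?thesis by (simp add: linear_sum[OF assms] linear_cmul[OF assms])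
qed

text \<open>Unlike \<open>e\<^sub>\<phi>\<close> and \<open>e\<^sub>\<theta>\<close>, the fields \<open>e3\<close> and \<open>rot_gen\<close> are smooth on the axis;
  \<open>u\<^sup>\<phi> = - b sin \<phi> / \<rho>\<close> and \<open>u\<^sup>\<theta> = c sin \<phi> / \<rho>\<close>.\<close>

definition axi_field :: "(real \<Rightarrow> real) \<Rightarrow> (real \<Rightarrow> real) \<Rightarrow> (real \<Rightarrow> real) \<Rightarrow> real^3 \<Rightarrow> real^3" where
  "axi_field a b c X = sc a 2 X *\<^sub>R X + sc b 1 X *\<^sub>R e3 + sc c 2 X *\<^sub>R rot_gen X"

definition daxi where
  "daxi a a' b b' c c' X h = dsc a a' 2 X h *\<^sub>R X + sc a 2 X *\<^sub>R h + dsc b b' 1 X h *\<^sub>R e3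
     + dsc c c' 2 X h *\<^sub>R rot_gen X + sc c 2 X *\<^sub>R rot_gen h"

end

text \<open>\<open>u\<close> is prescribed on \<open>Om\<close> and the derivatives of the profiles
  are parameters, so that the same formulas serve for profiles extracted from a solution and for
  those built from a fixed point.\<close>

locale axi_profiles = cone +
  fixes a a' a'' b b' b'' c c' c'' :: "real \<Rightarrow> real" and u :: "real^3 \<Rightarrow> real^3"
  assumes da: "\<And>t. x0 < t \<Longrightarrow> t < 1 \<Longrightarrow> (a has_real_derivative a' t) (at t)" "\<And>t. x0 < t \<Longrightarrow> t < 1 \<Longrightarrow> (a' has_real_derivative a'' t) (at t)"
    and db: "\<And>t. x0 < t \<Longrightarrow> t < 1 \<Longrightarrow> (b has_real_derivative b' t) (at t)" "\<And>t. x0 < t \<Longrightarrow> t < 1 \<Longrightarrow> (b' has_real_derivative b'' t) (at t)"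
    and dc: "\<And>t. x0 < t \<Longrightarrow> t < 1 \<Longrightarrow> (c has_real_derivative c' t) (at t)" "\<And>t. x0 < t \<Longrightarrow> t < 1 \<Longrightarrow> (c' has_real_derivative c'' t) (at t)"
    and u: "\<And>X. X \<in> Om \<Longrightarrow> u X = axi_field a b c X"
begin

lemma u_has_derivative: assumes "X \<in> Om" shows "(u has_derivative daxi a a' b b' c c' X) (at X)"
proof -
  have x: "x0 < mu X" "mu X < 1" using Om_S[of X] assms by auto
  have "(axi_field a b c has_derivative (\<lambda>h. (sc a 2 X *\<^sub>R h + dsc a a' 2 X h *\<^sub>R X) + dsc b b' 1 X h *\<^sub>R e3
     + (sc c 2 X *\<^sub>R rot_gen h + dsc c c' 2 X h *\<^sub>R rot_gen X))) (at X)"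
    unfolding axi_field_def[abs_def]
    by (intro has_derivative_add has_derivative_scaleR has_derivative_scaleR_left sc_has_derivative assms da db dc x has_derivative_ident
      bounded_linear.has_derivative[OF bounded_linear_rot_gen])
  moreover have "(\<lambda>h. (sc a 2 X *\<^sub>R h + dsc a a' 2 X h *\<^sub>R X) + dsc b b' 1 X h *\<^sub>R e3
     + (sc c 2 X *\<^sub>R rot_gen h + dsc c c' 2 X h *\<^sub>R rot_gen X)) = daxi a a' b b' c c' X"
    by (auto simp: daxi_def)
  ultimately have "(axi_field a b c has_derivative daxi a a' b b' c c' X) (at X)" by simp
  then show ?thesis by (rule has_derivative_transform_within_open[OF _ open_Om assms]) (simp add: u)
qed

lemma partial_u: "X \<in> Om \<Longrightarrow> partial_within S i u X = daxi a a' b b' c c' X (axis i 1)"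
  by (rule partial_within_Om[OF _ u_has_derivative])

lemma partial2_u:
  assumes "X \<in> Om"
  shows "partial_within S i (partial_within S i u) X = ddsc a a' a'' 2 i X (axis i 1) *\<^sub>R X + (2 * dsc a a' 2 X (axis i 1)) *\<^sub>R axis i 1
    + ddsc b b' b'' 1 i X (axis i 1) *\<^sub>R e3 + ddsc c c' c'' 2 i X (axis i 1) *\<^sub>R rot_gen X + (2 * dsc c c' 2 X (axis i 1)) *\<^sub>R rot_gen (axis i 1)"
proof -
  have x: "x0 < mu X" "mu X < 1" using Om_S[of X] assms by auto
  have "((\<lambda>X. daxi a a' b b' c c' X (axis i 1)) has_derivative
     (\<lambda>h. (dsc a a' 2 X (axis i 1) *\<^sub>R h + ddsc a a' a'' 2 i X h *\<^sub>R X) + dsc a a' 2 X h *\<^sub>R axis i 1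
     + ddsc b b' b'' 1 i X h *\<^sub>R e3 + (dsc c c' 2 X (axis i 1) *\<^sub>R rot_gen h + ddsc c c' c'' 2 i X h *\<^sub>R rot_gen X)
     + dsc c c' 2 X h *\<^sub>R rot_gen (axis i 1))) (at X)"
    unfolding daxi_def[abs_def]
    by (intro has_derivative_add has_derivative_scaleR has_derivative_scaleR_left sc_has_derivative dsc_has_derivative assms da db dc x has_derivative_ident
      bounded_linear.has_derivative[OF bounded_linear_rot_gen])
  then have "(partial_within S i u has_derivative (\<lambda>h. (dsc a a' 2 X (axis i 1) *\<^sub>R h + ddsc a a' a'' 2 i X h *\<^sub>R X) + dsc a a' 2 X h *\<^sub>R axis i 1
     + ddsc b b' b'' 1 i X h *\<^sub>R e3 + (dsc c c' 2 X (axis i 1) *\<^sub>R rot_gen h + ddsc c c' c'' 2 i X h *\<^sub>R rot_gen X)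
     + dsc c c' 2 X h *\<^sub>R rot_gen (axis i 1))) (at X)"
    by (rule has_derivative_transform_within_open[OF _ open_Om assms]) (simp add: partial_u)
  from partial_within_Om[OF assms this, of i] show ?thesis by (simp only: mult_2 scaleR_add_left ac_simps)
qed

text \<open>The product rule adds to the Laplacians of the coefficients twice the gradient of the
  \<open>X\<close>-coefficient and twice \<open>rot_gen\<close> of the gradient of the swirl
  coefficient. The first has an \<open>e3\<close> part, the source of \<open>2 * a' x\<close>; the
  second is a multiple of \<open>rot_gen X\<close>, as \<open>rot_gen e3 = 0\<close>.\<close>

lemma laplacian_u:
  assumes "X \<in> Om" defines "x \<equiv> mu X"
  shows "laplacian_within S u X = (rinv X ^ 4 * ((1 - x\<^sup>2) * a'' x - 4 * x * a' x - 2 * a x)) *\<^sub>R X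
    + (rinv X ^ 3 * ((1 - x\<^sup>2) * b'' x - 2 * x * b' x + 2 * a' x)) *\<^sub>R e3
    + (rinv X ^ 4 * ((1 - x\<^sup>2) * c'' x - 4 * x * c' x - 2 * c x)) *\<^sub>R rot_gen X"
proof -
  have X: "X \<noteq> 0" using Om_S assms by auto
  have "laplacian_within S u X = (\<Sum>i\<in>UNIV. ddsc a a' a'' 2 i X (axis i 1)) *\<^sub>R X + 2 *\<^sub>R (\<Sum>i\<in>UNIV. dsc a a' 2 X (axis i 1) *\<^sub>R axis i 1)
    + (\<Sum>i\<in>UNIV. ddsc b b' b'' 1 i X (axis i 1)) *\<^sub>R e3 + (\<Sum>i\<in>UNIV. ddsc c c' c'' 2 i X (axis i 1)) *\<^sub>R rot_gen X
    + 2 *\<^sub>R (\<Sum>i\<in>UNIV. dsc c c' 2 X (axis i 1) *\<^sub>R rot_gen (axis i 1))"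
    unfolding laplacian_within_def partial2_u[OF assms(1)]
    by (simp add: sum.distrib scaleR_sum_left scaleR_sum_right)
  also have "(\<Sum>i\<in>UNIV. dsc c c' 2 X (axis i 1) *\<^sub>R rot_gen (axis i 1)) = rot_gen (\<Sum>i\<in>UNIV. dsc c c' 2 X (axis i 1) *\<^sub>R axis i 1)"
    by (simp add: linear_sum[OF linear_rot_gen] linear_cmul[OF linear_rot_gen])
  also have "\<dots> = - (rinv X ^ 4 * (x * c' x + 2 * c x)) *\<^sub>R rot_gen X"
    unfolding sum_dsc_axis[OF X]
    by (simp add: vec_eq_iff forall_3 x_def axis_nth)
  also have "(\<Sum>i\<in>UNIV. dsc a a' 2 X (axis i 1) *\<^sub>R axis i 1) = (a' x * rinv X ^ 3) *\<^sub>R e3 - (rinv X ^ 4 * (x * a' x + 2 * a x)) *\<^sub>R X"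
    unfolding sum_dsc_axis[OF X] by (simp add: x_def)
  finally show ?thesis
    unfolding sum_ddsc[OF X] x_def[symmetric]
    by (simp add: vec_eq_iff forall_3 axis_nth algebra_simps power_numeral_reduce)
qed

text \<open>The advection term is the derivative of \<open>u\<close> applied to \<open>u\<close>
  itself, so only \<open>dmu X (u X)\<close> and \<open>X \<bullet> u X\<close> enter. Rotating
  \<open>rot_gen X\<close> once more gives \<open>- X + (X $ 3) *\<^sub>R e3\<close>, the origin of
  the centrifugal terms with the square of \<open>c x\<close>.\<close>

lemma advection_u:
  assumes "X \<in> Om" defines "x \<equiv> mu X"
  shows "advection_within S u u X = (rinv X ^ 4 * (- (a x)\<^sup>2 - (c x)\<^sup>2 + b x * (a' x * (1 - x\<^sup>2) - 2 * x * a x))) *\<^sub>R X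
    + (rinv X ^ 3 * (b x * (b' x * (1 - x\<^sup>2) - x * b x) + x * (c x)\<^sup>2)) *\<^sub>R e3
    + (rinv X ^ 4 * (b x * (c' x * (1 - x\<^sup>2) - 2 * x * c x))) *\<^sub>R rot_gen X"
proof -
  have X: "X \<noteq> 0" using Om_S assms by auto
  have lin: "linear (daxi a a' b b' c c' X)"
    using u_has_derivative[OF assms(1)] has_derivative_bounded_linear bounded_linear.linear by blast
  have "advection_within S u u X = (\<Sum>i\<in>UNIV. (u X $ i) *\<^sub>R daxi a a' b b' c c' X (axis i 1))"
    unfolding advection_within_def by (simp add: partial_u[OF assms(1)])
  also have "\<dots> = daxi a a' b b' c c' X (u X)" by (rule sum_axis_linear[OF lin])
  finally have 1: "advection_within S u u X = daxi a a' b b' c c' X (u X)" .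
  have R: "(X \<bullet> X) * rinv X ^ 2 = 1" by (rule inner_self_rinv[OF X])
  have Xe: "X \<bullet> e3 = X $ 3" by (simp add: inner_axis)
  have x3: "X $ 3 * rinv X = x" by (simp add: x_def mu_eq)
  have dmu_u: "dmu X (u X) = b x * (1 - x\<^sup>2) * rinv X ^ 2"
    unfolding u[OF assms(1)] axi_field_def dmu_lin dmu_frame[OF X] sc_def
    by (simp add: x_def power2_eq_square)
  have "X \<bullet> u X = a x * ((X \<bullet> X) * rinv X ^ 2) + b x * (X $ 3 * rinv X)"
    unfolding u[OF assms(1)] axi_field_def sc_def
    by (simp add: inner_add_right X_rot_gen Xe x_def algebra_simps)
  then have Xu: "X \<bullet> u X = a x + x * b x" by (simp add: R x3)
  have d: "dsc \<alpha> \<alpha>' n X (u X) = rinv X ^ (n + 2) * (b x * (1 - x\<^sup>2) * \<alpha>' x - real n * \<alpha> x * (a x + x * b x))" for \<alpha> \<alpha>' n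
    unfolding dsc_def dmu_u Xu by (simp add: power_add x_def algebra_simps power_numeral_reduce)
  have rr: "rot_gen (rot_gen X) = - X + (X $ 3) *\<^sub>R e3" by (simp add: vec_eq_iff forall_3 axis_nth)
  have ru: "rot_gen (u X) = sc a 2 X *\<^sub>R rot_gen X + sc c 2 X *\<^sub>R (- X + (X $ 3) *\<^sub>R e3)"
    unfolding u[OF assms(1)] axi_field_def
    by (simp only: linear_add[OF linear_rot_gen] linear_cmul[OF linear_rot_gen] rr) (simp add: vec_eq_iff forall_3 axis_nth)
  have x3': "rinv X ^ 4 * X $ 3 = rinv X ^ 3 * x" unfolding x3[symmetric] by (simp add: power_numeral_reduce)
  have "daxi a a' b b' c c' X (u X) = (rinv X ^ 4 * (b x * (1 - x\<^sup>2) * a' x - 2 * a x * (a x + x * b x) + a x * a x - c x * c x)) *\<^sub>R X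
    + (rinv X ^ 3 * (a x * b x + (b x * (1 - x\<^sup>2) * b' x - b x * (a x + x * b x))) + rinv X ^ 4 * X $ 3 * (c x * c x)) *\<^sub>R e3
    + (rinv X ^ 4 * (b x * (1 - x\<^sup>2) * c' x - 2 * c x * (a x + x * b x) + 2 * a x * c x)) *\<^sub>R rot_gen X"
    unfolding daxi_def d ru unfolding u[OF assms(1)] axi_field_def sc_def x_def[symmetric]
    by (simp add: vec_eq_iff forall_3 axis_nth algebra_simps power_numeral_reduce)
  then show ?thesis unfolding 1 x3' by (simp add: power2_eq_square algebra_simps)
qed

text \<open>The trace of the derivative: 3 from the identity, 0 from the rotation, and the
  derivatives of the three coefficients along their own vectors.\<close>

lemma div_u:
  assumes "X \<in> Om" defines "x \<equiv> mu X"
  shows "div_within S u X = rinv X ^ 2 * (a x + b' x * (1 - x\<^sup>2) - x * b x)"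
proof -
  have X: "X \<noteq> 0" using Om_S assms by auto
  have s: "(\<Sum>i\<in>UNIV. dsc \<alpha> \<alpha>' n X (axis i 1) * v $ i) = dsc \<alpha> \<alpha>' n X v" for \<alpha> \<alpha>' n v
  proof -
    have "linear (dsc \<alpha> \<alpha>' n X)" by (intro linearI) (simp_all add: dsc_def dmu_lin inner_add_right algebra_simps)
    from sum_axis_linear[OF this, of v] show ?thesis by (simp add: mult.commute)
  qed
  have "div_within S u X = (\<Sum>i\<in>UNIV. dsc a a' 2 X (axis i 1) * X $ i) + 3 * sc a 2 X + (\<Sum>i\<in>UNIV. dsc b b' 1 X (axis i 1) * e3 $ i)
     + (\<Sum>i\<in>UNIV. dsc c c' 2 X (axis i 1) * rot_gen X $ i) + sc c 2 X * (\<Sum>i\<in>UNIV. rot_gen (axis i 1) $ i)"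
    unfolding div_within_def partial_u[OF assms(1)] daxi_def
    by (simp add: sum.distrib sum_distrib_left axis_nth)
  also have "(\<Sum>i\<in>UNIV. (rot_gen (axis i 1) :: real^3) $ i) = 0" by (simp add: sum_3 axis_nth)
  finally have "div_within S u X = dsc a a' 2 X X + 3 * sc a 2 X + dsc b b' 1 X e3 + dsc c c' 2 X (rot_gen X)"
    unfolding s by simp
  also have "\<dots> = - 2 * a x * ((X \<bullet> X) * rinv X ^ 2) * rinv X ^ 2 + 3 * (a x * rinv X ^ 2)
     + (b' x * (1 - x\<^sup>2) * rinv X ^ 2 - b x * (X $ 3 * rinv X) * rinv X ^ 2)"
    unfolding dsc_def dmu_frame[OF X] X_rot_gen sc_def x_def by (simp add: inner_axis power_numeral_reduce)
  also have "\<dots> = rinv X ^ 2 * (a x + b' x * (1 - x\<^sup>2) - x * b x)"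
    unfolding inner_self_rinv[OF X] mu_eq[symmetric] x_def[symmetric] by (simp add: algebra_simps)
  finally show ?thesis .
qed

end

context cone begin

lemma grad_p:
  assumes q: "\<And>t. x0 < t \<Longrightarrow> t < 1 \<Longrightarrow> (q has_real_derivative q' t) (at t)"
    and p: "\<And>X. X \<in> Om \<Longrightarrow> p X = sc q 2 X" and X: "X \<in> Om"
  shows "grad_within S p X = (rinv X ^ 3 * q' (mu X)) *\<^sub>R e3 - (rinv X ^ 4 * (mu X * q' (mu X) + 2 * q (mu X))) *\<^sub>R X"
proof -
  have "(sc q 2 has_derivative dsc q q' 2 X) (at X)" using X Om_S by (intro sc_has_derivative q) auto
  then have "(p has_derivative dsc q q' 2 X) (at X)"
    by (rule has_derivative_transform_within_open[OF _ open_Om X]) (simp add: p)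
  then have "partial_within S i p X = dsc q q' 2 X (axis i 1)" for i by (rule partial_within_Om[OF X])
  then have "grad_within S p X = (\<Sum>i\<in>UNIV. dsc q q' 2 X (axis i 1) *\<^sub>R axis i 1)"
    by (simp add: grad_within_def vec_eq_iff forall_3 sum_3 axis_nth)
  then show ?thesis using sum_dsc_axis[OF Om_S(2)[OF X], of q q' 2] by (simp add: mult.commute)
qed

text \<open>Off the axis the horizontal part of \<open>X\<close> is nonzero and
  \<open>rot_gen X\<close> is orthogonal to it, so the three vectors are linearly
  independent.\<close>

lemma frame_eq:
  assumes "X \<in> Om" "A *\<^sub>R X + B *\<^sub>R e3 + C *\<^sub>R rot_gen X = A' *\<^sub>R X + B' *\<^sub>R e3 + C' *\<^sub>R rot_gen X"
  shows "A = A'" "B = B'" "C = C'"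
proof -
  have X: "X \<noteq> 0" using Om_S assms by auto
  define r where "r = (X$1)\<^sup>2 + (X$2)\<^sup>2"
  have "r \<noteq> 0"
  proof
    assume "r = 0"
    then have "X$1 = 0" "X$2 = 0" by (auto simp: r_def sum_power2_eq_zero_iff)
    then have "mu X = 1" using axis_S_open(2)[OF Om_S(1)[OF assms(1)]] by simp
    then show False using Om_S(4)[OF assms(1)] by simp
  qed
  have 1: "(A - A') * X$1 = (C - C') * X$2" and 2: "(A - A') * X$2 = - (C - C') * X$1" and 3: "(A - A') * X$3 + (B - B') = 0"
    using arg_cong[OF assms(2), of "\<lambda>v. v$1"] arg_cong[OF assms(2), of "\<lambda>v. v$2"] arg_cong[OF assms(2), of "\<lambda>v. v$3"]
    by (simp_all add: axis_nth algebra_simps)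
  have "(A - A') * r = ((A - A') * X$1) * X$1 + ((A - A') * X$2) * X$2" by (simp add: r_def power2_eq_square algebra_simps)
  also have "\<dots> = 0" unfolding 1 2 by (simp add: algebra_simps)
  finally show A: "A = A'" using \<open>r \<noteq> 0\<close> by simp
  have "(C - C') * X$2 = 0" "(C - C') * X$1 = 0" using 1 2 A by auto
  then have "(C - C') * r = 0" unfolding r_def power2_eq_square distrib_left mult.assoc[symmetric] by auto
  then show "C = C'" using \<open>r \<noteq> 0\<close> by simp
  show "B = B'" using 3 A by simp
qed

end

section \<open>Averaging operators\<close>

lemma bound_incr:
  fixes F \<phi> :: "real \<Rightarrow> real"
  assumes "a \<le> b" "continuous_on {a..b} F" "continuous_on {a..b} \<phi>"
    "\<And>x. a < x \<Longrightarrow> x < b \<Longrightarrow> (F has_real_derivative F' x) (at x)"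
    "\<And>x. a < x \<Longrightarrow> x < b \<Longrightarrow> (\<phi> has_real_derivative \<phi>' x) (at x)"
    "\<And>x. a < x \<Longrightarrow> x < b \<Longrightarrow> \<bar>F' x\<bar> \<le> \<phi>' x"
  shows "\<bar>F b - F a\<bar> \<le> \<phi> b - \<phi> a"
proof (cases "a = b")
  case False
  then have "a < b" using assms by simp
  from differentiable_bound_general[OF this assms(2,3), of F' \<phi>'] assms(4-6)
  show ?thesis by (simp add: has_real_derivative_iff_has_vector_derivative)
qed simp

lemma bound_incr_const:
  fixes F :: "real \<Rightarrow> real"
  assumes "a \<le> b" "continuous_on {a..b} F"
    "\<And>x. a < x \<Longrightarrow> x < b \<Longrightarrow> (F has_real_derivative F' x) (at x)"
    "\<And>x. a < x \<Longrightarrow> x < b \<Longrightarrow> \<bar>F' x\<bar> \<le> M"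
  shows "\<bar>F b - F a\<bar> \<le> M * (b - a)"
  using bound_incr[of a b F "\<lambda>x. M * x" F' "\<lambda>_. M"] assms
  by (auto intro!: continuous_intros derivative_eq_intros simp: right_diff_distrib)

lemma one_minus_power_deriv:
  "((\<lambda>x. (1 - x) ^ (n + 1)) has_real_derivative - ((real n + 1) * (1 - x) ^ n)) (at x within T)"
proof -
  have "((\<lambda>x. 1 - x) has_real_derivative - 1) (at x within T)" by (auto intro!: derivative_eq_intros)
  from DERIV_power[OF this, of "n + 1"] show ?thesis by (simp del: power_Suc add: add.commute)
qed

context cone begin

lemma at_Ix: "x0 < x \<Longrightarrow> x < 1 \<Longrightarrow> at x within Ix = at x"
  by (intro at_within_interior) (auto simp: interior_atLeastAtMost_real)

lemma const_Ix:
  fixes H :: "real \<Rightarrow> real"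
  assumes "continuous_on Ix H" "\<And>x. x0 < x \<Longrightarrow> x < 1 \<Longrightarrow> (H has_real_derivative 0) (at x)" "x \<in> Ix" "y \<in> Ix"
  shows "H x = H y"
proof -
  have *: "H x = H y" if "x \<in> Ix" "y \<in> Ix" "x \<le> y" for x y
    using bound_incr_const[of x y H "\<lambda>_. 0" 0] continuous_on_subset[OF assms(1), of "{x..y}"] assms(2) that by auto
  show ?thesis using *[OF assms(3,4)] *[OF assms(4,3), symmetric] linear[of x y] by blast
qed

definition prim :: "(real \<Rightarrow> real) \<Rightarrow> real \<Rightarrow> real" where "prim g x = integral {x0..x} g"

definition tail :: "(real \<Rightarrow> real) \<Rightarrow> real \<Rightarrow> real" where "tail g x = prim g 1 - prim g x"

lemma x0_Ix: "x0 \<in> Ix" "1 \<in> Ix" using x0_lt by auto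

lemma prim_x0 [simp]: "prim g x0 = 0" by (simp add: prim_def)
lemma tail_1 [simp]: "tail g 1 = 0" by (simp add: tail_def)

lemma prim_deriv: "continuous_on Ix g \<Longrightarrow> x \<in> Ix \<Longrightarrow> (prim g has_real_derivative g x) (at x within Ix)"
  unfolding prim_def[abs_def] by (rule integral_has_real_derivative)

lemma prim_cont: "continuous_on Ix g \<Longrightarrow> continuous_on Ix (prim g)"
  by (rule DERIV_continuous_on[OF prim_deriv])

lemma tail_deriv: "continuous_on Ix g \<Longrightarrow> x \<in> Ix \<Longrightarrow> (tail g has_real_derivative - g x) (at x within Ix)"
  unfolding tail_def[abs_def] using prim_deriv[of g x] by (auto intro!: derivative_eq_intros)

lemma tail_cont: "continuous_on Ix g \<Longrightarrow> continuous_on Ix (tail g)"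
  by (rule DERIV_continuous_on[OF tail_deriv])

lemma prim_cong: "(\<And>t. t \<in> Ix \<Longrightarrow> f t = g t) \<Longrightarrow> x \<in> Ix \<Longrightarrow> prim f x = prim g x"
  unfolding prim_def by (rule integral_cong) auto

lemma tail_cong: "(\<And>t. t \<in> Ix \<Longrightarrow> f t = g t) \<Longrightarrow> x \<in> Ix \<Longrightarrow> tail f x = tail g x"
  unfolding tail_def using prim_cong[of f g] x0_Ix by auto

lemma tail_unique:
  assumes "continuous_on Ix g" "continuous_on Ix F" "F 1 = 0"
    "\<And>x. x0 < x \<Longrightarrow> x < 1 \<Longrightarrow> (F has_real_derivative - g x) (at x)" "x \<in> Ix"
  shows "F x = tail g x"
proof -
  have "F x - tail g x = F 1 - tail g 1"
  proof (rule const_Ix[where H = "\<lambda>x. F x - tail g x"])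
    show "continuous_on Ix (\<lambda>x. F x - tail g x)" by (intro continuous_intros assms tail_cont)
    fix x assume x: "x0 < x" "x < 1"
    have "(tail g has_real_derivative - g x) (at x)" using tail_deriv[OF assms(1), of x] at_Ix[OF x] x by auto
    then show "((\<lambda>x. F x - tail g x) has_real_derivative 0) (at x)" using assms(4)[OF x] by (auto intro!: derivative_eq_intros)
  qed (use assms x0_Ix in auto)
  then show ?thesis using assms(3) by simp
qed

lemma prim_unique:
  assumes "continuous_on Ix g" "continuous_on Ix F" "F x0 = 0"
    "\<And>x. x0 < x \<Longrightarrow> x < 1 \<Longrightarrow> (F has_real_derivative g x) (at x)" "x \<in> Ix"
  shows "F x = prim g x"
proof -
  have "F x - prim g x = F x0 - prim g x0"
  proof (rule const_Ix[where H = "\<lambda>x. F x - prim g x"])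
    show "continuous_on Ix (\<lambda>x. F x - prim g x)" by (intro continuous_intros assms prim_cont)
    fix x assume x: "x0 < x" "x < 1"
    have "(prim g has_real_derivative g x) (at x)" using prim_deriv[OF assms(1), of x] at_Ix[OF x] x by auto
    then show "((\<lambda>x. F x - prim g x) has_real_derivative 0) (at x)" using assms(4)[OF x] by (auto intro!: derivative_eq_intros)
  qed (use assms x0_Ix in auto)
  then show ?thesis using assms(3) by simp
qed

lemma prim_bound:
  assumes "continuous_on Ix g" "\<And>t. t \<in> Ix \<Longrightarrow> \<bar>g t\<bar> \<le> M" "x \<in> Ix" shows "\<bar>prim g x\<bar> \<le> 2 * M"
proof -
  have "\<bar>prim g x - prim g x0\<bar> \<le> M * (x - x0)"
  proof (rule bound_incr_const)
    show "continuous_on {x0..x} (prim g)" using assms(3) by (intro continuous_on_subset[OF prim_cont[OF assms(1)]]) auto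
    fix t assume t: "x0 < t" "t < x"
    then have t1: "t < 1" using assms(3) by auto
    show "(prim g has_real_derivative g t) (at t)" using prim_deriv[OF assms(1), of t] at_Ix[OF t(1) t1] t t1 by auto
    show "\<bar>g t\<bar> \<le> M" using assms(2) t t1 by auto
  qed (use assms in auto)
  also have "M * (x - x0) \<le> M * 2" using assms(2)[OF x0_Ix(1)] assms(3) x0_gt by (intro mult_left_mono) auto
  finally show ?thesis by simp
qed

lemma tail_bound:
  assumes "continuous_on Ix g" "\<And>t. t \<in> Ix \<Longrightarrow> \<bar>g t\<bar> \<le> M" "x \<in> Ix" shows "\<bar>tail g x\<bar> \<le> 2 * M"
proof -
  have "\<bar>tail g 1 - tail g x\<bar> \<le> M * (1 - x)"
  proof (rule bound_incr_const)
    show "continuous_on {x..1} (tail g)" using assms(3) by (intro continuous_on_subset[OF tail_cont[OF assms(1)]]) auto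
    fix t assume t: "x < t" "t < 1"
    then have t1: "x0 < t" using assms(3) by auto
    show "(tail g has_real_derivative - g t) (at t)" using tail_deriv[OF assms(1), of t] at_Ix[OF t1 t(2)] t t1 by auto
    show "\<bar>- g t\<bar> \<le> M" using assms(2)[of t] t t1 by auto
  qed (use assms in auto)
  also have "M * (1 - x) \<le> M * 2" using assms(2)[OF x0_Ix(1)] assms(3) x0_gt by (intro mult_left_mono) auto
  finally show ?thesis by simp
qed

lemma tail_diff:
  assumes "continuous_on Ix f" "continuous_on Ix g" "x \<in> Ix"
  shows "tail f x - tail g x = tail (\<lambda>t. f t - g t) x"
proof (rule tail_unique)
  fix x assume x: "x0 < x" "x < 1"
  show "((\<lambda>x. tail f x - tail g x) has_real_derivative - (f x - g x)) (at x)"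
    using tail_deriv[OF assms(1), of x] tail_deriv[OF assms(2), of x] at_Ix[OF x] x by (auto intro!: derivative_eq_intros)
qed (use assms in \<open>auto intro!: continuous_intros tail_cont\<close>)

text \<open>A weighted mean of \<open>k\<close> over \<open>[x, 1]\<close>, up to the factor
  \<open>n + 1\<close>. The value at 1 is its limit, so that quotients singular on the axis become
  continuous functions.\<close>

definition avg :: "nat \<Rightarrow> (real \<Rightarrow> real) \<Rightarrow> real \<Rightarrow> real" where
  "avg n k x = (if x = 1 then k 1 / (real n + 1) else tail (\<lambda>t. (1 - t) ^ n * k t) x / (1 - x) ^ (n + 1))"

lemma wt_cont: "continuous_on Ix k \<Longrightarrow> continuous_on Ix (\<lambda>t. (1 - t) ^ n * k t)"
  by (intro continuous_intros)

lemma avg_tail: "continuous_on Ix k \<Longrightarrow> tail (\<lambda>t. (1 - t) ^ n * k t) x = (1 - x) ^ (n + 1) * avg n k x"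
  by (auto simp: avg_def)

lemma avg_unique:
  assumes "continuous_on Ix k" "continuous_on Ix F" "F 1 = 0"
    "\<And>x. x0 < x \<Longrightarrow> x < 1 \<Longrightarrow> (F has_real_derivative - ((1 - x) ^ n * k x)) (at x)" "x \<in> Ix"
  shows "F x = (1 - x) ^ (n + 1) * avg n k x"
  unfolding avg_tail[OF assms(1), symmetric] by (rule tail_unique[OF wt_cont[OF assms(1)] assms(2-5)])

text \<open>Only the values of \<open>k\<close> on \<open>[x, 1]\<close> count. This locality gives
  continuity at 1 and lets decay towards the axis pass to the average.\<close>

lemma avg_bound_local:
  assumes "continuous_on Ix k" "x \<in> Ix" "\<And>t. x \<le> t \<Longrightarrow> t \<le> 1 \<Longrightarrow> \<bar>k t\<bar> \<le> M"
  shows "\<bar>avg n k x\<bar> \<le> M"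
proof -
  have M: "M \<ge> 0" using assms(3)[of x] assms(2) by auto
  have M': "M / (real n + 1) \<le> M" using M by (simp add: divide_simps algebra_simps)
  show ?thesis
  proof (cases "x = 1")
    case True
    then show ?thesis using assms(3)[of 1] M' by (simp add: avg_def abs_divide) (smt (verit, best) divide_right_mono of_nat_0_le_iff)
  next
    case False
    then have x: "x < 1" using assms by auto
    define g where "g = (\<lambda>t. (1 - t) ^ n * k t)"
    have g: "continuous_on Ix g" unfolding g_def by (rule wt_cont[OF assms(1)])
    have "\<bar>tail g 1 - tail g x\<bar> \<le> - M * (1 - 1) ^ (n + 1) / (real n + 1) - (- M * (1 - x) ^ (n + 1) / (real n + 1))"
    proof (rule bound_incr)
      show "continuous_on {x..1} (tail g)" using assms by (intro continuous_on_subset[OF tail_cont[OF g]]) auto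
      show "continuous_on {x..1} (\<lambda>x. - M * (1 - x) ^ (n + 1) / (real n + 1))" by (intro continuous_intros) auto
      fix t assume t: "x < t" "t < 1"
      then have t1: "x0 < t" using assms by auto
      show "(tail g has_real_derivative - g t) (at t)" using tail_deriv[OF g, of t] at_Ix[OF t1 t(2)] t t1 by auto
      show "((\<lambda>x. - M * (1 - x) ^ (n + 1) / (real n + 1)) has_real_derivative M * (1 - t) ^ n) (at t)"
        using DERIV_cmult[OF one_minus_power_deriv[of n t UNIV], of "- M / (real n + 1)"] by (simp del: power_Suc)
      show "\<bar>- g t\<bar> \<le> M * (1 - t) ^ n" using assms(3)[of t] t by (simp add: g_def abs_mult mult.commute mult_left_mono)
    qed (use x in auto)
    then have "\<bar>tail g x\<bar> \<le> (M / (real n + 1)) * (1 - x) ^ (n + 1)" by simp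
    also have "\<dots> \<le> M * (1 - x) ^ (n + 1)" using M' x by (intro mult_right_mono) auto
    finally have *: "\<bar>tail g x\<bar> \<le> M * (1 - x) ^ (n + 1)" .
    have "avg n k x = tail g x / (1 - x) ^ (n + 1)" using False by (simp add: avg_def g_def)
    moreover have "(1 - x) ^ (n + 1) > 0" using x by (intro zero_less_power) simp
    ultimately show ?thesis using * by (simp add: abs_divide pos_divide_le_eq)
  qed
qed

lemma avg_bound: "continuous_on Ix k \<Longrightarrow> x \<in> Ix \<Longrightarrow> (\<And>t. t \<in> Ix \<Longrightarrow> \<bar>k t\<bar> \<le> M) \<Longrightarrow> \<bar>avg n k x\<bar> \<le> M"
  by (rule avg_bound_local) auto

lemma avg_diff:
  assumes "continuous_on Ix k" "continuous_on Ix l" "x \<in> Ix"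
  shows "avg n (\<lambda>t. k t - l t) x = avg n k x - avg n l x"
proof (cases "x = 1")
  case False
  have "tail (\<lambda>t. (1 - t) ^ n * (k t - l t)) x = tail (\<lambda>t. (1 - t) ^ n * k t) x - tail (\<lambda>t. (1 - t) ^ n * l t) x"
    using tail_diff[OF wt_cont[OF assms(1)] wt_cont[OF assms(2)] assms(3), of n n] by (simp add: right_diff_distrib)
  then show ?thesis using False by (simp add: avg_def diff_divide_distrib)
qed (simp add: avg_def diff_divide_distrib)

lemma avg_const: assumes "x \<in> Ix" shows "avg n (\<lambda>_. c) x = c / (real n + 1)"
proof (cases "x = 1")
  case False
  have "c / (real n + 1) * (1 - x) ^ (n + 1) = (1 - x) ^ (n + 1) * avg n (\<lambda>_. c) x"
  proof (rule avg_unique[where F = "\<lambda>x. c / (real n + 1) * (1 - x) ^ (n + 1)"])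
    show "((\<lambda>x. c / (real n + 1) * (1 - x) ^ (n + 1)) has_real_derivative - ((1 - t) ^ n * c)) (at t)" for t
      using DERIV_cmult[OF one_minus_power_deriv[of n t UNIV], of "c / (real n + 1)"] by (simp del: power_Suc add: mult.commute)
  qed (use assms in \<open>auto intro!: continuous_intros\<close>)
  then have "(1 - x) ^ (n + 1) * (avg n (\<lambda>_. c) x - c / (real n + 1)) = 0" by (simp add: algebra_simps)
  then show ?thesis using False by simp
qed (simp add: avg_def)

lemma avg_deriv:
  assumes "continuous_on Ix k" "x0 \<le> x" "x < 1"
  shows "(avg n k has_real_derivative ((real n + 1) * avg n k x - k x) / (1 - x)) (at x within Ix)"
proof -
  define g where "g = (\<lambda>t. (1 - t) ^ n * k t)"
  have g: "continuous_on Ix g" unfolding g_def by (rule wt_cont[OF assms(1)])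
  have pos: "(1 - x) ^ (n + 1) > 0" using assms by (intro zero_less_power) simp
  have a: "avg n k x = tail g x / (1 - x) ^ (n + 1)" using assms by (simp add: avg_def g_def)
  have "((\<lambda>x. tail g x / (1 - x) ^ (n + 1)) has_real_derivative
     (- g x * (1 - x) ^ (n + 1) - tail g x * (- ((real n + 1) * (1 - x) ^ n))) / ((1 - x) ^ (n + 1) * (1 - x) ^ (n + 1))) (at x within Ix)"
    using pos assms by (intro DERIV_divide one_minus_power_deriv tail_deriv[OF g]) auto
  also have "(- g x * (1 - x) ^ (n + 1) - tail g x * (- ((real n + 1) * (1 - x) ^ n))) / ((1 - x) ^ (n + 1) * (1 - x) ^ (n + 1)) =
     ((real n + 1) * avg n k x - k x) / (1 - x)"
  proof -
    have "(- (P * k) * (q * P) - t * (- (m * P))) / ((q * P) * (q * P)) = (m * (t / (q * P)) - k) / q"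
      if "P \<noteq> 0" "q \<noteq> 0" for P q k t m :: real using that by (simp add: field_simps)
    then show ?thesis unfolding a using assms by (simp add: g_def)
  qed
  finally show ?thesis
  proof (rule has_field_derivative_transform_within[where d = "1 - x"])
    fix y assume "y \<in> Ix" "dist y x < 1 - x"
    then have "y \<noteq> 1" by (auto simp: dist_real_def)
    then show "tail g y / (1 - y) ^ (n + 1) = avg n k y" by (simp add: avg_def g_def)
  qed (use assms in auto)
qed

lemma avg_cont: assumes "continuous_on Ix k" shows "continuous_on Ix (avg n k)"
  unfolding continuous_on_eq_continuous_within
proof
  fix x assume x: "x \<in> Ix"
  show "continuous (at x within Ix) (avg n k)"
  proof (cases "x = 1")
    case False
    then have "x0 \<le> x" "x < 1" using x by auto
    from avg_deriv[OF assms this] show ?thesis by (rule DERIV_continuous)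
  next
    case True
    have "(avg n k \<longlongrightarrow> avg n k 1) (at 1 within Ix)"
    proof (rule LIM_zero_cancel, rule tendstoI)
      fix e :: real assume e: "e > 0"
      have "continuous (at 1 within Ix) k" using assms x0_Ix by (simp add: continuous_on_eq_continuous_within)
      then obtain d where d: "d > 0" "\<And>y. y \<in> Ix \<Longrightarrow> dist y 1 < d \<Longrightarrow> dist (k y) (k 1) < e / 2"
        using e unfolding continuous_within_eps_delta by (meson half_gt_zero)
      have "dist (avg n k y - avg n k 1) 0 < e" if y: "y \<in> Ix" "dist y 1 < d" for y
      proof -
        \<comment> \<open>Averages of constants are exact, so the claim reduces to the oscillation
          of \<open>k\<close> near 1, where the local bound applies.\<close>
        have "\<bar>avg n (\<lambda>t. k t - k 1) y\<bar> \<le> e / 2"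
        proof (rule avg_bound_local[OF _ y(1)])
          show "continuous_on Ix (\<lambda>t. k t - k 1)" by (intro continuous_intros assms)
          fix t assume t: "y \<le> t" "t \<le> 1"
          then show "\<bar>k t - k 1\<bar> \<le> e / 2" using d(2)[of t] y by (auto simp: dist_real_def)
        qed
        moreover have "avg n (\<lambda>t. k t - k 1) y = avg n k y - avg n k 1"
          using avg_diff[OF assms _ y(1), of "\<lambda>_. k 1" n] avg_const[OF y(1), of n "k 1"] by (simp add: avg_def)
        ultimately show ?thesis using e by simp
      qed
      then show "\<forall>\<^sub>F y in at 1 within Ix. dist (avg n k y - avg n k 1) 0 < e"
        unfolding eventually_at using d(1) by (intro exI[of _ d]) auto
    qed
    then show ?thesis using True by (simp add: continuous_within)
  qed
qed

lemma avg_cong: "(\<And>t. t \<in> Ix \<Longrightarrow> f t = g t) \<Longrightarrow> x \<in> Ix \<Longrightarrow> avg n f x = avg n g x"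
proof -
  assume fg: "\<And>t. t \<in> Ix \<Longrightarrow> f t = g t" and x: "x \<in> Ix"
  have "tail (\<lambda>t. (1 - t) ^ n * f t) x = tail (\<lambda>t. (1 - t) ^ n * g t) x" by (rule tail_cong[OF _ x]) (simp only: fg)
  then show ?thesis unfolding avg_def fg[OF x0_Ix(2)] by (simp only:)
qed

text \<open>Differentiating an average costs one factor \<open>1 / (1 - x)\<close>, which is the
  loss that \<open>bdw\<close> tolerates; averaging thus upgrades continuity to
  \<open>bdw\<close>.\<close>

lemma bdw_avg: assumes "continuous_on Ix k" shows "bdw (avg n k)"
proof -
  obtain M where M: "M \<ge> 0" "\<And>x. x \<in> Ix \<Longrightarrow> \<bar>k x\<bar> \<le> M" using continuous_on_Ix_bounded[OF assms] by blast
  have b: "\<bar>avg n k x\<bar> \<le> M" if "x \<in> Ix" for x using avg_bound[OF assms that M(2)] .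
  show ?thesis
  proof (rule bdwI[where N = M and d = "\<lambda>x. ((real n + 1) * avg n k x - k x) / (1 - x)" and M = "(real n + 2) * M"])
    fix x assume x: "x0 \<le> x" "x < 1"
    show "(avg n k has_real_derivative ((real n + 1) * avg n k x - k x) / (1 - x)) (at x within Ix)" by (rule avg_deriv[OF assms x])
    show "\<bar>avg n k x\<bar> \<le> M" using b x by auto
    have "\<bar>((real n + 1) * avg n k x - k x) / (1 - x)\<bar> * (1 - x) = \<bar>(real n + 1) * avg n k x - k x\<bar>" using x by (simp add: abs_divide)
    also have "\<dots> \<le> (real n + 1) * \<bar>avg n k x\<bar> + \<bar>k x\<bar>" using abs_triangle_ineq4[of "(real n + 1) * avg n k x" "k x"] by (simp add: abs_mult)
    also have "\<dots> \<le> (real n + 1) * M + M" using b[of x] M(2)[of x] x by (intro add_mono mult_left_mono) auto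
    finally show "\<bar>((real n + 1) * avg n k x - k x) / (1 - x)\<bar> * (1 - x) \<le> (real n + 2) * M" by (simp add: algebra_simps)
  qed
qed

text \<open>The bound \<open>M * sqrt (1 - t)\<close> decreases in \<open>t\<close>, hence passes
  from \<open>k\<close> to its average over \<open>[x, 1]\<close>; the derivative formula then has
  the right weight.\<close>

lemma lip0_avg: assumes "lip0 k" shows "lip0 (avg n k)"
proof -
  have k: "continuous_on Ix k" using assms lip0_lip_wt lip_wt_cont by blast
  obtain M where M: "\<And>x. x \<in> Ix \<Longrightarrow> \<bar>k x\<bar> \<le> M * sqrt (1 - x)" using assms unfolding lip0_def by blast
  have M0: "M \<ge> 0"
  proof -
    have "0 \<le> M * sqrt (1 - x0)" using M[OF x0_Ix(1)] abs_ge_zero order_trans by blast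
    then show ?thesis using x0_lt by (simp add: zero_le_mult_iff)
  qed
  have b: "\<bar>avg n k x\<bar> \<le> M * sqrt (1 - x)" if "x \<in> Ix" for x
  proof (rule avg_bound_local[OF k that])
    fix t assume t: "x \<le> t" "t \<le> 1"
    have "\<bar>k t\<bar> \<le> M * sqrt (1 - t)" using M t that by auto
    also have "\<dots> \<le> M * sqrt (1 - x)" using t M0 by (intro mult_left_mono) auto
    finally show "\<bar>k t\<bar> \<le> M * sqrt (1 - x)" .
  qed
  show ?thesis
  proof (rule lip0I[where d = "\<lambda>x. ((real n + 1) * avg n k x - k x) / (1 - x)" and M = "(real n + 2) * M" and N = M])
    fix x assume x: "x0 \<le> x" "x < 1"
    show "(avg n k has_real_derivative ((real n + 1) * avg n k x - k x) / (1 - x)) (at x within Ix)" by (rule avg_deriv[OF k x])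
    have sq: "sqrt (1 - x) / (1 - x) = inverse (sqrt (1 - x))" using x by (simp add: real_div_sqrt divide_simps)
    have "\<bar>(real n + 1) * avg n k x - k x\<bar> \<le> (real n + 1) * \<bar>avg n k x\<bar> + \<bar>k x\<bar>" using abs_triangle_ineq4[of "(real n + 1) * avg n k x" "k x"] by (simp add: abs_mult)
    also have "\<dots> \<le> (real n + 1) * (M * sqrt (1 - x)) + M * sqrt (1 - x)" using b[of x] M[of x] x by (intro add_mono mult_left_mono) auto
    finally have 1: "\<bar>(real n + 1) * avg n k x - k x\<bar> \<le> (real n + 2) * M * sqrt (1 - x)" by (simp add: algebra_simps)
    have "\<bar>((real n + 1) * avg n k x - k x) / (1 - x)\<bar> * sqrt (1 - x) = \<bar>(real n + 1) * avg n k x - k x\<bar> * inverse (sqrt (1 - x))"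
      unfolding sq[symmetric] using x by (simp add: abs_divide)
    also have "\<dots> \<le> (real n + 2) * M * sqrt (1 - x) * inverse (sqrt (1 - x))" by (rule mult_right_mono[OF 1]) (use x in auto)
    also have "\<dots> = (real n + 2) * M" using x by simp
    finally show "\<bar>((real n + 1) * avg n k x - k x) / (1 - x)\<bar> * sqrt (1 - x) \<le> (real n + 2) * M" .
  qed (use b in auto)
qed

lemma Ix_bounds: "x \<in> Ix \<Longrightarrow> - 1 < x" "x \<in> Ix \<Longrightarrow> 0 \<le> 1 - x" "x \<in> Ix \<Longrightarrow> 1 - x \<le> 2" "x \<in> Ix \<Longrightarrow> 1 + x0 \<le> 1 + x" "x \<in> Ix \<Longrightarrow> \<bar>x\<bar> \<le> 1"
  using x0_gt by auto

section \<open>The reduced system and its fixed points\<close>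

text \<open>The integrating factor of the swirl equation.\<close>

definition En :: "(real \<Rightarrow> real) \<Rightarrow> real \<Rightarrow> real" where "En \<eta> x = exp (prim \<eta> x)"

lemma En_pos [simp]: "En \<eta> x > 0" "En \<eta> x \<noteq> 0" by (simp_all add: En_def)

lemma En_deriv: "continuous_on Ix \<eta> \<Longrightarrow> x \<in> Ix \<Longrightarrow> (En \<eta> has_real_derivative \<eta> x * En \<eta> x) (at x within Ix)"
  unfolding En_def[abs_def] by (auto intro!: derivative_eq_intros prim_deriv)

lemma En_deriv_open: "continuous_on Ix \<eta> \<Longrightarrow> x0 < x \<Longrightarrow> x < 1 \<Longrightarrow> (En \<eta> has_real_derivative \<eta> x * En \<eta> x) (at x)"
  using En_deriv[of \<eta> x] at_Ix[of x] by auto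

lemma En_cont: "continuous_on Ix \<eta> \<Longrightarrow> continuous_on Ix (En \<eta>)"
  by (rule DERIV_continuous_on[OF En_deriv])

lemma En_bounds:
  assumes "continuous_on Ix \<eta>" "\<And>t. t \<in> Ix \<Longrightarrow> \<bar>\<eta> t\<bar> \<le> 1" "x \<in> Ix"
  shows "En \<eta> x \<le> exp 2" "inverse (En \<eta> x) \<le> exp 2"
  using prim_bound[OF assms, of] unfolding En_def exp_minus[symmetric] by auto

text \<open>Equal end values of \<open>s\<close> give, by Rolle, a zero of its derivative
  \<open>v\<close>, from which \<open>En \<eta> x * v x\<close> is integrated. A singularity
  \<open>1 / sqrt (1 - t)\<close> of \<open>g\<close> is integrable and contributes the factor 4;
  \<open>exp 4\<close> collects the bounds \<open>exp 2\<close> for \<open>En \<eta>\<close> and for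
  its inverse.\<close>

lemma lin_bound:
  assumes \<eta>: "continuous_on Ix \<eta>" "\<And>t. t \<in> Ix \<Longrightarrow> \<bar>\<eta> t\<bar> \<le> 1"
    and s: "continuous_on Ix s" "\<And>t. x0 < t \<Longrightarrow> t < 1 \<Longrightarrow> (s has_real_derivative v t) (at t)" "s x0 = s 1"
    and v: "continuous_on Ix v" "\<And>t. x0 < t \<Longrightarrow> t < 1 \<Longrightarrow> (v has_real_derivative - \<eta> t * v t - g t) (at t)"
      "\<And>t. x0 < t \<Longrightarrow> t < 1 \<Longrightarrow> \<bar>g t\<bar> * sqrt (1 - t) \<le> T" and x: "x \<in> Ix"
  shows "\<bar>v x\<bar> \<le> 4 * exp 4 * T"
proof -
  obtain \<xi> where \<xi>: "x0 < \<xi>" "\<xi> < 1" "(s has_real_derivative 0) (at \<xi>)"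
    using Rolle[OF x0_lt s(3,1)] s(2) by (metis real_differentiable_def)
  then have v0: "v \<xi> = 0" using s(2) DERIV_unique by blast
  have T: "T \<ge> 0" using v(3)[OF \<xi>(1,2)] \<xi> by (smt (verit) mult_nonneg_nonneg real_sqrt_ge_zero)
  define W where "W = (\<lambda>x. En \<eta> x * v x)"
  have W: "continuous_on Ix W" unfolding W_def by (intro continuous_intros En_cont \<eta> v)
  have dW: "(W has_real_derivative - (En \<eta> t * g t)) (at t)" if "x0 < t" "t < 1" for t
    unfolding W_def by (rule derivative_eq_intros En_deriv_open \<eta> v(2) that refl)+ (simp add: algebra_simps)
  have inc: "\<bar>W b - W a\<bar> \<le> 4 * exp 2 * T" if "a \<in> Ix" "b \<in> Ix" "a \<le> b" for a b
  proof -
    have "\<bar>W b - W a\<bar> \<le> - 2 * exp 2 * T * sqrt (1 - b) - (- 2 * exp 2 * T * sqrt (1 - a))"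
    proof (rule bound_incr[OF that(3)])
      show "continuous_on {a..b} W" using that by (intro continuous_on_subset[OF W]) auto
      show "continuous_on {a..b} (\<lambda>x. - 2 * exp 2 * T * sqrt (1 - x))" by (intro continuous_intros)
      fix t assume t: "a < t" "t < b"
      then have t': "x0 < t" "t < 1" using that by auto
      show "(W has_real_derivative - (En \<eta> t * g t)) (at t)" by (rule dW[OF t'])
      show "((\<lambda>x. - 2 * exp 2 * T * sqrt (1 - x)) has_real_derivative exp 2 * T / sqrt (1 - t)) (at t)"
        using t' by (auto intro!: derivative_eq_intros simp: field_simps)
      have "\<bar>- (En \<eta> t * g t)\<bar> = En \<eta> t * \<bar>g t\<bar>" by (simp add: abs_mult En_def)
      also have "\<dots> \<le> exp 2 * (T / sqrt (1 - t))"
        using En_bounds(1)[OF \<eta>, of t] v(3)[OF t'] t' by (intro mult_mono) (auto simp: field_simps)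
      finally show "\<bar>- (En \<eta> t * g t)\<bar> \<le> exp 2 * T / sqrt (1 - t)" by simp
    qed
    also have "\<dots> \<le> 2 * exp 2 * T * sqrt (1 - a)" using that T by auto
    also have "\<dots> \<le> 2 * exp 2 * T * 2"
      using that x0_gt T by (intro mult_left_mono real_le_lsqrt) auto
    finally show ?thesis by simp
  qed
  have \<xi>I: "\<xi> \<in> Ix" using \<xi> by auto
  have "\<bar>W x\<bar> \<le> 4 * exp 2 * T"
    using inc[OF \<xi>I x] inc[OF x \<xi>I] v0 by (cases "\<xi> \<le> x") (auto simp: W_def)
  moreover have "v x = W x * inverse (En \<eta> x)" by (simp add: W_def)
  ultimately have "\<bar>v x\<bar> \<le> (4 * exp 2 * T) * exp 2"
    using En_bounds(2)[OF \<eta> x] T abs_of_pos[OF En_pos(1)[of \<eta> x]] by (simp only: abs_mult abs_inverse) (intro mult_mono; simp)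
  also have "\<dots> = 4 * exp 4 * T" by (simp add: mult_exp_exp)
  finally show ?thesis .
qed

end

text \<open>\<open>ss\<close> is the solution \<open>s\<close> of \<open>s'' + \<eta> s' = - \<tau>\<close> with \<open>s = 0\<close> at both ends, \<open>sp = s'\<close> and
  \<open>sg = s / (1 - x\<^sup>2)\<close>. Subtracting \<open>Mk (Kf \<eta>) x0\<close> in \<open>Qf\<close> makes \<open>Q\<close>, and with it \<open>\<eta>'\<close>, vanish at \<open>x0\<close>, which is the no-slip
  condition for \<open>u\<^sup>\<rho>\<close>.\<close>

locale reduced = cone +
  fixes \<tau> KF :: "real \<Rightarrow> real"
  assumes \<tau>_cont: "continuous_on Ix \<tau>" and KF_cont: "continuous_on Ix KF"
begin

definition Vp where "Vp \<eta> = prim (\<lambda>t. En \<eta> t * \<tau> t)"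
text \<open>By variation of constants this is the initial slope of \<open>ss \<eta>\<close>, chosen
  so that \<open>ss \<eta>\<close> vanishes at 1.\<close>

definition A0 where "A0 \<eta> = prim (\<lambda>t. Vp \<eta> t / En \<eta> t) 1 / prim (\<lambda>t. 1 / En \<eta> t) 1"
definition sp where "sp \<eta> x = (A0 \<eta> - Vp \<eta> x) / En \<eta> x"
definition ss where "ss \<eta> = prim (sp \<eta>)"
definition sg where "sg \<eta> x = avg 0 (\<lambda>t. - sp \<eta> t) x / (1 + x)"
text \<open>Force and swirl terms of the radial momentum equation after the pressure has been
  eliminated by integrating the polar equation; the \<open>tail\<close> term is the part of the
  pressure that balances the centrifugal force.\<close>

definition Kf where "Kf \<eta> x = KF x + (1 - x\<^sup>2) * (sg \<eta> x)\<^sup>2 + 2 * tail (\<lambda>t. t * (sg \<eta> t)\<^sup>2) x"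
text \<open>The double integral of \<open>k\<close> from the axis, divided by the square of
  \<open>1 - x\<close>.\<close>

definition Mk where "Mk k = avg 1 (avg 0 k)"
definition Qf where "Qf \<eta> x = (Mk (Kf \<eta>) x - Mk (Kf \<eta>) x0) / (1 + x)\<^sup>2"
definition Tf where "Tf \<eta> x = - prim (\<lambda>t. (\<eta> t)\<^sup>2 / 2 + Qf \<eta> t) x"

lemma Vp_cont: "continuous_on Ix \<eta> \<Longrightarrow> continuous_on Ix (Vp \<eta>)"
  unfolding Vp_def by (intro prim_cont continuous_intros En_cont \<tau>_cont)

lemma sp_cont: "continuous_on Ix \<eta> \<Longrightarrow> continuous_on Ix (sp \<eta>)"
  unfolding sp_def[abs_def] by (intro continuous_intros En_cont Vp_cont) auto

lemma sp_deriv: "continuous_on Ix \<eta> \<Longrightarrow> x \<in> Ix \<Longrightarrow> (sp \<eta> has_real_derivative - \<eta> x * sp \<eta> x - \<tau> x) (at x within Ix)"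
proof -
  assume \<eta>: "continuous_on Ix \<eta>" and x: "x \<in> Ix"
  have V: "(Vp \<eta> has_real_derivative En \<eta> x * \<tau> x) (at x within Ix)"
    unfolding Vp_def by (intro prim_deriv continuous_intros En_cont \<tau>_cont \<eta> x)
  have "((\<lambda>x. (A0 \<eta> - Vp \<eta> x) / En \<eta> x) has_real_derivative
      ((0 - En \<eta> x * \<tau> x) * En \<eta> x - (A0 \<eta> - Vp \<eta> x) * (\<eta> x * En \<eta> x)) / (En \<eta> x * En \<eta> x)) (at x within Ix)"
    by (intro DERIV_divide DERIV_diff DERIV_const V En_deriv \<eta> x) auto
  also have "((0 - En \<eta> x * \<tau> x) * En \<eta> x - (A0 \<eta> - Vp \<eta> x) * (\<eta> x * En \<eta> x)) / (En \<eta> x * En \<eta> x) = - \<eta> x * sp \<eta> x - \<tau> x"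
    by (simp add: sp_def field_simps)
  finally show ?thesis unfolding sp_def[abs_def] .
qed

lemma sp_deriv_open: "continuous_on Ix \<eta> \<Longrightarrow> x0 < x \<Longrightarrow> x < 1 \<Longrightarrow> (sp \<eta> has_real_derivative - \<eta> x * sp \<eta> x - \<tau> x) (at x)"
  using sp_deriv[of \<eta> x] at_Ix[of x] by auto

lemma ss_cont: "continuous_on Ix \<eta> \<Longrightarrow> continuous_on Ix (ss \<eta>)"
  unfolding ss_def by (intro prim_cont sp_cont)

lemma ss_deriv: "continuous_on Ix \<eta> \<Longrightarrow> x \<in> Ix \<Longrightarrow> (ss \<eta> has_real_derivative sp \<eta> x) (at x within Ix)"
  unfolding ss_def by (intro prim_deriv sp_cont)

lemma ss_deriv_open: "continuous_on Ix \<eta> \<Longrightarrow> x0 < x \<Longrightarrow> x < 1 \<Longrightarrow> (ss \<eta> has_real_derivative sp \<eta> x) (at x)"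
  using ss_deriv[of \<eta> x] at_Ix[of x] by auto

lemma ss_x0: "ss \<eta> x0 = 0" by (simp add: ss_def)

lemma ss_1: assumes \<eta>: "continuous_on Ix \<eta>" shows "ss \<eta> 1 = 0"
proof -
  define I where "I = prim (\<lambda>t. 1 / En \<eta> t)"
  have c1: "continuous_on Ix (\<lambda>t. 1 / En \<eta> t)" by (intro continuous_intros En_cont \<eta>) auto
  have c2: "continuous_on Ix (\<lambda>t. Vp \<eta> t / En \<eta> t)" by (intro continuous_intros En_cont Vp_cont \<eta>) auto
  have dI: "(I has_real_derivative 1 / En \<eta> x) (at x within Ix)" if "x \<in> Ix" for x
    unfolding I_def by (rule prim_deriv[OF c1 that])
  \<comment> \<open>Positivity of this integral gives meaning to the quotient in
    \<open>A0\<close>.\<close>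
  have "I x0 < I 1"
  proof (rule DERIV_pos_imp_increasing_open[OF x0_lt])
    show "continuous_on Ix I" using dI by (rule DERIV_continuous_on)
    fix x assume "x0 < x" "x < 1"
    then show "\<exists>y. (I has_real_derivative y) (at x) \<and> 0 < y" using dI[of x] at_Ix[of x] by auto
  qed
  then have I1: "I 1 \<noteq> 0" by (simp add: I_def)
  have "A0 \<eta> * I 1 - prim (\<lambda>t. Vp \<eta> t / En \<eta> t) 1 = prim (sp \<eta>) 1"
  proof (rule prim_unique[where F = "\<lambda>x. A0 \<eta> * I x - prim (\<lambda>t. Vp \<eta> t / En \<eta> t) x", OF sp_cont[OF \<eta>]])
    show "continuous_on Ix (\<lambda>x. A0 \<eta> * I x - prim (\<lambda>t. Vp \<eta> t / En \<eta> t) x)"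
      unfolding I_def by (intro continuous_intros prim_cont c1 c2)
    fix x assume x: "x0 < x" "x < 1"
    have "(I has_real_derivative 1 / En \<eta> x) (at x)" "(prim (\<lambda>t. Vp \<eta> t / En \<eta> t) has_real_derivative Vp \<eta> x / En \<eta> x) (at x)"
      using dI[of x] prim_deriv[OF c2, of x] at_Ix[OF x] x by auto
    then show "((\<lambda>x. A0 \<eta> * I x - prim (\<lambda>t. Vp \<eta> t / En \<eta> t) x) has_real_derivative sp \<eta> x) (at x)"
      by (auto intro!: derivative_eq_intros simp: sp_def diff_divide_distrib)
  qed (use x0_Ix in \<open>auto simp: I_def\<close>)
  then show ?thesis using I1 by (simp add: ss_def A0_def I_def)
qed

text \<open>The difference solves the homogeneous equation, so \<open>En \<eta> x * w x\<close> is
  constant, and Rolle supplies a zero. The argument stays in the open interval, where the derivative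
  \<open>v\<close> of the given solution is known.\<close>

lemma lin_unique:
  assumes \<eta>: "continuous_on Ix \<eta>" and s: "continuous_on Ix s" "\<And>t. x0 < t \<Longrightarrow> t < 1 \<Longrightarrow> (s has_real_derivative v t) (at t)"
      "s x0 = 0" "s 1 = 0"
    and v: "\<And>t. x0 < t \<Longrightarrow> t < 1 \<Longrightarrow> (v has_real_derivative - \<eta> t * v t - \<tau> t) (at t)" and x: "x \<in> Ix"
  shows "s x = ss \<eta> x"
proof -
  define D where "D = (\<lambda>x. s x - ss \<eta> x)"
  define w where "w = (\<lambda>x. v x - sp \<eta> x)"
  have D: "continuous_on Ix D" "D x0 = D 1" unfolding D_def using s ss_x0 ss_1[OF \<eta>] by (auto intro!: continuous_intros ss_cont \<eta>)
  have dD: "(D has_real_derivative w t) (at t)" if "x0 < t" "t < 1" for t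
    unfolding D_def w_def using s(2)[OF that] ss_deriv_open[OF \<eta> that] by (auto intro!: derivative_eq_intros)
  have dw: "((\<lambda>x. En \<eta> x * w x) has_real_derivative 0) (at t)" if "x0 < t" "t < 1" for t
    unfolding w_def
    by (rule derivative_eq_intros En_deriv_open sp_deriv_open \<eta> v that refl)+ (simp add: algebra_simps)
  obtain \<xi> where \<xi>: "x0 < \<xi>" "\<xi> < 1" "(D has_real_derivative 0) (at \<xi>)"
    using Rolle[OF x0_lt D(2,1)] dD by (metis real_differentiable_def)
  then have w0: "w \<xi> = 0" using dD DERIV_unique by blast
  have inc: "En \<eta> b * w b = En \<eta> a * w a" if "x0 < a" "a \<le> b" "b < 1" for a b
  proof -
    have "\<bar>En \<eta> b * w b - En \<eta> a * w a\<bar> \<le> 0 * (b - a)"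
    proof (rule bound_incr_const[OF that(2), of "\<lambda>x. En \<eta> x * w x" "\<lambda>_. 0"])
      show "continuous_on {a..b} (\<lambda>x. En \<eta> x * w x)"
        using dw that by (intro continuous_at_imp_continuous_on ballI DERIV_isCont[of _ 0]) auto
    qed (use dw that in auto)
    then show ?thesis by simp
  qed
  have w: "w t = 0" if "x0 < t" "t < 1" for t
  proof (cases "\<xi> \<le> t")
    case True
    then show ?thesis using inc[of \<xi> t] \<xi> that w0 by simp
  next
    case False
    then show ?thesis using inc[of t \<xi>] \<xi> that w0 by simp
  qed
  have "D x = D x0"
    using dD w x x0_Ix by (intro const_Ix[OF D(1)]) auto
  then show ?thesis using s(3) ss_x0 by (simp add: D_def)
qed

lemma sg_cont: "continuous_on Ix \<eta> \<Longrightarrow> continuous_on Ix (sg \<eta>)"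
  unfolding sg_def[abs_def] using x0_gt by (intro continuous_intros avg_cont sp_cont) auto

lemma ss_sg: assumes \<eta>: "continuous_on Ix \<eta>" and x: "x \<in> Ix" shows "ss \<eta> x = (1 - x\<^sup>2) * sg \<eta> x"
proof -
  have "ss \<eta> x = (1 - x) ^ (0 + 1) * avg 0 (\<lambda>t. - sp \<eta> t) x"
  proof (rule avg_unique[OF _ ss_cont[OF \<eta>] ss_1[OF \<eta>] _ x])
    show "continuous_on Ix (\<lambda>t. - sp \<eta> t)" by (intro continuous_intros sp_cont \<eta>)
    fix t assume "x0 < t" "t < 1"
    from ss_deriv_open[OF \<eta> this] show "(ss \<eta> has_real_derivative - ((1 - t) ^ 0 * - sp \<eta> t)) (at t)" by simp
  qed
  also have "\<dots> = (1 - x\<^sup>2) * sg \<eta> x"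
    using x x0_gt by (simp add: sg_def power2_eq_square field_simps)
  finally show ?thesis .
qed

lemma Kf_cont: "continuous_on Ix \<eta> \<Longrightarrow> continuous_on Ix (Kf \<eta>)"
  unfolding Kf_def[abs_def] by (intro continuous_intros tail_cont sg_cont KF_cont)

lemma Mk_cont: "continuous_on Ix k \<Longrightarrow> continuous_on Ix (Mk k)"
  unfolding Mk_def by (intro avg_cont)

lemma Qf_cont: "continuous_on Ix \<eta> \<Longrightarrow> continuous_on Ix (Qf \<eta>)"
  unfolding Qf_def[abs_def] using x0_gt by (intro continuous_intros Mk_cont Kf_cont) auto

lemma Tint_cont: "continuous_on Ix \<eta> \<Longrightarrow> continuous_on Ix (\<lambda>t. (\<eta> t)\<^sup>2 / 2 + Qf \<eta> t)"
  by (intro continuous_intros Qf_cont) auto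

lemma Tf_cont: "continuous_on Ix \<eta> \<Longrightarrow> continuous_on Ix (Tf \<eta>)"
  unfolding Tf_def[abs_def] by (intro continuous_intros prim_cont Tint_cont)

lemma Tf_deriv: "continuous_on Ix \<eta> \<Longrightarrow> x \<in> Ix \<Longrightarrow> (Tf \<eta> has_real_derivative - ((\<eta> x)\<^sup>2 / 2 + Qf \<eta> x)) (at x within Ix)"
  unfolding Tf_def[abs_def] by (intro DERIV_minus prim_deriv Tint_cont)

lemma Mk_bound: "continuous_on Ix k \<Longrightarrow> x \<in> Ix \<Longrightarrow> (\<And>t. t \<in> Ix \<Longrightarrow> \<bar>k t\<bar> \<le> M) \<Longrightarrow> \<bar>Mk k x\<bar> \<le> M"
  unfolding Mk_def by (intro avg_bound avg_cont) auto

lemma Mk_diff: assumes "continuous_on Ix k" "continuous_on Ix l" "x \<in> Ix" shows "Mk (\<lambda>t. k t - l t) x = Mk k x - Mk l x"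
proof -
  have "avg 1 (avg 0 (\<lambda>t. k t - l t)) x = avg 1 (\<lambda>t. avg 0 k t - avg 0 l t) x"
    by (rule avg_cong[OF avg_diff[OF assms(1,2)] assms(3)])
  also have "\<dots> = avg 1 (avg 0 k) x - avg 1 (avg 0 l) x" by (intro avg_diff avg_cont assms)
  finally show ?thesis by (simp add: Mk_def)
qed

text \<open>The factor 2 comes from the value at \<open>x0\<close> that is subtracted in
  \<open>Qf\<close>; the denominator is the smallest value of
  \<open>(1 + x)\<^sup>2\<close>.\<close>

lemma Qf_diff_bound:
  assumes "continuous_on Ix \<eta>" "continuous_on Ix \<zeta>" "x \<in> Ix" "\<And>t. t \<in> Ix \<Longrightarrow> \<bar>Kf \<eta> t - Kf \<zeta> t\<bar> \<le> M"
  shows "\<bar>Qf \<eta> x - Qf \<zeta> x\<bar> \<le> 2 * M / (1 + x0)\<^sup>2"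
proof -
  define k where "k = (\<lambda>t. Kf \<eta> t - Kf \<zeta> t)"
  have k: "continuous_on Ix k" unfolding k_def by (intro continuous_intros Kf_cont assms)
  have b: "\<bar>Mk k y\<bar> \<le> M" if "y \<in> Ix" for y using Mk_bound[OF k that] assms(4) by (auto simp: k_def)
  have e: "Mk k y = Mk (Kf \<eta>) y - Mk (Kf \<zeta>) y" if "y \<in> Ix" for y
    unfolding k_def by (intro Mk_diff Kf_cont assms that)
  have "Qf \<eta> x - Qf \<zeta> x = (Mk k x - Mk k x0) / (1 + x)\<^sup>2"
    unfolding Qf_def e[OF assms(3)] e[OF x0_Ix(1)] by (simp add: diff_divide_distrib)
  then have "\<bar>Qf \<eta> x - Qf \<zeta> x\<bar> = \<bar>Mk k x - Mk k x0\<bar> / (1 + x)\<^sup>2" by (simp add: abs_divide)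
  also have "\<dots> \<le> (2 * M) / (1 + x0)\<^sup>2"
    using b[OF assms(3)] b[OF x0_Ix(1)] assms(3) x0_gt by (intro frac_le power_mono) auto
  finally show ?thesis .
qed

lemma Qf_bound:
  assumes "continuous_on Ix \<eta>" "x \<in> Ix" "\<And>t. t \<in> Ix \<Longrightarrow> \<bar>Kf \<eta> t\<bar> \<le> M"
  shows "\<bar>Qf \<eta> x\<bar> \<le> 2 * M / (1 + x0)\<^sup>2"
proof -
  have b: "\<bar>Mk (Kf \<eta>) y\<bar> \<le> M" if "y \<in> Ix" for y by (intro Mk_bound Kf_cont assms that)
  have "\<bar>Qf \<eta> x\<bar> = \<bar>Mk (Kf \<eta>) x - Mk (Kf \<eta>) x0\<bar> / (1 + x)\<^sup>2" by (simp add: abs_divide Qf_def)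
  also have "\<dots> \<le> (2 * M) / (1 + x0)\<^sup>2"
    using b[OF assms(2)] b[OF x0_Ix(1)] assms(2) x0_gt by (intro frac_le power_mono) auto
  finally show ?thesis .
qed

end

section \<open>Contraction estimates for small data\<close>

locale reduced_small = reduced +
  fixes \<epsilon> :: real
  assumes \<epsilon>: "0 \<le> \<epsilon>" "\<epsilon> \<le> 1" and \<tau>_small: "\<And>t. x0 < t \<Longrightarrow> t < 1 \<Longrightarrow> \<bar>\<tau> t\<bar> * sqrt (1 - t) \<le> \<epsilon>"
    and KF_small: "\<And>t. t \<in> Ix \<Longrightarrow> \<bar>KF t\<bar> \<le> \<epsilon>"
begin

text \<open>Radius 1 serves for the a priori estimates of the swirl, where it bounds
  \<open>En \<eta>\<close>; the fixed point is sought in a smaller ball.\<close>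

definition adm :: "real \<Rightarrow> (real \<Rightarrow> real) \<Rightarrow> bool" where "adm r \<eta> \<longleftrightarrow> continuous_on Ix \<eta> \<and> (\<forall>t\<in>Ix. \<bar>\<eta> t\<bar> \<le> r)"

abbreviation "c0 \<equiv> 4 * exp (4::real)"

lemma sp_bound: assumes "adm 1 \<eta>" "x \<in> Ix" shows "\<bar>sp \<eta> x\<bar> \<le> c0 * \<epsilon>"
  using assms lin_bound[of \<eta> "ss \<eta>" "sp \<eta>" \<tau> \<epsilon> x] ss_cont ss_deriv_open ss_x0 ss_1 sp_cont sp_deriv_open \<tau>_small
  by (auto simp: adm_def)

lemma sg_bound_gen:
  assumes "continuous_on Ix k" "x \<in> Ix" "\<And>t. t \<in> Ix \<Longrightarrow> \<bar>k t\<bar> \<le> M" shows "\<bar>avg 0 k x / (1 + x)\<bar> \<le> M / (1 + x0)"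
  unfolding abs_divide using avg_bound[OF assms, of 0] assms(2) x0_gt by (intro frac_le) auto

lemma sg_bound: assumes "adm 1 \<eta>" "x \<in> Ix" shows "\<bar>sg \<eta> x\<bar> \<le> c0 * \<epsilon> / (1 + x0)"
  unfolding sg_def using assms sp_bound[OF assms(1)] by (intro sg_bound_gen continuous_intros sp_cont) (auto simp: adm_def)

text \<open>The difference solves the linear problem for \<open>\<eta>\<close> with source
  \<open>(\<eta> t - \<zeta> t) * sp \<zeta> t\<close>. The second factor of the source is already
  of order \<epsilon>, so \<open>lin_bound\<close> applies again.\<close>

lemma sp_diff:
  assumes \<eta>: "adm 1 \<eta>" and \<zeta>: "adm 1 \<zeta>" and x: "x \<in> Ix" and d: "\<And>t. t \<in> Ix \<Longrightarrow> \<bar>\<eta> t - \<zeta> t\<bar> \<le> d"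
  shows "\<bar>sp \<eta> x - sp \<zeta> x\<bar> \<le> 2 * c0\<^sup>2 * \<epsilon> * d"
proof -
  have c: "continuous_on Ix \<eta>" "continuous_on Ix \<zeta>" using \<eta> \<zeta> by (auto simp: adm_def)
  have d0: "d \<ge> 0" using d[OF x] by simp
  have "\<bar>sp \<eta> x - sp \<zeta> x\<bar> \<le> 4 * exp 4 * (2 * (c0 * \<epsilon> * d))"
  proof (rule lin_bound[OF c(1) _ _ _ _ _ _ _ x, where s = "\<lambda>x. ss \<eta> x - ss \<zeta> x" and v = "\<lambda>x. sp \<eta> x - sp \<zeta> x" and g = "\<lambda>t. (\<eta> t - \<zeta> t) * sp \<zeta> t"])
    fix t assume t: "x0 < t" "t < 1"
    show "((\<lambda>x. ss \<eta> x - ss \<zeta> x) has_real_derivative sp \<eta> t - sp \<zeta> t) (at t)"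
      by (intro DERIV_diff ss_deriv_open c t)
    have "((\<lambda>x. sp \<eta> x - sp \<zeta> x) has_real_derivative (- \<eta> t * sp \<eta> t - \<tau> t) - (- \<zeta> t * sp \<zeta> t - \<tau> t)) (at t)"
      by (intro DERIV_diff sp_deriv_open c t)
    then show "((\<lambda>x. sp \<eta> x - sp \<zeta> x) has_real_derivative - \<eta> t * (sp \<eta> t - sp \<zeta> t) - (\<eta> t - \<zeta> t) * sp \<zeta> t) (at t)"
      by (simp add: algebra_simps)
    have sq: "sqrt (1 - t) \<le> 2" using t x0_gt by (intro real_le_lsqrt) auto
    have "\<bar>(\<eta> t - \<zeta> t) * sp \<zeta> t\<bar> * sqrt (1 - t) \<le> (d * (c0 * \<epsilon>)) * 2"
      unfolding abs_mult using d[of t] sp_bound[OF \<zeta>, of t] t d0 \<epsilon> sq by (intro mult_mono) auto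
    then show "\<bar>(\<eta> t - \<zeta> t) * sp \<zeta> t\<bar> * sqrt (1 - t) \<le> 2 * (c0 * \<epsilon> * d)" by (simp add: mult_ac)
  qed (use \<eta> c ss_x0 ss_1 in \<open>auto simp: adm_def intro!: continuous_intros ss_cont sp_cont\<close>)
  then show ?thesis by (simp add: power2_eq_square)
qed

lemma sg_diff:
  assumes \<eta>: "adm 1 \<eta>" and \<zeta>: "adm 1 \<zeta>" and x: "x \<in> Ix" and d: "\<And>t. t \<in> Ix \<Longrightarrow> \<bar>\<eta> t - \<zeta> t\<bar> \<le> d"
  shows "\<bar>sg \<eta> x - sg \<zeta> x\<bar> \<le> 2 * c0\<^sup>2 * \<epsilon> * d / (1 + x0)"
proof -
  have c: "continuous_on Ix (\<lambda>t. - sp \<eta> t)" "continuous_on Ix (\<lambda>t. - sp \<zeta> t)" using \<eta> \<zeta>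
    by (auto simp: adm_def intro!: continuous_intros sp_cont)
  have "sg \<eta> x - sg \<zeta> x = avg 0 (\<lambda>t. - sp \<eta> t - - sp \<zeta> t) x / (1 + x)"
    using avg_diff[OF c x, of 0] by (simp add: sg_def diff_divide_distrib)
  moreover have "\<bar>avg 0 (\<lambda>t. - sp \<eta> t - - sp \<zeta> t) x / (1 + x)\<bar> \<le> 2 * c0\<^sup>2 * \<epsilon> * d / (1 + x0)"
    using sp_diff[OF \<eta> \<zeta> _ d] by (intro sg_bound_gen continuous_intros c x) (simp add: abs_minus_commute)
  ultimately show ?thesis by simp
qed

lemma Kf_bound: assumes "adm 1 \<eta>" "x \<in> Ix" shows "\<bar>Kf \<eta> x\<bar> \<le> (1 + 5 * (c0 / (1 + x0))\<^sup>2) * \<epsilon>"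
proof -
  define m where "m = c0 * \<epsilon> / (1 + x0)"
  have m0: "m \<ge> 0" using \<epsilon> x0_gt by (simp add: m_def)
  have c: "continuous_on Ix \<eta>" using assms by (auto simp: adm_def)
  have sq: "\<bar>(sg \<eta> t)\<^sup>2\<bar> \<le> m\<^sup>2" if "t \<in> Ix" for t
    using sg_bound[OF assms(1) that] m0 unfolding m_def[symmetric] by (simp add: abs_le_square_iff[symmetric])
  have 1: "\<bar>(1 - x\<^sup>2) * (sg \<eta> x)\<^sup>2\<bar> \<le> 1 * m\<^sup>2"
    unfolding abs_mult using sq[OF assms(2)] Ix_bounds(5)[OF assms(2)] by (intro mult_mono) (auto simp: abs_square_le_1)
  have 2: "\<bar>tail (\<lambda>t. t * (sg \<eta> t)\<^sup>2) x\<bar> \<le> 2 * m\<^sup>2"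
  proof (rule tail_bound)
    show "continuous_on Ix (\<lambda>t. t * (sg \<eta> t)\<^sup>2)" by (intro continuous_intros sg_cont c)
    fix t assume t: "t \<in> Ix"
    have "\<bar>t * (sg \<eta> t)\<^sup>2\<bar> \<le> 1 * m\<^sup>2" unfolding abs_mult using sq[OF t] Ix_bounds(5)[OF t] by (intro mult_mono) auto
    then show "\<bar>t * (sg \<eta> t)\<^sup>2\<bar> \<le> m\<^sup>2" by simp
  qed (rule assms)
  have "\<bar>Kf \<eta> x\<bar> \<le> \<epsilon> + 5 * m\<^sup>2" using 1 2 KF_small[OF assms(2)] unfolding Kf_def by linarith
  also have "m\<^sup>2 = (c0 / (1 + x0))\<^sup>2 * \<epsilon>\<^sup>2" by (simp add: m_def power_mult_distrib power_divide)
  also have "\<dots> \<le> (c0 / (1 + x0))\<^sup>2 * \<epsilon>" using \<epsilon> by (intro mult_left_mono) (auto simp: power2_eq_square mult_left_le)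
  finally show ?thesis by (simp add: algebra_simps)
qed

lemma Kf_diff:
  assumes \<eta>: "adm 1 \<eta>" and \<zeta>: "adm 1 \<zeta>" and x: "x \<in> Ix" and d: "\<And>t. t \<in> Ix \<Longrightarrow> \<bar>\<eta> t - \<zeta> t\<bar> \<le> d"
  shows "\<bar>Kf \<eta> x - Kf \<zeta> x\<bar> \<le> (20 * c0 ^ 3 / (1 + x0)\<^sup>2) * \<epsilon> * d"
proof -
  define m where "m = c0 * \<epsilon> / (1 + x0)"
  define e where "e = 2 * c0\<^sup>2 * \<epsilon> * d / (1 + x0)"
  have d0: "d \<ge> 0" using d[OF x] by simp
  have m0: "m \<ge> 0" "e \<ge> 0" using \<epsilon> x0_gt d0 by (simp_all add: m_def e_def)
  have c: "continuous_on Ix \<eta>" "continuous_on Ix \<zeta>" using \<eta> \<zeta> by (auto simp: adm_def)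
  have sq: "\<bar>(sg \<eta> t)\<^sup>2 - (sg \<zeta> t)\<^sup>2\<bar> \<le> e * (2 * m)" if "t \<in> Ix" for t
  proof -
    have "(sg \<eta> t)\<^sup>2 - (sg \<zeta> t)\<^sup>2 = (sg \<eta> t - sg \<zeta> t) * (sg \<eta> t + sg \<zeta> t)" by (simp add: power2_eq_square algebra_simps)
    moreover have "\<bar>sg \<eta> t + sg \<zeta> t\<bar> \<le> 2 * m" using sg_bound[OF \<eta> that] sg_bound[OF \<zeta> that] unfolding m_def by linarith
    ultimately show ?thesis using sg_diff[OF \<eta> \<zeta> that d] m0 unfolding e_def[symmetric] by (simp add: abs_mult mult_mono)
  qed
  have 1: "\<bar>(1 - x\<^sup>2) * ((sg \<eta> x)\<^sup>2 - (sg \<zeta> x)\<^sup>2)\<bar> \<le> 1 * (e * (2 * m))"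
    unfolding abs_mult using sq[OF x] Ix_bounds(5)[OF x] by (intro mult_mono) (auto simp: abs_square_le_1)
  have 2: "\<bar>tail (\<lambda>t. t * (sg \<eta> t)\<^sup>2 - t * (sg \<zeta> t)\<^sup>2) x\<bar> \<le> 2 * (e * (2 * m))"
  proof (rule tail_bound)
    show "continuous_on Ix (\<lambda>t. t * (sg \<eta> t)\<^sup>2 - t * (sg \<zeta> t)\<^sup>2)" by (intro continuous_intros sg_cont c)
    fix t assume t: "t \<in> Ix"
    have "\<bar>t * ((sg \<eta> t)\<^sup>2 - (sg \<zeta> t)\<^sup>2)\<bar> \<le> 1 * (e * (2 * m))" unfolding abs_mult using sq[OF t] Ix_bounds(5)[OF t] by (intro mult_mono) auto
    then show "\<bar>t * (sg \<eta> t)\<^sup>2 - t * (sg \<zeta> t)\<^sup>2\<bar> \<le> e * (2 * m)" by (simp add: right_diff_distrib)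
  qed (rule x)
  have "Kf \<eta> x - Kf \<zeta> x = (1 - x\<^sup>2) * ((sg \<eta> x)\<^sup>2 - (sg \<zeta> x)\<^sup>2) + 2 * (tail (\<lambda>t. t * (sg \<eta> t)\<^sup>2) x - tail (\<lambda>t. t * (sg \<zeta> t)\<^sup>2) x)"
    by (simp add: Kf_def algebra_simps)
  also have "tail (\<lambda>t. t * (sg \<eta> t)\<^sup>2) x - tail (\<lambda>t. t * (sg \<zeta> t)\<^sup>2) x = tail (\<lambda>t. t * (sg \<eta> t)\<^sup>2 - t * (sg \<zeta> t)\<^sup>2) x"
    by (rule tail_diff) (auto intro!: continuous_intros sg_cont c simp: x[simplified])
  \<comment> \<open>One share comes from the first term and four from the doubled
    \<open>tail\<close>, whose bound has itself a factor 2 from the length of the interval.\<close>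
  finally have "\<bar>Kf \<eta> x - Kf \<zeta> x\<bar> \<le> 5 * (e * (2 * m))" using 1 2 by linarith
  also have "\<dots> = (20 * c0 ^ 3 / (1 + x0)\<^sup>2) * \<epsilon>\<^sup>2 * d"
    by (simp add: e_def m_def power2_eq_square power3_eq_cube)
  also have "\<dots> \<le> (20 * c0 ^ 3 / (1 + x0)\<^sup>2) * \<epsilon> * d"
    using \<epsilon> d0 by (intro mult_right_mono mult_left_mono) (auto simp: power2_eq_square mult_left_le)
  finally show ?thesis .
qed

text \<open>A sum that dominates the three constants of the estimates below. It depends on
  \<open>x0\<close> alone, so the smallness threshold can be chosen before the force.\<close>

definition Cst :: real where
  "Cst = c0 / (1 + x0) + 2 * (1 + 5 * (c0 / (1 + x0))\<^sup>2) / (1 + x0)\<^sup>2 + 40 * c0 ^ 3 / (1 + x0) ^ 4"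

lemma Cst_parts:
  "c0 / (1 + x0) \<le> Cst" "2 * (1 + 5 * (c0 / (1 + x0))\<^sup>2) / (1 + x0)\<^sup>2 \<le> Cst" "40 * c0 ^ 3 / (1 + x0) ^ 4 \<le> Cst"
  using x0_gt unfolding Cst_def by auto

lemma sg_small: assumes "adm 1 \<eta>" "x \<in> Ix" shows "\<bar>sg \<eta> x\<bar> \<le> Cst * \<epsilon>"
  using sg_bound[OF assms] mult_right_mono[OF Cst_parts(1) \<epsilon>(1)] by simp

lemma Qf_small: assumes "adm 1 \<eta>" "x \<in> Ix" shows "\<bar>Qf \<eta> x\<bar> \<le> Cst * \<epsilon>"
proof -
  have "\<bar>Qf \<eta> x\<bar> \<le> 2 * ((1 + 5 * (c0 / (1 + x0))\<^sup>2) * \<epsilon>) / (1 + x0)\<^sup>2"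
    using assms by (intro Qf_bound Kf_bound) (auto simp: adm_def)
  also have "\<dots> = 2 * (1 + 5 * (c0 / (1 + x0))\<^sup>2) / (1 + x0)\<^sup>2 * \<epsilon>" by (simp only: times_divide_eq_left mult.assoc)
  also have "\<dots> \<le> Cst * \<epsilon>" by (rule mult_right_mono[OF Cst_parts(2) \<epsilon>(1)])
  finally show ?thesis .
qed

lemma Qf_diff_small:
  assumes \<eta>: "adm 1 \<eta>" and \<zeta>: "adm 1 \<zeta>" and x: "x \<in> Ix" and d: "\<And>t. t \<in> Ix \<Longrightarrow> \<bar>\<eta> t - \<zeta> t\<bar> \<le> d"
  shows "\<bar>Qf \<eta> x - Qf \<zeta> x\<bar> \<le> Cst * \<epsilon> * d"
proof -
  have d0: "d \<ge> 0" using d[OF x] by simp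
  have "\<bar>Qf \<eta> x - Qf \<zeta> x\<bar> \<le> 2 * ((20 * c0 ^ 3 / (1 + x0)\<^sup>2) * \<epsilon> * d) / (1 + x0)\<^sup>2"
    using \<eta> \<zeta> by (intro Qf_diff_bound Kf_diff[OF \<eta> \<zeta> _ d] x) (auto simp: adm_def)
  also have "\<dots> = (40 * c0 ^ 3 / (1 + x0) ^ 4) * \<epsilon> * d" using x0_gt by (simp add: power_numeral_reduce)
  also have "\<dots> \<le> Cst * \<epsilon> * d" using \<epsilon> d0 Cst_parts(3) by (intro mult_right_mono) auto
  finally show ?thesis .
qed

lemma adm_mono: "adm r \<eta> \<Longrightarrow> r \<le> r' \<Longrightarrow> adm r' \<eta>" unfolding adm_def by (auto intro: order_trans[of _ r r'])

lemma Tf_bound: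
  assumes "adm r \<eta>" "r \<le> 1" "x \<in> Ix" shows "\<bar>Tf \<eta> x\<bar> \<le> r\<^sup>2 + 2 * Cst * \<epsilon>"
proof -
  have c: "continuous_on Ix \<eta>" using assms by (auto simp: adm_def)
  have "\<bar>prim (\<lambda>t. (\<eta> t)\<^sup>2 / 2 + Qf \<eta> t) x\<bar> \<le> 2 * (r\<^sup>2 / 2 + Cst * \<epsilon>)"
  proof (rule prim_bound[OF Tint_cont[OF c] _ assms(3)])
    fix t assume t: "t \<in> Ix"
    have "\<bar>\<eta> t\<bar> \<le> r" using assms t by (auto simp: adm_def)
    then have "(\<eta> t)\<^sup>2 \<le> r\<^sup>2" by (metis abs_ge_zero power2_abs power_mono)
    then show "\<bar>(\<eta> t)\<^sup>2 / 2 + Qf \<eta> t\<bar> \<le> r\<^sup>2 / 2 + Cst * \<epsilon>"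
      using Qf_small[OF adm_mono[OF assms(1,2)] t] zero_le_power2[of "\<eta> t"] by linarith
  qed
  then show ?thesis by (simp add: Tf_def)
qed

lemma Tf_diff:
  assumes \<eta>: "adm r \<eta>" and \<zeta>: "adm r \<zeta>" and r: "r \<le> 1" and x: "x \<in> Ix" and d: "\<And>t. t \<in> Ix \<Longrightarrow> \<bar>\<eta> t - \<zeta> t\<bar> \<le> d"
  shows "\<bar>Tf \<eta> x - Tf \<zeta> x\<bar> \<le> 2 * (r + Cst * \<epsilon>) * d"
proof -
  have c: "continuous_on Ix \<eta>" "continuous_on Ix \<zeta>" using \<eta> \<zeta> by (auto simp: adm_def)
  define f where "f = (\<lambda>t. ((\<eta> t)\<^sup>2 / 2 + Qf \<eta> t) - ((\<zeta> t)\<^sup>2 / 2 + Qf \<zeta> t))"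
  have f: "continuous_on Ix f" unfolding f_def by (intro continuous_on_diff Tint_cont c)
  have "Tf \<zeta> x - Tf \<eta> x = prim f x"
  proof (rule prim_unique[OF f _ _ _ x, where F = "\<lambda>x. Tf \<zeta> x - Tf \<eta> x"])
    show "continuous_on Ix (\<lambda>x. Tf \<zeta> x - Tf \<eta> x)" by (intro continuous_intros Tf_cont c)
    fix t assume t: "x0 < t" "t < 1"
    then show "((\<lambda>x. Tf \<zeta> x - Tf \<eta> x) has_real_derivative f t) (at t)"
      using Tf_deriv[OF c(1), of t] Tf_deriv[OF c(2), of t] at_Ix[OF t] unfolding f_def by (auto intro!: derivative_eq_intros)
  qed (simp add: Tf_def)
  moreover have "\<bar>prim f x\<bar> \<le> 2 * (r * d + Cst * \<epsilon> * d)"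
  proof (rule prim_bound[OF f _ x])
    fix t assume t: "t \<in> Ix"
    have e: "\<bar>\<eta> t\<bar> \<le> r" "\<bar>\<zeta> t\<bar> \<le> r" using \<eta> \<zeta> t by (auto simp: adm_def)
    have "\<bar>(\<eta> t + \<zeta> t) / 2 * (\<eta> t - \<zeta> t)\<bar> \<le> r * d" unfolding abs_mult using e d[OF t] by (intro mult_mono) auto
    moreover have "(\<eta> t + \<zeta> t) / 2 * (\<eta> t - \<zeta> t) = (\<eta> t)\<^sup>2 / 2 - (\<zeta> t)\<^sup>2 / 2" by (simp add: power2_eq_square field_simps)
    ultimately show "\<bar>f t\<bar> \<le> r * d + Cst * \<epsilon> * d"
      using Qf_diff_small[OF adm_mono[OF \<eta> r] adm_mono[OF \<zeta> r] t d] unfolding f_def by linarith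
  qed
  ultimately show ?thesis by (simp add: algebra_simps abs_minus_commute)
qed

text \<open>At a maximum point of the difference, \<open>Tf_diff\<close> bounds that maximum by its
  half: \<open>2 * (1/8 + 1/8) = 1/2\<close>.\<close>

lemma fixpoint_unique:
  assumes \<eta>: "adm (1/8) \<eta>" "\<And>x. x \<in> Ix \<Longrightarrow> \<eta> x = Tf \<eta> x" and \<zeta>: "adm (1/8) \<zeta>" "\<And>x. x \<in> Ix \<Longrightarrow> \<zeta> x = Tf \<zeta> x"
    and C: "Cst * \<epsilon> \<le> 1/8" and x: "x \<in> Ix"
  shows "\<eta> x = \<zeta> x"
proof -
  have c: "continuous_on Ix (\<lambda>t. \<bar>\<eta> t - \<zeta> t\<bar>)" using \<eta> \<zeta> by (auto simp: adm_def intro!: continuous_intros)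
  obtain y where y: "y \<in> Ix" "\<And>t. t \<in> Ix \<Longrightarrow> \<bar>\<eta> t - \<zeta> t\<bar> \<le> \<bar>\<eta> y - \<zeta> y\<bar>"
    using continuous_attains_sup[OF _ _ c] x0_Ix by (metis compact_Icc empty_iff)
  have "\<bar>\<eta> y - \<zeta> y\<bar> = \<bar>Tf \<eta> y - Tf \<zeta> y\<bar>" using \<eta> \<zeta> y by simp
  also have "\<dots> \<le> 2 * (1/8 + Cst * \<epsilon>) * \<bar>\<eta> y - \<zeta> y\<bar>" by (rule Tf_diff[OF \<eta>(1) \<zeta>(1) _ y]) simp
  also have "\<dots> \<le> (1/2) * \<bar>\<eta> y - \<zeta> y\<bar>" using C by (intro mult_right_mono) auto
  finally have "\<bar>\<eta> y - \<zeta> y\<bar> = 0" by simp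
  then show ?thesis using y(2)[OF x] by simp
qed

text \<open>Banach's theorem in a ball of bounded continuous functions on the whole line.
  \<open>Tf\<close> sees only the values on \<open>Ix\<close>, and its result is extended constantly
  beyond the ends by \<open>clamp\<close>.\<close>

lemma fixpoint_exists:
  assumes r: "0 < r" "r \<le> 1/8" and C: "Cst * \<epsilon> \<le> r / 8"
  obtains \<eta> where "adm r \<eta>" "\<And>x. x \<in> Ix \<Longrightarrow> \<eta> x = Tf \<eta> x"
proof -
  \<comment> \<open>With \<open>Tf_bound\<close> this leaves \<open>r / 8 + r / 4\<close>, so the
    ball is mapped into itself.\<close>
  have r2: "r\<^sup>2 \<le> r / 8" using r by (simp add: power2_eq_square)
  have "\<exists>g :: real \<Rightarrow>\<^sub>C real. \<forall>x. apply_bcontfun g x = Tf (apply_bcontfun f) (clamp x0 1 x)" for f :: "real \<Rightarrow>\<^sub>C real"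
  proof -
    have "continuous_on (cbox x0 1) (Tf (apply_bcontfun f))" unfolding cbox_interval
      by (rule Tf_cont) (rule continuous_on_apply_bcontfun)
    then show ?thesis using continuous_on_cbox_bcontfunE by metis
  qed
  then obtain G :: "(real \<Rightarrow>\<^sub>C real) \<Rightarrow> (real \<Rightarrow>\<^sub>C real)" where G: "\<And>f x. apply_bcontfun (G f) x = Tf (apply_bcontfun f) (clamp x0 1 x)"
    by metis
  have cl: "clamp x0 1 x \<in> Ix" for x using clamp_in_interval[of x0 1 x] x0_lt by (simp add: cbox_interval)
  have adm: "adm r (apply_bcontfun f)" if "f \<in> cball 0 r" for f
    unfolding adm_def
  proof (intro conjI ballI continuous_on_apply_bcontfun)
    fix t
    have "norm f \<le> r" using that by simp
    then show "\<bar>apply_bcontfun f t\<bar> \<le> r" using norm_bounded[of f t] by simp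
  qed
  have "\<exists>!f\<in>cball 0 r. G f = f"
  proof (rule Banach_fix[of _ "1/2"])
    show "complete (cball (0 :: real \<Rightarrow>\<^sub>C real) r)" by (simp add: complete_eq_closed)
    show "cball (0 :: real \<Rightarrow>\<^sub>C real) r \<noteq> {}" using r by simp
    show "G ` cball 0 r \<subseteq> cball 0 r"
    proof safe
      fix f :: "real \<Rightarrow>\<^sub>C real" assume f: "f \<in> cball 0 r"
      have "norm (apply_bcontfun (G f) x) \<le> r" for x
        using Tf_bound[OF adm[OF f] _ cl[of x]] r r2 C by (simp add: G)
      then have "norm (G f) \<le> r" by (rule norm_bound)
      then show "G f \<in> cball 0 r" by simp
    qed
    fix f g :: "real \<Rightarrow>\<^sub>C real" assume f: "f \<in> cball 0 r" and g: "g \<in> cball 0 r"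
    show "dist (G f) (G g) \<le> 1/2 * dist f g"
    proof (rule dist_bound)
      fix x
      have "dist (apply_bcontfun (G f) x) (apply_bcontfun (G g) x) \<le> 2 * (r + Cst * \<epsilon>) * dist f g"
        unfolding G dist_real_def
      proof (rule Tf_diff[OF adm[OF f] adm[OF g] _ cl])
        show "\<bar>apply_bcontfun f t - apply_bcontfun g t\<bar> \<le> dist f g" for t
          using dist_bounded[of f t g] by (simp add: dist_real_def)
      qed (use r in simp)
      also have "\<dots> \<le> 1/2 * dist f g" using r C by (intro mult_right_mono) auto
      finally show "dist (apply_bcontfun (G f) x) (apply_bcontfun (G g) x) \<le> 1/2 * dist f g" .
    qed
  qed auto
  then obtain f where f: "f \<in> cball 0 r" "G f = f" by blast
  show ?thesis
  proof (rule that[OF adm[OF f(1)]])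
    fix x assume "x \<in> Ix"
    then have "clamp x0 1 x = x" by (intro clamp_cancel_cbox) (simp add: cbox_interval)
    then show "apply_bcontfun f x = Tf (apply_bcontfun f) x" using G[of f x] f(2) by simp
  qed
qed

end

section \<open>Uniqueness for the Riccati equation\<close>

context reduced begin

text \<open>The difference d of two solutions satisfies d' = - h d with \<open>h\<close> their mean,
  hence \<open>En h\<close> times d is constant; it vanishes at \<open>x0\<close> by the definition
  of \<open>Tf\<close>. This covers solutions of any size.\<close>

lemma riccati_unique:
  assumes \<eta>: "continuous_on Ix \<eta>" "\<And>x. x \<in> Ix \<Longrightarrow> \<eta> x = Tf \<eta> x" and \<zeta>: "continuous_on Ix \<zeta>" "\<And>x. x \<in> Ix \<Longrightarrow> \<zeta> x = Tf \<zeta> x"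
    and Q: "\<And>x. x \<in> Ix \<Longrightarrow> Qf \<eta> x = Qf \<zeta> x" and x: "x \<in> Ix"
  shows "\<eta> x = \<zeta> x"
proof -
  define h where "h = (\<lambda>t. (\<eta> t + \<zeta> t) / 2)"
  have h: "continuous_on Ix h" unfolding h_def by (intro continuous_intros \<eta> \<zeta>) auto
  have "En h x * (Tf \<eta> x - Tf \<zeta> x) = En h x0 * (Tf \<eta> x0 - Tf \<zeta> x0)"
  proof (rule const_Ix[OF _ _ x x0_Ix(1), where H = "\<lambda>x. En h x * (Tf \<eta> x - Tf \<zeta> x)"])
    show "continuous_on Ix (\<lambda>x. En h x * (Tf \<eta> x - Tf \<zeta> x))" by (intro continuous_intros En_cont Tf_cont h \<eta> \<zeta>)
    fix t assume t: "x0 < t" "t < 1"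
    then have tI: "t \<in> Ix" by auto
    have 1: "(Tf \<eta> has_real_derivative - ((\<eta> t)\<^sup>2 / 2 + Qf \<eta> t)) (at t)" "(Tf \<zeta> has_real_derivative - ((\<zeta> t)\<^sup>2 / 2 + Qf \<zeta> t)) (at t)"
      using Tf_deriv[OF \<eta>(1) tI] Tf_deriv[OF \<zeta>(1) tI] at_Ix[OF t] by auto
    have "((\<lambda>x. En h x * (Tf \<eta> x - Tf \<zeta> x)) has_real_derivative
       En h t * (- ((\<eta> t)\<^sup>2 / 2 + Qf \<eta> t) - - ((\<zeta> t)\<^sup>2 / 2 + Qf \<zeta> t)) + h t * En h t * (Tf \<eta> t - Tf \<zeta> t)) (at t)"
      using DERIV_mult[OF En_deriv_open[OF h t] DERIV_diff[OF 1]] by (simp only: mult_ac add_ac)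
    also have "En h t * (- ((\<eta> t)\<^sup>2 / 2 + Qf \<eta> t) - - ((\<zeta> t)\<^sup>2 / 2 + Qf \<zeta> t)) + h t * En h t * (Tf \<eta> t - Tf \<zeta> t) = 0"
      unfolding \<eta>(2)[OF tI, symmetric] \<zeta>(2)[OF tI, symmetric] Q[OF tI] h_def by (simp add: power2_eq_square field_simps)
    finally show "((\<lambda>x. En h x * (Tf \<eta> x - Tf \<zeta> x)) has_real_derivative 0) (at t)" .
  qed
  then have "Tf \<eta> x = Tf \<zeta> x" by (simp add: Tf_def)
  then show ?thesis using \<eta> \<zeta> x by simp
qed

lemma no_swirl:
  assumes "\<And>t. t \<in> Ix \<Longrightarrow> \<tau> t = 0" "x \<in> Ix" shows "sp \<eta> x = 0" "sg \<eta> x = 0"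
proof -
  have V: "Vp \<eta> t = 0" if "t \<in> Ix" for t
    unfolding Vp_def using prim_cong[of "\<lambda>t. En \<eta> t * \<tau> t" "\<lambda>_. 0", OF _ that] assms(1) by (simp add: prim_def)
  have "prim (\<lambda>t. Vp \<eta> t / En \<eta> t) 1 = prim (\<lambda>_. 0) 1" by (rule prim_cong) (use V x0_Ix in auto)
  then have A: "A0 \<eta> = 0" by (simp add: A0_def prim_def)
  have sp0: "sp \<eta> t = 0" if "t \<in> Ix" for t using V[OF that] A by (simp add: sp_def)
  show "sp \<eta> x = 0" by (rule sp0[OF assms(2)])
  have "avg 0 (\<lambda>t. - sp \<eta> t) x = avg 0 (\<lambda>_. 0) x" by (rule avg_cong[OF _ assms(2)]) (simp only: sp0 minus_zero)
  then show "sg \<eta> x = 0" using avg_const[OF assms(2), of 0 0] by (simp add: sg_def)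
qed

lemma no_swirl_Qf:
  assumes "\<And>t. t \<in> Ix \<Longrightarrow> \<tau> t = 0" "x \<in> Ix" shows "Qf \<eta> x = Qf \<zeta> x"
proof -
  have K: "Kf \<eta> t = Kf \<zeta> t" if "t \<in> Ix" for t
  proof -
    have "tail (\<lambda>t. t * (sg \<eta> t)\<^sup>2) t = tail (\<lambda>t. t * (sg \<zeta> t)\<^sup>2) t"
      by (rule tail_cong[OF _ that]) (simp only: no_swirl(2)[OF assms(1)])
    then show ?thesis unfolding Kf_def by (simp only: no_swirl(2)[OF assms(1) that])
  qed
  have "Mk (Kf \<eta>) t = Mk (Kf \<zeta>) t" if "t \<in> Ix" for t
    unfolding Mk_def by (intro avg_cong[OF avg_cong[OF K]] that)
  then show ?thesis unfolding Qf_def using assms(2) x0_Ix(1) by metis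
qed

end

lemma e_rho_nth: "e_rho \<phi> \<theta> $ 1 = sin \<phi> * cos \<theta>" "e_rho \<phi> \<theta> $ 2 = sin \<phi> * sin \<theta>" "e_rho \<phi> \<theta> $ 3 = cos \<phi>"
  by (simp_all add: e_rho_def)

lemma e_theta_nth: "e_theta \<theta> $ 1 = - sin \<theta>" "e_theta \<theta> $ 2 = cos \<theta>" "e_theta \<theta> $ 3 = 0"
  by (simp_all add: e_theta_def)

lemma e_phi_nth: "e_phi \<phi> \<theta> $ 1 = cos \<phi> * cos \<theta>" "e_phi \<phi> \<theta> $ 2 = cos \<phi> * sin \<theta>" "e_phi \<phi> \<theta> $ 3 = - sin \<phi>"
proof -
  have "sin \<theta> * sin \<theta> + cos \<theta> * cos \<theta> = 1" using sin_cos_squared_add[of \<theta>] by (simp add: power2_eq_square)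
  then have "- (sin \<phi> * (sin \<theta> * sin \<theta>)) - sin \<phi> * (cos \<theta> * cos \<theta>) = - sin \<phi>"
    by (metis (no_types, opaque_lifting) distrib_left minus_diff_eq minus_diff_minus mult.right_neutral uminus_add_conv_diff diff_minus_eq_add)
  then show "e_phi \<phi> \<theta> $ 3 = - sin \<phi>"
    by (simp add: e_phi_def cross3_def e_rho_nth e_theta_nth mult_ac)
qed (simp_all add: e_phi_def cross3_def e_rho_nth e_theta_nth mult_ac)

lemma sph_frame_expand:
  "y = (y \<bullet> e_rho \<phi> \<theta>) *\<^sub>R e_rho \<phi> \<theta> + (y \<bullet> e_phi \<phi> \<theta>) *\<^sub>R e_phi \<phi> \<theta> + (y \<bullet> e_theta \<theta>) *\<^sub>R e_theta \<theta>"
proof -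
  have e1: "sin \<phi> * sin \<phi> = 1 - cos \<phi> * cos \<phi>" and e2: "sin \<theta> * sin \<theta> = 1 - cos \<theta> * cos \<theta>"
    using sin_cos_squared_add[of \<phi>] sin_cos_squared_add[of \<theta>] by (simp_all add: power2_eq_square)
  show ?thesis using e1 e2
    by (simp add: vec_eq_iff forall_3 inner_vec_def sum_3 e_rho_nth e_phi_nth e_theta_nth) algebra
qed

lemma sph_frame_inner:
  "e_rho \<phi> \<theta> \<bullet> e_rho \<phi> \<theta> = 1" "e_phi \<phi> \<theta> \<bullet> e_phi \<phi> \<theta> = 1" "e_theta \<theta> \<bullet> e_theta \<theta> = 1"
  "e_rho \<phi> \<theta> \<bullet> e_phi \<phi> \<theta> = 0" "e_rho \<phi> \<theta> \<bullet> e_theta \<theta> = 0" "e_phi \<phi> \<theta> \<bullet> e_theta \<theta> = 0"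
  "e_phi \<phi> \<theta> \<bullet> e_rho \<phi> \<theta> = 0" "e_theta \<theta> \<bullet> e_rho \<phi> \<theta> = 0" "e_theta \<theta> \<bullet> e_phi \<phi> \<theta> = 0"
proof -
  have e1: "sin \<phi> * sin \<phi> = 1 - cos \<phi> * cos \<phi>" and e2: "sin \<theta> * sin \<theta> = 1 - cos \<theta> * cos \<theta>"
    using sin_cos_squared_add[of \<phi>] sin_cos_squared_add[of \<theta>] by (simp_all add: power2_eq_square)
  note d = inner_vec_def sum_3 e_rho_nth e_phi_nth e_theta_nth
  show "e_rho \<phi> \<theta> \<bullet> e_rho \<phi> \<theta> = 1" using e1 e2 by (simp add: d, algebra)
  show "e_phi \<phi> \<theta> \<bullet> e_phi \<phi> \<theta> = 1" using e1 e2 by (simp add: d, algebra)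
  show "e_theta \<theta> \<bullet> e_theta \<theta> = 1" using e2 by (simp add: d)
  show "e_rho \<phi> \<theta> \<bullet> e_phi \<phi> \<theta> = 0" using e1 e2 by (simp add: d, algebra)
  then show "e_phi \<phi> \<theta> \<bullet> e_rho \<phi> \<theta> = 0" by (simp add: inner_commute)
  show "e_rho \<phi> \<theta> \<bullet> e_theta \<theta> = 0" "e_phi \<phi> \<theta> \<bullet> e_theta \<theta> = 0"
     "e_theta \<theta> \<bullet> e_rho \<phi> \<theta> = 0" "e_theta \<theta> \<bullet> e_phi \<phi> \<theta> = 0" by (simp_all add: d)
qed

section \<open>Profiles of axisymmetric fields\<close>

text \<open>The unit meridian at \<open>\<theta> = 2 * pi\<close>, the angle 0 being outside the
  range (0, 2\<pi>]; profiles are read off along it.\<close>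

definition gam :: "real \<Rightarrow> real^3" where "gam \<phi> = sin \<phi> *\<^sub>R axis 1 1 + cos \<phi> *\<^sub>R e3"
definition gamd :: "real \<Rightarrow> real^3" where "gamd \<phi> = cos \<phi> *\<^sub>R axis 1 1 - sin \<phi> *\<^sub>R e3"

lemma gam_eq: "gam \<phi> = spherical 1 \<phi> (2 * pi)" "gam \<phi> = e_rho \<phi> (2 * pi)" "gamd \<phi> = e_phi \<phi> (2 * pi)" "axis 2 1 = e_theta (2 * pi)"
  by (simp_all add: vec_eq_iff forall_3 gam_def gamd_def axis_nth e_rho_nth e_phi_nth e_theta_nth)

lemma gam_deriv: "(gam has_vector_derivative gamd \<phi>) (at \<phi> within T)"
  unfolding gam_def[abs_def] gamd_def by (auto intro!: derivative_eq_intros)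

lemma gamd_deriv: "(gamd has_vector_derivative - gam \<phi>) (at \<phi> within T)"
  unfolding gamd_def[abs_def] gam_def by (auto intro!: derivative_eq_intros)

definition prR :: "(real^3 \<Rightarrow> real^3) \<Rightarrow> real \<Rightarrow> real" where "prR v \<phi> = v (gam \<phi>) \<bullet> gam \<phi>"
definition prP :: "(real^3 \<Rightarrow> real^3) \<Rightarrow> real \<Rightarrow> real" where "prP v \<phi> = v (gam \<phi>) \<bullet> gamd \<phi>"
definition prT :: "(real^3 \<Rightarrow> real^3) \<Rightarrow> real \<Rightarrow> real" where "prT v \<phi> = v (gam \<phi>) \<bullet> axis 2 1"

context cone begin

lemma gam_S: "0 \<le> \<phi> \<Longrightarrow> \<phi> \<le> \<phi>0 \<Longrightarrow> gam \<phi> \<in> S"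
  unfolding gam_eq by (rule spherical_in_S) auto

lemma axisym_components:
  assumes "axisymmetric \<phi>0 v" "0 \<le> \<phi>" "\<phi> \<le> \<phi>0" "0 < \<theta>" "\<theta> \<le> 2 * pi"
  shows "v (spherical 1 \<phi> \<theta>) = prR v \<phi> *\<^sub>R e_rho \<phi> \<theta> + prP v \<phi> *\<^sub>R e_phi \<phi> \<theta> + prT v \<phi> *\<^sub>R e_theta \<theta>"
proof -
  have "\<theta> \<in> {0<..2*pi}" "2*pi \<in> {0<..2*pi}" "\<phi> \<in> {0..\<phi>0}" using assms by auto
  then have "v_rho v 1 \<phi> \<theta> = v_rho v 1 \<phi> (2*pi)" "v_phi v 1 \<phi> \<theta> = v_phi v 1 \<phi> (2*pi)" "v_theta v 1 \<phi> \<theta> = v_theta v 1 \<phi> (2*pi)"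
    using assms(1) unfolding axisymmetric_def by (meson zero_less_one)+
  then have "v (spherical 1 \<phi> \<theta>) \<bullet> e_rho \<phi> \<theta> = prR v \<phi>" "v (spherical 1 \<phi> \<theta>) \<bullet> e_phi \<phi> \<theta> = prP v \<phi>" "v (spherical 1 \<phi> \<theta>) \<bullet> e_theta \<theta> = prT v \<phi>"
    unfolding v_rho_def v_phi_def v_theta_def prR_def prP_def prT_def gam_eq(3,4) by (simp_all add: gam_eq(1)[symmetric] gam_eq(2)[symmetric])
  then show ?thesis using sph_frame_expand[of "v (spherical 1 \<phi> \<theta>)" \<phi> \<theta>] by simp
qed

text \<open>At the pole the angles \<pi> and 2\<pi> describe the same point with opposite
  \<open>e_phi\<close> and \<open>e_theta\<close>, so components that do not depend on the angle
  must vanish.\<close>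

lemma axisym_axis: assumes "axisymmetric \<phi>0 v" shows "prP v 0 = 0" "prT v 0 = 0"
proof -
  have p: "0 \<le> \<phi>0" using phi0_pos by simp
  have s: "spherical 1 0 pi = gam 0" "spherical 1 0 (2*pi) = gam 0" by (simp_all add: vec_eq_iff forall_3 gam_def axis_nth)
  have "v (gam 0) = prR v 0 *\<^sub>R e_rho 0 pi + prP v 0 *\<^sub>R e_phi 0 pi + prT v 0 *\<^sub>R e_theta pi"
    using axisym_components[OF assms order_refl p, of pi] s by simp
  moreover have "v (gam 0) = prR v 0 *\<^sub>R e_rho 0 (2*pi) + prP v 0 *\<^sub>R e_phi 0 (2*pi) + prT v 0 *\<^sub>R e_theta (2*pi)"
    using axisym_components[OF assms order_refl p, of "2*pi"] s by simp
  ultimately have e: "(prR v 0 *\<^sub>R e_rho 0 pi + prP v 0 *\<^sub>R e_phi 0 pi + prT v 0 *\<^sub>R e_theta pi) $ i =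
    (prR v 0 *\<^sub>R e_rho 0 (2*pi) + prP v 0 *\<^sub>R e_phi 0 (2*pi) + prT v 0 *\<^sub>R e_theta (2*pi)) $ i" for i by metis
  show "prP v 0 = 0" using e[of 1] by (simp add: e_rho_nth e_phi_nth e_theta_nth)
  show "prT v 0 = 0" using e[of 2] by (simp add: e_rho_nth e_phi_nth e_theta_nth)
qed

lemma sph_coords:
  assumes "X \<in> S"
  obtains \<theta> where "0 < \<theta>" "\<theta> \<le> 2 * pi" "X = norm X *\<^sub>R spherical 1 (arccos (mu X)) \<theta>"
    "spherical 1 (arccos (mu X)) \<theta> \<in> S" "0 \<le> arccos (mu X)" "arccos (mu X) \<le> \<phi>0"
    "cos (arccos (mu X)) = mu X" "sin (arccos (mu X)) = sqrt (1 - (mu X)\<^sup>2)"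
proof -
  have X: "X \<noteq> 0" using S_nz[OF assms] .
  obtain \<theta> where \<theta>: "0 < \<theta>" "\<theta> \<le> 2*pi" "X = spherical (norm X) (arccos (mu X)) \<theta>" using spherical_surj[OF X] by blast
  have m: "x0 \<le> mu X" "mu X \<le> 1" "-1 \<le> mu X" using mu_mem[OF assms] x0_gt by auto
  have a: "0 \<le> arccos (mu X)" "arccos (mu X) \<le> \<phi>0"
  proof -
    show "0 \<le> arccos (mu X)" using m by (intro arccos_lbound) auto
    have "arccos (mu X) \<le> arccos x0" using m by (intro arccos_le_arccos) auto
    then show "arccos (mu X) \<le> \<phi>0" using phi0_pos phi0_pi by (simp add: arccos_cos)
  qed
  have "spherical (norm X) (arccos (mu X)) \<theta> = norm X *\<^sub>R spherical 1 (arccos (mu X)) \<theta>"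
    by (simp add: vec_eq_iff forall_3)
  then show ?thesis using that[OF \<theta>(1,2)] \<theta>(3) a spherical_in_S[of 1 "arccos (mu X)" \<theta>] m
    by (simp add: sin_arccos cos_arccos)
qed

text \<open>A factor sin \<phi> turns \<open>e_phi\<close> into cos \<phi> times
  \<open>e_rho\<close>, minus \<open>e3\<close>, and \<open>e_theta\<close> into
  \<open>rot_gen\<close> of \<open>e_rho\<close>. These combinations are determined by the point
  also on the axis.\<close>

lemma axisym_rep:
  assumes v: "axisymmetric \<phi>0 v" "homogeneous_on S k v" and X: "X \<in> S"
    and g: "prP v (arccos (mu X)) = sqrt (1 - (mu X)\<^sup>2) * g" and h: "prT v (arccos (mu X)) = sqrt (1 - (mu X)\<^sup>2) * h"
  shows "v X = (norm X powi k) *\<^sub>R (((prR v (arccos (mu X)) + mu X * g) * rinv X) *\<^sub>R X - g *\<^sub>R e3 + (h * rinv X) *\<^sub>R rot_gen X)"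
proof -
  define \<phi> where "\<phi> = arccos (mu X)"
  obtain \<theta> where \<theta>: "0 < \<theta>" "\<theta> \<le> 2 * pi" "X = norm X *\<^sub>R spherical 1 \<phi> \<theta>" "spherical 1 \<phi> \<theta> \<in> S" "0 \<le> \<phi>" "\<phi> \<le> \<phi>0"
    "cos \<phi> = mu X" "sin \<phi> = sqrt (1 - (mu X)\<^sup>2)"
    using sph_coords[OF X] unfolding \<phi>_def by blast
  have nX: "norm X > 0" using S_nz[OF X] by simp
  have "v X = (norm X powi k) *\<^sub>R v (spherical 1 \<phi> \<theta>)"
    using v(2) nX \<theta>(3,4) unfolding homogeneous_on_def by metis
  also have "v (spherical 1 \<phi> \<theta>) = prR v \<phi> *\<^sub>R e_rho \<phi> \<theta> + prP v \<phi> *\<^sub>R e_phi \<phi> \<theta> + prT v \<phi> *\<^sub>R e_theta \<theta>"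
    by (rule axisym_components[OF v(1) \<theta>(5,6,1,2)])
  also have "prP v \<phi> *\<^sub>R e_phi \<phi> \<theta> = g *\<^sub>R (sin \<phi> *\<^sub>R e_phi \<phi> \<theta>)" using g \<theta>(8) by (simp add: \<phi>_def)
  also have "prT v \<phi> *\<^sub>R e_theta \<theta> = h *\<^sub>R (sin \<phi> *\<^sub>R e_theta \<theta>)" using h \<theta>(8) by (simp add: \<phi>_def)
  also have "sin \<phi> *\<^sub>R e_phi \<phi> \<theta> = cos \<phi> *\<^sub>R e_rho \<phi> \<theta> - e3"
  proof -
    have "sin \<phi> * sin \<phi> + cos \<phi> * cos \<phi> = 1" using sin_cos_squared_add[of \<phi>] by (simp add: power2_eq_square)
    then show ?thesis by (simp add: vec_eq_iff forall_3 e_rho_nth e_phi_nth axis_nth)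
  qed
  also have "sin \<phi> *\<^sub>R e_theta \<theta> = rot_gen (e_rho \<phi> \<theta>)" by (simp add: vec_eq_iff forall_3 e_rho_nth e_theta_nth)
  also have "e_rho \<phi> \<theta> = rinv X *\<^sub>R X"
  proof -
    have "rinv X *\<^sub>R X = rinv X *\<^sub>R (norm X *\<^sub>R spherical 1 \<phi> \<theta>)" using \<theta>(3) by simp
    then show ?thesis using rinv_norm[OF S_nz[OF X]] by (simp add: e_rho_def)
  qed
  finally show ?thesis unfolding \<phi>_def[symmetric] \<theta>(7)
    by (simp add: linear_cmul[OF linear_rot_gen] algebra_simps)
qed

definition Phi where "Phi = {0..\<phi>0}"

text \<open>If a profile vanishes on the axis, dividing it by \<open>sin \<phi>\<close> keeps it continuous.\<close>

lemma div_sin_profile: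
  assumes d: "\<And>\<phi>. \<phi> \<in> Phi \<Longrightarrow> (P has_real_derivative P' \<phi>) (at \<phi> within Phi)" and P': "continuous_on Phi P'" and 0: "P 0 = 0"
  defines "\<kappa> \<equiv> \<lambda>x. if x = 1 then P' 0 else P (arccos x) / sqrt (1 - x\<^sup>2)"
  shows "continuous_on Ix \<kappa>" "bdw \<kappa>" "\<And>x. x \<in> Ix \<Longrightarrow> P (arccos x) = sqrt (1 - x\<^sup>2) * \<kappa> x"
proof -
  have arc: "arccos x \<in> Phi" if "x \<in> Ix" for x
  proof -
    have "arccos x \<le> arccos x0" using that x0_gt by (intro arccos_le_arccos) auto
    then show ?thesis using that x0_gt phi0_pos phi0_pi by (auto simp: Phi_def arccos_cos intro: arccos_lbound)
  qed
  have ac: "continuous_on Ix arccos" using x0_gt by (intro continuous_on_subset[OF continuous_on_arccos']) auto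
  have Pc: "continuous_on Phi P" by (rule DERIV_continuous_on[OF d])
  have sq: "1 - x\<^sup>2 > 0" if "x0 \<le> x" "x < 1" for x using that x0_gt by (simp add: abs_square_less_1)
  have darc: "(arccos has_real_derivative - 1 / sqrt (1 - x\<^sup>2)) (at x within Ix)" if "x0 \<le> x" "x < 1" for x
    using DERIV_arccos[of x] that x0_gt by (auto intro!: has_field_derivative_at_within simp: divide_inverse)
  have dP: "((\<lambda>x. P (arccos x)) has_real_derivative - P' (arccos x) / sqrt (1 - x\<^sup>2)) (at x within Ix)" if x: "x0 \<le> x" "x < 1" for x
  proof -
    have xI: "x \<in> Ix" using x by simp
    have "(P has_real_derivative P' (arccos x)) (at (arccos x) within arccos ` Ix)"
      using arc by (intro DERIV_subset[OF d[OF arc[OF xI]]]) auto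
    from DERIV_image_chain[OF this darc[OF x]] show ?thesis by (simp add: o_def)
  qed
  show e: "P (arccos x) = sqrt (1 - x\<^sup>2) * \<kappa> x" if "x \<in> Ix" for x
    using that 0 sq[of x] by (cases "x = 1") (auto simp: \<kappa>_def)
  show c: "continuous_on Ix \<kappa>"
    unfolding continuous_on_eq_continuous_within
  proof
    fix x assume x: "x \<in> Ix"
    show "continuous (at x within Ix) \<kappa>"
    proof (cases "x = 1")
      case False
      then have x': "x0 \<le> x" "x < 1" using x by auto
      have "continuous (at x within Ix) (\<lambda>x. P (arccos x) / sqrt (1 - x\<^sup>2))"
        using DERIV_continuous[OF dP[OF x']] sq[OF x'] by (intro continuous_intros) auto
      then show ?thesis
      proof (rule continuous_transform_within[where \<delta> = "1 - x"])
        show "P (arccos x') / sqrt (1 - x'\<^sup>2) = \<kappa> x'" if "x' \<in> Ix" "dist x' x < 1 - x" for x'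
          using that by (auto simp: \<kappa>_def dist_real_def)
      qed (use x' x in auto)
    next
      case True
      have P0: "0 \<in> Phi" using phi0_pos by (simp add: Phi_def)
      \<comment> \<open>Numerator and denominator both vanish on the axis, so the limit of
        \<open>P \<phi> / sin \<phi>\<close> is taken as a quotient of difference quotients.\<close>
      have "((\<lambda>\<phi>. (P \<phi> - P 0) / (\<phi> - 0)) \<longlongrightarrow> P' 0) (at 0 within Phi)"
        using d[OF P0] by (simp add: has_field_derivative_iff)
      moreover have "((\<lambda>\<phi>. (sin \<phi> - sin 0) / (\<phi> - 0)) \<longlongrightarrow> cos (0::real)) (at 0 within Phi)"
        using DERIV_sin[of 0 , THEN has_field_derivative_at_within, of Phi] by (simp add: has_field_derivative_iff)
      ultimately have "((\<lambda>\<phi>. ((P \<phi> - P 0) / (\<phi> - 0)) / ((sin \<phi> - sin 0) / (\<phi> - 0))) \<longlongrightarrow> P' 0 / cos 0) (at 0 within Phi)"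
        by (rule tendsto_divide) simp
      then have "((\<lambda>\<phi>. (P \<phi> / \<phi>) / (sin \<phi> / \<phi>)) \<longlongrightarrow> P' 0) (at 0 within Phi)" using 0 by simp
      then have l1: "((\<lambda>\<phi>. P \<phi> / sin \<phi>) \<longlongrightarrow> P' 0) (at 0 within Phi)"
        by (rule Lim_transform_eventually) (auto simp: eventually_at_filter)
      have "filterlim arccos (at 0 within Phi) (at 1 within Ix)"
        unfolding filterlim_at
      proof
        show "\<forall>\<^sub>F y in at 1 within Ix. arccos y \<in> Phi \<and> arccos y \<noteq> 0"
        proof -
          have "arccos y \<in> Phi \<and> arccos y \<noteq> 0" if "y \<in> Ix" "y \<noteq> 1" for y
          proof -
            have "cos (arccos y) = y" using that x0_gt by (intro cos_arccos) auto
            then show ?thesis using arc[OF that(1)] that(2) by (metis cos_zero)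
          qed
          then show ?thesis by (auto simp: eventually_at_filter)
        qed
        show "(arccos \<longlongrightarrow> 0) (at 1 within Ix)"
          using ac x0_Ix unfolding continuous_on_def by fastforce
      qed
      from filterlim_compose[OF l1 this] have "((\<lambda>y. P (arccos y) / sin (arccos y)) \<longlongrightarrow> P' 0) (at 1 within Ix)" .
      then have "(\<kappa> \<longlongrightarrow> P' 0) (at 1 within Ix)"
        by (rule Lim_transform_eventually) (use x0_gt in \<open>auto simp: eventually_at_filter \<kappa>_def sin_arccos\<close>)
      then show ?thesis using True by (simp add: continuous_within \<kappa>_def)
    qed
  qed
  obtain N where N: "N \<ge> 0" "\<And>x. x \<in> Ix \<Longrightarrow> \<bar>\<kappa> x\<bar> \<le> N" using continuous_on_Ix_bounded[OF c] by blast
  have "continuous_on Ix (\<lambda>x. P' (arccos x))" using continuous_on_compose2[OF P' ac] arc by blast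
  then obtain M where M: "M \<ge> 0" "\<And>x. x \<in> Ix \<Longrightarrow> \<bar>P' (arccos x)\<bar> \<le> M" using continuous_on_Ix_bounded by blast
  show "bdw \<kappa>"
  proof (rule bdwI[where N = N and d = "\<lambda>x. (x * \<kappa> x - P' (arccos x)) / (1 - x\<^sup>2)" and M = "(N + M) / (1 + x0)"])
    fix x assume x: "x0 \<le> x" "x < 1"
    have xI: "x \<in> Ix" using x by simp
    show "\<bar>\<kappa> x\<bar> \<le> N" by (rule N(2)[OF xI])
    have ds: "((\<lambda>x. sqrt (1 - x\<^sup>2)) has_real_derivative - x / sqrt (1 - x\<^sup>2)) (at x within Ix)"
      using sq[OF x] by (auto intro!: derivative_eq_intros simp: field_simps)
    have s0: "sqrt (1 - x\<^sup>2) \<noteq> 0" "sqrt (1 - x\<^sup>2) * sqrt (1 - x\<^sup>2) = 1 - x\<^sup>2" using sq[OF x] by auto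
    have "((\<lambda>x. P (arccos x) / sqrt (1 - x\<^sup>2)) has_real_derivative
       ((- P' (arccos x) / sqrt (1 - x\<^sup>2)) * sqrt (1 - x\<^sup>2) - P (arccos x) * (- x / sqrt (1 - x\<^sup>2))) / (sqrt (1 - x\<^sup>2) * sqrt (1 - x\<^sup>2))) (at x within Ix)"
      by (intro DERIV_divide dP ds x s0)
    also have "((- P' (arccos x) / sqrt (1 - x\<^sup>2)) * sqrt (1 - x\<^sup>2) - P (arccos x) * (- x / sqrt (1 - x\<^sup>2))) / (sqrt (1 - x\<^sup>2) * sqrt (1 - x\<^sup>2))
       = (x * \<kappa> x - P' (arccos x)) / (1 - x\<^sup>2)"
      unfolding s0(2) e[OF xI] using s0(1) by simp
    finally show "(\<kappa> has_real_derivative (x * \<kappa> x - P' (arccos x)) / (1 - x\<^sup>2)) (at x within Ix)"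
      by (rule has_field_derivative_transform_within[where d = "1 - x"]) (use x in \<open>auto simp: \<kappa>_def dist_real_def\<close>)
    have "\<bar>x * \<kappa> x - P' (arccos x)\<bar> \<le> 1 * N + M"
      using abs_triangle_ineq4[of "x * \<kappa> x" "P' (arccos x)"] mult_mono[OF Ix_bounds(5)[OF xI] N(2)[OF xI]] M(2)[OF xI]
      unfolding abs_mult by linarith
    then have "\<bar>x * \<kappa> x - P' (arccos x)\<bar> / (1 + x) \<le> (N + M) / (1 + x0)" using x x0_gt N M by (intro frac_le) auto
    moreover have "\<bar>(x * \<kappa> x - P' (arccos x)) / (1 - x\<^sup>2)\<bar> * (1 - x) = \<bar>x * \<kappa> x - P' (arccos x)\<bar> / (1 + x)"
    proof -
      have "1 - x\<^sup>2 = (1 + x) * (1 - x)" by (simp add: power2_eq_square algebra_simps)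
      then show ?thesis using x x0_gt by (simp add: abs_divide abs_mult)
    qed
    ultimately show "\<bar>(x * \<kappa> x - P' (arccos x)) / (1 - x\<^sup>2)\<bar> * (1 - x) \<le> (N + M) / (1 + x0)" by simp
  qed
qed

text \<open>Since d\<phi>/dx = - 1 / sin \<phi>, a C^1 function of \<phi> has an
  \<open>x\<close>-derivative of order \<open>1 / sqrt (1 - x)\<close>, which is what
  \<open>lip_wt\<close> allows.\<close>

lemma C1_profile:
  assumes d: "\<And>\<phi>. \<phi> \<in> Phi \<Longrightarrow> (P has_real_derivative P' \<phi>) (at \<phi> within Phi)" and P': "continuous_on Phi P'"
  shows "lip_wt (\<lambda>x. P (arccos x))"
    "\<And>x. x0 \<le> x \<Longrightarrow> x < 1 \<Longrightarrow> ((\<lambda>x. P (arccos x)) has_real_derivative - P' (arccos x) / sqrt (1 - x\<^sup>2)) (at x within Ix)"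
proof -
  have arc: "arccos x \<in> Phi" if "x \<in> Ix" for x
  proof -
    have "arccos x \<le> arccos x0" using that x0_gt by (intro arccos_le_arccos) auto
    then show ?thesis using that x0_gt phi0_pos phi0_pi by (auto simp: Phi_def arccos_cos intro: arccos_lbound)
  qed
  have ac: "continuous_on Ix arccos" using x0_gt by (intro continuous_on_subset[OF continuous_on_arccos']) auto
  have Pc: "continuous_on Phi P" by (rule DERIV_continuous_on[OF d])
  have darc: "(arccos has_real_derivative - 1 / sqrt (1 - x\<^sup>2)) (at x within Ix)" if "x0 \<le> x" "x < 1" for x
    using DERIV_arccos[of x] that x0_gt by (auto intro!: has_field_derivative_at_within simp: divide_inverse)
  show dP: "((\<lambda>x. P (arccos x)) has_real_derivative - P' (arccos x) / sqrt (1 - x\<^sup>2)) (at x within Ix)" if x: "x0 \<le> x" "x < 1" for x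
  proof -
    have xI: "x \<in> Ix" using x by simp
    have "(P has_real_derivative P' (arccos x)) (at (arccos x) within arccos ` Ix)"
      using arc by (intro DERIV_subset[OF d[OF arc[OF xI]]]) auto
    from DERIV_image_chain[OF this darc[OF x]] show ?thesis by (simp add: o_def)
  qed
  have "continuous_on Ix (\<lambda>x. P' (arccos x))" using continuous_on_compose2[OF P' ac] arc by blast
  then obtain M where M: "M \<ge> 0" "\<And>x. x \<in> Ix \<Longrightarrow> \<bar>P' (arccos x)\<bar> \<le> M" using continuous_on_Ix_bounded by blast
  show "lip_wt (\<lambda>x. P (arccos x))"
  proof (rule lip_wtI[OF _ dP, where M = "M / sqrt (1 + x0)"])
    show "continuous_on Ix (\<lambda>x. P (arccos x))" using continuous_on_compose2[OF Pc ac] arc by blast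
    fix x assume x: "x0 \<le> x" "x < 1"
    have "1 - x\<^sup>2 = (1 + x) * (1 - x)" by (simp add: power2_eq_square algebra_simps)
    then have "\<bar>- P' (arccos x) / sqrt (1 - x\<^sup>2)\<bar> * sqrt (1 - x) = \<bar>P' (arccos x)\<bar> / sqrt (1 + x)"
      using x x0_gt by (simp add: abs_divide abs_mult real_sqrt_mult)
    also have "\<dots> \<le> M / sqrt (1 + x0)" using M x x0_gt by (intro frac_le) auto
    finally show "\<bar>- P' (arccos x) / sqrt (1 - x\<^sup>2)\<bar> * sqrt (1 - x) \<le> M / sqrt (1 + x0)" .
  qed auto
qed

lemma lip_wt_lip0: assumes "lip_wt \<beta>" "\<beta> 1 = 0" shows "lip0 \<beta>"
proof -
  obtain M where M: "M \<ge> 0" "\<And>x y. x \<in> Ix \<Longrightarrow> y \<in> Ix \<Longrightarrow> \<bar>\<beta> x - \<beta> y\<bar> \<le> M * \<bar>sqrt (1 - x) - sqrt (1 - y)\<bar>"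
    using lip_wt_increment[OF assms(1)] by blast
  have "\<bar>\<beta> x\<bar> \<le> M * sqrt (1 - x)" if "x \<in> Ix" for x
    using M(2)[OF that x0_Ix(2)] assms(2) that by simp
  then show ?thesis unfolding lip0_def using assms(1) by blast
qed

end

section \<open>Derivatives of homogeneous axisymmetric fields and their curl\<close>

lemma powi_deriv_at_0: "((\<lambda>t::real. (1 + t) powi k) has_real_derivative of_int k) (at 0 within T)"
  by (auto intro!: derivative_eq_intros)

context cone begin

text \<open>Assembled from the partial derivatives, so that their regularity passes to derivatives
  in a moving direction.\<close>

definition dW :: "(real^3 \<Rightarrow> 'b::real_normed_vector) \<Rightarrow> real^3 \<Rightarrow> real^3 \<Rightarrow> 'b" where
  "dW v X h = (\<Sum>i\<in>UNIV. (h $ i) *\<^sub>R partial_within S i v X)"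

lemma dW_has_derivative:
  assumes "v differentiable_on S" "X \<in> S" shows "(v has_derivative dW v X) (at X within S)"
proof -
  obtain f' where f': "(v has_derivative f') (at X within S)" "\<And>i. partial_within S i v X = f' (axis i 1)"
    using diff_on_has_derivative[OF assms] by blast
  have "linear f'" using f'(1) has_derivative_bounded_linear bounded_linear.linear by blast
  then have "dW v X h = f' h" for h unfolding dW_def f'(2) by (rule sum_axis_linear)
  then have "dW v X = f'" by blast
  then show ?thesis using f'(1) by simp
qed

lemma dW_linear: "v differentiable_on S \<Longrightarrow> X \<in> S \<Longrightarrow> linear (dW v X)"
  using dW_has_derivative has_derivative_bounded_linear bounded_linear.linear by blast

lemma dW_axis: "dW v X (axis i 1) = partial_within S i v X"
proof -
  have "dW v X (axis i 1) = (\<Sum>j\<in>UNIV. if j = i then partial_within S j v X else 0)"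
    unfolding dW_def axis_nth by (rule sum.cong) auto
  then show ?thesis by simp
qed

lemma dW_curve:
  assumes "v differentiable_on S" "(g has_vector_derivative w) (at t within T)" "g ` T \<subseteq> S" "t \<in> T"
  shows "((\<lambda>s. v (g s)) has_vector_derivative dW v (g t) w) (at t within T)"
proof -
  have "(v has_derivative dW v (g t)) (at (g t) within g ` T)"
    using dW_has_derivative[OF assms(1), of "g t"] assms(3,4) by (auto intro: has_derivative_subset)
  from vector_derivative_diff_chain_within[OF assms(2) this] show ?thesis by (simp add: o_def)
qed

text \<open>Euler's identity. The ray \<open>(1 + t) *\<^sub>R X\<close> with \<open>t\<close> in
  [0, 1] stays in the cone, so one-sided differentiation also covers the boundary.\<close>

lemma euler_homogeneous:
  assumes "v differentiable_on S" "homogeneous_on S k v" "X \<in> S"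
  shows "dW v X X = of_int k *\<^sub>R v X"
proof -
  have "((\<lambda>t. (1 + t) *\<^sub>R X) has_vector_derivative X) (at 0 within {0..1})"
    by (auto intro!: derivative_eq_intros)
  then have "((\<lambda>t. v ((1 + t) *\<^sub>R X)) has_vector_derivative dW v ((1 + 0) *\<^sub>R X) X) (at 0 within {0..1})"
    by (rule dW_curve[OF assms(1)]) (use assms in \<open>auto intro!: scale_S\<close>)
  then have 1: "((\<lambda>t. v ((1 + t) *\<^sub>R X)) has_vector_derivative dW v X X) (at 0 within {0..1})" by simp
  have "((\<lambda>t. ((1 + t) powi k) *\<^sub>R v X) has_vector_derivative (of_int k *\<^sub>R v X)) (at 0 within {0..1})"
    using powi_deriv_at_0[of k "{0..1}"] by (auto intro!: derivative_eq_intros)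
  moreover have "v ((1 + t) *\<^sub>R X) = ((1 + t) powi k) *\<^sub>R v X" if "t \<in> {0..1}" for t
    using assms(2,3) that unfolding homogeneous_on_def by auto
  ultimately have 2: "((\<lambda>t. v ((1 + t) *\<^sub>R X)) has_vector_derivative (of_int k *\<^sub>R v X)) (at 0 within {0..1})"
    using has_vector_derivative_transform[of 0 "{0..1}" "\<lambda>t. v ((1 + t) *\<^sub>R X)" "\<lambda>t. ((1 + t) powi k) *\<^sub>R v X"] by simp
  show ?thesis using vector_derivative_unique_within_closed_interval[of 0 1 0, unfolded cbox_interval, OF _ _ 1 2] by auto
qed

lemma Phi_gam: "gam ` Phi \<subseteq> S" using gam_S by (auto simp: Phi_def)

lemma gam_vderiv:
  assumes "v differentiable_on S" "\<phi> \<in> Phi"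
  shows "((\<lambda>\<phi>. v (gam \<phi>)) has_vector_derivative dW v (gam \<phi>) (gamd \<phi>)) (at \<phi> within Phi)"
  by (rule dW_curve[OF assms(1) gam_deriv Phi_gam assms(2)])

lemma has_vector_derivative_inner:
  assumes "(f has_vector_derivative f') (at x within T)" "(g has_vector_derivative g') (at x within T)"
  shows "((\<lambda>x. f x \<bullet> g x) has_real_derivative f' \<bullet> g x + f x \<bullet> g') (at x within T)"
proof -
  have "((\<lambda>x. f x \<bullet> g x) has_derivative (\<lambda>h. f x \<bullet> (h *\<^sub>R g') + (h *\<^sub>R f') \<bullet> g x)) (at x within T)"
    using assms unfolding has_vector_derivative_def by (rule has_derivative_inner)
  then show ?thesis unfolding has_field_derivative_def
    by (rule has_derivative_eq_rhs) (auto simp: algebra_simps)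
qed

lemma profile_derivs:
  assumes "v differentiable_on S" "\<phi> \<in> Phi"
  shows "(prR v has_real_derivative dW v (gam \<phi>) (gamd \<phi>) \<bullet> gam \<phi> + prP v \<phi>) (at \<phi> within Phi)"
    "(prP v has_real_derivative dW v (gam \<phi>) (gamd \<phi>) \<bullet> gamd \<phi> - prR v \<phi>) (at \<phi> within Phi)"
    "(prT v has_real_derivative dW v (gam \<phi>) (gamd \<phi>) \<bullet> axis 2 1) (at \<phi> within Phi)"
  unfolding prR_def[abs_def] prP_def[abs_def] prT_def[abs_def]
  using has_vector_derivative_inner[OF gam_vderiv[OF assms] gam_deriv] has_vector_derivative_inner[OF gam_vderiv[OF assms] gamd_deriv]
    has_vector_derivative_inner[OF gam_vderiv[OF assms] has_vector_derivative_const[of "axis 2 1"]]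
  by simp_all

lemma Ck_1: "Ck_on 1 S v \<longleftrightarrow> v differentiable_on S \<and> (\<forall>i. continuous_on S (partial_within S i v))"
  by (simp add: One_nat_def)

lemma gam_cont: "continuous_on T gam" "continuous_on T gamd"
  unfolding gam_def[abs_def] gamd_def[abs_def] by (intro continuous_intros)+

lemma dW_gam_cont:
  assumes "Ck_on 1 S v" shows "continuous_on Phi (\<lambda>\<phi>. dW v (gam \<phi>) (gamd \<phi>))"
proof -
  have "continuous_on Phi (\<lambda>\<phi>. partial_within S i v (gam \<phi>))" for i
    using assms Phi_gam by (intro continuous_on_compose2[OF _ gam_cont(1)]) (auto simp: Ck_1)
  then show ?thesis unfolding dW_def by (intro continuous_intros gam_cont)
qed

lemma profile_cont:
  assumes "continuous_on S v" shows "continuous_on Phi (prR v)" "continuous_on Phi (prP v)" "continuous_on Phi (prT v)"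
proof -
  have "continuous_on Phi (\<lambda>\<phi>. v (gam \<phi>))" by (rule continuous_on_compose2[OF assms gam_cont(1) Phi_gam])
  then show "continuous_on Phi (prR v)" "continuous_on Phi (prP v)" "continuous_on Phi (prT v)"
    unfolding prR_def[abs_def] prP_def[abs_def] prT_def[abs_def] by (intro continuous_intros gam_cont; assumption)+
qed

text \<open>The field is differentiated along a circle of latitude, where its frame components are
  constant. The range of the angle ends at 2\<pi>, hence the derivative is taken from the left, on
  [\<pi>, 2\<pi>].\<close>

lemma rotation_derivative:
  assumes v: "v differentiable_on S" "axisymmetric \<phi>0 v" and \<phi>: "0 \<le> \<phi>" "\<phi> \<le> \<phi>0"
  shows "sin \<phi> *\<^sub>R partial_within S 2 v (gam \<phi>) = (prR v \<phi> * sin \<phi> + prP v \<phi> * cos \<phi>) *\<^sub>R axis 2 1 - prT v \<phi> *\<^sub>R axis 1 1"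
proof -
  define T where "T = {pi..2*pi}"
  define g where "g = (\<lambda>\<theta>. spherical 1 \<phi> \<theta>)"
  have e: "g (2*pi) = gam \<phi>" by (simp add: g_def gam_eq)
  have gS: "g ` T \<subseteq> S" using \<phi> by (auto simp: g_def intro!: spherical_in_S)
  have "(g has_vector_derivative sin \<phi> *\<^sub>R axis 2 1) (at (2*pi) within T)"
    unfolding g_def spherical_eq by (auto intro!: derivative_eq_intros)
  from dW_curve[OF v(1) this gS]
  have 1: "((\<lambda>\<theta>. v (g \<theta>)) has_vector_derivative dW v (gam \<phi>) (sin \<phi> *\<^sub>R axis 2 1)) (at (2*pi) within T)"
    by (simp add: e T_def)
  have r: "e_rho \<phi> \<theta> = (sin \<phi> * cos \<theta>) *\<^sub>R axis 1 1 + (sin \<phi> * sin \<theta>) *\<^sub>R axis 2 1 + cos \<phi> *\<^sub>R e3"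
    "e_phi \<phi> \<theta> = (cos \<phi> * cos \<theta>) *\<^sub>R axis 1 1 + (cos \<phi> * sin \<theta>) *\<^sub>R axis 2 1 - sin \<phi> *\<^sub>R e3"
    "e_theta \<theta> = - sin \<theta> *\<^sub>R axis 1 1 + cos \<theta> *\<^sub>R axis 2 1" for \<theta>
    by (simp_all add: vec_eq_iff forall_3 e_rho_nth e_phi_nth e_theta_nth axis_nth)
  define w where "w = (\<lambda>\<theta>. prR v \<phi> *\<^sub>R e_rho \<phi> \<theta> + prP v \<phi> *\<^sub>R e_phi \<phi> \<theta> + prT v \<phi> *\<^sub>R e_theta \<theta>)"
  have "(w has_vector_derivative (prR v \<phi> * sin \<phi> + prP v \<phi> * cos \<phi>) *\<^sub>R axis 2 1 - prT v \<phi> *\<^sub>R axis 1 1) (at (2*pi) within T)"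
    unfolding w_def r by (auto intro!: derivative_eq_intros simp: algebra_simps)
  moreover have "v (g \<theta>) = w \<theta>" if "\<theta> \<in> T" for \<theta>
  proof -
    have "0 < \<theta>" "\<theta> \<le> 2*pi" using that less_le_trans[OF pi_gt_zero, of \<theta>] by (auto simp: T_def)
    from axisym_components[OF v(2) \<phi> this] show ?thesis by (simp add: w_def g_def)
  qed
  ultimately have 2: "((\<lambda>\<theta>. v (g \<theta>)) has_vector_derivative (prR v \<phi> * sin \<phi> + prP v \<phi> * cos \<phi>) *\<^sub>R axis 2 1 - prT v \<phi> *\<^sub>R axis 1 1) (at (2*pi) within T)"
    using has_vector_derivative_transform[of "2*pi" T "\<lambda>\<theta>. v (g \<theta>)" w] by (simp add: T_def)
  have "dW v (gam \<phi>) (sin \<phi> *\<^sub>R axis 2 1) = (prR v \<phi> * sin \<phi> + prP v \<phi> * cos \<phi>) *\<^sub>R axis 2 1 - prT v \<phi> *\<^sub>R axis 1 1"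
    using vector_derivative_unique_within_closed_interval[of pi "2*pi" "2*pi", unfolded cbox_interval, OF _ _ 1[unfolded T_def] 2[unfolded T_def]] by auto
  then show ?thesis using linear_cmul[OF dW_linear[OF v(1) gam_S[OF \<phi>]]] by (simp add: dW_axis)
qed

text \<open>Radial derivatives come from Euler's identity and those in \<theta> from
  \<open>rotation_derivative\<close>, so only the derivative along the meridian remains. It drops
  out of the first component, which becomes algebraic in the swirl.\<close>

lemma curl_components:
  assumes v: "v differentiable_on S" "axisymmetric \<phi>0 v" "homogeneous_on S (-3) v" and \<phi>: "0 < \<phi>" "\<phi> \<le> \<phi>0"
  shows "curl_within S v (gam \<phi>) \<bullet> e_phi \<phi> (2*pi) = 2 * prT v \<phi>"
    "curl_within S v (gam \<phi>) \<bullet> e_theta (2*pi) = - (dW v (gam \<phi>) (gamd \<phi>) \<bullet> gam \<phi>) - 3 * prP v \<phi>"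
proof -
  define s c where "s = sin \<phi>" and "c = cos \<phi>"
  have s: "s > 0" unfolding s_def using \<phi> phi0_pi by (intro sin_gt_zero) auto
  have sc: "s * s + c * c = 1" unfolding s_def c_def using sin_cos_squared_add[of \<phi>] by (simp add: power2_eq_square)
  define d where "d = (\<lambda>i. partial_within S i v (gam \<phi>))"
  have gS: "gam \<phi> \<in> S" using gam_S \<phi> by simp
  have lin: "linear (dW v (gam \<phi>))" by (rule dW_linear[OF v(1) gS])
  have dg: "dW v (gam \<phi>) (gam \<phi>) = s *\<^sub>R d 1 + c *\<^sub>R d 3"
  proof -
    have "dW v (gam \<phi>) (s *\<^sub>R axis 1 1 + c *\<^sub>R e3) = s *\<^sub>R d 1 + c *\<^sub>R d 3"
      by (simp add: linear_add[OF lin] linear_cmul[OF lin] dW_axis d_def)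
    then show ?thesis by (simp only: gam_def[of \<phi>, folded s_def c_def])
  qed
  have dgd: "dW v (gam \<phi>) (gamd \<phi>) = c *\<^sub>R d 1 - s *\<^sub>R d 3"
    unfolding gamd_def[of \<phi>, folded s_def c_def] by (simp add: linear_diff[OF lin] linear_cmul[OF lin] dW_axis d_def)
  have E1: "s *\<^sub>R d 1 + c *\<^sub>R d 3 = - 3 *\<^sub>R v (gam \<phi>)"
    using euler_homogeneous[OF v(1,3) gS] by (simp add: dg)
  have E3: "s *\<^sub>R d 2 = (prR v \<phi> * s + prP v \<phi> * c) *\<^sub>R axis 2 1 - prT v \<phi> *\<^sub>R axis 1 1"
    using rotation_derivative[OF v(1,2)] \<phi> by (simp add: d_def s_def c_def)
  have cu: "curl_within S v (gam \<phi>) $ 1 = d 2 $ 3 - d 3 $ 2" "curl_within S v (gam \<phi>) $ 2 = d 3 $ 1 - d 1 $ 3" "curl_within S v (gam \<phi>) $ 3 = d 1 $ 2 - d 2 $ 1"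
    by (simp_all add: curl_within_def d_def)
  have prT: "prT v \<phi> = v (gam \<phi>) $ 2" by (simp add: prT_def inner_axis)
  have a: "s * d 2 $ 3 = 0" "s * d 2 $ 1 = - prT v \<phi>" using arg_cong[OF E3, of "\<lambda>y. y $ 3"] arg_cong[OF E3, of "\<lambda>y. y $ 1"] by (simp_all add: axis_nth)
  have b: "s * d 1 $ 2 + c * d 3 $ 2 = - 3 * prT v \<phi>" using arg_cong[OF E1, of "\<lambda>y. y $ 2"] by (simp add: prT)
  have "curl_within S v (gam \<phi>) \<bullet> e_phi \<phi> (2*pi) = (d 2 $ 3 - d 3 $ 2) * c - (d 1 $ 2 - d 2 $ 1) * s"
    by (simp add: inner_vec_def sum_3 e_phi_nth cu c_def s_def)
  also have "\<dots> = d 2 $ 3 * c + s * d 2 $ 1 - (s * d 1 $ 2 + c * d 3 $ 2)" by (simp add: algebra_simps)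
  also have "\<dots> = 2 * prT v \<phi>" unfolding a(2) b using a(1) s by simp
  finally show "curl_within S v (gam \<phi>) \<bullet> e_phi \<phi> (2*pi) = 2 * prT v \<phi>" .
  have b1: "s * d 1 $ 1 + c * d 3 $ 1 = - 3 * v (gam \<phi>) $ 1" and b3: "s * d 1 $ 3 + c * d 3 $ 3 = - 3 * v (gam \<phi>) $ 3"
    using arg_cong[OF E1, of "\<lambda>y. y $ 1"] arg_cong[OF E1, of "\<lambda>y. y $ 3"] by simp_all
  have g1: "gam \<phi> $ 1 = s" "gam \<phi> $ 2 = 0" "gam \<phi> $ 3 = c" "gamd \<phi> $ 1 = c" "gamd \<phi> $ 2 = 0" "gamd \<phi> $ 3 = - s"
    by (simp_all add: gam_def gamd_def axis_nth s_def c_def)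
  have "dW v (gam \<phi>) (gamd \<phi>) \<bullet> gam \<phi> = (c * d 1 $ 1 - s * d 3 $ 1) * s + (c * d 1 $ 3 - s * d 3 $ 3) * c"
    unfolding dgd by (simp add: inner_vec_def sum_3 g1)
  also have "\<dots> = c * (s * d 1 $ 1 + c * d 3 $ 1) - s * (s * d 1 $ 3 + c * d 3 $ 3) + (s * s + c * c) * (d 1 $ 3 - d 3 $ 1)"
    by (simp add: algebra_simps)
  also have "\<dots> = - 3 * (v (gam \<phi>) $ 1 * c - v (gam \<phi>) $ 3 * s) + (d 1 $ 3 - d 3 $ 1)"
    unfolding b1 b3 sc by (simp add: algebra_simps)
  also have "v (gam \<phi>) $ 1 * c - v (gam \<phi>) $ 3 * s = prP v \<phi>" by (simp add: prP_def inner_vec_def sum_3 g1)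
  finally have "d 3 $ 1 - d 1 $ 3 = - (dW v (gam \<phi>) (gamd \<phi>) \<bullet> gam \<phi>) - 3 * prP v \<phi>" by simp
  then show "curl_within S v (gam \<phi>) \<bullet> e_theta (2*pi) = - (dW v (gam \<phi>) (gamd \<phi>) \<bullet> gam \<phi>) - 3 * prP v \<phi>"
    by (simp add: inner_vec_def sum_3 e_theta_nth cu)
qed

lemma compact_sphere_S: "compact (sphere 0 1 \<inter> S)"
proof -
  have "sphere 0 1 \<inter> S = sphere 0 1 \<inter> {X. x0 * norm X \<le> X $ 3}" by (auto simp: S_eq)
  moreover have "closed {X::real^3. x0 * norm X \<le> X $ 3}" by (intro closed_Collect_le continuous_intros)
  ultimately show ?thesis by (simp add: compact_Int_closed)
qed

lemma C0_norm_upper: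
  assumes "continuous_on (sphere 0 1 \<inter> S) f" "X \<in> sphere 0 1 \<inter> S" shows "norm (f X) \<le> C0_norm (sphere 0 1 \<inter> S) f"
proof -
  have "bounded (f ` (sphere 0 1 \<inter> S))" by (intro compact_imp_bounded compact_continuous_image assms compact_sphere_S)
  then have "bdd_above ((\<lambda>x. norm (f x)) ` (sphere 0 1 \<inter> S))" unfolding bounded_iff bdd_above_def by auto
  then show ?thesis unfolding C0_norm_def by (rule cSUP_upper[OF assms(2)])
qed

lemma C0_norm_least:
  assumes "\<And>X. X \<in> sphere 0 1 \<inter> S \<Longrightarrow> norm (f X) \<le> M" shows "C0_norm (sphere 0 1 \<inter> S) f \<le> M"
proof -
  have "gam 0 \<in> sphere 0 1 \<inter> S" using gam_S[of 0] phi0_pos by (simp add: gam_eq norm_spherical)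
  then show ?thesis unfolding C0_norm_def using assms by (intro cSUP_least) auto
qed

lemma tangential_bound:
  assumes v: "Ck_on 1 S v" "axisymmetric \<phi>0 v" "homogeneous_on S (-3) v" and \<phi>: "0 < \<phi>" "\<phi> \<le> \<phi>0"
    and \<epsilon>: "C0_norm (sphere 0 1 \<inter> S) (tangential_part (curl_within S v)) \<le> \<epsilon>"
  shows "2 * \<bar>prT v \<phi>\<bar> \<le> \<epsilon>" "\<bar>dW v (gam \<phi>) (gamd \<phi>) \<bullet> gam \<phi> + 3 * prP v \<phi>\<bar> \<le> \<epsilon>"
proof -
  have vd: "v differentiable_on S" and vc: "\<And>i. continuous_on S (partial_within S i v)" using v(1) by (auto simp: Ck_1)
  have gS: "gam \<phi> \<in> sphere 0 1 \<inter> S" using gam_S[of \<phi>] \<phi> by (simp add: gam_eq norm_spherical)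
  have "continuous_on (sphere 0 1 \<inter> S) (tangential_part (curl_within S v))"
  proof -
    have pc: "continuous_on (sphere 0 1 \<inter> S) (\<lambda>x. partial_within S i v x $ j)" for i j
      using continuous_on_subset[OF vc] by (intro continuous_intros) auto
    have "curl_within S v = (\<lambda>x. (partial_within S 2 v x $ 3 - partial_within S 3 v x $ 2) *\<^sub>R axis 1 1
      + (partial_within S 3 v x $ 1 - partial_within S 1 v x $ 3) *\<^sub>R axis 2 1 + (partial_within S 1 v x $ 2 - partial_within S 2 v x $ 1) *\<^sub>R e3)"
      by (auto simp: curl_within_def vec_eq_iff forall_3 axis_nth)
    then have "continuous_on (sphere 0 1 \<inter> S) (curl_within S v)" by (simp only:) (intro continuous_intros pc)
    then show ?thesis unfolding tangential_part_def[abs_def] sgn_div_norm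
      by (intro continuous_intros) auto
  qed
  from C0_norm_upper[OF this gS] have n: "norm (tangential_part (curl_within S v) (gam \<phi>)) \<le> \<epsilon>" using \<epsilon> by simp
  define w where "w = tangential_part (curl_within S v) (gam \<phi>)"
  have w: "w = (curl_within S v (gam \<phi>) \<bullet> e_phi \<phi> (2*pi)) *\<^sub>R e_phi \<phi> (2*pi) + (curl_within S v (gam \<phi>) \<bullet> e_theta (2*pi)) *\<^sub>R e_theta (2*pi)"
    unfolding w_def gam_eq(1) by (subst tangential_part_spherical) (simp_all add: v_phi_def v_theta_def)
  have "\<bar>w \<bullet> e_phi \<phi> (2*pi)\<bar> \<le> norm w" "\<bar>w \<bullet> e_theta (2*pi)\<bar> \<le> norm w"
    using Cauchy_Schwarz_ineq2[of w "e_phi \<phi> (2*pi)"] Cauchy_Schwarz_ineq2[of w "e_theta (2*pi)"] by (simp_all add: norm_eq_sqrt_inner sph_frame_inner)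
  moreover have "w \<bullet> e_phi \<phi> (2*pi) = 2 * prT v \<phi>" "w \<bullet> e_theta (2*pi) = - (dW v (gam \<phi>) (gamd \<phi>) \<bullet> gam \<phi>) - 3 * prP v \<phi>"
    unfolding w by (simp_all add: inner_add_left sph_frame_inner curl_components[OF vd v(2,3) \<phi>])
  ultimately show "2 * \<bar>prT v \<phi>\<bar> \<le> \<epsilon>" "\<bar>dW v (gam \<phi>) (gamd \<phi>) \<bullet> gam \<phi> + 3 * prP v \<phi>\<bar> \<le> \<epsilon>"
    using n unfolding w_def[symmetric] by (auto simp: abs_mult)
qed

end

section \<open>Profiles of the force\<close>

locale forced = cone +
  fixes F :: "real^3 \<Rightarrow> real^3"
  assumes F_axi: "axisymmetric \<phi>0 F" and F_C1: "Ck_on 1 S F" and F_hom: "homogeneous_on S (-3) F"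
begin

lemma F_diff: "F differentiable_on S" using F_C1 by (simp add: Ck_1)

lemma F_cont: "continuous_on S F" using F_diff by (rule differentiable_imp_continuous_on)

definition Fd where "Fd \<phi> = dW F (gam \<phi>) (gamd \<phi>)"

lemma Fd_cont: "continuous_on Phi Fd" unfolding Fd_def[abs_def] by (rule dW_gam_cont[OF F_C1])

text \<open>The values of \<open>\<kappa>\<close> and \<open>\<tau>\<close> at \<open>1\<close> are the limits on the axis, where \<open>F\<^sup>\<phi>\<close>, \<open>F\<^sup>\<theta>\<close> and \<open>sin \<phi>\<close> vanish.\<close>

definition Fr where "Fr x = prR F (arccos x)"
definition \<kappa> where "\<kappa> x = (if x = 1 then Fd 0 \<bullet> gamd 0 - prR F 0 else prP F (arccos x) / sqrt (1 - x\<^sup>2))"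
definition \<tau> where "\<tau> x = (if x = 1 then Fd 0 \<bullet> axis 2 1 else prT F (arccos x) / sqrt (1 - x\<^sup>2))"

lemma Fr_lip: "lip_wt Fr"
  and Fr_deriv: "\<And>x. x0 \<le> x \<Longrightarrow> x < 1 \<Longrightarrow> (Fr has_real_derivative - (Fd (arccos x) \<bullet> gam (arccos x) + prP F (arccos x)) / sqrt (1 - x\<^sup>2)) (at x within Ix)"
proof -
  have d: "(prR F has_real_derivative Fd \<phi> \<bullet> gam \<phi> + prP F \<phi>) (at \<phi> within Phi)" if "\<phi> \<in> Phi" for \<phi>
    using profile_derivs(1)[OF F_diff that] by (simp add: Fd_def)
  have c: "continuous_on Phi (\<lambda>\<phi>. Fd \<phi> \<bullet> gam \<phi> + prP F \<phi>)"
    by (intro continuous_intros Fd_cont gam_cont profile_cont F_cont)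
  show "lip_wt Fr" using C1_profile(1)[OF d c] by (simp add: Fr_def[abs_def])
  show "(Fr has_real_derivative - (Fd (arccos x) \<bullet> gam (arccos x) + prP F (arccos x)) / sqrt (1 - x\<^sup>2)) (at x within Ix)" if "x0 \<le> x" "x < 1" for x
    using C1_profile(2)[OF d c that] by (simp add: Fr_def[abs_def])
qed

lemma \<kappa>_cont: "continuous_on Ix \<kappa>" and \<kappa>_bdw: "bdw \<kappa>" and \<kappa>_eq: "\<And>x. x \<in> Ix \<Longrightarrow> prP F (arccos x) = sqrt (1 - x\<^sup>2) * \<kappa> x"
proof -
  have d: "(prP F has_real_derivative Fd \<phi> \<bullet> gamd \<phi> - prR F \<phi>) (at \<phi> within Phi)" if "\<phi> \<in> Phi" for \<phi>
    using profile_derivs(2)[OF F_diff that] by (simp add: Fd_def)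
  have c: "continuous_on Phi (\<lambda>\<phi>. Fd \<phi> \<bullet> gamd \<phi> - prR F \<phi>)"
    by (intro continuous_intros Fd_cont gam_cont profile_cont F_cont)
  note * = div_sin_profile[where P = "prP F" and P' = "\<lambda>\<phi>. Fd \<phi> \<bullet> gamd \<phi> - prR F \<phi>", OF d c axisym_axis(1)[OF F_axi], simplified]
  show "continuous_on Ix \<kappa>" "bdw \<kappa>" using *(1,2) by (simp_all add: \<kappa>_def[abs_def])
  show "prP F (arccos x) = sqrt (1 - x\<^sup>2) * \<kappa> x" if "x \<in> Ix" for x using *(3) that by (simp add: \<kappa>_def)
qed

lemma \<tau>_cont: "continuous_on Ix \<tau>" and \<tau>_bdw: "bdw \<tau>" and \<tau>_eq: "\<And>x. x \<in> Ix \<Longrightarrow> prT F (arccos x) = sqrt (1 - x\<^sup>2) * \<tau> x"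
proof -
  have d: "(prT F has_real_derivative Fd \<phi> \<bullet> axis 2 1) (at \<phi> within Phi)" if "\<phi> \<in> Phi" for \<phi>
    using profile_derivs(3)[OF F_diff that] by (simp add: Fd_def)
  have c: "continuous_on Phi (\<lambda>\<phi>. Fd \<phi> \<bullet> axis 2 1)" by (intro continuous_intros Fd_cont)
  note * = div_sin_profile[where P = "prT F" and P' = "\<lambda>\<phi>. Fd \<phi> \<bullet> axis 2 1", OF d c axisym_axis(2)[OF F_axi], simplified]
  show "continuous_on Ix \<tau>" "bdw \<tau>" using *(1,2) by (simp_all add: \<tau>_def[abs_def])
  show "prT F (arccos x) = sqrt (1 - x\<^sup>2) * \<tau> x" if "x \<in> Ix" for x using *(3) that by (simp add: \<tau>_def)
qed

lemma F_rep:
  assumes "X \<in> S"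
  shows "F X = (rinv X ^ 4 * (Fr (mu X) + mu X * \<kappa> (mu X))) *\<^sub>R X + (- (rinv X ^ 3 * \<kappa> (mu X))) *\<^sub>R e3 + (rinv X ^ 4 * \<tau> (mu X)) *\<^sub>R rot_gen X"
proof -
  have n: "norm X powi (-3) = rinv X ^ 3" by (simp add: rinv_def power_int_minus power_inverse)
  show ?thesis
    using axisym_rep[OF F_axi F_hom assms \<kappa>_eq[OF mu_mem[OF assms]] \<tau>_eq[OF mu_mem[OF assms]]] unfolding n
    by (simp add: Fr_def algebra_simps power_numeral_reduce)
qed

text \<open>The combination of force components that survives elimination of the pressure: by
  \<open>KF_deriv\<close> and \<open>curl_components\<close> its derivative is a curl component over
  sin \<phi>, so it is 0 for a gradient. Subtracting \<open>Fr 1\<close> moves a constant into the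
  pressure.\<close>

definition KF where "KF x = Fr x - Fr 1 + 2 * tail \<kappa> x"

lemma KF_deriv: assumes "x0 \<le> x" "x < 1"
  shows "(KF has_real_derivative - (Fd (arccos x) \<bullet> gam (arccos x) + 3 * prP F (arccos x)) / sqrt (1 - x\<^sup>2)) (at x within Ix)"
proof -
  have xI: "x \<in> Ix" using assms by simp
  have s: "sqrt (1 - x\<^sup>2) \<noteq> 0" using assms x0_gt by (simp add: power2_eq_1_iff)
  have "(KF has_real_derivative - (Fd (arccos x) \<bullet> gam (arccos x) + prP F (arccos x)) / sqrt (1 - x\<^sup>2) - 2 * \<kappa> x) (at x within Ix)"
    unfolding KF_def[abs_def] using Fr_deriv[OF assms] tail_deriv[OF \<kappa>_cont xI] by (auto intro!: derivative_eq_intros)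
  also have "- (Fd (arccos x) \<bullet> gam (arccos x) + prP F (arccos x)) / sqrt (1 - x\<^sup>2) - 2 * \<kappa> x = - (Fd (arccos x) \<bullet> gam (arccos x) + 3 * prP F (arccos x)) / sqrt (1 - x\<^sup>2)"
    using s \<kappa>_eq[OF xI] by (simp add: field_simps)
  finally show ?thesis .
qed

lemma KF_lip0: "lip0 KF"
proof -
  have "lip_wt (tail \<kappa>)" by (rule C1_lip_wt[OF tail_deriv[OF \<kappa>_cont]]) (auto intro!: continuous_intros \<kappa>_cont)
  moreover have cw: "lip_wt (\<lambda>_. c)" for c by (rule C1_lip_wt[where \<alpha>' = "\<lambda>_. 0"]) auto
  ultimately have "lip_wt (\<lambda>x. (Fr x + (- Fr 1)) + 2 * tail \<kappa> x)"
    by (intro lip_wt_add lip_wt_mult Fr_lip)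
  then have "lip_wt KF" by (simp add: KF_def[abs_def])
  then show ?thesis by (rule lip_wt_lip0) (simp add: KF_def)
qed

lemma KF_cont: "continuous_on Ix KF" using KF_lip0 lip0_lip_wt lip_wt_cont by blast

text \<open>The curl bounds the swirl of the force by \<epsilon>/2 and the derivative of
  \<open>KF\<close> by \<open>\<epsilon> / sqrt (1 - x\<^sup>2)\<close>; the latter is integrated
  from the axis, where \<open>KF\<close> vanishes. The factor 4 arises in this integration, with 2
  as a bound for \<open>sqrt (1 - t)\<close>, and is shared by both estimates.\<close>

lemma small_profiles:
  assumes \<epsilon>: "C0_norm (sphere 0 1 \<inter> S) (tangential_part (curl_within S F)) \<le> \<epsilon>"
  shows "\<And>t. x0 < t \<Longrightarrow> t < 1 \<Longrightarrow> \<bar>\<tau> t\<bar> * sqrt (1 - t) \<le> 4 * \<epsilon> / sqrt (1 + x0)"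
    "\<And>t. t \<in> Ix \<Longrightarrow> \<bar>KF t\<bar> \<le> 4 * \<epsilon> / sqrt (1 + x0)" "\<epsilon> \<ge> 0"
proof -
  have arc: "0 < arccos t" "arccos t \<le> \<phi>0" if "x0 \<le> t" "t < 1" for t
  proof -
    have "arccos t \<le> arccos x0" using that x0_gt by (intro arccos_le_arccos) auto
    then show "arccos t \<le> \<phi>0" using phi0_pos phi0_pi by (simp add: arccos_cos)
    show "0 < arccos t" using arccos_less_arccos[of t 1] that x0_gt by simp
  qed
  note B = tangential_bound[OF F_C1 F_axi F_hom _ _ \<epsilon>]
  show \<epsilon>0: "\<epsilon> \<ge> 0" using B(1)[OF arc[OF order_refl x0_lt]] by linarith
  have sqt: "sqrt (1 - t\<^sup>2) = sqrt (1 + t) * sqrt (1 - t)" for t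
    by (simp add: real_sqrt_mult[symmetric] power2_eq_square algebra_simps)
  have sle: "sqrt (1 + x0) \<le> sqrt (1 + t)" if "x0 \<le> t" for t using that by simp
  have sp: "sqrt (1 + x0) > 0" using x0_gt by simp
  show "\<bar>\<tau> t\<bar> * sqrt (1 - t) \<le> 4 * \<epsilon> / sqrt (1 + x0)" if t: "x0 < t" "t < 1" for t
  proof -
    have "2 * \<bar>prT F (arccos t)\<bar> \<le> \<epsilon>" using B(1)[OF arc[of t]] t by simp
    then have "sqrt (1 + t) * (\<bar>\<tau> t\<bar> * sqrt (1 - t)) \<le> \<epsilon>" using \<tau>_eq[of t] t x0_gt sqt[of t] \<epsilon>0 by (simp add: abs_mult mult_ac)
    moreover have "sqrt (1 + x0) * (\<bar>\<tau> t\<bar> * sqrt (1 - t)) \<le> sqrt (1 + t) * (\<bar>\<tau> t\<bar> * sqrt (1 - t))"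
      using t sle[of t] by (intro mult_right_mono) auto
    ultimately have "sqrt (1 + x0) * (\<bar>\<tau> t\<bar> * sqrt (1 - t)) \<le> 4 * \<epsilon>" using \<epsilon>0 by linarith
    then show ?thesis using sp by (simp add: pos_le_divide_eq mult.commute)
  qed
  show "\<bar>KF t\<bar> \<le> 4 * \<epsilon> / sqrt (1 + x0)" if tI: "t \<in> Ix" for t
  proof -
    define M where "M = \<epsilon> / sqrt (1 + x0)"
    have M0: "M \<ge> 0" using \<epsilon>0 sp by (simp add: M_def)
    have "\<bar>KF 1 - KF t\<bar> \<le> - 2 * M * sqrt (1 - 1) - (- 2 * M * sqrt (1 - t))"
    proof (rule bound_incr)
      show "continuous_on {t..1} KF" using tI by (intro continuous_on_subset[OF KF_cont]) auto
      show "continuous_on {t..1} (\<lambda>t. - 2 * M * sqrt (1 - t))" by (intro continuous_intros)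
      fix y assume y: "t < y" "y < 1"
      then have y': "x0 < y" "x0 \<le> y" using tI by auto
      show "(KF has_real_derivative - (Fd (arccos y) \<bullet> gam (arccos y) + 3 * prP F (arccos y)) / sqrt (1 - y\<^sup>2)) (at y)"
        using KF_deriv[OF y'(2) y(2)] at_Ix[OF y'(1) y(2)] by simp
      show "((\<lambda>t. - 2 * M * sqrt (1 - t)) has_real_derivative M / sqrt (1 - y)) (at y)"
        using y by (auto intro!: derivative_eq_intros simp: field_simps)
      have "\<bar>Fd (arccos y) \<bullet> gam (arccos y) + 3 * prP F (arccos y)\<bar> \<le> \<epsilon>"
        using B(2)[OF arc[OF y'(2) y(2)]] by (simp add: Fd_def)
      then have "\<bar>Fd (arccos y) \<bullet> gam (arccos y) + 3 * prP F (arccos y)\<bar> / (sqrt (1 + y) * sqrt (1 - y)) \<le> \<epsilon> / (sqrt (1 + x0) * sqrt (1 - y))"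
        using y sle[OF y'(2)] sp \<epsilon>0 by (intro frac_le mult_right_mono) auto
      then show "\<bar>- (Fd (arccos y) \<bullet> gam (arccos y) + 3 * prP F (arccos y)) / sqrt (1 - y\<^sup>2)\<bar> \<le> M / sqrt (1 - y)"
        using y y' x0_gt abs_minus_cancel[of "Fd (arccos y) \<bullet> gam (arccos y) + 3 * prP F (arccos y)"]
        by (simp only: sqt M_def abs_divide abs_mult abs_of_pos real_sqrt_gt_zero) (simp add: abs_mult)
    qed (use tI in auto)
    then have "\<bar>KF t\<bar> \<le> 2 * M * sqrt (1 - t)" by (simp add: KF_def)
    also have "\<dots> \<le> 2 * M * 2" using tI x0_gt M0 by (intro mult_left_mono real_le_lsqrt) auto
    finally show ?thesis by (simp add: M_def)
  qed
qed

lemma swirl_free_\<tau>: assumes "swirl_free \<phi>0 F" "x \<in> Ix" shows "\<tau> x = 0"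
proof -
  have T0: "prT F \<phi> = 0" if "\<phi> \<in> Phi" for \<phi>
  proof -
    have "v_theta F 1 \<phi> (2*pi) = 0" using assms(1) that unfolding swirl_free_def Phi_def by auto
    then show ?thesis by (simp add: v_theta_def prT_def gam_eq)
  qed
  have z: "0 \<in> Phi" using phi0_pos by (simp add: Phi_def)
  have arc: "arccos x \<in> Phi"
  proof -
    have "arccos x \<le> arccos x0" using assms(2) x0_gt by (intro arccos_le_arccos) auto
    then show ?thesis using assms(2) x0_gt phi0_pos phi0_pi by (auto simp: Phi_def arccos_cos intro: arccos_lbound)
  qed
  \<comment> \<open>\<open>\<tau> 1\<close> is a derivative, not a quotient; it is the one-sided
    derivative of a function that vanishes identically.\<close>
  have 1: "(prT F has_real_derivative Fd 0 \<bullet> axis 2 1) (at 0 within {0..\<phi>0})"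
    using profile_derivs(3)[OF F_diff z] by (simp add: Fd_def Phi_def)
  have 2: "(prT F has_real_derivative 0) (at 0 within {0..\<phi>0})"
    by (rule has_field_derivative_transform_within[where f = "\<lambda>_. 0" and d = 1]) (use T0 z in \<open>auto simp: Phi_def\<close>)
  have "Fd 0 \<bullet> axis 2 1 = 0"
    using vector_derivative_unique_within_closed_interval[of 0 \<phi>0 0 "prT F" "Fd 0 \<bullet> axis 2 1" 0] 1 2 phi0_pos
    by (simp add: has_real_derivative_iff_has_vector_derivative)
  then show ?thesis using T0[OF arc] by (simp add: \<tau>_def)
qed

sublocale reduced \<phi>0 \<tau> KF by unfold_locales (rule \<tau>_cont KF_cont)+

end

section \<open>Second derivatives of profiles off the axis\<close>

context cone begin

lemma arccos_Phi: assumes "x \<in> Ix" shows "arccos x \<in> Phi"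
proof -
  have "arccos x \<le> arccos x0" using assms x0_gt by (intro arccos_le_arccos) auto
  then show ?thesis using assms x0_gt phi0_pos phi0_pi by (auto simp: Phi_def arccos_cos intro: arccos_lbound)
qed

lemma arccos_cont_Ix: "continuous_on Ix arccos"
  using x0_gt by (intro continuous_on_subset[OF continuous_on_arccos']) auto

lemma arccos_x0: "arccos x0 = \<phi>0" using phi0_pos phi0_pi by (simp add: arccos_cos)

lemma one_minus_sq: "1 - x\<^sup>2 = (1 - x) * (1 + x)" for x :: real by (simp add: power2_eq_square algebra_simps)

lemma sq_pos: "x0 \<le> x \<Longrightarrow> x < 1 \<Longrightarrow> 1 - x\<^sup>2 > 0" using x0_gt by (simp add: abs_square_less_1)

lemma arccos_chain:
  assumes d: "(P has_real_derivative P') (at (arccos x) within Phi)" and x: "x0 < x" "x < 1"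
  shows "((\<lambda>x. P (arccos x)) has_real_derivative - P' / sqrt (1 - x\<^sup>2)) (at x)"
proof -
  have "(P has_real_derivative P') (at (arccos x) within arccos ` Ix)"
    using arccos_Phi by (intro DERIV_subset[OF d]) auto
  moreover have "(arccos has_real_derivative - 1 / sqrt (1 - x\<^sup>2)) (at x within Ix)"
    using DERIV_arccos[of x] x x0_gt by (auto intro!: has_field_derivative_at_within simp: divide_inverse)
  ultimately have "(P \<circ> arccos has_real_derivative P' * (- 1 / sqrt (1 - x\<^sup>2))) (at x within Ix)"
    by (rule DERIV_image_chain)
  then show ?thesis using at_Ix[OF x] by (simp add: o_def)
qed

lemma eq_Ix:
  fixes f g :: "real \<Rightarrow> real"
  assumes "continuous_on Ix f" "continuous_on Ix g" "\<And>x. x0 < x \<Longrightarrow> x < 1 \<Longrightarrow> f x = g x" "x \<in> Ix"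
  shows "f x = g x"
proof -
  define m where "m = (x0 + 1) / 2"
  have m: "x0 < m" "m < 1" using x0_lt by (auto simp: m_def)
  have "f x - g x = f m - g m"
  proof (rule const_Ix[where H = "\<lambda>x. f x - g x"])
    fix y assume y: "x0 < y" "y < 1"
    show "((\<lambda>x. f x - g x) has_real_derivative 0) (at y)"
      by (rule has_field_derivative_transform_within_open[where f = "\<lambda>_. 0" and S = "{x0<..<1}"]) (use assms(3) y in auto)
  qed (use assms m in \<open>auto intro!: continuous_intros\<close>)
  then show ?thesis using assms(3)[OF m] by simp
qed

lemma const_open:
  fixes W :: "real \<Rightarrow> real"
  assumes "\<And>t. x0 < t \<Longrightarrow> t < 1 \<Longrightarrow> (W has_real_derivative 0) (at t)"
  obtains w where "\<And>t. x0 < t \<Longrightarrow> t < 1 \<Longrightarrow> W t = w"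
proof -
  define m where "m = (x0 + 1) / 2"
  have m: "x0 < m" "m < 1" using x0_lt by (auto simp: m_def)
  have inc: "W b = W a" if "x0 < a" "a \<le> b" "b < 1" for a b
  proof -
    have "\<bar>W b - W a\<bar> \<le> 0 * (b - a)"
    proof (rule bound_incr_const[OF that(2), of W "\<lambda>_. 0"])
      show "continuous_on {a..b} W"
        using assms that by (intro continuous_at_imp_continuous_on ballI DERIV_isCont[of _ 0]) auto
    qed (use assms that in auto)
    then show ?thesis by simp
  qed
  show ?thesis
  proof (rule that[of "W m"])
    fix t assume t: "x0 < t" "t < 1"
    show "W t = W m" using inc[of m t] inc[of t m] m t by (cases "m \<le> t") auto
  qed
qed

text \<open>Mere existence in the open interval, which is what the pointwise equations use; towards
  the ends these derivatives may blow up.\<close>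

definition D2 :: "(real \<Rightarrow> real) \<Rightarrow> bool" where
  "D2 f \<longleftrightarrow> (\<exists>f' f''. \<forall>t. x0 < t \<and> t < 1 \<longrightarrow> (f has_real_derivative f' t) (at t) \<and> (f' has_real_derivative f'' t) (at t))"

lemma D2I:
  assumes "\<And>t. x0 < t \<Longrightarrow> t < 1 \<Longrightarrow> (f has_real_derivative f' t) (at t)" "\<And>t. x0 < t \<Longrightarrow> t < 1 \<Longrightarrow> (f' has_real_derivative f'' t) (at t)"
  shows "D2 f" unfolding D2_def using assms by blast

lemma D2E:
  assumes "D2 f"
  obtains f' f'' where "\<And>t. x0 < t \<Longrightarrow> t < 1 \<Longrightarrow> (f has_real_derivative f' t) (at t)" "\<And>t. x0 < t \<Longrightarrow> t < 1 \<Longrightarrow> (f' has_real_derivative f'' t) (at t)"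
  using assms unfolding D2_def by blast

lemma D2_mult: assumes "D2 f" "D2 g" shows "D2 (\<lambda>x. f x * g x)"
proof -
  obtain f' f'' where f: "\<And>t. x0 < t \<Longrightarrow> t < 1 \<Longrightarrow> (f has_real_derivative f' t) (at t)" "\<And>t. x0 < t \<Longrightarrow> t < 1 \<Longrightarrow> (f' has_real_derivative f'' t) (at t)"
    using D2E[OF assms(1)] by metis
  obtain g' g'' where g: "\<And>t. x0 < t \<Longrightarrow> t < 1 \<Longrightarrow> (g has_real_derivative g' t) (at t)" "\<And>t. x0 < t \<Longrightarrow> t < 1 \<Longrightarrow> (g' has_real_derivative g'' t) (at t)"
    using D2E[OF assms(2)] by metis
  show ?thesis
  proof (rule D2I[where f' = "\<lambda>x. f x * g' x + f' x * g x"])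
    fix t assume t: "x0 < t" "t < 1"
    show "((\<lambda>x. f x * g x) has_real_derivative f t * g' t + f' t * g t) (at t)"
      using DERIV_mult[OF f(1)[OF t] g(1)[OF t]] by (simp add: algebra_simps)
    show "((\<lambda>x. f x * g' x + f' x * g x) has_real_derivative (f' t * g' t + g'' t * f t) + (f'' t * g t + g' t * f' t)) (at t)"
      by (intro DERIV_add DERIV_mult f g t)
  qed
qed

lemma D2_inv_sqrt: "D2 (\<lambda>x. inverse (sqrt (1 - x\<^sup>2)))"
proof (rule D2I[where f' = "\<lambda>x. x * inverse (sqrt (1 - x\<^sup>2)) ^ 3"])
  fix t assume t: "x0 < t" "t < 1"
  have s: "1 - t\<^sup>2 > 0" using sq_pos t by simp
  show 1: "((\<lambda>x. inverse (sqrt (1 - x\<^sup>2))) has_real_derivative t * inverse (sqrt (1 - t\<^sup>2)) ^ 3) (at t)"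
    using s by (auto intro!: derivative_eq_intros simp: field_simps power3_eq_cube power2_eq_square)
  show "((\<lambda>x. x * inverse (sqrt (1 - x\<^sup>2)) ^ 3) has_real_derivative
     1 * inverse (sqrt (1 - t\<^sup>2)) ^ 3 + (real 3 * ((t * inverse (sqrt (1 - t\<^sup>2)) ^ 3) * inverse (sqrt (1 - t\<^sup>2)) ^ (3 - Suc 0))) * t) (at t)"
    by (intro DERIV_mult DERIV_power 1 DERIV_ident)
qed

lemma D2_arccos:
  assumes "\<And>\<phi>. \<phi> \<in> Phi \<Longrightarrow> (P has_real_derivative P' \<phi>) (at \<phi> within Phi)" "\<And>\<phi>. \<phi> \<in> Phi \<Longrightarrow> (P' has_real_derivative P'' \<phi>) (at \<phi> within Phi)"
  shows "D2 (\<lambda>x. P (arccos x))"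
proof -
  obtain h' h'' where h: "\<And>t. x0 < t \<Longrightarrow> t < 1 \<Longrightarrow> ((\<lambda>x. inverse (sqrt (1 - x\<^sup>2))) has_real_derivative h' t) (at t)"
    using D2E[OF D2_inv_sqrt] by metis
  show ?thesis
  proof (rule D2I[where f' = "\<lambda>x. - (P' (arccos x) * inverse (sqrt (1 - x\<^sup>2)))"])
    fix t assume t: "x0 < t" "t < 1"
    have a: "arccos t \<in> Phi" using t by (intro arccos_Phi) auto
    show "((\<lambda>x. P (arccos x)) has_real_derivative - (P' (arccos t) * inverse (sqrt (1 - t\<^sup>2)))) (at t)"
      using arccos_chain[OF assms(1)[OF a] t] by (simp add: divide_inverse)
    show "((\<lambda>x. - (P' (arccos x) * inverse (sqrt (1 - x\<^sup>2)))) has_real_derivative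
      - ((- P'' (arccos t) / sqrt (1 - t\<^sup>2)) * inverse (sqrt (1 - t\<^sup>2)) + h' t * P' (arccos t))) (at t)"
      by (intro DERIV_minus DERIV_mult arccos_chain assms a t h)
  qed
qed

lemma Ck_2: "Ck_on 2 S v \<longleftrightarrow> v differentiable_on S \<and> (\<forall>i. Ck_on 1 S (partial_within S i v))"
  by (simp add: numeral_2_eq_2 One_nat_def)

text \<open>The derivative of \<open>v\<close> along the meridian is a sum of differentiable partial
  derivatives times components of the tangent, so its components in the moving frame can be
  differentiated once more.\<close>

lemma profiles_D2:
  assumes v: "Ck_on 2 S v"
  shows "D2 (\<lambda>x. prR v (arccos x))" "D2 (\<lambda>x. prP v (arccos x))" "D2 (\<lambda>x. prT v (arccos x))"
proof -
  have vd: "v differentiable_on S" and vp: "\<And>i. partial_within S i v differentiable_on S" using v by (auto simp: Ck_2 Ck_1)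
  define W where "W = (\<lambda>\<phi>. dW v (gam \<phi>) (gamd \<phi>))"
  have "\<exists>W'. (W has_vector_derivative W') (at \<phi> within Phi)" if "\<phi> \<in> Phi" for \<phi>
  proof -
    have "((\<lambda>\<phi>. gamd \<phi> $ i) has_real_derivative - gam \<phi> $ i) (at \<phi> within Phi)" for i
      unfolding gamd_def gam_def by (auto intro!: derivative_eq_intros)
    then have "(W has_vector_derivative (\<Sum>i\<in>UNIV. (gamd \<phi> $ i) *\<^sub>R dW (partial_within S i v) (gam \<phi>) (gamd \<phi>) + (- gam \<phi> $ i) *\<^sub>R partial_within S i v (gam \<phi>))) (at \<phi> within Phi)"
      unfolding W_def dW_def[of v] using gam_vderiv[OF vp that]
      by (intro has_vector_derivative_sum has_vector_derivative_scaleR)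
    then show ?thesis by blast
  qed
  then obtain W' where W': "\<And>\<phi>. \<phi> \<in> Phi \<Longrightarrow> (W has_vector_derivative W' \<phi>) (at \<phi> within Phi)" by metis
  have ig: "((\<lambda>\<phi>. W \<phi> \<bullet> gam \<phi>) has_real_derivative W' \<phi> \<bullet> gam \<phi> + W \<phi> \<bullet> gamd \<phi>) (at \<phi> within Phi)"
    "((\<lambda>\<phi>. W \<phi> \<bullet> gamd \<phi>) has_real_derivative W' \<phi> \<bullet> gamd \<phi> + W \<phi> \<bullet> (- gam \<phi>)) (at \<phi> within Phi)"
    "((\<lambda>\<phi>. W \<phi> \<bullet> axis 2 1) has_real_derivative W' \<phi> \<bullet> axis 2 1 + W \<phi> \<bullet> 0) (at \<phi> within Phi)" if "\<phi> \<in> Phi" for \<phi>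
    by (intro has_vector_derivative_inner W' gam_deriv gamd_deriv has_vector_derivative_const that)+
  have p: "((\<lambda>\<phi>. dW v (gam \<phi>) (gamd \<phi>)) = W)" by (simp add: W_def)
  have pd': "\<And>\<phi>. \<phi> \<in> Phi \<Longrightarrow> (prR v has_real_derivative W \<phi> \<bullet> gam \<phi> + prP v \<phi>) (at \<phi> within Phi)"
    "\<And>\<phi>. \<phi> \<in> Phi \<Longrightarrow> (prP v has_real_derivative W \<phi> \<bullet> gamd \<phi> - prR v \<phi>) (at \<phi> within Phi)"
    "\<And>\<phi>. \<phi> \<in> Phi \<Longrightarrow> (prT v has_real_derivative W \<phi> \<bullet> axis 2 1) (at \<phi> within Phi)"
    using profile_derivs[OF vd] by (simp_all add: W_def)
  show "D2 (\<lambda>x. prR v (arccos x))"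
    by (rule D2_arccos[OF pd'(1), where P'' = "\<lambda>\<phi>. (W' \<phi> \<bullet> gam \<phi> + W \<phi> \<bullet> gamd \<phi>) + (W \<phi> \<bullet> gamd \<phi> - prR v \<phi>)"])
      (assumption | rule DERIV_add ig pd')+
  show "D2 (\<lambda>x. prP v (arccos x))"
    by (rule D2_arccos[OF pd'(2), where P'' = "\<lambda>\<phi>. (W' \<phi> \<bullet> gamd \<phi> + W \<phi> \<bullet> (- gam \<phi>)) - (W \<phi> \<bullet> gam \<phi> + prP v \<phi>)"])
      (assumption | rule DERIV_diff ig pd')+
  show "D2 (\<lambda>x. prT v (arccos x))"
    by (rule D2_arccos[OF pd'(3), where P'' = "\<lambda>\<phi>. W' \<phi> \<bullet> axis 2 1 + W \<phi> \<bullet> 0"])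
      (assumption | rule ig)+
qed

lemma scalar_rep:
  assumes "axisymmetric_scalar \<phi>0 p" "homogeneous_on S (-2) p" "X \<in> S"
  shows "p X = sc (\<lambda>x. p (gam (arccos x))) 2 X"
proof -
  define \<phi> where "\<phi> = arccos (mu X)"
  obtain \<theta> where \<theta>: "0 < \<theta>" "\<theta> \<le> 2 * pi" "X = norm X *\<^sub>R spherical 1 \<phi> \<theta>" "spherical 1 \<phi> \<theta> \<in> S" "0 \<le> \<phi>" "\<phi> \<le> \<phi>0"
    using sph_coords[OF assms(3)] unfolding \<phi>_def by metis
  have nX: "norm X > 0" using S_nz[OF assms(3)] by simp
  have "p X = (norm X powi (-2)) *\<^sub>R p (spherical 1 \<phi> \<theta>)"
    using assms(2) nX \<theta>(3,4) unfolding homogeneous_on_def by metis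
  also have "p (spherical 1 \<phi> \<theta>) = p (spherical 1 \<phi> (2*pi))"
  proof -
    have "\<theta> \<in> {0<..2*pi}" "2*pi \<in> {0<..2*pi}" "\<phi> \<in> {0..\<phi>0}" using \<theta> by auto
    then show ?thesis using assms(1) unfolding axisymmetric_scalar_def by (meson zero_less_one)
  qed
  also have "norm X powi (-2) = rinv X ^ 2" by (simp add: rinv_def power_int_minus power_inverse)
  finally show ?thesis by (simp add: sc_def \<phi>_def gam_eq(1)[symmetric])
qed

lemma gam_Om: assumes "x0 < x" "x < 1" shows "gam (arccos x) \<in> Om" "mu (gam (arccos x)) = x" "rinv (gam (arccos x)) = 1"
proof -
  show m: "mu (gam (arccos x)) = x" using assms x0_gt unfolding gam_eq(1) by (simp add: mu_spherical cos_arccos)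
  show "rinv (gam (arccos x)) = 1" by (simp add: rinv_def gam_eq(1) norm_spherical)
  have "gam (arccos x) \<noteq> 0" by (metis gam_eq(1) norm_spherical norm_zero zero_le_one zero_neq_one)
  then show "gam (arccos x) \<in> Om" using m assms by (simp add: Om_iff)
qed

end

context reduced begin

text \<open>The radial profile \<open>((1 - x\<^sup>2) \<eta>)'\<close>, with \<open>\<eta>'\<close> eliminated by the Riccati equation.\<close>

definition Rf where "Rf \<eta> x = - (1 - x\<^sup>2) * ((\<eta> x)\<^sup>2 / 2 + Qf \<eta> x) - 2 * x * \<eta> x"

definition uf where "uf \<eta> = axi_field (\<lambda>x. Rf \<eta> x + x * \<eta> x) (\<lambda>x. - \<eta> x) (sg \<eta>)"

lemma Rf_cont: "continuous_on Ix \<eta> \<Longrightarrow> continuous_on Ix (Rf \<eta>)"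
  unfolding Rf_def[abs_def] by (intro continuous_intros Qf_cont) auto

lemma Mk_const: "x \<in> Ix \<Longrightarrow> Mk (\<lambda>_. c) x = c / 2"
proof -
  assume x: "x \<in> Ix"
  have "avg 1 (avg 0 (\<lambda>_. c)) x = avg 1 (\<lambda>_. c) x" by (rule avg_cong[OF _ x]) (simp add: avg_const del: atLeastAtMost_iff)
  then show ?thesis using avg_const[OF x, of 1 c] by (simp add: Mk_def)
qed

end

section \<open>Solutions are fixed points\<close>

locale soln = forced +
  fixes u :: "real^3 \<Rightarrow> real^3" and p :: "real^3 \<Rightarrow> real"
  assumes sol: "axi_self_similar_solution \<phi>0 F u p"
begin

lemma u_C2: "Ck_on 2 S u" and p_C1: "Ck_on 1 S p" and u_axi: "axisymmetric \<phi>0 u" and p_axi: "axisymmetric_scalar \<phi>0 p"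
  and u_hom: "homogeneous_on S (-1) u" and p_hom: "homogeneous_on S (-2) p" and NS: "solves_NS \<phi>0 F u p"
  using sol by (auto simp: axi_self_similar_solution_def)

lemma u_cont: "continuous_on S u" using u_C2 by (auto simp: Ck_2 intro: differentiable_imp_continuous_on)
lemma p_diff: "p differentiable_on S" using p_C1 by (simp add: Ck_1)

definition R where "R x = prR u (arccos x)"
definition P where "P x = prP u (arccos x)"
definition T where "T x = prT u (arccos x)"
definition q where "q x = p (gam (arccos x))"

lemma RPT_cont: "continuous_on Ix R" "continuous_on Ix P" "continuous_on Ix T" "continuous_on Ix q"
proof -
  have sub: "arccos ` Ix \<subseteq> Phi" using arccos_Phi by blast
  show "continuous_on Ix R" "continuous_on Ix P" "continuous_on Ix T"
    unfolding R_def[abs_def] P_def[abs_def] T_def[abs_def]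
    by (rule continuous_on_compose2[OF profile_cont(1)[OF u_cont] arccos_cont_Ix sub]
        continuous_on_compose2[OF profile_cont(2)[OF u_cont] arccos_cont_Ix sub]
        continuous_on_compose2[OF profile_cont(3)[OF u_cont] arccos_cont_Ix sub])+
  have "continuous_on S p" using p_diff by (rule differentiable_imp_continuous_on)
  then have "continuous_on Phi (\<lambda>\<phi>. p (gam \<phi>))" by (rule continuous_on_compose2[OF _ gam_cont(1) Phi_gam])
  from continuous_on_compose2[OF this arccos_cont_Ix sub] show "continuous_on Ix q" by (simp add: q_def[abs_def])
qed

lemma bdry: "R x0 = 0" "P x0 = 0" "T x0 = 0"
proof -
  have "gam \<phi>0 \<in> S" using gam_S[of \<phi>0] phi0_pos by simp
  moreover have "mu (gam \<phi>0) = x0" by (simp add: gam_eq(1) mu_spherical)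
  ultimately have "u (gam \<phi>0) = 0" using NS boundary_frontier unfolding solves_NS_def by blast
  then show "R x0 = 0" "P x0 = 0" "T x0 = 0" by (simp_all add: R_def P_def T_def arccos_x0 prR_def prP_def prT_def)
qed

lemma axis0: "P 1 = 0" "T 1 = 0" using axisym_axis[OF u_axi] by (simp_all add: P_def T_def)

definition eta0 where "eta0 x = P x * inverse (sqrt (1 - x\<^sup>2))"
definition c0 where "c0 x = T x * inverse (sqrt (1 - x\<^sup>2))"

text \<open>Unlike the quotient \<open>eta0\<close>, this expression (equal to it off the axis by the divergence condition) is continuous on the axis.\<close>

definition etas where "etas x = avg 0 (\<lambda>t. - R t) x / (1 + x)"

lemma D2s: "D2 R" "D2 eta0" "D2 c0"
  unfolding R_def[abs_def] eta0_def[abs_def] c0_def[abs_def] P_def T_def using profiles_D2[OF u_C2] D2_mult D2_inv_sqrt by auto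

lemma PT_sqrt: "x0 \<le> x \<Longrightarrow> x < 1 \<Longrightarrow> P x = sqrt (1 - x\<^sup>2) * eta0 x" "x0 \<le> x \<Longrightarrow> x < 1 \<Longrightarrow> T x = sqrt (1 - x\<^sup>2) * c0 x"
  using sq_pos[of x] by (auto simp: eta0_def c0_def)

lemma u_rep_Om: assumes "X \<in> Om" shows "u X = axi_field (\<lambda>x. R x + x * eta0 x) (\<lambda>x. - eta0 x) c0 X"
proof -
  have x: "x0 \<le> mu X" "mu X < 1" using Om_S[of X] assms by auto
  have n: "norm X powi (-1) = rinv X" by (simp add: rinv_def power_int_minus)
  show ?thesis
    using axisym_rep[OF u_axi u_hom Om_S(1)[OF assms] PT_sqrt[OF x, unfolded P_def T_def]] unfolding n
    by (simp add: axi_field_def sc_def R_def algebra_simps power2_eq_square)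
qed

lemma q_deriv:
  obtains q' where "\<And>t. x0 < t \<Longrightarrow> t < 1 \<Longrightarrow> (q has_real_derivative q' t) (at t)"
proof -
  have "(q has_real_derivative - dW p (gam (arccos t)) (gamd (arccos t)) / sqrt (1 - t\<^sup>2)) (at t)" if t: "x0 < t" "t < 1" for t
  proof -
    have "((\<lambda>\<phi>. p (gam \<phi>)) has_real_derivative dW p (gam (arccos t)) (gamd (arccos t))) (at (arccos t) within Phi)"
      using gam_vderiv[OF p_diff arccos_Phi, of t] t by (simp add: has_real_derivative_iff_has_vector_derivative)
    from arccos_chain[OF this t] show ?thesis by (simp add: q_def[abs_def])
  qed
  then show ?thesis by (rule that)
qed

text \<open>At the point of the unit meridian with \<open>mu\<close> equal to \<open>t\<close> the
  system becomes scalar. The last four conjuncts are the divergence condition and the swirl, polar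
  and radial momentum equations; one existential makes all of them speak about the same
  derivatives.\<close>

lemma odes:
  "\<exists>R' R'' \<eta>' c' c'' q'. \<forall>t. x0 < t \<and> t < 1 \<longrightarrow>
    (R has_real_derivative R' t) (at t) \<and> (R' has_real_derivative R'' t) (at t) \<and>
    (eta0 has_real_derivative \<eta>' t) (at t) \<and>
    (c0 has_real_derivative c' t) (at t) \<and> (c' has_real_derivative c'' t) (at t) \<and>
    (q has_real_derivative q' t) (at t) \<and>
    R t = (1 - t\<^sup>2) * \<eta>' t - 2 * t * eta0 t \<and>
    (1 - t\<^sup>2) * c'' t - 4 * t * c' t - 2 * c0 t = - eta0 t * ((1 - t\<^sup>2) * c' t - 2 * t * c0 t) - \<tau> t \<and>
    q' t - R' t + ((1 - t\<^sup>2) * eta0 t * \<eta>' t - t * (eta0 t)\<^sup>2) = - (t * (c0 t)\<^sup>2 + \<kappa> t) \<and>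
    (1 - t\<^sup>2) * R'' t - 2 * t * R' t + (1 - t\<^sup>2) * eta0 t * R' t + (R t)\<^sup>2 + 2 * R t
        + (1 - t\<^sup>2) * (c0 t)\<^sup>2 + 2 * (q t - R t + (1 - t\<^sup>2) * (eta0 t)\<^sup>2 / 2) + Fr t = 0"
proof -
  obtain R' R'' where R: "\<And>t. x0 < t \<Longrightarrow> t < 1 \<Longrightarrow> (R has_real_derivative R' t) (at t)" "\<And>t. x0 < t \<Longrightarrow> t < 1 \<Longrightarrow> (R' has_real_derivative R'' t) (at t)"
    using D2E[OF D2s(1)] by metis
  obtain e' e'' where e: "\<And>t. x0 < t \<Longrightarrow> t < 1 \<Longrightarrow> (eta0 has_real_derivative e' t) (at t)" "\<And>t. x0 < t \<Longrightarrow> t < 1 \<Longrightarrow> (e' has_real_derivative e'' t) (at t)"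
    using D2E[OF D2s(2)] by metis
  obtain c' c'' where c: "\<And>t. x0 < t \<Longrightarrow> t < 1 \<Longrightarrow> (c0 has_real_derivative c' t) (at t)" "\<And>t. x0 < t \<Longrightarrow> t < 1 \<Longrightarrow> (c' has_real_derivative c'' t) (at t)"
    using D2E[OF D2s(3)] by metis
  obtain q' where q: "\<And>t. x0 < t \<Longrightarrow> t < 1 \<Longrightarrow> (q has_real_derivative q' t) (at t)" using q_deriv by blast
  interpret axi_profiles \<phi>0 "\<lambda>x. R x + x * eta0 x" "\<lambda>x. R' x + (eta0 x + x * e' x)" "\<lambda>x. R'' x + (2 * e' x + x * e'' x)"
    "\<lambda>x. - eta0 x" "\<lambda>x. - e' x" "\<lambda>x. - e'' x" c0 c' c'' u
  proof unfold_locales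
    fix t assume t: "x0 < t" "t < 1"
    show "((\<lambda>x. R x + x * eta0 x) has_real_derivative R' t + (eta0 t + t * e' t)) (at t)"
      using R(1)[OF t] e(1)[OF t] by (auto intro!: derivative_eq_intros)
    show "((\<lambda>x. R' x + (eta0 x + x * e' x)) has_real_derivative R'' t + (2 * e' t + t * e'' t)) (at t)"
      using R(2)[OF t] e(1)[OF t] e(2)[OF t] by (auto intro!: derivative_eq_intros)
  qed (use e c u_rep_Om in \<open>auto intro: DERIV_minus\<close>)
  have pde: "- laplacian_within S u X + advection_within S u u X + grad_within S p X = F X" "div_within S u X = 0" if "X \<in> Om" for X
    using NS that unfolding solves_NS_def interior_S Om_def by blast+
  have prep: "p X = sc q 2 X" if "X \<in> Om" for X using scalar_rep[OF p_axi p_hom Om_S(1)[OF that]] by (simp add: q_def[abs_def])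
  have div: "R t = (1 - t\<^sup>2) * e' t - 2 * t * eta0 t" if t: "x0 < t" "t < 1" for t
    using div_u[OF gam_Om(1)[OF t]] pde(2)[OF gam_Om(1)[OF t]] gam_Om(2,3)[OF t] by (simp add: algebra_simps)
  have main: "(1 - t\<^sup>2) * c'' t - 4 * t * c' t - 2 * c0 t = - eta0 t * ((1 - t\<^sup>2) * c' t - 2 * t * c0 t) - \<tau> t"
    "q' t - R' t + ((1 - t\<^sup>2) * eta0 t * e' t - t * (eta0 t)\<^sup>2) = - (t * (c0 t)\<^sup>2 + \<kappa> t)"
    "(1 - t\<^sup>2) * R'' t - 2 * t * R' t + (1 - t\<^sup>2) * eta0 t * R' t + (R t)\<^sup>2 + 2 * R t
        + (1 - t\<^sup>2) * (c0 t)\<^sup>2 + 2 * (q t - R t + (1 - t\<^sup>2) * (eta0 t)\<^sup>2 / 2) + Fr t = 0"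
    if t: "x0 < t" "t < 1" for t
  proof -
    define X where "X = gam (arccos t)"
    have X: "X \<in> Om" "mu X = t" "rinv X = 1" using gam_Om[OF t] by (simp_all add: X_def)
    define E1 where "E1 = - ((1 - t\<^sup>2) * (R'' t + (2 * e' t + t * e'' t)) - 4 * t * (R' t + (eta0 t + t * e' t)) - 2 * (R t + t * eta0 t))
       + (- (R t + t * eta0 t)\<^sup>2 - (c0 t)\<^sup>2 + - eta0 t * ((R' t + (eta0 t + t * e' t)) * (1 - t\<^sup>2) - 2 * t * (R t + t * eta0 t))) - (t * q' t + 2 * q t)"
    define E2 where "E2 = - ((1 - t\<^sup>2) * - e'' t - 2 * t * - e' t + 2 * (R' t + (eta0 t + t * e' t)))
       + (- eta0 t * (- e' t * (1 - t\<^sup>2) - t * - eta0 t) + t * (c0 t)\<^sup>2) + q' t"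
    define E3 where "E3 = - ((1 - t\<^sup>2) * c'' t - 4 * t * c' t - 2 * c0 t) + - eta0 t * (c' t * (1 - t\<^sup>2) - 2 * t * c0 t)"
    have gr: "grad_within S p X = q' t *\<^sub>R e3 - (t * q' t + 2 * q t) *\<^sub>R X"
      using grad_p[of q q' p X, OF q prep X(1)] X(2,3) by simp
    have "E1 *\<^sub>R X + E2 *\<^sub>R e3 + E3 *\<^sub>R rot_gen X = - laplacian_within S u X + advection_within S u u X + grad_within S p X"
      unfolding laplacian_u[OF X(1)] advection_u[OF X(1)] gr X(2,3) E1_def E2_def E3_def
      by (simp add: algebra_simps)
    also have "\<dots> = (Fr t + t * \<kappa> t) *\<^sub>R X + (- \<kappa> t) *\<^sub>R e3 + \<tau> t *\<^sub>R rot_gen X"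
      unfolding pde(1)[OF X(1)] F_rep[OF Om_S(1)[OF X(1)]] X(2,3) by simp
    finally have E: "E1 = Fr t + t * \<kappa> t" "E2 = - \<kappa> t" "E3 = \<tau> t" using frame_eq[OF X(1)] by blast+
    show "(1 - t\<^sup>2) * c'' t - 4 * t * c' t - 2 * c0 t = - eta0 t * ((1 - t\<^sup>2) * c' t - 2 * t * c0 t) - \<tau> t"
      using E(3) unfolding E3_def by (simp add: algebra_simps)
    \<comment> \<open>Differentiating the divergence condition expresses the second derivative of
      \<open>eta0\<close> by \<open>R'\<close> and lower terms, which removes it from the
      \<open>e3\<close> component.\<close>
    have d: "((\<lambda>x. R x - ((1 - x\<^sup>2) * e' x - 2 * x * eta0 x)) has_real_derivative R' t - ((1 - t\<^sup>2) * e'' t - 2 * t * e' t - (2 * eta0 t + 2 * t * e' t))) (at t)"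
      using R(1)[OF t] e(1)[OF t] e(2)[OF t] by (auto intro!: derivative_eq_intros simp: algebra_simps)
    have "((\<lambda>x. R x - ((1 - x\<^sup>2) * e' x - 2 * x * eta0 x)) has_real_derivative 0) (at t)"
      by (rule has_field_derivative_transform_within_open[where f = "\<lambda>_. 0" and S = "{x0<..<1}"]) (use div t in auto)
    from DERIV_unique[OF d this] have R't: "R' t = (1 - t\<^sup>2) * e'' t - 4 * t * e' t - 2 * eta0 t" by simp
    have N': "q' t - R' t + ((1 - t\<^sup>2) * eta0 t * e' t - t * (eta0 t)\<^sup>2) - (- (t * (c0 t)\<^sup>2 + \<kappa> t)) = E2 + \<kappa> t"
    proof -
      have "E2 = ((1 - t\<^sup>2) * e'' t - 4 * t * e' t - 2 * eta0 t) - 2 * R' t + ((1 - t\<^sup>2) * eta0 t * e' t - t * (eta0 t)\<^sup>2) + t * (c0 t)\<^sup>2 + q' t"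
        unfolding E2_def by (simp add: algebra_simps power2_eq_square)
      then show ?thesis unfolding R't[symmetric] by simp
    qed
    then show "q' t - R' t + ((1 - t\<^sup>2) * eta0 t * e' t - t * (eta0 t)\<^sup>2) = - (t * (c0 t)\<^sup>2 + \<kappa> t)" using E(2) by simp
    \<comment> \<open>On the unit sphere \<open>X \<bullet> e3 = t\<close>, so this combination is
      the radial component.\<close>
    have "E1 + t * E2 = Fr t" using E by simp
    moreover have "E1 + t * E2 = - ((1 - t\<^sup>2) * R'' t - 2 * t * R' t + (1 - t\<^sup>2) * eta0 t * R' t + (R t)\<^sup>2 + 2 * R t
        + (1 - t\<^sup>2) * (c0 t)\<^sup>2 + 2 * (q t - R t + (1 - t\<^sup>2) * (eta0 t)\<^sup>2 / 2))
        + 2 * (R t - ((1 - t\<^sup>2) * e' t - 2 * t * eta0 t))"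
      unfolding E1_def E2_def by (simp add: algebra_simps power2_eq_square diff_divide_distrib)
    ultimately show "(1 - t\<^sup>2) * R'' t - 2 * t * R' t + (1 - t\<^sup>2) * eta0 t * R' t + (R t)\<^sup>2 + 2 * R t
        + (1 - t\<^sup>2) * (c0 t)\<^sup>2 + 2 * (q t - R t + (1 - t\<^sup>2) * (eta0 t)\<^sup>2 / 2) + Fr t = 0"
      using div[OF t] by simp
  qed
  show ?thesis
    by (rule exI[of _ R'], rule exI[of _ R''], rule exI[of _ e'], rule exI[of _ c'], rule exI[of _ c''], rule exI[of _ q'])
      (use R e(1) c q div main in blast)
qed

end

context reduced begin

text \<open>Profiles are compared on \<open>Ix\<close> only, while the operators take total
  functions.\<close>

lemma profile_cong:
  assumes e: "\<And>t. t \<in> Ix \<Longrightarrow> \<eta> t = \<zeta> t" and x: "x \<in> Ix"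
  shows "sg \<eta> x = sg \<zeta> x" "Qf \<eta> x = Qf \<zeta> x"
proof -
  have E: "En \<eta> t = En \<zeta> t" if "t \<in> Ix" for t unfolding En_def using prim_cong[OF e that] by simp
  have V: "Vp \<eta> t = Vp \<zeta> t" if "t \<in> Ix" for t unfolding Vp_def by (rule prim_cong[OF _ that]) (simp only: E)
  have A: "A0 \<eta> = A0 \<zeta>"
  proof -
    have "prim (\<lambda>t. Vp \<eta> t / En \<eta> t) 1 = prim (\<lambda>t. Vp \<zeta> t / En \<zeta> t) 1" by (rule prim_cong[OF _ x0_Ix(2)]) (simp only: E V)
    moreover have "prim (\<lambda>t. 1 / En \<eta> t) 1 = prim (\<lambda>t. 1 / En \<zeta> t) 1" by (rule prim_cong[OF _ x0_Ix(2)]) (simp only: E)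
    ultimately show ?thesis by (simp add: A0_def)
  qed
  have s: "sp \<eta> t = sp \<zeta> t" if "t \<in> Ix" for t unfolding sp_def A E[OF that] V[OF that] ..
  have g: "sg \<eta> t = sg \<zeta> t" if "t \<in> Ix" for t unfolding sg_def by (subst avg_cong[OF _ that, of _ "\<lambda>t. - sp \<zeta> t"]) (simp_all only: s)
  have K: "Kf \<eta> t = Kf \<zeta> t" if "t \<in> Ix" for t
  proof -
    have "tail (\<lambda>t. t * (sg \<eta> t)\<^sup>2) t = tail (\<lambda>t. t * (sg \<zeta> t)\<^sup>2) t" by (rule tail_cong[OF _ that]) (simp only: g)
    then show ?thesis unfolding Kf_def g[OF that] by simp
  qed
  have M: "Mk (Kf \<eta>) t = Mk (Kf \<zeta>) t" if "t \<in> Ix" for t unfolding Mk_def by (intro avg_cong[OF avg_cong[OF K]] that)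
  show "sg \<eta> x = sg \<zeta> x" by (rule g[OF x])
  show "Qf \<eta> x = Qf \<zeta> x" unfolding Qf_def M[OF x] M[OF x0_Ix(1)] ..
qed

lemma uf_cong:
  assumes e: "\<And>t. t \<in> Ix \<Longrightarrow> \<eta> t = \<zeta> t" and X: "X \<in> S" shows "uf \<eta> X = uf \<zeta> X"
  using profile_cong[OF e mu_mem[OF X]] e[OF mu_mem[OF X]] by (simp add: uf_def axi_field_def sc_def Rf_def)

end

context soln begin

text \<open>Up to sign and a factor \<rho> the Stokes stream function; by the divergence condition
  its derivative is \<open>R\<close>.\<close>

definition ys where "ys x = sqrt (1 - x\<^sup>2) * P x"

lemma ys_cont: "continuous_on Ix ys" unfolding ys_def[abs_def] by (intro continuous_intros RPT_cont)

lemma open_sqrt: "x0 < t \<Longrightarrow> t < 1 \<Longrightarrow> sqrt (1 - t\<^sup>2) * sqrt (1 - t\<^sup>2) = 1 - t\<^sup>2"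
  using sq_pos[of t] by simp

lemma ys_open: "x0 < t \<Longrightarrow> t < 1 \<Longrightarrow> ys t = (1 - t\<^sup>2) * eta0 t"
  using PT_sqrt(1)[of t] open_sqrt[of t] by (simp add: ys_def flip: mult.assoc)

lemma etas_cont: "continuous_on Ix etas"
  unfolding etas_def[abs_def] using x0_gt by (intro continuous_intros avg_cont RPT_cont) auto

text \<open>The radial equation is an exact derivative, and its first integral is exact again up to
  a \<open>tail\<close>; \<open>W1\<close> and \<open>W2\<close> are the primitives. The integration
  constant \<open>w\<close> is eliminated on the axis, the pressure constant \<open>C\<close> on the
  lateral boundary.\<close>

lemma reduction:
  shows "\<And>x. x \<in> Ix \<Longrightarrow> etas x = Tf etas x" "\<And>x. x \<in> Ix \<Longrightarrow> R x = Rf etas x"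
    "\<And>x. x \<in> Ix \<Longrightarrow> P x = sqrt (1 - x\<^sup>2) * etas x" "\<And>x. x \<in> Ix \<Longrightarrow> T x = sqrt (1 - x\<^sup>2) * sg etas x"
proof -
  obtain R' R'' e' c' c'' q' where H: "\<And>t. x0 < t \<and> t < 1 \<Longrightarrow>
    (R has_real_derivative R' t) (at t) \<and> (R' has_real_derivative R'' t) (at t) \<and>
    (eta0 has_real_derivative e' t) (at t) \<and>
    (c0 has_real_derivative c' t) (at t) \<and> (c' has_real_derivative c'' t) (at t) \<and>
    (q has_real_derivative q' t) (at t) \<and>
    R t = (1 - t\<^sup>2) * e' t - 2 * t * eta0 t \<and>
    (1 - t\<^sup>2) * c'' t - 4 * t * c' t - 2 * c0 t = - eta0 t * ((1 - t\<^sup>2) * c' t - 2 * t * c0 t) - \<tau> t \<and>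
    q' t - R' t + ((1 - t\<^sup>2) * eta0 t * e' t - t * (eta0 t)\<^sup>2) = - (t * (c0 t)\<^sup>2 + \<kappa> t) \<and>
    (1 - t\<^sup>2) * R'' t - 2 * t * R' t + (1 - t\<^sup>2) * eta0 t * R' t + (R t)\<^sup>2 + 2 * R t
        + (1 - t\<^sup>2) * (c0 t)\<^sup>2 + 2 * (q t - R t + (1 - t\<^sup>2) * (eta0 t)\<^sup>2 / 2) + Fr t = 0"
    using odes by blast
  have
    dR: "\<And>t. x0 < t \<Longrightarrow> t < 1 \<Longrightarrow> (R has_real_derivative R' t) (at t)" "\<And>t. x0 < t \<Longrightarrow> t < 1 \<Longrightarrow> (R' has_real_derivative R'' t) (at t)"
    and de: "\<And>t. x0 < t \<Longrightarrow> t < 1 \<Longrightarrow> (eta0 has_real_derivative e' t) (at t)"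
    and dc: "\<And>t. x0 < t \<Longrightarrow> t < 1 \<Longrightarrow> (c0 has_real_derivative c' t) (at t)" "\<And>t. x0 < t \<Longrightarrow> t < 1 \<Longrightarrow> (c' has_real_derivative c'' t) (at t)"
    and dq: "\<And>t. x0 < t \<Longrightarrow> t < 1 \<Longrightarrow> (q has_real_derivative q' t) (at t)"
    and Req: "\<And>t. x0 < t \<Longrightarrow> t < 1 \<Longrightarrow> R t = (1 - t\<^sup>2) * e' t - 2 * t * eta0 t"
    and seq: "\<And>t. x0 < t \<Longrightarrow> t < 1 \<Longrightarrow> (1 - t\<^sup>2) * c'' t - 4 * t * c' t - 2 * c0 t = - eta0 t * ((1 - t\<^sup>2) * c' t - 2 * t * c0 t) - \<tau> t"
    and Neq: "\<And>t. x0 < t \<Longrightarrow> t < 1 \<Longrightarrow> q' t - R' t + ((1 - t\<^sup>2) * eta0 t * e' t - t * (eta0 t)\<^sup>2) = - (t * (c0 t)\<^sup>2 + \<kappa> t)"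
    and Peq: "\<And>t. x0 < t \<Longrightarrow> t < 1 \<Longrightarrow> (1 - t\<^sup>2) * R'' t - 2 * t * R' t + (1 - t\<^sup>2) * eta0 t * R' t + (R t)\<^sup>2 + 2 * R t
        + (1 - t\<^sup>2) * (c0 t)\<^sup>2 + 2 * (q t - R t + (1 - t\<^sup>2) * (eta0 t)\<^sup>2 / 2) + Fr t = 0"
    using H by blast+
  have dy0: "((\<lambda>x. (1 - x\<^sup>2) * eta0 x) has_real_derivative R t) (at t)" if t: "x0 < t" "t < 1" for t
    using de[OF t] Req[OF t] by (auto intro!: derivative_eq_intros)
  have dy: "(ys has_real_derivative R t) (at t)" if t: "x0 < t" "t < 1" for t
    by (rule has_field_derivative_transform_within_open[OF dy0[OF t], where S = "{x0<..<1}"]) (use t ys_open in auto)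
  have y1: "ys 1 = 0" "ys x0 = 0" using bdry axis0 by (simp_all add: ys_def)
  have y_etas: "ys x = (1 - x\<^sup>2) * etas x" if x: "x \<in> Ix" for x
  proof -
    have "ys x = (1 - x) ^ (0 + 1) * avg 0 (\<lambda>t. - R t) x"
      by (rule avg_unique[OF _ ys_cont y1(1) _ x]) (auto intro!: continuous_intros RPT_cont dy)
    then show ?thesis using x x0_gt by (simp add: etas_def one_minus_sq)
  qed
  have eta0: "eta0 t = etas t" if t: "x0 < t" "t < 1" for t
    using y_etas[of t] ys_open[OF t] t sq_pos[of t] by auto
  have Peta: "P x = sqrt (1 - x\<^sup>2) * etas x" if x: "x \<in> Ix" for x
    by (rule eq_Ix[OF RPT_cont(2) _ _ x]) (auto intro!: continuous_intros etas_cont simp: PT_sqrt eta0)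
  show "\<And>x. x \<in> Ix \<Longrightarrow> P x = sqrt (1 - x\<^sup>2) * etas x" by (rule Peta)
  define s where "s = (\<lambda>x. sqrt (1 - x\<^sup>2) * T x)"
  have s_open: "s t = (1 - t\<^sup>2) * c0 t" if t: "x0 < t" "t < 1" for t
    using PT_sqrt(2)[of t] open_sqrt[OF t] t by (simp add: s_def flip: mult.assoc)
  have s_eq: "s x = ss etas x" if x: "x \<in> Ix" for x
  proof (rule lin_unique[OF etas_cont _ _ _ _ _ x, where v = "\<lambda>t. (1 - t\<^sup>2) * c' t - 2 * t * c0 t"])
    show "continuous_on Ix s" unfolding s_def by (intro continuous_intros RPT_cont)
    show "s x0 = 0" "s 1 = 0" using bdry axis0 by (simp_all add: s_def)
    fix t assume t: "x0 < t" "t < 1"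
    have "((\<lambda>x. (1 - x\<^sup>2) * c0 x) has_real_derivative (1 - t\<^sup>2) * c' t - 2 * t * c0 t) (at t)"
      using dc(1)[OF t] by (auto intro!: derivative_eq_intros)
    then show "(s has_real_derivative (1 - t\<^sup>2) * c' t - 2 * t * c0 t) (at t)"
      by (rule has_field_derivative_transform_within_open[where S = "{x0<..<1}"]) (use t s_open in auto)
    have "((\<lambda>t. (1 - t\<^sup>2) * c' t - 2 * t * c0 t) has_real_derivative (1 - t\<^sup>2) * c'' t - 4 * t * c' t - 2 * c0 t) (at t)"
      using dc(1)[OF t] dc(2)[OF t] by (auto intro!: derivative_eq_intros simp: algebra_simps)
    then show "((\<lambda>t. (1 - t\<^sup>2) * c' t - 2 * t * c0 t) has_real_derivative - etas t * ((1 - t\<^sup>2) * c' t - 2 * t * c0 t) - \<tau> t) (at t)"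
      unfolding seq[OF t] eta0[OF t] .
  qed
  have c0: "c0 t = sg etas t" if t: "x0 < t" "t < 1" for t
    using s_eq[of t] ss_sg[OF etas_cont, of t] s_open[OF t] t sq_pos[of t] by auto
  have Tsg: "T x = sqrt (1 - x\<^sup>2) * sg etas x" if x: "x \<in> Ix" for x
    by (rule eq_Ix[OF RPT_cont(3) _ _ x]) (auto intro!: continuous_intros sg_cont etas_cont simp: PT_sqrt c0)
  show "\<And>x. x \<in> Ix \<Longrightarrow> T x = sqrt (1 - x\<^sup>2) * sg etas x" by (rule Tsg)
  have sq_Ix: "sqrt (1 - x\<^sup>2) * sqrt (1 - x\<^sup>2) = 1 - x\<^sup>2" if "x \<in> Ix" for x
    using Ix_bounds(5)[OF that] by (simp add: abs_square_le_1)
  have T2: "(T x)\<^sup>2 = (1 - x\<^sup>2) * (sg etas x)\<^sup>2" if x: "x \<in> Ix" for x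
    unfolding Tsg[OF x] power_mult_distrib power2_eq_square[of "sqrt _"] sq_Ix[OF x] ..
  have P2: "(P x)\<^sup>2 = (1 - x\<^sup>2) * (etas x)\<^sup>2" if x: "x \<in> Ix" for x
    unfolding Peta[OF x] power_mult_distrib power2_eq_square[of "sqrt _"] sq_Ix[OF x] ..
  define Kh where "Kh = (\<lambda>x. (T x)\<^sup>2 + 2 * (q x - R x + (P x)\<^sup>2 / 2) + Fr x)"
  have Kh_cont: "continuous_on Ix Kh" unfolding Kh_def by (intro continuous_intros RPT_cont lip_wt_cont[OF Fr_lip]) auto
  \<comment> \<open>The polar equation says that \<open>H\<close> is constant; this replaces the
    pressure in \<open>Kh\<close> by force and swirl.\<close>
  define H where "H = (\<lambda>x. 2 * (q x - R x + (P x)\<^sup>2 / 2) + Fr 1 - 2 * tail \<kappa> x - 2 * tail (\<lambda>t. t * (sg etas t)\<^sup>2) x)"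
  have tc: "continuous_on Ix (\<lambda>t. t * (sg etas t)\<^sup>2)" by (intro continuous_intros sg_cont etas_cont)
  define C where "C = H 1"
  have HC: "H x = C" if x: "x \<in> Ix" for x
    unfolding C_def
  proof (rule const_Ix[OF _ _ x x0_Ix(2)])
    show "continuous_on Ix H" unfolding H_def by (intro continuous_intros RPT_cont tail_cont \<kappa>_cont tc) auto
    fix t assume t: "x0 < t" "t < 1"
    have tl: "(tail \<kappa> has_real_derivative - \<kappa> t) (at t)" "(tail (\<lambda>t. t * (sg etas t)\<^sup>2) has_real_derivative - (t * (sg etas t)\<^sup>2)) (at t)"
      using tail_deriv[OF \<kappa>_cont, of t] tail_deriv[OF tc, of t] at_Ix[OF t] t by auto
    have "((\<lambda>x. 2 * (q x - R x + (1 - x\<^sup>2) * (eta0 x)\<^sup>2 / 2) + Fr 1 - 2 * tail \<kappa> x - 2 * tail (\<lambda>t. t * (sg etas t)\<^sup>2) x) has_real_derivative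
       2 * (q' t - R' t + ((1 - t\<^sup>2) * eta0 t * e' t - t * (eta0 t)\<^sup>2)) + 2 * \<kappa> t + 2 * (t * (sg etas t)\<^sup>2)) (at t)"
      using dq[OF t] dR(1)[OF t] de[OF t] tl
      by (auto intro!: derivative_eq_intros simp: algebra_simps diff_divide_distrib add_divide_distrib)
    also have "2 * (q' t - R' t + ((1 - t\<^sup>2) * eta0 t * e' t - t * (eta0 t)\<^sup>2)) + 2 * \<kappa> t + 2 * (t * (sg etas t)\<^sup>2) = 0"
      unfolding Neq[OF t] c0[OF t] by simp
    finally show "(H has_real_derivative 0) (at t)"
      by (rule has_field_derivative_transform_within_open[where S = "{x0<..<1}"]) (use t P2 eta0 in \<open>auto simp: H_def\<close>)
  qed
  have Kh_eq: "Kh x - C = Kf etas x" if x: "x \<in> Ix" for x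
    using HC[OF x] unfolding Kh_def H_def Kf_def KF_def T2[OF x] by simp
  \<comment> \<open>Its derivative is the left-hand side of \<open>Peq\<close>, the
    \<open>tail\<close> accounting for the terms collected in \<open>Kh\<close>.\<close>
  define W1 where "W1 = (\<lambda>t. (1 - t\<^sup>2) * R' t + ((1 - t\<^sup>2) * eta0 t) * R t + 2 * ((1 - t\<^sup>2) * eta0 t) - tail Kh t)"
  have dW1: "(W1 has_real_derivative 0) (at t)" if t: "x0 < t" "t < 1" for t
  proof -
    have tl: "(tail Kh has_real_derivative - Kh t) (at t)" using tail_deriv[OF Kh_cont, of t] at_Ix[OF t] t by auto
    have q1: "((\<lambda>t. 1 - t\<^sup>2) has_real_derivative - 2 * t) (at t)" by (auto intro!: derivative_eq_intros)
    have "(W1 has_real_derivative (- 2 * t * R' t + R'' t * (1 - t\<^sup>2)) + (R t * R t + R' t * ((1 - t\<^sup>2) * eta0 t)) + 2 * R t - - Kh t) (at t)"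
      unfolding W1_def by (intro DERIV_diff DERIV_add DERIV_mult DERIV_cmult q1 dR dy0 tl t)
    also have "(- 2 * t * R' t + R'' t * (1 - t\<^sup>2)) + (R t * R t + R' t * ((1 - t\<^sup>2) * eta0 t)) + 2 * R t - - Kh t = 0"
    proof -
      have tI: "t \<in> Ix" using t by auto
      show ?thesis using Peq[OF t] unfolding Kh_def T2[OF tI] P2[OF tI] c0[OF t] eta0[OF t]
        by (simp add: algebra_simps power2_eq_square diff_divide_distrib)
    qed
    finally show ?thesis .
  qed
  obtain w where w: "\<And>t. x0 < t \<Longrightarrow> t < 1 \<Longrightarrow> W1 t = w" using const_open[OF dW1] by blast
  \<comment> \<open>A primitive of \<open>W1\<close> without its \<open>tail\<close> term: the two
    contributions \<open>2 * x * R x\<close> cancel in the derivative. By the divergence condition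
    it is \<open>(1 - x\<^sup>2)\<^sup>2\<close> times \<eta>' + \<eta>^2 / 2, the left side of the
    Riccati equation without Q.\<close>
  define W2 where "W2 = (\<lambda>x. (1 - x\<^sup>2) * R x + 2 * x * ys x + (ys x)\<^sup>2 / 2)"
  have G: "- (W2 x + w * (1 - x)) = (1 - x) ^ (1 + 1) * avg 1 (avg 0 Kh) x" if x: "x \<in> Ix" for x
  proof (rule avg_unique[OF avg_cont[OF Kh_cont] _ _ _ x, where F = "\<lambda>x. - (W2 x + w * (1 - x))"])
    show "continuous_on Ix (\<lambda>x. - (W2 x + w * (1 - x)))" unfolding W2_def by (intro continuous_intros RPT_cont ys_cont) auto
    show "- (W2 1 + w * (1 - 1)) = 0" by (simp add: W2_def y1)
    fix t assume t: "x0 < t" "t < 1"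
    have "((\<lambda>x. - (W2 x + w * (1 - x))) has_real_derivative - ((1 - t\<^sup>2) * R' t + 2 * ys t + ys t * R t - w)) (at t)"
      unfolding W2_def using dR(1)[OF t] dy[OF t] by (auto intro!: derivative_eq_intros simp: algebra_simps)
    also have "(1 - t\<^sup>2) * R' t + 2 * ys t + ys t * R t - w = tail Kh t"
      using w[OF t] unfolding W1_def ys_open[OF t] by simp
    also have "tail Kh t = (1 - t) ^ 1 * avg 0 Kh t" using avg_tail[OF Kh_cont, of 0 t] by simp
    finally show "((\<lambda>x. - (W2 x + w * (1 - x))) has_real_derivative - ((1 - t) ^ 1 * avg 0 Kh t)) (at t)" .
  qed
  have W2_eq: "W2 x = (1 - x) * ((1 + x) * R x + 2 * x * (1 + x) * etas x + (1 - x) * (1 + x)\<^sup>2 * (etas x)\<^sup>2 / 2)" if x: "x \<in> Ix" for x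
    unfolding W2_def y_etas[OF x] one_minus_sq by (simp add: algebra_simps power2_eq_square)
  \<comment> \<open>The identity for \<open>W2\<close>, divided by \<open>1 - x\<close>, extends to
    the axis; there it reads \<open>w = 0\<close>, because
    \<open>etas 1 = - R 1 / 2\<close>.\<close>
  have "(1 + 1) * R 1 + 2 * 1 * (1 + 1) * etas 1 + (1 - 1) * (1 + 1)\<^sup>2 * (etas 1)\<^sup>2 / 2 + w = - ((1 - 1) * Mk Kh 1)"
  proof (rule eq_Ix[where f = "\<lambda>x. (1 + x) * R x + 2 * x * (1 + x) * etas x + (1 - x) * (1 + x)\<^sup>2 * (etas x)\<^sup>2 / 2 + w" and g = "\<lambda>x. - ((1 - x) * Mk Kh x)"])
    fix t assume t: "x0 < t" "t < 1"
    then have tI: "t \<in> Ix" by auto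
    have "(1 - t) * ((1 + t) * R t + 2 * t * (1 + t) * etas t + (1 - t) * (1 + t)\<^sup>2 * (etas t)\<^sup>2 / 2 + w) = (1 - t) * - ((1 - t) * Mk Kh t)"
      using G[OF tI] unfolding W2_eq[OF tI] Mk_def by (simp add: algebra_simps)
    then show "(1 + t) * R t + 2 * t * (1 + t) * etas t + (1 - t) * (1 + t)\<^sup>2 * (etas t)\<^sup>2 / 2 + w = - ((1 - t) * Mk Kh t)"
      using t by (simp only: mult_cancel_left) auto
  qed (auto intro!: continuous_intros RPT_cont etas_cont Mk_cont Kh_cont x0_Ix)
  moreover have "etas 1 = - R 1 / 2" by (simp add: etas_def avg_def)
  ultimately have w0: "w = 0" by simp
  have G0: "W2 x = - ((1 - x)\<^sup>2 * Mk Kh x)" if x: "x \<in> Ix" for x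
    using G[OF x] by (simp add: w0 Mk_def power2_eq_square)
  \<comment> \<open>No-slip makes \<open>ys\<close> and \<open>R\<close> vanish at
    \<open>x0\<close>; this fixes the remaining constant \<open>C\<close>.\<close>
  have "W2 x0 = 0" by (simp add: W2_def y1 bdry)
  then have M0: "Mk Kh x0 = 0" using G0[OF x0_Ix(1)] x0_lt by simp
  have MK: "Mk (Kf etas) x = Mk Kh x - C / 2" if x: "x \<in> Ix" for x
  proof -
    have "Mk (Kf etas) x = Mk (\<lambda>t. Kh t - C) x"
      unfolding Mk_def by (rule avg_cong[OF avg_cong x]) (simp_all only: Kh_eq)
    also have "\<dots> = Mk Kh x - Mk (\<lambda>_. C) x" by (rule Mk_diff[OF Kh_cont _ x]) auto
    finally show ?thesis unfolding Mk_const[OF x] .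
  qed
  have MQ: "Mk Kh x = (1 + x)\<^sup>2 * Qf etas x" if x: "x \<in> Ix" for x
    using Ix_bounds(1)[OF x] unfolding Qf_def MK[OF x] MK[OF x0_Ix(1)] M0 by simp
  have Rx: "R t = Rf etas t" if t: "x0 < t" "t < 1" for t
  proof -
    have tI: "t \<in> Ix" using t by auto
    have "(1 - t\<^sup>2) * R t + 2 * t * ((1 - t\<^sup>2) * etas t) + ((1 - t\<^sup>2) * etas t)\<^sup>2 / 2 = - ((1 - t)\<^sup>2 * ((1 + t)\<^sup>2 * Qf etas t))"
      using G0[OF tI] unfolding W2_def y_etas[OF tI] MQ[OF tI] .
    also have "\<dots> = - ((1 - t\<^sup>2)\<^sup>2 * Qf etas t)" unfolding one_minus_sq power_mult_distrib by simp
    finally have "(1 - t\<^sup>2) * (R t - Rf etas t) = 0" by (simp add: Rf_def power2_eq_square algebra_simps add_divide_distrib diff_divide_distrib)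
    then show ?thesis using sq_pos[of t] t by simp
  qed
  show RR: "\<And>x. x \<in> Ix \<Longrightarrow> R x = Rf etas x" by (rule eq_Ix[OF RPT_cont(1) Rf_cont[OF etas_cont] Rx])
  have et0: "etas x0 = 0" using y_etas[OF x0_Ix(1)] y1 sq_pos[of x0] x0_lt by simp
  show "etas x = Tf etas x" if x: "x \<in> Ix" for x
  proof -
    have "- etas x = prim (\<lambda>t. (etas t)\<^sup>2 / 2 + Qf etas t) x"
    proof (rule prim_unique[OF Tint_cont[OF etas_cont] _ _ _ x, where F = "\<lambda>x. - etas x"])
      show "continuous_on Ix (\<lambda>x. - etas x)" by (intro continuous_intros etas_cont)
      fix t assume t: "x0 < t" "t < 1"
      have "(1 - t\<^sup>2) * (e' t + ((etas t)\<^sup>2 / 2 + Qf etas t)) = 0"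
        using Req[OF t] Rx[OF t] unfolding Rf_def eta0[OF t] by (simp add: algebra_simps add_divide_distrib diff_divide_distrib)
      then have "e' t = - ((etas t)\<^sup>2 / 2 + Qf etas t)" using sq_pos[of t] t by auto
      moreover have "(etas has_real_derivative e' t) (at t)"
        by (rule has_field_derivative_transform_within_open[OF de[OF t], where S = "{x0<..<1}"]) (use t eta0 in auto)
      ultimately show "((\<lambda>x. - etas x) has_real_derivative (etas t)\<^sup>2 / 2 + Qf etas t) (at t)"
        by (auto intro!: derivative_eq_intros)
    qed (simp add: et0)
    then show ?thesis by (simp add: Tf_def)
  qed
qed

lemma u_uf: assumes "X \<in> S" shows "u X = uf etas X"
proof -
  have n: "norm X powi (-1) = rinv X" by (simp add: rinv_def power_int_minus)
  note r = reduction[OF mu_mem[OF assms]]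
  show ?thesis
    using axisym_rep[OF u_axi u_hom assms r(3,4)[unfolded P_def T_def]] r(2) unfolding n
    by (simp add: uf_def axi_field_def sc_def R_def algebra_simps power2_eq_square)
qed

text \<open>\<open>etas\<close> is an average of \<open>- R\<close> divided by \<open>1 + x\<close>,
  so the radial velocity alone bounds it, uniformly up to the axis.\<close>

lemma etas_small:
  assumes "C0_norm (sphere 0 1 \<inter> S) u \<le> \<delta>" "x \<in> Ix" shows "\<bar>etas x\<bar> \<le> \<delta> / (1 + x0)"
proof -
  have Rb: "\<bar>R t\<bar> \<le> \<delta>" if t: "t \<in> Ix" for t
  proof -
    have a: "arccos t \<in> Phi" by (rule arccos_Phi[OF t])
    then have g: "gam (arccos t) \<in> sphere 0 1 \<inter> S" using Phi_gam by (auto simp: gam_eq(1) norm_spherical)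
    have "norm (u (gam (arccos t))) \<le> C0_norm (sphere 0 1 \<inter> S) u"
      by (rule C0_norm_upper[OF continuous_on_subset[OF u_cont] g]) auto
    moreover have "\<bar>R t\<bar> \<le> norm (u (gam (arccos t))) * norm (gam (arccos t))" unfolding R_def prR_def by (rule Cauchy_Schwarz_ineq2)
    ultimately show ?thesis using assms(1) g by simp
  qed
  have "\<bar>avg 0 (\<lambda>t. - R t) x\<bar> \<le> \<delta>" by (rule avg_bound[OF _ assms(2)]) (use Rb in \<open>auto intro!: continuous_intros RPT_cont\<close>)
  then show ?thesis unfolding etas_def abs_divide using assms(2) x0_gt by (intro frac_le) auto
qed

lemma swirl_free_u: assumes "\<And>t. t \<in> Ix \<Longrightarrow> \<tau> t = 0" shows "swirl_free \<phi>0 u"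
  unfolding swirl_free_def
proof (intro allI impI ballI)
  fix \<rho> \<phi> \<theta> :: real assume *: "\<rho> > 0" "\<phi> \<in> {0..\<phi>0}" "\<theta> \<in> {0<..2*pi}"
  define X where "X = spherical \<rho> \<phi> \<theta>"
  have X: "X \<in> S" using * unfolding X_def by (intro spherical_in_S) auto
  have "sg etas (mu X) = 0" by (rule no_swirl(2)[OF assms mu_mem[OF X]])
  then have "u X = sc (\<lambda>x. Rf etas x + x * etas x) 2 X *\<^sub>R X + sc (\<lambda>x. - etas x) 1 X *\<^sub>R e3"
    unfolding u_uf[OF X] uf_def axi_field_def by (simp add: sc_def)
  moreover have "X \<bullet> e_theta \<theta> = 0" "e3 \<bullet> e_theta \<theta> = 0"
    by (simp_all add: X_def inner_vec_def sum_3 e_theta_nth axis_nth)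
  ultimately show "v_theta u \<rho> \<phi> \<theta> = 0" unfolding v_theta_def X_def[symmetric] by (simp add: inner_add_left)
qed

end

section \<open>Uniqueness of the pressure and of solutions\<close>

context forced begin

text \<open>The equation determines the gradient of the pressure, and Euler's identity in degree -2
  recovers the pressure from it without a free constant; continuity covers the lateral
  boundary.\<close>

lemma pressure_unique:
  assumes "axi_self_similar_solution \<phi>0 F u p" "axi_self_similar_solution \<phi>0 F u' p'" "\<And>X. X \<in> S \<Longrightarrow> u X = u' X" "X \<in> S"
  shows "p X = p' X"
proof -
  interpret a: soln \<phi>0 F u p by (rule soln.intro[OF forced_axioms soln_axioms.intro[OF assms(1)]])
  interpret b: soln \<phi>0 F u' p' by (rule soln.intro[OF forced_axioms soln_axioms.intro[OF assms(2)]])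
  have p1: "partial_within S i u Y = partial_within S i u' Y" if "Y \<in> S" for Y i
    by (rule partial_within_cong[OF assms(3) that])
  have p2: "partial_within S i (partial_within S i u) Y = partial_within S i (partial_within S i u') Y" if "Y \<in> S" for Y i
    by (rule partial_within_cong[OF p1 that])
  have eul: "pp Y = - (Y \<bullet> grad_within S pp Y) / 2" if "pp differentiable_on S" "homogeneous_on S (-2) pp" "Y \<in> S" for pp Y
  proof -
    have "Y \<bullet> grad_within S pp Y = dW pp Y Y" by (simp add: dW_def grad_within_def inner_vec_def)
    then show ?thesis using euler_homogeneous[OF that] by simp
  qed
  have op: "p Y = p' Y" if Y: "Y \<in> S_open" for Y
  proof -
    have YS: "Y \<in> S" using Y S_open_subset by blast
    have "grad_within S p Y = F Y + laplacian_within S u Y - advection_within S u u Y"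
    proof -
      have "F Y = - laplacian_within S u Y + advection_within S u u Y + grad_within S p Y"
        using a.NS Y unfolding solves_NS_def interior_S by metis
      then show ?thesis by simp
    qed
    moreover have "grad_within S p' Y = F Y + laplacian_within S u' Y - advection_within S u' u' Y"
    proof -
      have "F Y = - laplacian_within S u' Y + advection_within S u' u' Y + grad_within S p' Y"
        using b.NS Y unfolding solves_NS_def interior_S by metis
      then show ?thesis by simp
    qed
    moreover have "laplacian_within S u Y = laplacian_within S u' Y" unfolding laplacian_within_def using p2[OF YS] by simp
    moreover have "advection_within S u u Y = advection_within S u' u' Y" unfolding advection_within_def using p1[OF YS] assms(3)[OF YS] by simp
    ultimately have "grad_within S p Y = grad_within S p' Y" by simp
    then show ?thesis using eul[OF a.p_diff a.p_hom YS] eul[OF b.p_diff b.p_hom YS] by simp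
  qed
  have q: "a.q x = b.q x" if "x \<in> Ix" for x
  proof (rule eq_Ix[OF a.RPT_cont(4) b.RPT_cont(4) _ that])
    fix t assume "x0 < t" "t < 1"
    then have "gam (arccos t) \<in> S_open" using gam_Om(1)[of t] by (simp add: Om_def)
    then show "a.q t = b.q t" using op by (simp add: a.q_def b.q_def)
  qed
  show ?thesis
    using scalar_rep[OF a.p_axi a.p_hom assms(4)] scalar_rep[OF b.p_axi b.p_hom assms(4)] q[OF mu_mem[OF assms(4)]]
    by (simp add: sc_def a.q_def b.q_def)
qed

lemma same_solution:
  assumes "axi_self_similar_solution \<phi>0 F u p" "axi_self_similar_solution \<phi>0 F u' p'"
    "\<And>x. x \<in> Ix \<Longrightarrow> soln.etas \<phi>0 u x = soln.etas \<phi>0 u' x"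
  shows "same_on_cone \<phi>0 u p u' p'"
proof -
  interpret a: soln \<phi>0 F u p by (rule soln.intro[OF forced_axioms soln_axioms.intro[OF assms(1)]])
  interpret b: soln \<phi>0 F u' p' by (rule soln.intro[OF forced_axioms soln_axioms.intro[OF assms(2)]])
  have u: "u X = u' X" if "X \<in> S" for X
    using a.u_uf[OF that] b.u_uf[OF that] uf_cong[OF assms(3) that] by simp
  show ?thesis unfolding same_on_cone_def using u pressure_unique[OF assms(1,2) u] by blast
qed

lemma unique_swirl_free:
  assumes "swirl_free \<phi>0 F" "axi_self_similar_solution \<phi>0 F u p" "axi_self_similar_solution \<phi>0 F u' p'"
  shows "same_on_cone \<phi>0 u p u' p'"
proof -
  interpret a: soln \<phi>0 F u p by (rule soln.intro[OF forced_axioms soln_axioms.intro[OF assms(2)]])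
  interpret b: soln \<phi>0 F u' p' by (rule soln.intro[OF forced_axioms soln_axioms.intro[OF assms(3)]])
  note \<tau>0 = swirl_free_\<tau>[OF assms(1)]
  have "a.etas x = b.etas x" if "x \<in> Ix" for x
    by (rule riccati_unique[OF a.etas_cont a.reduction(1) b.etas_cont b.reduction(1) no_swirl_Qf[OF \<tau>0] that])
  then show ?thesis by (rule same_solution[OF assms(2,3)])
qed

end

context cone begin

section \<open>Fixed points are solutions\<close>

text \<open>A derivative formula known inside and continuous up to the ends also holds at the ends,
  since \<open>f\<close> is then \<open>f x0\<close> plus the integral of \<open>g\<close>.\<close>

lemma C1_extend:
  assumes "continuous_on Ix f" "continuous_on Ix g" "\<And>t. x0 < t \<Longrightarrow> t < 1 \<Longrightarrow> (f has_real_derivative g t) (at t)" "x \<in> Ix"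
  shows "(f has_real_derivative g x) (at x within Ix)"
proof -
  have e: "f y - f x0 = prim g y" if "y \<in> Ix" for y
    by (rule prim_unique[OF assms(2) _ _ _ that, where F = "\<lambda>y. f y - f x0"]) (use assms in \<open>auto intro!: continuous_intros derivative_eq_intros\<close>)
  have "((\<lambda>y. f x0 + prim g y) has_real_derivative g x) (at x within Ix)"
    using prim_deriv[OF assms(2,4)] by (auto intro!: derivative_eq_intros)
  then show ?thesis
  proof (rule has_field_derivative_transform_within[where d = 1])
    show "f x0 + prim g y = f y" if "y \<in> Ix" for y using e[OF that] by linarith
  qed (use assms(4) in simp_all)
qed

text \<open>Integration by parts: \<open>tail k t - (1 - t) * k t\<close> has derivative
  \<open>- ((1 - t) * k' t)\<close>. So averaging a C^1 function loses no power of
  \<open>1 - x\<close>, in contrast to \<open>bdw_avg\<close>.\<close>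

lemma avg0_deriv_C1:
  assumes k: "\<And>x. x \<in> Ix \<Longrightarrow> (k has_real_derivative k' x) (at x within Ix)" and k': "continuous_on Ix k'" and x: "x \<in> Ix"
  shows "(avg 0 k has_real_derivative avg 1 k' x) (at x within Ix)"
proof (rule C1_extend[OF _ avg_cont[OF k'] _ x])
  have kc: "continuous_on Ix k" by (rule DERIV_continuous_on[OF k])
  show "continuous_on Ix (avg 0 k)" by (rule avg_cont[OF kc])
  fix t assume t: "x0 < t" "t < 1"
  have "tail k t - (1 - t) * k t = (1 - t) ^ (1 + 1) * avg 1 k' t"
  proof (rule avg_unique[OF k', where F = "\<lambda>t. tail k t - (1 - t) * k t"])
    fix y assume y: "x0 < y" "y < 1"
    have "(tail k has_real_derivative - k y) (at y)" "(k has_real_derivative k' y) (at y)"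
      using tail_deriv[OF kc, of y] k[of y] at_Ix[OF y] y by auto
    then show "((\<lambda>t. tail k t - (1 - t) * k t) has_real_derivative - ((1 - y) ^ 1 * k' y)) (at y)"
      by (auto intro!: derivative_eq_intros simp: algebra_simps)
  qed (use t in \<open>auto intro!: continuous_intros tail_cont kc\<close>)
  moreover have "tail k t = (1 - t) * avg 0 k t" using avg_tail[OF kc, of 0 t] by simp
  ultimately have "(1 - t) * (avg 0 k t - k t) = (1 - t) * ((1 - t) * avg 1 k' t)" by (simp add: algebra_simps)
  then have "avg 0 k t - k t = (1 - t) * avg 1 k' t" using t by simp
  then have "((real 0 + 1) * avg 0 k t - k t) / (1 - t) = avg 1 k' t" using t by simp
  then show "(avg 0 k has_real_derivative avg 1 k' t) (at t)"
    using avg_deriv[OF kc, of t 0] at_Ix[OF t] t by simp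
qed

lemma lip_wt_const: "lip_wt (\<lambda>_. c)" by (rule C1_lip_wt[where \<alpha>' = "\<lambda>_. 0"]) auto
lemma lip_wt_id: "lip_wt (\<lambda>x. x)" by (rule C1_lip_wt[where \<alpha>' = "\<lambda>_. 1"]) auto
lemma lip_wt_minus: "lip_wt f \<Longrightarrow> lip_wt (\<lambda>x. - f x)" using lip_wt_mult[OF lip_wt_const[of "-1"], of f] by simp
lemma lip_wt_diff: "lip_wt f \<Longrightarrow> lip_wt g \<Longrightarrow> lip_wt (\<lambda>x. f x - g x)" using lip_wt_add[of f "\<lambda>x. - g x"] lip_wt_minus[of g] by simp
lemma lip_wt_power: "lip_wt f \<Longrightarrow> lip_wt (\<lambda>x. f x ^ n)" by (induction n) (auto intro: lip_wt_const lip_wt_mult)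

definition ri :: "real \<Rightarrow> real" where "ri x = inverse (1 + x)"

lemma ri: "x \<in> Ix \<Longrightarrow> (1 + x) * ri x = 1" using Ix_bounds(1)[of x] by (simp add: ri_def)

lemma ri_deriv: assumes "x \<in> Ix" shows "(ri has_real_derivative - (ri x)\<^sup>2) (at x within Ix)"
  unfolding ri_def[abs_def] using Ix_bounds(1)[OF assms] by (auto intro!: derivative_eq_intros simp: power2_eq_square)

lemma lip_wt_ri: "lip_wt ri"
  by (rule C1_lip_wt[OF ri_deriv]) (use x0_gt in \<open>auto simp: ri_def intro!: continuous_intros\<close>)

lemmas lip_wt_intros = lip_wt_add lip_wt_mult lip_wt_diff lip_wt_minus lip_wt_power lip_wt_const lip_wt_id lip_wt_ri

lemma bdw_minus: "bdw f \<Longrightarrow> bdw (\<lambda>x. - f x)" using bdw_mult[OF lip_wt_bdw[OF lip_wt_const[of "-1"]], of f] by simp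
lemma bdw_diff: "bdw f \<Longrightarrow> bdw g \<Longrightarrow> bdw (\<lambda>x. f x - g x)" using bdw_add[of f "\<lambda>x. - g x"] bdw_minus[of g] by simp

lemma bdw_cong: assumes "bdw f" "\<And>x. x0 \<le> x \<Longrightarrow> x < 1 \<Longrightarrow> f x = g x" shows "bdw g"
proof -
  obtain d M where d: "M \<ge> 0" "\<And>x. x0 \<le> x \<Longrightarrow> x < 1 \<Longrightarrow> (f has_real_derivative d x) (at x within Ix)"
    "\<And>x. x0 \<le> x \<Longrightarrow> x < 1 \<Longrightarrow> \<bar>d x\<bar> * (1 - x) \<le> M" "\<And>x. x0 \<le> x \<Longrightarrow> x < 1 \<Longrightarrow> \<bar>f x\<bar> \<le> M" using bdwE[OF assms(1)] by metis
  show ?thesis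
  proof (rule bdwI[OF _ _ d(3)])
    fix x assume x: "x0 \<le> x" "x < 1"
    show "(g has_real_derivative d x) (at x within Ix)"
      by (rule has_field_derivative_transform_within[OF d(2)[OF x], where d = "1 - x"]) (use x assms(2) in \<open>auto simp: dist_real_def\<close>)
    show "\<bar>g x\<bar> \<le> M" using d(4)[OF x] assms(2)[OF x] by simp
  qed
qed

text \<open>Applied with \<open>g\<close> a product of \<open>1 - x\<^sup>2\<close> and an
  expression divided by \<open>1 - x\<close>, and \<open>f\<close> the same after cancellation. At 1
  the product is 0 by its first factor, so \<open>f\<close> has to vanish there as well.\<close>

lemma lip0_cong: assumes "lip_wt f" "f 1 = 0" "\<And>x. x0 \<le> x \<Longrightarrow> x < 1 \<Longrightarrow> f x = g x" "g 1 = 0" shows "lip0 g"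
proof -
  have e: "f x = g x" if "x \<in> Ix" for x using assms(2-4) that by (cases "x = 1") auto
  obtain d M where d: "\<And>x. x0 \<le> x \<Longrightarrow> x < 1 \<Longrightarrow> (f has_real_derivative d x) (at x within Ix)"
    "\<And>x. x0 \<le> x \<Longrightarrow> x < 1 \<Longrightarrow> \<bar>d x\<bar> * sqrt (1 - x) \<le> M" using lip_wtE[OF assms(1)] by metis
  have "lip_wt g"
  proof (rule lip_wtI[OF _ _ d(2)])
    show "continuous_on Ix g" using lip_wt_cont[OF assms(1)] e continuous_on_cong[of Ix Ix f g] by blast
    fix x assume x: "x0 \<le> x" "x < 1"
    show "(g has_real_derivative d x) (at x within Ix)"
      by (rule has_field_derivative_transform_within[OF d(1)[OF x], where d = 1]) (use x e in auto)
  qed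
  then show ?thesis by (rule lip_wt_lip0) (rule assms(4))
qed

text \<open>The equations, computed off the axis, extend to the axis by continuity.\<close>

lemma zero_on_S_open:
  fixes D :: "real^3 \<Rightarrow> 'b::real_normed_vector"
  assumes "continuous_on S D" "\<And>X. X \<in> Om \<Longrightarrow> D X = 0" "X \<in> S_open" shows "D X = 0"
proof (cases "mu X = 1")
  case False
  then have "X \<in> Om" using assms(3) mu_mem[of X] S_open_subset by (auto simp: Om_def)
  then show ?thesis by (rule assms(2))
next
  case True
  have XS: "X \<in> S" using assms(3) S_open_subset by blast
  define g where "g = (\<lambda>\<phi>. norm X *\<^sub>R gam \<phi>)"
  have n: "norm X > 0" using S_nz[OF XS] by simp
  have gS: "g ` {0..\<phi>0} \<subseteq> S" using gam_S n by (auto simp: g_def intro!: scale_S)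
  have gX: "g 0 = X" using True n coord_axis[OF XS True, of 1] coord_axis[OF XS True, of 2]
    by (simp add: g_def gam_def vec_eq_iff forall_3 axis_nth mu_def)
  have c: "continuous_on {0..\<phi>0} (\<lambda>\<phi>. D (g \<phi>))"
    by (rule continuous_on_compose2[OF assms(1) _ gS]) (auto simp: g_def intro!: continuous_intros gam_cont)
  have cl: "closure {0<..<\<phi>0} = {0..\<phi>0}" using phi0_pos by simp
  have "D (g 0) = 0"
  proof (rule continuous_constant_on_closure[of "{0<..<\<phi>0}" "\<lambda>\<phi>. D (g \<phi>)"])
    show "continuous_on (closure {0<..<\<phi>0}) (\<lambda>\<phi>. D (g \<phi>))" using c cl by simp
    show "0 \<in> closure {0<..<\<phi>0}" using cl phi0_pos by simp
    fix \<phi> assume \<phi>: "\<phi> \<in> {0<..<\<phi>0}"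
    have "mu (g \<phi>) = cos \<phi>" using n mu_spherical[of 1 \<phi> "2*pi"] by (simp add: g_def mu_def gam_eq(1) norm_spherical)
    moreover have "cos \<phi> < 1" using \<phi> phi0_pi cos_monotone_0_pi[of 0 \<phi>] by simp
    moreover have "x0 < cos \<phi>" using \<phi> phi0_pi by (intro cos_monotone_0_pi) auto
    moreover have "g \<phi> \<noteq> 0" using gS \<phi> S_nz[of "g \<phi>"] by (simp add: image_subset_iff)
    ultimately show "D (g \<phi>) = 0" by (intro assms(2)) (simp add: Om_iff)
  qed
  then show ?thesis by (simp add: gX)
qed

lemma mu_scale: "l > 0 \<Longrightarrow> mu (l *\<^sub>R X) = mu X" "l > 0 \<Longrightarrow> rinv (l *\<^sub>R X) = inverse l * rinv X"
  by (simp_all add: mu_def rinv_def)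

lemma axi_field_axisymmetric: "axisymmetric \<phi>0 (axi_field a b c)"
proof -
  have "v_rho (axi_field a b c) \<rho> \<phi> \<theta> = a (cos \<phi>) * inverse \<rho> ^ 2 * \<rho> + b (cos \<phi>) * inverse \<rho> * cos \<phi>"
    "v_phi (axi_field a b c) \<rho> \<phi> \<theta> = - b (cos \<phi>) * inverse \<rho> * sin \<phi>"
    "v_theta (axi_field a b c) \<rho> \<phi> \<theta> = c (cos \<phi>) * inverse \<rho> ^ 2 * \<rho> * sin \<phi>" if "\<rho> > 0" for \<rho> \<phi> \<theta>
  proof -
    have s: "spherical \<rho> \<phi> \<theta> = \<rho> *\<^sub>R e_rho \<phi> \<theta>" by (simp add: vec_eq_iff forall_3 e_rho_nth)
    have r: "rot_gen (spherical \<rho> \<phi> \<theta>) = (\<rho> * sin \<phi>) *\<^sub>R e_theta \<theta>" by (simp add: vec_eq_iff forall_3 e_theta_nth)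
    have e: "e3 \<bullet> e_rho \<phi> \<theta> = cos \<phi>" "e3 \<bullet> e_phi \<phi> \<theta> = - sin \<phi>" "e3 \<bullet> e_theta \<theta> = 0"
      by (simp_all add: inner_vec_def sum_3 axis_nth e_rho_nth e_phi_nth e_theta_nth)
    have m: "mu (spherical \<rho> \<phi> \<theta>) = cos \<phi>" "rinv (spherical \<rho> \<phi> \<theta>) = inverse \<rho>"
      using that by (simp_all add: mu_spherical rinv_def norm_spherical)
    note d = axi_field_def sc_def m r inner_add_left sph_frame_inner e
    show "v_rho (axi_field a b c) \<rho> \<phi> \<theta> = a (cos \<phi>) * inverse \<rho> ^ 2 * \<rho> + b (cos \<phi>) * inverse \<rho> * cos \<phi>"
      unfolding v_rho_def d inner_scaleR_left by (simp add: s sph_frame_inner)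
    show "v_phi (axi_field a b c) \<rho> \<phi> \<theta> = - b (cos \<phi>) * inverse \<rho> * sin \<phi>"
      unfolding v_phi_def d inner_scaleR_left by (simp add: s sph_frame_inner)
    show "v_theta (axi_field a b c) \<rho> \<phi> \<theta> = c (cos \<phi>) * inverse \<rho> ^ 2 * \<rho> * sin \<phi>"
      unfolding v_theta_def d inner_scaleR_left by (simp add: s sph_frame_inner)
  qed
  then show ?thesis unfolding axisymmetric_def by simp
qed

lemma axi_field_homogeneous: "homogeneous_on S (-1) (axi_field a b c)"
  unfolding homogeneous_on_def
proof (intro allI impI ballI)
  fix l :: real and X assume l: "l > 0" and X: "X \<in> S"
  have r: "rot_gen (l *\<^sub>R X) = l *\<^sub>R rot_gen X" by (rule linear_cmul[OF linear_rot_gen])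
  have p: "l powi (-1) = inverse l" by (simp add: power_int_minus)
  have li: "l * (inverse l * y) = y" for y using l by simp
  show "axi_field a b c (l *\<^sub>R X) = (l powi (-1)) *\<^sub>R axi_field a b c X"
    unfolding axi_field_def sc_def mu_scale[OF l] r p by (simp add: algebra_simps power2_eq_square li)
qed

end

section \<open>Regularity of the fields built from a fixed point\<close>

locale fixed_profile = forced +
  fixes \<eta> :: "real \<Rightarrow> real"
  assumes \<eta>_cont: "continuous_on Ix \<eta>" and \<eta>_fix: "\<And>x. x \<in> Ix \<Longrightarrow> \<eta> x = Tf \<eta> x"
begin

text \<open>The derivative of \<open>\<eta>\<close> according to the Riccati equation.\<close>

definition e1 where "e1 x = - ((\<eta> x)\<^sup>2 / 2 + Qf \<eta> x)"

lemma e1_cont: "continuous_on Ix e1" unfolding e1_def[abs_def] by (intro continuous_intros Qf_cont \<eta>_cont) auto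

lemma \<eta>_deriv: assumes "x \<in> Ix" shows "(\<eta> has_real_derivative e1 x) (at x within Ix)"
  unfolding e1_def
  by (rule has_field_derivative_transform_within[OF Tf_deriv[OF \<eta>_cont assms], where d = 1]) (use assms \<eta>_fix in auto)

lemma \<eta>_lip: "lip_wt \<eta>" by (rule C1_lip_wt[OF \<eta>_deriv e1_cont])

text \<open>By the swirl equation \<open>k1\<close> is the derivative of \<open>- sp \<eta>\<close>;
  \<open>sg1\<close> and \<open>sg2\<close> are the first two derivatives of
  \<open>sg \<eta>\<close>, the second one off the axis.\<close>

definition k1 where "k1 x = \<eta> x * sp \<eta> x + \<tau> x"
definition sg1 where "sg1 x = avg 1 k1 x * ri x - avg 0 (\<lambda>t. - sp \<eta> t) x * (ri x)\<^sup>2"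
definition sg2 where "sg2 x = ((2 * avg 1 k1 x - k1 x) / (1 - x) * ri x - avg 1 k1 x * (ri x)\<^sup>2)
   - (avg 1 k1 x * (ri x)\<^sup>2 - 2 * avg 0 (\<lambda>t. - sp \<eta> t) x * (ri x) ^ 3)"

lemma k1_cont: "continuous_on Ix k1" unfolding k1_def[abs_def] by (intro continuous_intros sp_cont \<eta>_cont \<tau>_cont)

lemma sp_lip: "lip_wt (sp \<eta>)"
  by (rule C1_lip_wt[OF sp_deriv[OF \<eta>_cont]]) (auto intro!: continuous_intros \<eta>_cont sp_cont \<tau>_cont)

lemma k1_bdw: "bdw k1" unfolding k1_def[abs_def] by (intro bdw_add bdw_mult lip_wt_bdw \<eta>_lip sp_lip \<tau>_bdw)

lemma msp_cont: "continuous_on Ix (\<lambda>t. - sp \<eta> t)" by (intro continuous_intros sp_cont \<eta>_cont)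

lemma avg0_deriv: "x \<in> Ix \<Longrightarrow> (avg 0 (\<lambda>t. - sp \<eta> t) has_real_derivative avg 1 k1 x) (at x within Ix)"
proof (rule avg0_deriv_C1[OF _ k1_cont])
  fix t assume "t \<in> Ix"
  then show "((\<lambda>t. - sp \<eta> t) has_real_derivative k1 t) (at t within Ix)"
    using DERIV_minus[OF sp_deriv[OF \<eta>_cont]] by (simp add: k1_def add.commute)
qed

lemma sg_deriv: assumes "x \<in> Ix" shows "(sg \<eta> has_real_derivative sg1 x) (at x within Ix)"
proof -
  have "((\<lambda>x. avg 0 (\<lambda>t. - sp \<eta> t) x * ri x) has_real_derivative sg1 x) (at x within Ix)"
    using DERIV_mult[OF avg0_deriv[OF assms] ri_deriv[OF assms]] by (simp add: sg1_def algebra_simps)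
  moreover have "sg \<eta> = (\<lambda>x. avg 0 (\<lambda>t. - sp \<eta> t) x * ri x)" by (auto simp: sg_def ri_def divide_inverse)
  ultimately show ?thesis by simp
qed

lemma ri_cont: "continuous_on Ix ri" by (rule lip_wt_cont[OF lip_wt_ri])

lemma sg1_cont: "continuous_on Ix sg1"
  unfolding sg1_def[abs_def] by (intro continuous_intros avg_cont k1_cont msp_cont ri_cont)

lemma sg1_deriv: assumes "x0 \<le> x" "x < 1" shows "(sg1 has_real_derivative sg2 x) (at x within Ix)"
proof -
  have xI: "x \<in> Ix" using assms by simp
  have "((\<lambda>x. (ri x)\<^sup>2) has_real_derivative - 2 * (ri x) ^ 3) (at x within Ix)"
    using ri_deriv[OF xI] by (auto intro!: derivative_eq_intros simp: power2_eq_square power3_eq_cube)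
  from DERIV_diff[OF DERIV_mult[OF avg_deriv[OF k1_cont assms, of 1] ri_deriv[OF xI]] DERIV_mult[OF avg0_deriv[OF xI] this]]
  show ?thesis unfolding sg1_def[abs_def] sg2_def by (simp add: algebra_simps)
qed

lemma bdw_ri: "bdw ri" by (rule lip_wt_bdw[OF lip_wt_ri])

lemma sg1_bdw: "bdw sg1"
  unfolding sg1_def[abs_def] power2_eq_square by (intro bdw_diff bdw_mult bdw_avg k1_cont msp_cont bdw_ri)

lemma sg2_bdw: "bdw (\<lambda>x. (1 - x\<^sup>2) * sg2 x)"
proof (rule bdw_cong)
  \<comment> \<open>This is \<open>(1 - x\<^sup>2) * sg2 x\<close> with the division by
    \<open>1 - x\<close> carried out; what is left are averages, \<open>k1\<close> and smooth
    factors.\<close>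
  show "bdw (\<lambda>x. (1 + x) * ((2 * avg 1 k1 x - k1 x) * ri x - (1 - x) * (avg 1 k1 x * (ri x * ri x))
   - (1 - x) * (avg 1 k1 x * (ri x * ri x) - 2 * avg 0 (\<lambda>t. - sp \<eta> t) x * (ri x * (ri x * ri x)))))"
    by (intro bdw_diff bdw_mult bdw_add bdw_avg k1_cont k1_bdw msp_cont bdw_ri lip_wt_bdw[OF lip_wt_const] lip_wt_bdw[OF lip_wt_id])
  fix x assume x: "x0 \<le> x" "x < 1"
  define w where "w = (2 * avg 1 k1 x - k1 x) / (1 - x)"
  have w: "(2 * avg 1 k1 x - k1 x) / (1 - x) = w" "2 * avg 1 k1 x - k1 x = (1 - x) * w" using x by (simp_all add: w_def)
  show "(1 + x) * ((2 * avg 1 k1 x - k1 x) * ri x - (1 - x) * (avg 1 k1 x * (ri x * ri x))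
   - (1 - x) * (avg 1 k1 x * (ri x * ri x) - 2 * avg 0 (\<lambda>t. - sp \<eta> t) x * (ri x * (ri x * ri x)))) = (1 - x\<^sup>2) * sg2 x"
    unfolding sg2_def one_minus_sq power2_eq_square power3_eq_cube w(1) unfolding w(2) by (simp add: algebra_simps)
qed

lemma sg_lip: "lip_wt (sg \<eta>)" by (rule C1_lip_wt[OF sg_deriv sg1_cont])

text \<open>\<open>Ab\<close> is \<open>Mk K\<close>, obtained by averaging twice, and
  \<open>B x / (1 - x)\<close> is its derivative off the axis.\<close>

definition K where "K = Kf \<eta>"
definition Aa where "Aa = avg 0 K"
definition Ab where "Ab = avg 1 Aa"
definition c1 where "c1 = Ab x0"
definition B where "B x = 2 * Ab x - Aa x"

lemma tsg_cont: "continuous_on Ix (\<lambda>t. t * (sg \<eta> t)\<^sup>2)" by (intro continuous_intros sg_cont \<eta>_cont)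

text \<open>\<open>K\<close> is normalised to vanish on the axis, which turns \<open>lip_wt\<close>
  into \<open>lip0\<close>, the property that passes through both averages by
  \<open>lip0_avg\<close>.\<close>

lemma K_lip0: "lip0 K"
proof (rule lip_wt_lip0)
  have "lip_wt (tail (\<lambda>t. t * (sg \<eta> t)\<^sup>2))"
    by (rule C1_lip_wt[OF tail_deriv[OF tsg_cont]]) (auto intro!: continuous_intros sg_cont \<eta>_cont)
  then show "lip_wt K" unfolding K_def Kf_def[abs_def] by (intro lip_wt_intros sg_lip lip0_lip_wt[OF KF_lip0])
  show "K 1 = 0" by (simp add: K_def Kf_def KF_def)
qed

lemma K_cont: "continuous_on Ix K" unfolding K_def by (rule Kf_cont[OF \<eta>_cont])
lemma Aa_lip0: "lip0 Aa" unfolding Aa_def by (rule lip0_avg[OF K_lip0])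
lemma Ab_lip0: "lip0 Ab" unfolding Ab_def by (rule lip0_avg[OF Aa_lip0])
lemma Aa_cont: "continuous_on Ix Aa" unfolding Aa_def by (rule avg_cont[OF K_cont])

lemma lip0_1: "lip0 f \<Longrightarrow> f 1 = 0"
proof -
  assume "lip0 f"
  then obtain M where "\<bar>f 1\<bar> \<le> M * sqrt (1 - 1)" using x0_Ix(2) unfolding lip0_def by blast
  then show "f 1 = 0" by simp
qed

lemma lips: "lip_wt K" "lip_wt Aa" "lip_wt Ab" "lip_wt B"
proof -
  show "lip_wt K" "lip_wt Aa" "lip_wt Ab" using K_lip0 Aa_lip0 Ab_lip0 lip0_lip_wt by auto
  then show "lip_wt B" unfolding B_def[abs_def] by (intro lip_wt_intros)
qed

lemma ones: "K 1 = 0" "Aa 1 = 0" "Ab 1 = 0" "B 1 = 0" by (simp_all add: lip0_1[OF K_lip0] lip0_1[OF Aa_lip0] lip0_1[OF Ab_lip0] B_def)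

lemma Aa_deriv: "x0 \<le> x \<Longrightarrow> x < 1 \<Longrightarrow> (Aa has_real_derivative (Aa x - K x) / (1 - x)) (at x within Ix)"
  using avg_deriv[OF K_cont, of x 0] by (simp add: Aa_def)

lemma Ab_deriv: "x0 \<le> x \<Longrightarrow> x < 1 \<Longrightarrow> (Ab has_real_derivative B x / (1 - x)) (at x within Ix)"
  using avg_deriv[OF Aa_cont, of x 1] by (simp add: Ab_def B_def)

lemma B_deriv: assumes "x0 \<le> x" "x < 1" shows "(B has_real_derivative (2 * B x - Aa x + K x) / (1 - x)) (at x within Ix)"
proof -
  have "(B has_real_derivative 2 * (B x / (1 - x)) - (Aa x - K x) / (1 - x)) (at x within Ix)"
    unfolding B_def[abs_def] using Ab_deriv[OF assms] Aa_deriv[OF assms] by (auto intro!: derivative_eq_intros simp: B_def)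
  also have "2 * (B x / (1 - x)) - (Aa x - K x) / (1 - x) = (2 * B x - Aa x + K x) / (1 - x)" by (simp add: diff_divide_distrib add_divide_distrib)
  finally show ?thesis .
qed

lemma Qf_eq: "Qf \<eta> x = (Ab x - c1) * (ri x)\<^sup>2"
  by (simp add: Qf_def Mk_def Ab_def Aa_def K_def c1_def ri_def divide_inverse power_inverse)

lemma e1_lip: "lip_wt e1"
proof -
  have "lip_wt (\<lambda>x. - ((1/2) * (\<eta> x)\<^sup>2 + (Ab x - c1) * (ri x)\<^sup>2))" by (intro lip_wt_intros \<eta>_lip lips)
  then show ?thesis by (simp add: e1_def[abs_def] Qf_eq)
qed

definition e2 where "e2 x = - \<eta> x * e1 x - B x / (1 - x) * (ri x)\<^sup>2 + 2 * (Ab x - c1) * (ri x) ^ 3"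

lemma ri2_deriv: assumes "x \<in> Ix" shows "((\<lambda>x. (ri x)\<^sup>2) has_real_derivative - 2 * (ri x) ^ 3) (at x within Ix)"
  using ri_deriv[OF assms] by (auto intro!: derivative_eq_intros simp: power2_eq_square power3_eq_cube)

lemma e1_deriv: assumes x: "x0 \<le> x" "x < 1" shows "(e1 has_real_derivative e2 x) (at x within Ix)"
proof -
  have xI: "x \<in> Ix" using x by simp
  have "((\<lambda>x. - ((1/2) * (\<eta> x * \<eta> x) + (Ab x - c1) * (ri x)\<^sup>2)) has_real_derivative
     - ((1/2) * (e1 x * \<eta> x + e1 x * \<eta> x) + ((B x / (1 - x) - 0) * (ri x)\<^sup>2 + - 2 * (ri x) ^ 3 * (Ab x - c1)))) (at x within Ix)"
    by (intro DERIV_minus DERIV_add DERIV_cmult DERIV_mult DERIV_diff DERIV_const \<eta>_deriv Ab_deriv ri2_deriv xI x)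
  moreover have "(\<lambda>x. - ((1/2) * (\<eta> x * \<eta> x) + (Ab x - c1) * (ri x)\<^sup>2)) = e1" by (auto simp: e1_def Qf_eq power2_eq_square)
  ultimately show ?thesis by (simp add: e2_def algebra_simps)
qed

text \<open>\<open>(1 - x\<^sup>2) * e2 x\<close> with the division by \<open>1 - x\<close>
  cancelled, so that the formula makes sense at 1; \<open>m2\<close> below does the same for the
  derivative \<open>m1\<close>.\<close>

definition m where "m x = - (1 - x\<^sup>2) * \<eta> x * e1 x - B x * ri x + 2 * (1 - x) * (Ab x - c1) * (ri x)\<^sup>2"

lemma m_eq: assumes x: "x0 \<le> x" "x < 1" shows "(1 - x\<^sup>2) * e2 x = m x"
proof -
  have r: "(1 + x) * ri x = 1" using x by (intro ri) simp
  define b where "b = B x / (1 - x)"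
  have b: "(1 - x) * b = B x" using x by (simp add: b_def)
  have "(1 - x\<^sup>2) * e2 x = - (1 - x\<^sup>2) * \<eta> x * e1 x - (((1 + x) * ri x) * ri x) * ((1 - x) * b)
     + 2 * (1 - x) * (Ab x - c1) * (((1 + x) * ri x) * (ri x)\<^sup>2)"
    unfolding e2_def one_minus_sq b_def[symmetric] by (simp add: algebra_simps power2_eq_square power3_eq_cube)
  also have "\<dots> = m x" unfolding r b m_def by (simp add: mult_ac)
  finally show ?thesis .
qed

lemma m_lip: "lip_wt m" unfolding m_def[abs_def] by (intro lip_wt_intros \<eta>_lip e1_lip lips)
lemma m_1: "m 1 = 0" by (simp add: m_def ones)

lemma e2_lip0: "lip0 (\<lambda>x. (1 - x\<^sup>2) * e2 x)" by (rule lip0_cong[OF m_lip m_1]) (simp_all add: m_eq)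

definition m1 where "m1 x = 2 * x * \<eta> x * e1 x - (1 - x\<^sup>2) * (e1 x * e1 x + \<eta> x * e2 x)
   - ((2 * B x - Aa x + K x) / (1 - x) * ri x - B x * (ri x)\<^sup>2)
   + 2 * (- (Ab x - c1) * (ri x)\<^sup>2 + (1 - x) * (B x / (1 - x)) * (ri x)\<^sup>2 - 2 * (1 - x) * (Ab x - c1) * (ri x) ^ 3)"

lemma m_deriv: assumes x: "x0 \<le> x" "x < 1" shows "(m has_real_derivative m1 x) (at x within Ix)"
proof -
  have xI: "x \<in> Ix" using x by simp
  have q: "((\<lambda>x. 1 - x\<^sup>2) has_real_derivative - 2 * x) (at x within Ix)" "((\<lambda>x. 1 - x) has_real_derivative - 1) (at x within Ix)"
    by (auto intro!: derivative_eq_intros)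
  have "((\<lambda>x. - ((1 - x\<^sup>2) * (\<eta> x * e1 x)) - B x * ri x + 2 * (((1 - x) * (Ab x - c1)) * (ri x)\<^sup>2)) has_real_derivative
    - (- 2 * x * (\<eta> x * e1 x) + (e1 x * e1 x + e2 x * \<eta> x) * (1 - x\<^sup>2)) - ((2 * B x - Aa x + K x) / (1 - x) * ri x + - (ri x)\<^sup>2 * B x)
    + 2 * ((- 1 * (Ab x - c1) + (B x / (1 - x) - 0) * (1 - x)) * (ri x)\<^sup>2 + - 2 * (ri x) ^ 3 * ((1 - x) * (Ab x - c1)))) (at x within Ix)"
    by (intro DERIV_minus DERIV_add DERIV_cmult DERIV_mult DERIV_diff DERIV_const \<eta>_deriv e1_deriv B_deriv Ab_deriv ri2_deriv ri_deriv q xI x)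
  moreover have "(\<lambda>x. - ((1 - x\<^sup>2) * (\<eta> x * e1 x)) - B x * ri x + 2 * (((1 - x) * (Ab x - c1)) * (ri x)\<^sup>2)) = m"
    by (auto simp: m_def algebra_simps)
  moreover have "- (- 2 * x * (\<eta> x * e1 x) + (e1 x * e1 x + e2 x * \<eta> x) * (1 - x\<^sup>2)) - ((2 * B x - Aa x + K x) / (1 - x) * ri x + - (ri x)\<^sup>2 * B x)
    + 2 * ((- 1 * (Ab x - c1) + (B x / (1 - x) - 0) * (1 - x)) * (ri x)\<^sup>2 + - 2 * (ri x) ^ 3 * ((1 - x) * (Ab x - c1))) = m1 x"
    unfolding m1_def by (simp add: algebra_simps)
  ultimately show ?thesis by simp
qed

definition m2 where "m2 x = (1 - x\<^sup>2) * (2 * x * \<eta> x * e1 x) - (1 - x\<^sup>2) * ((1 - x\<^sup>2) * (e1 x * e1 x) + \<eta> x * m x)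
   - ((2 * B x - Aa x + K x) - (1 - x) * B x * ri x)
   + 2 * (- ((1 - x) * ri x * (Ab x - c1)) + (1 - x) * ri x * B x - 2 * (1 - x)\<^sup>2 * (Ab x - c1) * (ri x)\<^sup>2)"

lemma m2_eq: assumes x: "x0 \<le> x" "x < 1" shows "(1 - x\<^sup>2) * m1 x = m2 x"
proof -
  have r: "(1 + x) * ri x = 1" using x by (intro ri) simp
  have d: "(1 - x) * (y / (1 - x)) = y" for y using x by simp
  have "(1 - x\<^sup>2) * m1 x = (1 - x\<^sup>2) * (2 * x * \<eta> x * e1 x) - (1 - x\<^sup>2) * ((1 - x\<^sup>2) * (e1 x * e1 x) + \<eta> x * ((1 - x\<^sup>2) * e2 x))
   - (((1 + x) * ri x) * ((1 - x) * ((2 * B x - Aa x + K x) / (1 - x))) - (1 - x) * B x * (((1 + x) * ri x) * ri x))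
   + 2 * (- ((1 - x) * (((1 + x) * ri x) * ri x) * (Ab x - c1)) + (1 - x) * (((1 + x) * ri x) * ri x) * ((1 - x) * (B x / (1 - x)))
     - 2 * (1 - x)\<^sup>2 * (Ab x - c1) * (((1 + x) * ri x) * (ri x)\<^sup>2))"
    unfolding m1_def one_minus_sq power2_eq_square power3_eq_cube by (simp add: algebra_simps)
  then show ?thesis unfolding r d m_eq[OF x] m2_def by simp
qed

lemma m2_lip: "lip_wt m2" unfolding m2_def[abs_def] by (intro lip_wt_intros \<eta>_lip e1_lip lips m_lip)
lemma m2_1: "m2 1 = 0" by (simp add: m2_def ones)

text \<open>The radial velocity contains \<open>(1 - x\<^sup>2) * e1 x\<close>, so two derivatives
  of \<open>Rf \<eta>\<close> amount to three of \<open>\<eta>\<close>; this is why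
  \<open>m1\<close> and \<open>m2\<close> are carried along.\<close>

definition ze where "ze x = (1 - x\<^sup>2) * e1 x"
definition z1 where "z1 x = - 2 * x * e1 x + m x"
definition z2 where "z2 x = - 2 * e1 x - 2 * x * e2 x + m1 x"

lemma z1_lip: "lip_wt z1" unfolding z1_def[abs_def] by (intro lip_wt_intros e1_lip m_lip)

lemma ze_deriv: assumes "x \<in> Ix" shows "(ze has_real_derivative z1 x) (at x within Ix)"
proof (rule C1_extend[OF _ lip_wt_cont[OF z1_lip] _ assms])
  show "continuous_on Ix ze" unfolding ze_def[abs_def] by (intro continuous_intros e1_cont)
  fix t assume t: "x0 < t" "t < 1"
  have "(e1 has_real_derivative e2 t) (at t)" using e1_deriv[of t] at_Ix[OF t] t by simp
  then have "(ze has_real_derivative - 2 * t * e1 t + (1 - t\<^sup>2) * e2 t) (at t)"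
    unfolding ze_def[abs_def] by (auto intro!: derivative_eq_intros)
  then show "(ze has_real_derivative z1 t) (at t)" using m_eq[of t] t by (simp add: z1_def)
qed

lemma z1_deriv: assumes x: "x0 \<le> x" "x < 1" shows "(z1 has_real_derivative z2 x) (at x within Ix)"
  unfolding z1_def[abs_def] z2_def using e1_deriv[OF x] m_deriv[OF x] by (auto intro!: derivative_eq_intros)

lemma z2_lip0: "lip0 (\<lambda>x. (1 - x\<^sup>2) * z2 x)"
proof (rule lip0_cong)
  show "lip_wt (\<lambda>x. - 2 * (1 - x\<^sup>2) * e1 x - 2 * x * m x + m2 x)" by (intro lip_wt_intros e1_lip m_lip m2_lip)
  show "(- 2 * (1 - x\<^sup>2) * e1 x - 2 * x * m x + m2 x) = (1 - x\<^sup>2) * z2 x" if x: "x0 \<le> x" "x < 1" for x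
    unfolding m_eq[OF x, symmetric] m2_eq[OF x, symmetric] z2_def by (simp add: algebra_simps)
qed (simp_all add: m_1 m2_1)

lemma Rf_eq: "Rf \<eta> x = ze x - 2 * x * \<eta> x"
  by (simp add: Rf_def ze_def e1_def algebra_simps diff_divide_distrib)

lemma CL_\<eta>: "CL 2 S (\<lambda>X. \<eta> (mu X))" by (rule CL2_comp_mu[OF \<eta>_deriv e1_deriv e1_lip e2_lip0])
lemma CL_ze: "CL 2 S (\<lambda>X. ze (mu X))" by (rule CL2_comp_mu[OF ze_deriv z1_deriv z1_lip z2_lip0])
lemma CL_sg: "k \<noteq> 3 \<Longrightarrow> CL 2 S (\<lambda>X. sg \<eta> (mu X) * X $ k)"
  by (rule CL2_comp_mu_coord[OF sg_deriv sg1_deriv sg1_cont sg1_bdw sg2_bdw])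

definition us where "us = uf \<eta>"
text \<open>The integrated polar equation solved for the pressure. The constant is forced by
  no-slip: \<open>- c1\<close> is the value found for \<open>C / 2\<close> in
  \<open>reduction\<close>.\<close>

definition qs where "qs x = - c1 - Fr 1 / 2 + tail \<kappa> x + tail (\<lambda>t. t * (sg \<eta> t)\<^sup>2) x + Rf \<eta> x - (1 - x\<^sup>2) * (\<eta> x)\<^sup>2 / 2"
definition ps where "ps = sc qs 2"

lemma CL_us: "CL 2 S us"
proof -
  define A where "A = (\<lambda>X. (ze (mu X) - mu X * \<eta> (mu X)) * (rinv X * rinv X))"
  have A: "CL 2 S A" unfolding A_def by (intro CL_mult CL_diff CL_ze CL_\<eta> CL_mu CL_rinv)
  \<comment> \<open>The swirl profile occurs only multiplied by a horizontal coordinate, the form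
    that \<open>CL_sg\<close> handles.\<close>
  have "CL 2 S (\<lambda>X. (A X * X $ 1 - (sg \<eta> (mu X) * X $ 2) * (rinv X * rinv X)) *\<^sub>R axis 1 1
    + (A X * X $ 2 + (sg \<eta> (mu X) * X $ 1) * (rinv X * rinv X)) *\<^sub>R axis 2 1
    + (A X * X $ 3 - \<eta> (mu X) * rinv X) *\<^sub>R e3)"
    by (intro CL_add CL_scaleR CL_diff CL_mult CL_sg A CL_coord CL_\<eta> CL_rinv) simp_all
  moreover have "(A X * X $ 1 - (sg \<eta> (mu X) * X $ 2) * (rinv X * rinv X)) *\<^sub>R axis 1 1
    + (A X * X $ 2 + (sg \<eta> (mu X) * X $ 1) * (rinv X * rinv X)) *\<^sub>R axis 2 1
    + (A X * X $ 3 - \<eta> (mu X) * rinv X) *\<^sub>R e3 = us X" for X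
    unfolding us_def uf_def axi_field_def sc_def vec_eq_iff forall_3 Rf_eq A_def
    by (simp add: axis_nth power2_eq_square algebra_simps)
  ultimately show ?thesis by simp
qed

lemma CL_ps: "CL 1 S ps"
proof -
  have CL1: "CL 2 S f \<Longrightarrow> CL 1 S f" for f :: "real^3 \<Rightarrow> real" using CL_Suc_D[of 1 S f] by (simp add: numeral_2_eq_2)
  have 1: "CL 1 S (\<lambda>X. tail \<kappa> (mu X))"
    by (rule CL1_comp_mu[OF tail_deriv[OF \<kappa>_cont]]) (auto intro!: continuous_intros \<kappa>_cont bdw_minus \<kappa>_bdw)
  have 2: "CL 1 S (\<lambda>X. tail (\<lambda>t. t * (sg \<eta> t)\<^sup>2) (mu X))"
  proof (rule CL1_comp_mu[OF tail_deriv[OF tsg_cont]])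
    show "continuous_on Ix (\<lambda>x. - (x * (sg \<eta> x)\<^sup>2))" by (intro continuous_intros sg_cont \<eta>_cont)
    show "bdw (\<lambda>x. - (x * (sg \<eta> x)\<^sup>2))" by (intro lip_wt_bdw lip_wt_intros sg_lip)
  qed
  have "CL 1 S (\<lambda>X. ((- c1 - Fr 1 / 2) + tail \<kappa> (mu X) + tail (\<lambda>t. t * (sg \<eta> t)\<^sup>2) (mu X) + (ze (mu X) - 2 * mu X * \<eta> (mu X))
    - (1 - mu X * mu X) * (\<eta> (mu X) * \<eta> (mu X)) * (1/2)) * (rinv X * rinv X))"
    by (intro CL_mult CL_add CL_diff 1 2 CL1[OF CL_ze] CL1[OF CL_\<eta>] CL_const CL_mu CL_rinv)
  then show ?thesis by (simp add: ps_def sc_def[abs_def] qs_def Rf_eq power2_eq_square)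
qed

lemma open_derivs:
  assumes t: "x0 < t" "t < 1"
  shows "(\<eta> has_real_derivative e1 t) (at t)" "(e1 has_real_derivative e2 t) (at t)" "(ze has_real_derivative z1 t) (at t)" "(z1 has_real_derivative z2 t) (at t)"
    "(sg \<eta> has_real_derivative sg1 t) (at t)" "(sg1 has_real_derivative sg2 t) (at t)"
    "(tail \<kappa> has_real_derivative - \<kappa> t) (at t)" "(tail (\<lambda>t. t * (sg \<eta> t)\<^sup>2) has_real_derivative - (t * (sg \<eta> t)\<^sup>2)) (at t)"
    "(Ab has_real_derivative B t / (1 - t)) (at t)" "(Aa has_real_derivative (Aa t - K t) / (1 - t)) (at t)"
  using \<eta>_deriv[of t] e1_deriv[of t] ze_deriv[of t] z1_deriv[of t] sg_deriv[of t] sg1_deriv[of t] tail_deriv[OF \<kappa>_cont, of t] tail_deriv[OF tsg_cont, of t]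
    Ab_deriv[of t] Aa_deriv[of t] t at_Ix[OF t] by auto

definition R1 where "R1 t = z1 t - 2 * \<eta> t - 2 * t * e1 t"
definition R2 where "R2 t = z2 t - 4 * e1 t - 2 * t * e2 t"

lemma Rf_derivs: assumes t: "x0 < t" "t < 1" shows "(Rf \<eta> has_real_derivative R1 t) (at t)" "(R1 has_real_derivative R2 t) (at t)"
proof -
  have "Rf \<eta> = (\<lambda>x. ze x - 2 * x * \<eta> x)" using Rf_eq by blast
  then show "(Rf \<eta> has_real_derivative R1 t) (at t)"
    unfolding R1_def using open_derivs[OF t] by (auto intro!: derivative_eq_intros)
  show "(R1 has_real_derivative R2 t) (at t)"
    unfolding R1_def[abs_def] R2_def using open_derivs[OF t] by (auto intro!: derivative_eq_intros)
qed

text \<open>The identity \<open>ss \<eta> x = (1 - x\<^sup>2) * sg \<eta> x\<close> is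
  differentiated twice, comparing derivatives by their uniqueness.\<close>

lemma swirl_ode:
  assumes t: "x0 < t" "t < 1"
  shows "(1 - t\<^sup>2) * sg2 t - 4 * t * sg1 t - 2 * sg \<eta> t = - \<eta> t * ((1 - t\<^sup>2) * sg1 t - 2 * t * sg \<eta> t) - \<tau> t"
proof -
  have 1: "(1 - y\<^sup>2) * sg1 y - 2 * y * sg \<eta> y = sp \<eta> y" if y: "x0 < y" "y < 1" for y
  proof (rule DERIV_unique)
    show "((\<lambda>x. (1 - x\<^sup>2) * sg \<eta> x) has_real_derivative (1 - y\<^sup>2) * sg1 y - 2 * y * sg \<eta> y) (at y)"
      using open_derivs(5)[OF y] by (auto intro!: derivative_eq_intros)
    show "((\<lambda>x. (1 - x\<^sup>2) * sg \<eta> x) has_real_derivative sp \<eta> y) (at y)"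
      by (rule has_field_derivative_transform_within_open[OF ss_deriv_open[OF \<eta>_cont y], where S = "{x0<..<1}"])
        (use y ss_sg[OF \<eta>_cont] in auto)
  qed
  have "(1 - t\<^sup>2) * sg2 t - 4 * t * sg1 t - 2 * sg \<eta> t = - \<eta> t * sp \<eta> t - \<tau> t"
  proof (rule DERIV_unique)
    show "((\<lambda>y. (1 - y\<^sup>2) * sg1 y - 2 * y * sg \<eta> y) has_real_derivative (1 - t\<^sup>2) * sg2 t - 4 * t * sg1 t - 2 * sg \<eta> t) (at t)"
      using open_derivs(5,6)[OF t] by (auto intro!: derivative_eq_intros simp: algebra_simps)
    show "((\<lambda>y. (1 - y\<^sup>2) * sg1 y - 2 * y * sg \<eta> y) has_real_derivative - \<eta> t * sp \<eta> t - \<tau> t) (at t)"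
      by (rule has_field_derivative_transform_within_open[OF sp_deriv_open[OF \<eta>_cont t], where S = "{x0<..<1}"])
        (use t 1 in auto)
  qed
  then show ?thesis unfolding 1[OF t] .
qed

text \<open>The integrations of \<open>reduction\<close> undone: the Riccati equation multiplied by
  \<open>(1 - x\<^sup>2)\<^sup>2\<close> is differentiated twice, and each derivative strips one
  average from \<open>Ab\<close>.\<close>

lemma radial_ode:
  assumes t: "x0 < t" "t < 1"
  shows "(1 - t\<^sup>2) * R2 t - 2 * t * R1 t + (1 - t\<^sup>2) * \<eta> t * R1 t + (Rf \<eta> t)\<^sup>2 + 2 * Rf \<eta> t + K t - 2 * c1 = 0"
proof -
  define y where "y = (\<lambda>x. (1 - x\<^sup>2) * \<eta> x)"
  have dy: "(y has_real_derivative Rf \<eta> x) (at x)" if x: "x0 < x" "x < 1" for x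
    unfolding y_def using open_derivs(1)[OF x] by (auto intro!: derivative_eq_intros simp: Rf_eq ze_def)
  have W: "(1 - x\<^sup>2) * Rf \<eta> x + 2 * x * y x + (y x)\<^sup>2 / 2 = - ((1 - x)\<^sup>2 * (Ab x - c1))" if x: "x0 < x" "x < 1" for x
  proof -
    have r: "(1 + x) * ri x = 1" using x by (intro ri) simp
    have "(1 - x\<^sup>2) * Rf \<eta> x + 2 * x * y x + (y x)\<^sup>2 / 2 = - ((1 - x\<^sup>2)\<^sup>2 * Qf \<eta> x)"
      unfolding Rf_def y_def by (simp add: algebra_simps power2_eq_square add_divide_distrib diff_divide_distrib)
    also have "\<dots> = - ((1 - x)\<^sup>2 * (Ab x - c1) * ((1 + x) * ri x)\<^sup>2)" unfolding Qf_eq one_minus_sq power_mult_distrib by simp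
    finally show ?thesis unfolding r by simp
  qed
  have V: "(1 - x\<^sup>2) * R1 x + 2 * y x + y x * Rf \<eta> x = (1 - x) * (Aa x - 2 * c1)" if x: "x0 < x" "x < 1" for x
  proof (rule DERIV_unique)
    show "((\<lambda>x. (1 - x\<^sup>2) * Rf \<eta> x + 2 * x * y x + (y x)\<^sup>2 / 2) has_real_derivative (1 - x\<^sup>2) * R1 x + 2 * y x + y x * Rf \<eta> x) (at x)"
      using Rf_derivs(1)[OF x] dy[OF x] by (auto intro!: derivative_eq_intros simp: algebra_simps)
    have "((\<lambda>x. - ((1 - x)\<^sup>2 * (Ab x - c1))) has_real_derivative 2 * (1 - x) * (Ab x - c1) - (1 - x) * ((1 - x) * (B x / (1 - x)))) (at x)"
      using open_derivs(9)[OF x] by (auto intro!: derivative_eq_intros simp: power2_eq_square algebra_simps diff_divide_distrib add_divide_distrib)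
    also have "2 * (1 - x) * (Ab x - c1) - (1 - x) * ((1 - x) * (B x / (1 - x))) = (1 - x) * (Aa x - 2 * c1)"
    proof -
      have d: "(1 - x) * (B x / (1 - x)) = B x" using x by simp
      show ?thesis unfolding d by (simp add: B_def algebra_simps)
    qed
    finally show "((\<lambda>x. (1 - x\<^sup>2) * Rf \<eta> x + 2 * x * y x + (y x)\<^sup>2 / 2) has_real_derivative (1 - x) * (Aa x - 2 * c1)) (at x)"
      by (rule has_field_derivative_transform_within_open[where S = "{x0<..<1}"]) (use x W in auto)
  qed
  have "(1 - t\<^sup>2) * R2 t - 2 * t * R1 t + 2 * Rf \<eta> t + (y t * R1 t + Rf \<eta> t * Rf \<eta> t) = - K t + 2 * c1"
  proof (rule DERIV_unique)
    show "((\<lambda>x. (1 - x\<^sup>2) * R1 x + 2 * y x + y x * Rf \<eta> x) has_real_derivative (1 - t\<^sup>2) * R2 t - 2 * t * R1 t + 2 * Rf \<eta> t + (y t * R1 t + Rf \<eta> t * Rf \<eta> t)) (at t)"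
      using Rf_derivs[OF t] dy[OF t] by (auto intro!: derivative_eq_intros simp: algebra_simps)
    have "((\<lambda>x. (1 - x) * (Aa x - 2 * c1)) has_real_derivative - (Aa t - 2 * c1) + (1 - t) * ((Aa t - K t) / (1 - t))) (at t)"
      using open_derivs(10)[OF t] by (auto intro!: derivative_eq_intros)
    also have "- (Aa t - 2 * c1) + (1 - t) * ((Aa t - K t) / (1 - t)) = - K t + 2 * c1" using t by simp
    finally show "((\<lambda>x. (1 - x\<^sup>2) * R1 x + 2 * y x + y x * Rf \<eta> x) has_real_derivative - K t + 2 * c1) (at t)"
      by (rule has_field_derivative_transform_within_open[where S = "{x0<..<1}"]) (use t V in auto)
  qed
  then show ?thesis unfolding y_def by (simp add: power2_eq_square algebra_simps)
qed

definition q1 where "q1 t = - \<kappa> t - t * (sg \<eta> t)\<^sup>2 + R1 t - ((1 - t\<^sup>2) * \<eta> t * e1 t - t * (\<eta> t)\<^sup>2)"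

lemma qs_deriv: assumes t: "x0 < t" "t < 1" shows "(qs has_real_derivative q1 t) (at t)"
  unfolding qs_def[abs_def] q1_def using open_derivs[OF t] Rf_derivs(1)[OF t]
  by (auto intro!: derivative_eq_intros simp: algebra_simps diff_divide_distrib add_divide_distrib)

lemma qs_eq: "K t - 2 * c1 = (1 - t\<^sup>2) * (sg \<eta> t)\<^sup>2 + 2 * (qs t - Rf \<eta> t + (1 - t\<^sup>2) * (\<eta> t)\<^sup>2 / 2) + Fr t"
  unfolding qs_def K_def Kf_def KF_def by simp

lemma pde_Om:
  assumes X: "X \<in> Om"
  shows "- laplacian_within S us X + advection_within S us us X + grad_within S ps X = F X" "div_within S us X = 0"
proof -
  interpret axi_profiles \<phi>0 "\<lambda>x. Rf \<eta> x + x * \<eta> x" "\<lambda>x. R1 x + (\<eta> x + x * e1 x)" "\<lambda>x. R2 x + (2 * e1 x + x * e2 x)"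
    "\<lambda>x. - \<eta> x" "\<lambda>x. - e1 x" "\<lambda>x. - e2 x" "sg \<eta>" sg1 sg2 us
  proof unfold_locales
    fix t assume t: "x0 < t" "t < 1"
    show "((\<lambda>x. Rf \<eta> x + x * \<eta> x) has_real_derivative R1 t + (\<eta> t + t * e1 t)) (at t)"
      using Rf_derivs(1)[OF t] open_derivs(1)[OF t] by (auto intro!: derivative_eq_intros)
    show "((\<lambda>x. R1 x + (\<eta> x + x * e1 x)) has_real_derivative R2 t + (2 * e1 t + t * e2 t)) (at t)"
      using Rf_derivs(2)[OF t] open_derivs(1,2)[OF t] by (auto intro!: derivative_eq_intros)
  qed (use open_derivs in \<open>auto intro: DERIV_minus simp: us_def uf_def\<close>)
  define t where "t = mu X"
  have t: "x0 < t" "t < 1" using Om_S[of X] X by (auto simp: t_def)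
  show "div_within S us X = 0"
    unfolding div_u[OF X] t_def[symmetric] by (simp add: Rf_eq ze_def algebra_simps)
  have gr: "grad_within S ps X = (rinv X ^ 3 * q1 t) *\<^sub>R e3 - (rinv X ^ 4 * (t * q1 t + 2 * qs t)) *\<^sub>R X"
    unfolding t_def by (rule grad_p[OF qs_deriv _ X]) (simp_all add: ps_def)
  have z1m: "z1 t = - 2 * t * e1 t + (1 - t\<^sup>2) * e2 t" using m_eq[of t] t by (simp add: z1_def)
  define E2 where "E2 = - ((1 - t\<^sup>2) * - e2 t - 2 * t * - e1 t + 2 * (R1 t + (\<eta> t + t * e1 t)))
       + (- \<eta> t * (- e1 t * (1 - t\<^sup>2) - t * - \<eta> t) + t * (sg \<eta> t)\<^sup>2) + q1 t"
  define E1 where "E1 = - ((1 - t\<^sup>2) * (R2 t + (2 * e1 t + t * e2 t)) - 4 * t * (R1 t + (\<eta> t + t * e1 t)) - 2 * (Rf \<eta> t + t * \<eta> t))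
       + (- (Rf \<eta> t + t * \<eta> t)\<^sup>2 - (sg \<eta> t)\<^sup>2 + - \<eta> t * ((R1 t + (\<eta> t + t * e1 t)) * (1 - t\<^sup>2) - 2 * t * (Rf \<eta> t + t * \<eta> t))) - (t * q1 t + 2 * qs t)"
  define E3 where "E3 = - ((1 - t\<^sup>2) * sg2 t - 4 * t * sg1 t - 2 * sg \<eta> t) + - \<eta> t * (sg1 t * (1 - t\<^sup>2) - 2 * t * sg \<eta> t)"
  have E3: "E3 = \<tau> t" unfolding E3_def swirl_ode[OF t] by (simp add: algebra_simps)
  have R1m: "R1 t = (1 - t\<^sup>2) * e2 t - 4 * t * e1 t - 2 * \<eta> t" unfolding R1_def z1m by simp
  have E2: "E2 = - \<kappa> t"
  proof -
    have "E2 = ((1 - t\<^sup>2) * e2 t - 4 * t * e1 t - 2 * \<eta> t) - R1 t - \<kappa> t"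
      unfolding E2_def q1_def by (simp add: algebra_simps power2_eq_square)
    then show ?thesis unfolding R1m[symmetric] by simp
  qed
  \<comment> \<open>The radial component, as in \<open>odes\<close>; its last bracket vanishes by
    the divergence condition.\<close>
  have "E1 + t * E2 = - ((1 - t\<^sup>2) * R2 t - 2 * t * R1 t + (1 - t\<^sup>2) * \<eta> t * R1 t + (Rf \<eta> t)\<^sup>2 + 2 * Rf \<eta> t
        + (1 - t\<^sup>2) * (sg \<eta> t)\<^sup>2 + 2 * (qs t - Rf \<eta> t + (1 - t\<^sup>2) * (\<eta> t)\<^sup>2 / 2))
        + 2 * (Rf \<eta> t - ((1 - t\<^sup>2) * e1 t - 2 * t * \<eta> t))"
    unfolding E1_def E2_def by (simp add: algebra_simps power2_eq_square diff_divide_distrib)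
  also have "Rf \<eta> t - ((1 - t\<^sup>2) * e1 t - 2 * t * \<eta> t) = 0" by (simp add: Rf_eq ze_def)
  finally have E1: "E1 = Fr t + t * \<kappa> t" using radial_ode[OF t] qs_eq[of t] E2 by simp
  have "- laplacian_within S us X + advection_within S us us X + grad_within S ps X
    = (rinv X ^ 4 * E1) *\<^sub>R X + (rinv X ^ 3 * E2) *\<^sub>R e3 + (rinv X ^ 4 * E3) *\<^sub>R rot_gen X"
    unfolding laplacian_u[OF X] advection_u[OF X] gr E1_def E2_def E3_def t_def[symmetric]
    by (simp add: algebra_simps)
  also have "\<dots> = F X" unfolding E1 E2 E3 F_rep[OF Om_S(1)[OF X]] t_def[symmetric] by simp
  finally show "- laplacian_within S us X + advection_within S us us X + grad_within S ps X = F X" .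
qed

lemma us_C2: "Ck_on 2 S us" by (rule CL_Ck_on[OF CL_us])
lemma ps_C1: "Ck_on 1 S ps" by (rule CL_Ck_on[OF CL_ps])

lemma pde_S_open:
  assumes X: "X \<in> S_open"
  shows "- laplacian_within S us X + advection_within S us us X + grad_within S ps X = F X" "div_within S us X = 0"
proof -
  have usd: "us differentiable_on S" and p1: "\<And>i. partial_within S i us differentiable_on S"
    and p2: "\<And>i j. continuous_on S (partial_within S j (partial_within S i us))" using us_C2 by (auto simp: Ck_2 Ck_1)
  have pd: "\<And>i. continuous_on S (partial_within S i ps)" using ps_C1 by (auto simp: Ck_1)
  note c = differentiable_imp_continuous_on[OF usd] differentiable_imp_continuous_on[OF p1]
  have g: "grad_within S ps = (\<lambda>x. \<Sum>i\<in>UNIV. partial_within S i ps x *\<^sub>R axis i 1)"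
    by (auto simp: grad_within_def vec_eq_iff forall_3 sum_3 axis_nth)
  have "continuous_on S (\<lambda>X. - laplacian_within S us X + advection_within S us us X + grad_within S ps X - F X)"
    unfolding laplacian_within_def advection_within_def g
    by (intro continuous_intros p2 c pd F_cont)
  from zero_on_S_open[OF this _ X] show "- laplacian_within S us X + advection_within S us us X + grad_within S ps X = F X"
    using pde_Om(1) by simp
  have "continuous_on S (div_within S us)" unfolding div_within_def[abs_def] by (intro continuous_intros c)
  from zero_on_S_open[OF this _ X] show "div_within S us X = 0" using pde_Om(2) by simp
qed

lemma us_boundary: assumes "X \<in> frontier S - {0}" shows "us X = 0"
proof -
  have X: "X \<in> S" "mu X = x0" using frontier_S[of X] assms by auto
  have e: "\<eta> x0 = 0" using \<eta>_fix[OF x0_Ix(1)] by (simp add: Tf_def)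
  have "Qf \<eta> x0 = 0" by (simp add: Qf_def)
  then have R: "Rf \<eta> x0 = 0" using e by (simp add: Rf_def)
  have s: "sg \<eta> x0 = 0" using ss_sg[OF \<eta>_cont x0_Ix(1)] ss_x0[of \<eta>] sq_pos[of x0] x0_lt by simp
  show ?thesis using X e R s by (simp add: us_def uf_def axi_field_def sc_def)
qed

lemma solution: "axi_self_similar_solution \<phi>0 F us ps"
proof -
  have "axisymmetric_scalar \<phi>0 ps"
    unfolding axisymmetric_scalar_def by (simp add: ps_def sc_def mu_spherical rinv_def norm_spherical)
  moreover have "homogeneous_on S (-2) ps"
    unfolding homogeneous_on_def by (auto simp: ps_def sc_def mu_scale power_int_minus power_mult_distrib power_inverse)
  moreover have "solves_NS \<phi>0 F us ps"
    unfolding solves_NS_def interior_S using pde_S_open us_boundary by blast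
  ultimately show ?thesis unfolding axi_self_similar_solution_def
    using us_C2 ps_C1 axi_field_axisymmetric axi_field_homogeneous by (auto simp: us_def uf_def)
qed

lemma us_bound:
  assumes "\<And>x. x \<in> Ix \<Longrightarrow> \<bar>\<eta> x\<bar> \<le> r" "\<And>x. x \<in> Ix \<Longrightarrow> \<bar>Qf \<eta> x\<bar> \<le> e" "\<And>x. x \<in> Ix \<Longrightarrow> \<bar>sg \<eta> x\<bar> \<le> e"
  shows "C0_norm (sphere 0 1 \<inter> S) us \<le> r\<^sup>2 / 2 + 4 * r + 2 * e"
proof (rule C0_norm_least)
  fix X assume X: "X \<in> sphere 0 1 \<inter> S"
  define x where "x = mu X"
  have xI: "x \<in> Ix" using mu_mem X by (simp add: x_def)
  have n: "norm X = 1" "rinv X = 1" using X by (auto simp: rinv_def)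
  note b = assms[OF xI]
  have x1: "\<bar>x\<bar> \<le> 1" by (rule Ix_bounds(5)[OF xI])
  have "(norm (rot_gen X))\<^sup>2 \<le> (norm X)\<^sup>2" unfolding norm_sq3 by simp
  then have rot: "norm (rot_gen X) \<le> 1" using n by (simp add: power2_le_iff_abs_le abs_square_le_1)
  have "(\<eta> x)\<^sup>2 \<le> r\<^sup>2" using b(1) by (metis abs_ge_zero power2_abs power_mono)
  then have "\<bar>(\<eta> x)\<^sup>2 / 2 + Qf \<eta> x\<bar> \<le> r\<^sup>2 / 2 + e" using b(2) zero_le_power2[of "\<eta> x"] by linarith
  then have 1: "\<bar>(1 - x\<^sup>2) * ((\<eta> x)\<^sup>2 / 2 + Qf \<eta> x)\<bar> \<le> 1 * (r\<^sup>2 / 2 + e)"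
    unfolding abs_mult using x1 by (intro mult_mono) (auto simp: abs_square_le_1)
  have 2: "\<bar>x * \<eta> x\<bar> \<le> 1 * r" unfolding abs_mult using x1 b(1) by (intro mult_mono) auto
  define y where "y = (1 - x\<^sup>2) * ((\<eta> x)\<^sup>2 / 2 + Qf \<eta> x)"
  have "Rf \<eta> x + x * \<eta> x = - ((1 - x\<^sup>2) * ((\<eta> x)\<^sup>2 / 2 + Qf \<eta> x)) - x * \<eta> x" by (simp add: Rf_def algebra_simps diff_divide_distrib)
  then have "\<bar>Rf \<eta> x + x * \<eta> x\<bar> \<le> \<bar>y\<bar> + \<bar>x * \<eta> x\<bar>"
    using abs_triangle_ineq4[of "- y" "x * \<eta> x"] unfolding y_def[symmetric] by simp
  then have a: "\<bar>Rf \<eta> x + x * \<eta> x\<bar> \<le> r\<^sup>2 / 2 + e + r" using 1 2 unfolding y_def[symmetric] by simp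
  have "us X = (Rf \<eta> x + x * \<eta> x) *\<^sub>R X + (- \<eta> x) *\<^sub>R e3 + sg \<eta> x *\<^sub>R rot_gen X"
    by (simp add: us_def uf_def axi_field_def sc_def n x_def)
  also have "norm \<dots> \<le> norm ((Rf \<eta> x + x * \<eta> x) *\<^sub>R X) + norm ((- \<eta> x) *\<^sub>R e3) + norm (sg \<eta> x *\<^sub>R rot_gen X)"
    by (meson add_mono norm_triangle_ineq order_refl order_trans)
  also have "\<dots> \<le> (r\<^sup>2 / 2 + e + r) + r + e * 1"
  proof (intro add_mono)
    show "norm ((Rf \<eta> x + x * \<eta> x) *\<^sub>R X) \<le> r\<^sup>2 / 2 + e + r" using a n by simp
    show "norm ((- \<eta> x) *\<^sub>R e3) \<le> r" using b(1) by simp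
    show "norm (sg \<eta> x *\<^sub>R rot_gen X) \<le> e * 1" unfolding norm_scaleR using b(3) rot by (intro mult_mono) auto
  qed
  finally show "norm (us X) \<le> r\<^sup>2 / 2 + 4 * r + 2 * e" using b(1) by linarith
qed

end

section \<open>Choice of the constants and conclusion\<close>

theorem theorem5p1:
  fixes \<phi>0 :: real
  assumes "0 < \<phi>0" and "\<phi>0 < pi"
  shows "\<exists>\<epsilon>>0. \<exists>\<delta>>0. \<forall>F :: real^3 \<Rightarrow> real^3.
    axisymmetric \<phi>0 F \<and> Ck_on 1 (solid_cone \<phi>0) F \<and> homogeneous_on (solid_cone \<phi>0) (-3) F \<and>
    C0_norm (sphere 0 1 \<inter> solid_cone \<phi>0) (tangential_part (curl_within (solid_cone \<phi>0) F)) \<le> \<epsilon> \<longrightarrow>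
    (\<exists>u p.
        axi_self_similar_solution \<phi>0 F u p \<and> C0_norm (sphere 0 1 \<inter> solid_cone \<phi>0) u \<le> \<delta> \<and>
        (\<forall>u' p'. axi_self_similar_solution \<phi>0 F u' p' \<and>
            C0_norm (sphere 0 1 \<inter> solid_cone \<phi>0) u' \<le> \<delta> \<longrightarrow> same_on_cone \<phi>0 u p u' p') \<and>
        (\<forall>\<alpha>\<in>{0<..<1}. Ck_Holder_loc_on 2 \<alpha> (solid_cone \<phi>0) u \<and> Ck_Holder_loc_on 1 \<alpha> (solid_cone \<phi>0) p)) \<and>
    (swirl_free \<phi>0 F \<longrightarrow>
        (\<forall>u p. axi_self_similar_solution \<phi>0 F u p \<longrightarrow> swirl_free \<phi>0 u) \<and>
        (\<forall>u p u' p'. axi_self_similar_solution \<phi>0 F u p \<and> axi_self_similar_solution \<phi>0 F u' p' \<longrightarrow>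
            same_on_cone \<phi>0 u p u' p'))"
proof -
  interpret cone \<phi>0 by unfold_locales (use assms in auto)
  \<comment> \<open>By \<open>etas_small\<close> every solution below this bound has
    \<open>etas\<close> at most 1/8, the radius in \<open>fixpoint_unique\<close>.\<close>
  define \<delta> where "\<delta> = (1 + x0) / 8"
  \<comment> \<open>With \<open>\<delta> = 16 * r\<close> and \<open>r\<^sup>2 \<le> r\<close>, the
    bound of \<open>us_bound\<close> for a fixed point of size \<open>r\<close> stays below
    \<open>\<delta>\<close>.\<close>
  define r where "r = (1 + x0) / 128"
  define C where "C = reduced_small.Cst \<phi>0"
  have k: "0 < 1 + x0" "1 + x0 < 2" using x0_gt x0_lt by auto
  have r: "0 < r" "r \<le> 1/64" using k by (auto simp: r_def)
  \<comment> \<open>Zero data satisfy the locale, which makes facts about \<open>Cst\<close>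
    available before any force is given.\<close>
  interpret z: reduced_small \<phi>0 "\<lambda>_. 0" "\<lambda>_. 0" 0 by unfold_locales auto
  have C: "C > 0" using z.Cst_parts(1) k unfolding C_def by (smt (verit) divide_pos_pos exp_gt_zero)
  define \<epsilon>' where "\<epsilon>' = min 1 (r / (8 * C))"
  have \<epsilon>': "0 < \<epsilon>'" "\<epsilon>' \<le> 1" "C * \<epsilon>' \<le> r / 8"
  proof -
    show "0 < \<epsilon>'" "\<epsilon>' \<le> 1" using r C by (auto simp: \<epsilon>'_def)
    have "C * \<epsilon>' \<le> C * (r / (8 * C))" using C by (intro mult_left_mono) (auto simp: \<epsilon>'_def)
    then show "C * \<epsilon>' \<le> r / 8" using C by simp
  qed
  \<comment> \<open>Inverts the factor \<open>4 / sqrt (1 + x0)\<close> of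
    \<open>small_profiles\<close>.\<close>
  define \<epsilon> where "\<epsilon> = \<epsilon>' * sqrt (1 + x0) / 4"
  have \<epsilon>: "0 < \<epsilon>" "4 * \<epsilon> / sqrt (1 + x0) = \<epsilon>'" using \<epsilon>'(1) k by (auto simp: \<epsilon>_def)
  show ?thesis
  proof (rule exI[of _ \<epsilon>], rule conjI[OF \<epsilon>(1)], rule exI[of _ \<delta>], rule conjI)
    show "0 < \<delta>" using k by (simp add: \<delta>_def)
    show "\<forall>F :: real^3 \<Rightarrow> real^3.
    axisymmetric \<phi>0 F \<and> Ck_on 1 (solid_cone \<phi>0) F \<and> homogeneous_on (solid_cone \<phi>0) (-3) F \<and>
    C0_norm (sphere 0 1 \<inter> solid_cone \<phi>0) (tangential_part (curl_within (solid_cone \<phi>0) F)) \<le> \<epsilon> \<longrightarrow>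
    (\<exists>u p.
        axi_self_similar_solution \<phi>0 F u p \<and> C0_norm (sphere 0 1 \<inter> solid_cone \<phi>0) u \<le> \<delta> \<and>
        (\<forall>u' p'. axi_self_similar_solution \<phi>0 F u' p' \<and>
            C0_norm (sphere 0 1 \<inter> solid_cone \<phi>0) u' \<le> \<delta> \<longrightarrow> same_on_cone \<phi>0 u p u' p') \<and>
        (\<forall>\<alpha>\<in>{0<..<1}. Ck_Holder_loc_on 2 \<alpha> (solid_cone \<phi>0) u \<and> Ck_Holder_loc_on 1 \<alpha> (solid_cone \<phi>0) p)) \<and>
    (swirl_free \<phi>0 F \<longrightarrow>
        (\<forall>u p. axi_self_similar_solution \<phi>0 F u p \<longrightarrow> swirl_free \<phi>0 u) \<and>
        (\<forall>u p u' p'. axi_self_similar_solution \<phi>0 F u p \<and> axi_self_similar_solution \<phi>0 F u' p' \<longrightarrow>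
            same_on_cone \<phi>0 u p u' p'))"
    proof (intro allI impI, elim conjE)
      fix F :: "real^3 \<Rightarrow> real^3"
      assume F: "axisymmetric \<phi>0 F" "Ck_on 1 S F" "homogeneous_on S (-3) F"
        and F\<epsilon>: "C0_norm (sphere 0 1 \<inter> S) (tangential_part (curl_within S F)) \<le> \<epsilon>"
      interpret forced \<phi>0 F by unfold_locales (rule F)+
      interpret s: reduced_small \<phi>0 \<tau> KF \<epsilon>'
        by unfold_locales (use \<epsilon>' small_profiles[OF F\<epsilon>] \<epsilon>(2) in auto)
      have C\<epsilon>: "s.Cst * \<epsilon>' \<le> r / 8" using \<epsilon>'(3) by (simp add: C_def)
      obtain \<eta> where \<eta>: "s.adm r \<eta>" "\<And>x. x \<in> Ix \<Longrightarrow> \<eta> x = Tf \<eta> x"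
        using s.fixpoint_exists[OF r(1) _ C\<epsilon>] r(2) by auto
      interpret fixed_profile \<phi>0 F \<eta>
        by unfold_locales (use \<eta> in \<open>auto simp: s.adm_def\<close>)
      have adm1: "s.adm 1 \<eta>" by (rule s.adm_mono[OF \<eta>(1)]) (use r in simp)
      have "C0_norm (sphere 0 1 \<inter> S) us \<le> r\<^sup>2 / 2 + 4 * r + 2 * (s.Cst * \<epsilon>')"
        by (rule us_bound) (use \<eta>(1) s.Qf_small[OF adm1] s.sg_small[OF adm1] in \<open>auto simp: s.adm_def\<close>)
      also have "\<dots> \<le> \<delta>"
      proof -
        have "r\<^sup>2 \<le> r" using r by (simp add: power2_eq_square mult_left_le)
        moreover have "\<delta> = 16 * r" by (simp add: \<delta>_def r_def)
        ultimately show ?thesis using C\<epsilon> r by linarith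
      qed
      finally have us\<delta>: "C0_norm (sphere 0 1 \<inter> S) us \<le> \<delta>" .
      have etas_adm: "s.adm (1/8) (soln.etas \<phi>0 v)" "\<And>x. x \<in> Ix \<Longrightarrow> soln.etas \<phi>0 v x = Tf (soln.etas \<phi>0 v) x"
        if "axi_self_similar_solution \<phi>0 F v w" "C0_norm (sphere 0 1 \<inter> S) v \<le> \<delta>" for v w
      proof -
        interpret v: soln \<phi>0 F v w by (rule soln.intro[OF forced_axioms soln_axioms.intro[OF that(1)]])
        have "\<delta> / (1 + x0) = 1/8" using k by (simp add: \<delta>_def)
        then show "s.adm (1/8) v.etas" using v.etas_small[OF that(2)] v.etas_cont by (auto simp: s.adm_def)
        show "v.etas x = Tf v.etas x" if "x \<in> Ix" for x by (rule v.reduction(1)[OF that])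
      qed
      have C8: "s.Cst * \<epsilon>' \<le> 1/8" using C\<epsilon> r by simp
      \<comment> \<open>The constructed solution is treated like any other small one: the
        \<open>etas\<close> of both are fixed points in the ball of radius 1/8.\<close>
      have uniq: "same_on_cone \<phi>0 us ps v w" if v: "axi_self_similar_solution \<phi>0 F v w" "C0_norm (sphere 0 1 \<inter> S) v \<le> \<delta>" for v w
        by (rule same_solution[OF solution v(1)], rule s.fixpoint_unique[OF etas_adm[OF solution us\<delta>] etas_adm[OF v] C8])
      have reg: "Ck_Holder_loc_on 2 \<alpha> S us \<and> Ck_Holder_loc_on 1 \<alpha> S ps" if "\<alpha> \<in> {0<..<1}" for \<alpha>
        using CL_Ck_Holder[OF CL_us, of \<alpha>] CL_Ck_Holder[OF CL_ps, of \<alpha>] that by auto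
      have sf: "swirl_free \<phi>0 v" if "swirl_free \<phi>0 F" "axi_self_similar_solution \<phi>0 F v w" for v w
      proof -
        interpret v: soln \<phi>0 F v w by (rule soln.intro[OF forced_axioms soln_axioms.intro[OF that(2)]])
        show ?thesis by (rule v.swirl_free_u[OF swirl_free_\<tau>[OF that(1)]])
      qed
      show "(\<exists>u p.
        axi_self_similar_solution \<phi>0 F u p \<and> C0_norm (sphere 0 1 \<inter> solid_cone \<phi>0) u \<le> \<delta> \<and>
        (\<forall>u' p'. axi_self_similar_solution \<phi>0 F u' p' \<and>
            C0_norm (sphere 0 1 \<inter> solid_cone \<phi>0) u' \<le> \<delta> \<longrightarrow> same_on_cone \<phi>0 u p u' p') \<and>
        (\<forall>\<alpha>\<in>{0<..<1}. Ck_Holder_loc_on 2 \<alpha> (solid_cone \<phi>0) u \<and> Ck_Holder_loc_on 1 \<alpha> (solid_cone \<phi>0) p)) \<and>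
        (swirl_free \<phi>0 F \<longrightarrow>
        (\<forall>u p. axi_self_similar_solution \<phi>0 F u p \<longrightarrow> swirl_free \<phi>0 u) \<and>
        (\<forall>u p u' p'. axi_self_similar_solution \<phi>0 F u p \<and> axi_self_similar_solution \<phi>0 F u' p' \<longrightarrow>
            same_on_cone \<phi>0 u p u' p'))"
        using solution us\<delta> uniq reg sf unique_swirl_free by blast
    qed
  qed
qed

end
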